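(* Let $(Q,\tau)$ be the $\imath$quiver consisting of a single vertex, no arrows, and trivial involution, with $\imath$quiver algebra $\Lambda^\imath=k[x]/(x^2)$, $k=\mathbb F_q$. The following identity holds in the $\imath$Hall algebra $\widetilde{\mathcal H}(kQ,\tau)$ for all $n\in\mathbb N$: $$[S]^{(n)}_{\bar1}=\sum_{l=0}^{\lfloor n/2\rfloor}\frac{\mathbf v^{\,l(l+(-1)^n)-\binom{n-2l}{2}}\,(\mathbf v-\mathbf v^{-1})^l}{[n-2l]_{\mathbf v}!\,[2l]_{\mathbf v}^{!!}}\,[(n-2l)S]*[\mathbb K]^l .$$
   Context: $\mathbf v=\sqrt q$, $[m]_{\mathbf v}=\frac{\mathbf v^m-\mathbf v^{-m}}{\mathbf v-\mathbf v^{-1}}$, $[m]_{\mathbf v}!=\prod_{s=1}^m[s]_{\mathbf v}$, $[0]_{\mathbf v}^{!!}=1$, $[2l]_{\mathbf v}^{!!}=[2l]_{\mathbf v}[2l-2]_{\mathbf v}\cdots[2]_{\mathbf v}$. $\lfloor x\rfloor$ is the floor. $S$ is the simple $\Lambda^\imath$-module, $[mS]=[S^{\oplus m}]$, $\mathbb K=k[x]/(x^2)$ is the regular module. $\mathcal H(\Lambda^\imath)$ is the $\mathbb Q(\mathbf v)$-vector space with basis isoclasses $[M]$ of finite-dimensional $\Lambda^\imath$-modules and product $[M]\diamond[N]=\sum_{[L]}\frac{|\mathrm{Ext}^1(M,N)_L|}{|\mathrm{Hom}(M,N)|}[L]$, where $\mathrm{Ext}^1(M,N)_L$ is the set of classes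 of extensions $0\to N\to L'\to M\to0$ with $L'\cong L$. Let $\mathcal P^{\le1}$ be the class of finite-dimensional $\Lambda^\imath$-modules of projective dimension $\le1$, let $I$ be the two-sided ideal generated by all $[K]-[K']$ with $K\cong K'$ in $\mathcal P^{\le1}$ (i.e. $0$) and all $[L]-[K\oplus M]$ for which there is an exact sequence $0\to K\to L\to M\to0$ with $K\in\mathcal P^{\le1}$, and let $\mathcal S=\{a[K]\mid a\in\mathbb Q^\times,K\in\mathcal P^{\le1}\}$. $\widetilde{\mathcal H}(kQ,\tau)$ is $(\mathcal H(\Lambda^\imath)/I)[\mathcal S^{-1}]$ with twisted product $[M]*[N]=\mathbf v^{\dim_k M\cdot\dim_k N}[M]\diamond[N]$ (the exponent is the Euler form of $kQ=k$ on the restrictions). $[\mathbb K]^l$ is the $l$-th power with respect to $*$; $[\mathbb K]$ is central. The $\imath$-divided powers (all products with respect to $*$) are $$[S]^{(2l)}_{\bar1}=\tfrac1{[2l]_{\mathbf v}!}\prod_{j=1}^l\big([S]^2+\mathbf v^{-1}(\mathbf v^2-1)^2[2j-1]_{\mathbf v}^2[\mathbb K]\big),\quad [S]^{(2l+1)}_{\bar1}=\tfrac1{[2l+1]_{\mathbf v}!}[S]\prod_{j=1}^l\big([S]^2+\mathbf v^{-1}(\mathbf v^2-1)^2[2j-1]_{\mathbf v}^2[\mathbb K]\big).$$ *)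

theory Defs
  imports
    "HOL-Algebra.Polynomial_Divisibility"
    "Jordan_Normal_Form.Missing_VectorSpace"
begin

section \<open>Modules over a commutative ring\<close>

text \<open>
  The fields \<^const>\<open>mult\<close> and \<^const>\<open>one\<close> of a module record carry no information and are ignored
  throughout.
\<close>

definition regular_module :: "('r, 'c) ring_scheme \<Rightarrow> ('r, 'r) module" where
  "regular_module R = \<lparr>carrier = carrier R, mult = undefined, one = undefined,
     zero = \<zero>\<^bsub>R\<^esub>, add = add R, smult = mult R\<rparr>"

definition zero_module :: "('r, unit) module" where
  "zero_module = \<lparr>carrier = {()}, mult = undefined, one = undefined,
     zero = (), add = (\<lambda>_ _. ()), smult = (\<lambda>_ _. ())\<rparr>"

definition power_module :: "nat \<Rightarrow> ('r, 'm) module \<Rightarrow> ('r, nat \<Rightarrow> 'm) module" where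
  "power_module n M = \<lparr>carrier = (\<Pi>\<^sub>E i\<in>{..<n}. carrier M), mult = undefined, one = undefined,
     zero = (\<lambda>i\<in>{..<n}. \<zero>\<^bsub>M\<^esub>),
     add = (\<lambda>x y. \<lambda>i\<in>{..<n}. x i \<oplus>\<^bsub>M\<^esub> y i),
     smult = (\<lambda>r x. \<lambda>i\<in>{..<n}. r \<odot>\<^bsub>M\<^esub> x i)\<rparr>"

definition restrict_scalars :: "('s \<Rightarrow> 'r) \<Rightarrow> ('r, 'm) module \<Rightarrow> ('s, 'm) module" where
  "restrict_scalars h M = \<lparr>carrier = carrier M, mult = mult M, one = one M,
     zero = zero M, add = add M, smult = (\<lambda>a x. h a \<odot>\<^bsub>M\<^esub> x)\<rparr>"

definition simple_module :: "('r, 'c) ring_scheme \<Rightarrow> ('r, 'm) module \<Rightarrow> bool" where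
  "simple_module R M \<longleftrightarrow> module R M \<and> carrier M \<noteq> {\<zero>\<^bsub>M\<^esub>} \<and>
     (\<forall>N. Module.submodule N R M \<longrightarrow> N = {\<zero>\<^bsub>M\<^esub>} \<or> N = carrier M)"

text \<open>Homomorphisms are made extensional so that they can be counted.\<close>

definition Hom :: "('r, 'c) ring_scheme \<Rightarrow> ('r, 'm) module \<Rightarrow> ('r, 'n) module \<Rightarrow> ('m \<Rightarrow> 'n) set" where
  "Hom R M N = module_hom R M N \<inter> extensional (carrier M)"

definition module_isomorphic ::
    "('r, 'c) ring_scheme \<Rightarrow> ('r, 'm) module \<Rightarrow> ('r, 'n) module \<Rightarrow> bool" where
  "module_isomorphic R M N \<longleftrightarrow>
     (\<exists>f \<in> module_hom R M N. bij_betw f (carrier M) (carrier N))"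

definition short_exact ::
    "('r, 'c) ring_scheme \<Rightarrow> ('r, 'n) module \<Rightarrow> ('r, 'l) module \<Rightarrow> ('r, 'm) module \<Rightarrow>
     ('n \<Rightarrow> 'l) \<Rightarrow> ('l \<Rightarrow> 'm) \<Rightarrow> bool" where
  "short_exact R N L M f g \<longleftrightarrow>
     f \<in> module_hom R N L \<and> g \<in> module_hom R L M \<and>
     inj_on f (carrier N) \<and> g ` carrier L = carrier M \<and>
     f ` carrier N = {x \<in> carrier L. g x = \<zero>\<^bsub>M\<^esub>}"


section \<open>The \<open>\<imath>\<close>quiver algebra \<open>k[x]/(x\<^sup>2)\<close> and its finite-dimensional modules\<close>

definition ialg_rel :: "('a, 'c) ring_scheme \<Rightarrow> 'a list" where
  "ialg_rel k = X\<^bsub>k\<^esub> [^]\<^bsub>poly_ring k\<^esub> (2::nat)"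

definition ialg :: "('a, 'c) ring_scheme \<Rightarrow> 'a list set ring" where
  "ialg k = Rupt\<^bsub>k\<^esub> (carrier k) (ialg_rel k)"

definition ialg_const :: "('a, 'c) ring_scheme \<Rightarrow> 'a \<Rightarrow> 'a list set" where
  "ialg_const k a =
     (PIdl\<^bsub>poly_ring k\<^esub> (ialg_rel k)) +>\<^bsub>poly_ring k\<^esub> ring.poly_of_const k a"

definition fd_module :: "('a, 'c) ring_scheme \<Rightarrow> ('a list set, 'm) module \<Rightarrow> bool" where
  "fd_module k M \<longleftrightarrow> module (ialg k) M \<and>
     vectorspace.fin_dim k (restrict_scalars (ialg_const k) M)"

definition kdim :: "('a, 'c) ring_scheme \<Rightarrow> ('a list set, 'm) module \<Rightarrow> nat" where
  "kdim k M = vectorspace.dim k (restrict_scalars (ialg_const k) M)"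

text \<open>
  A finite-dimensional module over a finite field is finite, so up to isomorphism its carrier is a
  set of natural numbers.  These modules form a set-sized model of the category of all
  finite-dimensional modules; the isoclass \<open>[M]\<close> of a module \<open>M\<close> on an arbitrary type is the set of
  all members of the model that are isomorphic to \<open>M\<close>.
\<close>

type_synonym 'a imod = "('a list set, nat) module"

definition fd_modules :: "('a, 'c) ring_scheme \<Rightarrow> 'a imod set" where
  "fd_modules k = {M. fd_module k M}"

definition isoclass :: "('a, 'c) ring_scheme \<Rightarrow> ('a list set, 'm) module \<Rightarrow> 'a imod set" where
  "isoclass k M = {N \<in> fd_modules k. module_isomorphic (ialg k) N M}"

definition isoclasses :: "('a, 'c) ring_scheme \<Rightarrow> 'a imod set set" where
  "isoclasses k = isoclass k ` fd_modules k"

text \<open>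
  \<open>Ext1 k M N\<close> consists of the Yoneda classes of extensions \<open>0 \<rightarrow> N \<rightarrow> L \<rightarrow> M \<rightarrow> 0\<close>.  The maps of an
  extension are unconstrained off the carriers; this ambiguity is absorbed by the equivalence.
\<close>

definition extensions ::
    "('a, 'c) ring_scheme \<Rightarrow> 'a imod \<Rightarrow> 'a imod \<Rightarrow> ((nat \<Rightarrow> nat) \<times> 'a imod \<times> (nat \<Rightarrow> nat)) set" where
  "extensions k M N = {(f, L, g). L \<in> fd_modules k \<and> short_exact (ialg k) N L M f g}"

definition ext_equiv ::
    "('a, 'c) ring_scheme \<Rightarrow> 'a imod \<Rightarrow> 'a imod \<Rightarrow>
     ((nat \<Rightarrow> nat) \<times> 'a imod \<times> (nat \<Rightarrow> nat)) rel" where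
  "ext_equiv k M N = {((f, L, g), (f', L', g')).
     (f, L, g) \<in> extensions k M N \<and> (f', L', g') \<in> extensions k M N \<and>
     (\<exists>\<phi> \<in> module_hom (ialg k) L L'. bij_betw \<phi> (carrier L) (carrier L') \<and>
        (\<forall>x \<in> carrier N. \<phi> (f x) = f' x) \<and> (\<forall>y \<in> carrier L. g' (\<phi> y) = g y))}"

definition Ext1 ::
    "('a, 'c) ring_scheme \<Rightarrow> 'a imod \<Rightarrow> 'a imod \<Rightarrow>
     ((nat \<Rightarrow> nat) \<times> 'a imod \<times> (nat \<Rightarrow> nat)) set set" where
  "Ext1 k M N = extensions k M N // ext_equiv k M N"

definition Ext1_mid ::
    "('a, 'c) ring_scheme \<Rightarrow> 'a imod \<Rightarrow> 'a imod \<Rightarrow> 'a imod \<Rightarrow>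
     ((nat \<Rightarrow> nat) \<times> 'a imod \<times> (nat \<Rightarrow> nat)) set set" where
  "Ext1_mid k M N L =
     {E \<in> Ext1 k M N. \<exists>(f, L', g) \<in> E. module_isomorphic (ialg k) L' L}"

definition projective :: "('a, 'c) ring_scheme \<Rightarrow> 'a imod \<Rightarrow> bool" where
  "projective k P \<longleftrightarrow> P \<in> fd_modules k \<and>
     (\<forall>A \<in> fd_modules k. \<forall>B \<in> fd_modules k.
        \<forall>g \<in> module_hom (ialg k) A B. \<forall>f \<in> module_hom (ialg k) P B.
          g ` carrier A = carrier B \<longrightarrow>
          (\<exists>h \<in> module_hom (ialg k) P A. \<forall>x \<in> carrier P. g (h x) = f x))"

text \<open>The finite-dimensional modules of projective dimension at most 1.\<close>

definition pdim_le1 :: "('a, 'c) ring_scheme \<Rightarrow> 'a imod set" where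
  "pdim_le1 k = {M \<in> fd_modules k.
     \<exists>P1 P0 f g. projective k P1 \<and> projective k P0 \<and> short_exact (ialg k) P1 P0 M f g}"


section \<open>The Ringel-Hall algebra of \<open>k[x]/(x\<^sup>2)\<close>\<close>

definition vpar :: "('a, 'c) ring_scheme \<Rightarrow> real" where
  "vpar k = sqrt (real (card (carrier k)))"

text \<open>The subfield \<open>\<rat>(v)\<close> of the reals; it has this shape because \<open>v\<^sup>2 = q\<close> is rational.\<close>

definition Qv :: "('a, 'c) ring_scheme \<Rightarrow> real set" where
  "Qv k = {a + b * vpar k | a b. a \<in> \<rat> \<and> b \<in> \<rat>}"

text \<open>
  A formal linear combination of isoclasses is its coefficient function.  The structure constant
  \<open>|Ext\<^sup>1(M,N)\<^sub>L| / |Hom(M,N)|\<close> depends on the isoclasses only, and is computed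
  on chosen representatives.
\<close>

type_synonym 'a hall = "'a imod set \<Rightarrow> real"

definition rep :: "'a imod set \<Rightarrow> 'a imod" where
  "rep C = (SOME M. M \<in> C)"

definition hall_const ::
    "('a, 'c) ring_scheme \<Rightarrow> 'a imod set \<Rightarrow> 'a imod set \<Rightarrow> 'a imod set \<Rightarrow> real" where
  "hall_const k A B C =
     real (card (Ext1_mid k (rep A) (rep B) (rep C))) / real (card (Hom (ialg k) (rep A) (rep B)))"

definition hall_basis :: "('a, 'c) ring_scheme \<Rightarrow> ('a list set, 'm) module \<Rightarrow> 'a hall" where
  "hall_basis k M = (\<lambda>C. if C = isoclass k M then 1 else 0)"

definition hall_algebra :: "('a, 'c) ring_scheme \<Rightarrow> 'a hall ring" where
  "hall_algebra k = \<lparr>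
     carrier = {\<phi>. (\<forall>C. \<phi> C \<in> Qv k) \<and> finite {C. \<phi> C \<noteq> 0} \<and> {C. \<phi> C \<noteq> 0} \<subseteq> isoclasses k},
     mult = (\<lambda>\<phi> \<psi> C. if C \<in> isoclasses k
       then \<Sum>A\<in>{A. \<phi> A \<noteq> 0}. \<Sum>B\<in>{B. \<psi> B \<noteq> 0}. \<phi> A * \<psi> B * hall_const k A B C else 0),
     one = hall_basis k zero_module,
     zero = (\<lambda>_. 0),
     add = (\<lambda>\<phi> \<psi> C. \<phi> C + \<psi> C)\<rparr>"

definition hall_ideal :: "('a, 'c) ring_scheme \<Rightarrow> 'a hall set" where
  "hall_ideal k = Idl\<^bsub>hall_algebra k\<^esub>
     ({(\<lambda>C. hall_basis k P C - hall_basis k P' C) | P P'.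
         P \<in> pdim_le1 k \<and> P' \<in> pdim_le1 k \<and> module_isomorphic (ialg k) P P'} \<union>
      {(\<lambda>C. hall_basis k L C - hall_basis k (direct_sum P M) C) | P L M.
         P \<in> pdim_le1 k \<and> L \<in> fd_modules k \<and> M \<in> fd_modules k \<and>
         (\<exists>f g. short_exact (ialg k) P L M f g)})"

definition hall_quot :: "('a, 'c) ring_scheme \<Rightarrow> 'a hall set ring" where
  "hall_quot k = hall_algebra k Quot hall_ideal k"

definition quot_class :: "('a, 'c) ring_scheme \<Rightarrow> 'a hall \<Rightarrow> 'a hall set" where
  "quot_class k \<phi> = hall_ideal k +>\<^bsub>hall_algebra k\<^esub> \<phi>"

definition denom :: "('a, 'c) ring_scheme \<Rightarrow> real \<Rightarrow> 'a imod \<Rightarrow> 'a hall set" where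
  "denom k a P = quot_class k (\<lambda>C. a * hall_basis k P C)"

definition denoms :: "('a, 'c) ring_scheme \<Rightarrow> 'a hall set set" where
  "denoms k = {denom k a P | a P. a \<in> \<rat> \<and> a \<noteq> 0 \<and> P \<in> pdim_le1 k}"


section \<open>Right rings of fractions\<close>

text \<open>
  The Ore localisation \<open>R[S\<^sup>-\<^sup>1]\<close> at a right denominator set \<open>S\<close>: \<open>frac R S a s\<close> is the fraction
  \<open>a s\<^sup>-\<^sup>1\<close>.  The sum and the product are formed after clearing denominators by the Ore condition;
  the unions below range over all ways to do so, each of which gives the same fraction.
\<close>

definition frac_rel :: "('r, 'c) ring_scheme \<Rightarrow> 'r set \<Rightarrow> ('r \<times> 'r) rel" where
  "frac_rel R S = {((a, s), (b, t)).
     a \<in> carrier R \<and> s \<in> S \<and> b \<in> carrier R \<and> t \<in> S \<and>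
     (\<exists>u \<in> carrier R. \<exists>w \<in> carrier R.
        s \<otimes>\<^bsub>R\<^esub> u = t \<otimes>\<^bsub>R\<^esub> w \<and> s \<otimes>\<^bsub>R\<^esub> u \<in> S \<and> a \<otimes>\<^bsub>R\<^esub> u = b \<otimes>\<^bsub>R\<^esub> w)}"

definition frac :: "('r, 'c) ring_scheme \<Rightarrow> 'r set \<Rightarrow> 'r \<Rightarrow> 'r \<Rightarrow> ('r \<times> 'r) set" where
  "frac R S a s = frac_rel R S `` {(a, s)}"

definition localisation :: "('r, 'c) ring_scheme \<Rightarrow> 'r set \<Rightarrow> ('r \<times> 'r) set ring" where
  "localisation R S = \<lparr>
     carrier = (carrier R \<times> S) // frac_rel R S,
     mult = (\<lambda>x y. \<Union>{frac R S (a \<otimes>\<^bsub>R\<^esub> u) (t \<otimes>\<^bsub>R\<^esub> w) | a s b t u w.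
        (a, s) \<in> x \<and> (b, t) \<in> y \<and> u \<in> carrier R \<and> w \<in> S \<and> s \<otimes>\<^bsub>R\<^esub> u = b \<otimes>\<^bsub>R\<^esub> w}),
     one = frac R S \<one>\<^bsub>R\<^esub> \<one>\<^bsub>R\<^esub>,
     zero = frac R S \<zero>\<^bsub>R\<^esub> \<one>\<^bsub>R\<^esub>,
     add = (\<lambda>x y. \<Union>{frac R S (a \<otimes>\<^bsub>R\<^esub> u \<oplus>\<^bsub>R\<^esub> b \<otimes>\<^bsub>R\<^esub> w) (s \<otimes>\<^bsub>R\<^esub> u) | a s b t u w.
        (a, s) \<in> x \<and> (b, t) \<in> y \<and> u \<in> carrier R \<and> w \<in> carrier R \<and>
        s \<otimes>\<^bsub>R\<^esub> u = t \<otimes>\<^bsub>R\<^esub> w \<and> s \<otimes>\<^bsub>R\<^esub> u \<in> S})\<rparr>"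


section \<open>The \<open>\<imath>\<close>Hall algebra\<close>

text \<open>The untwisted algebra \<open>(H/I)[S\<^sup>-\<^sup>1]\<close>, with its scalars and the images of the isoclasses.\<close>

definition sdh :: "('a, 'c) ring_scheme \<Rightarrow> ('a hall set \<times> 'a hall set) set ring" where
  "sdh k = localisation (hall_quot k) (denoms k)"

definition sdh_frac ::
    "('a, 'c) ring_scheme \<Rightarrow> 'a hall \<Rightarrow> 'a hall set \<Rightarrow> ('a hall set \<times> 'a hall set) set" where
  "sdh_frac k \<phi> s = frac (hall_quot k) (denoms k) (quot_class k \<phi>) s"

definition ihall_class ::
    "('a, 'c) ring_scheme \<Rightarrow> ('a list set, 'm) module \<Rightarrow> ('a hall set \<times> 'a hall set) set" where
  "ihall_class k M = sdh_frac k (hall_basis k M) \<one>\<^bsub>hall_quot k\<^esub>"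

definition ihall_smult ::
    "('a, 'c) ring_scheme \<Rightarrow> real \<Rightarrow> ('a hall set \<times> 'a hall set) set \<Rightarrow>
     ('a hall set \<times> 'a hall set) set" where
  "ihall_smult k c x =
     sdh_frac k (\<lambda>C. c * \<one>\<^bsub>hall_algebra k\<^esub> C) \<one>\<^bsub>hall_quot k\<^esub> \<otimes>\<^bsub>sdh k\<^esub> x"

text \<open>
  The dimension of modules induces a grading of \<^term>\<open>sdh k\<close> by the integers, the fraction
  \<open>[M] (a[P])\<^sup>-\<^sup>1\<close> having degree \<open>dim M - dim P\<close>.  The twist by the Euler form
  \<open>\<langle>d, e\<rangle> = d e\<close> of the quiver with one vertex and no arrows is defined on homogeneous elements by
  \<open>x * y = v\<^bsup>d e\<^esup> x y\<close> and extended bilinearly, so that \<open>[M] * [N] = v\<^bsup>dim M dim N\<^esup> [M] [N]\<close>.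
\<close>

definition sdh_degree :: "('a, 'c) ring_scheme \<Rightarrow> int \<Rightarrow> ('a hall set \<times> 'a hall set) set set" where
  "sdh_degree k d = {sdh_frac k \<phi> (denom k a P) | \<phi> m a P.
     \<phi> \<in> carrier (hall_algebra k) \<and> (\<forall>C. \<phi> C \<noteq> 0 \<longrightarrow> (\<forall>M \<in> C. kdim k M = m)) \<and>
     a \<in> \<rat> \<and> a \<noteq> 0 \<and> P \<in> pdim_le1 k \<and> d = int m - int (kdim k P)}"

definition sdh_component ::
    "('a, 'c) ring_scheme \<Rightarrow> ('a hall set \<times> 'a hall set) set \<Rightarrow> int \<Rightarrow>
     ('a hall set \<times> 'a hall set) set" where
  "sdh_component k x = (THE f. (\<forall>d. f d \<in> sdh_degree k d) \<and>
     finite {d. f d \<noteq> \<zero>\<^bsub>sdh k\<^esub>} \<and> x = (\<Oplus>\<^bsub>sdh k\<^esub>d\<in>{d. f d \<noteq> \<zero>\<^bsub>sdh k\<^esub>}. f d))"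

definition twisted_mult ::
    "('a, 'c) ring_scheme \<Rightarrow> ('a hall set \<times> 'a hall set) set \<Rightarrow>
     ('a hall set \<times> 'a hall set) set \<Rightarrow> ('a hall set \<times> 'a hall set) set" where
  "twisted_mult k x y =
     (\<Oplus>\<^bsub>sdh k\<^esub>d\<in>{d. sdh_component k x d \<noteq> \<zero>\<^bsub>sdh k\<^esub>}.
      \<Oplus>\<^bsub>sdh k\<^esub>e\<in>{e. sdh_component k y e \<noteq> \<zero>\<^bsub>sdh k\<^esub>}.
        ihall_smult k (vpar k powi (d * e)) (sdh_component k x d \<otimes>\<^bsub>sdh k\<^esub> sdh_component k y e))"

definition ihall :: "('a, 'c) ring_scheme \<Rightarrow> ('a hall set \<times> 'a hall set) set ring" where
  "ihall k = (sdh k)\<lparr>mult := twisted_mult k\<rparr>"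


section \<open>\<open>\<imath>\<close>-divided powers\<close>

definition qint :: "real \<Rightarrow> nat \<Rightarrow> real" where
  "qint v m = (v powi int m - v powi (- int m)) / (v - inverse v)"

definition qfact :: "real \<Rightarrow> nat \<Rightarrow> real" where
  "qfact v m = (\<Prod>s = 1..m. qint v s)"

text \<open>\<open>qdfact_even v l\<close> is the double factorial \<open>[2l]!! = [2l] [2l-2] \<dots> [2]\<close>.\<close>

definition qdfact_even :: "real \<Rightarrow> nat \<Rightarrow> real" where
  "qdfact_even v l = (\<Prod>s = 1..l. qint v (2 * s))"

definition idiv_factor ::
    "('a, 'c) ring_scheme \<Rightarrow> ('a list set, 'm) module \<Rightarrow> nat \<Rightarrow> ('a hall set \<times> 'a hall set) set" where
  "idiv_factor k S j =
     ihall_class k S [^]\<^bsub>ihall k\<^esub> (2::nat) \<oplus>\<^bsub>ihall k\<^esub>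
     ihall_smult k (inverse (vpar k) * ((vpar k)\<^sup>2 - 1)\<^sup>2 * (qint (vpar k) (2 * j - 1))\<^sup>2)
       (ihall_class k (regular_module (ialg k)))"

text \<open>The factors commute, as \<open>[\<bbbK>]\<close> is central; they are multiplied in the order \<open>j = 1, \<dots>, l\<close>.\<close>

definition idiv_prod ::
    "('a, 'c) ring_scheme \<Rightarrow> ('a list set, 'm) module \<Rightarrow> nat \<Rightarrow> ('a hall set \<times> 'a hall set) set" where
  "idiv_prod k S l = foldr (\<lambda>j x. idiv_factor k S j \<otimes>\<^bsub>ihall k\<^esub> x) [1..<Suc l] \<one>\<^bsub>ihall k\<^esub>"

definition idiv_power ::
    "('a, 'c) ring_scheme \<Rightarrow> ('a list set, 'm) module \<Rightarrow> nat \<Rightarrow> ('a hall set \<times> 'a hall set) set" where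
  "idiv_power k S n = ihall_smult k (1 / qfact (vpar k) n)
     (if even n then idiv_prod k S (n div 2)
      else ihall_class k S \<otimes>\<^bsub>ihall k\<^esub> idiv_prod k S (n div 2))"

end

theory Submission
  imports Defs
begin

text \<open>A finite module over \<open>k[x]/(x\<^sup>2)\<close> is a sum of copies of \<open>S\<close> and \<open>K\<close>, hence determined by \<open>|M|\<close> and \<open>|xM|\<close>;
  its isoclass is \<open>cls |M| |xM|\<close>. Projective dimension at most one means that kernel and image of \<open>x\<close> on
  \<open>M\<close> agree. For such \<open>P\<close> every extension of \<open>M\<close> by \<open>P\<close> is isomorphic to \<open>P \<oplus> M\<close>, so the ideal \<open>I\<close> is zero.
  Riedtmann's formula expresses the structure constants by numbers of short exact sequences, and
  associativity follows by counting filtrations in two ways. Computing the products with \<open>[S]\<close> and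
  \<open>[K]\<close> on the left shows that these two generate the algebra and commute. In the twisted algebra,
  \<open>e(m, l) = [mS] * [K]\<^sup>l\<close> satisfies \<open>[S] * e(m, l) = v\<^sup>-\<^sup>m e(m + 1, l) + (v\<^sup>m - v\<^sup>-\<^sup>m) e(m - 1, l + 1)\<close>. With
  \<open>D\<^sub>n\<close> the divided power, \<open>[S] * D\<^sub>n = [n + 1] D\<^sub>n\<^sub>+\<^sub>1\<close> for even \<open>n\<close>, while for odd \<open>n\<close> the term
  \<open>v\<^sup>-\<^sup>1 (v\<^sup>2 - 1)\<^sup>2 [n] [K] * D\<^sub>n\<^sub>-\<^sub>1\<close> has to be added on the left; the coefficients of the expansion obey the same
  two recursions.\<close>

text \<open>The obstacle is the definition of the twisted product: it sums over homogeneous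
  components, selected by \<open>THE\<close>, in an Ore localisation of a quotient. Commutativity of
  the Hall algebra turns Ore fractions into ordinary ones, so that sums and products can be
  evaluated on a single choice of denominators. Components are unique because finitely many
  fractions can be brought over one homogeneous denominator, after which coefficients are separated
  by dimension. Since every element in the identity has denominator 1, the actual computation
  happens in the Hall algebra and is carried over by \<open>emb\<close>. Cardinalities replace
  dimensions throughout, and rank-nullity becomes a count of fibres. The constant v^(-1) (v^2 - 1)^2
  [2j-1]^2 equals v (v - v^(-1))^2 [2j-1]^2. One factor [2j-1] passes into the quantum factorial;
  the rest is what the coefficients of [S] * D_n lack, for n = 2j-1, in order to be those of [n+1]
  D_(n+1).\<close>

abbreviation (input) zero_sub ("\<zero>\<^sub>_" [1000] 1000) where "\<zero>\<^sub>M \<equiv> zero M"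
abbreviation (input) one_sub ("\<one>\<^sub>_" [1000] 1000) where "\<one>\<^sub>M \<equiv> one M"
abbreviation (input) add_sub ("_ \<oplus>\<^sub>_ _" [65, 1000, 66] 65) where "a \<oplus>\<^sub>M b \<equiv> add M a b"
abbreviation (input) minus_sub ("_ \<ominus>\<^sub>_ _" [65, 1000, 66] 65) where "a \<ominus>\<^sub>M b \<equiv> a_minus M a b"
abbreviation (input) uminus_sub ("\<ominus>\<^sub>_ _" [1000, 81] 80) where "\<ominus>\<^sub>M a \<equiv> a_inv M a"
abbreviation (input) mult_sub ("_ \<otimes>\<^sub>_ _" [70, 1000, 71] 70) where "a \<otimes>\<^sub>M b \<equiv> mult M a b"
abbreviation (input) smult_sub ("_ \<odot>\<^sub>_ _" [70, 1000, 71] 70) where "r \<odot>\<^sub>M a \<equiv> smult M r a"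

section \<open>Homomorphisms of modules\<close>

lemma module_homI:
  assumes "\<And>a. a \<in> carrier M \<Longrightarrow> f a \<in> carrier N"
    and "\<And>a b. a \<in> carrier M \<Longrightarrow> b \<in> carrier M \<Longrightarrow> f (a \<oplus>\<^sub>M b) = f a \<oplus>\<^sub>N f b"
    and "\<And>r a. r \<in> carrier R \<Longrightarrow> a \<in> carrier M \<Longrightarrow> f (r \<odot>\<^sub>M a) = r \<odot>\<^sub>N f a"
  shows "f \<in> module_hom R M N" using assms by (auto simp: module_hom_def)

lemma module_hom_mem: "f \<in> module_hom R M N \<Longrightarrow> a \<in> carrier M \<Longrightarrow> f a \<in> carrier N"
  by (auto simp: module_hom_def)

lemma module_hom_cong:
  assumes "module R M" "\<And>a. a \<in> carrier M \<Longrightarrow> f a = g a" "f \<in> module_hom R M N"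
  shows "g \<in> module_hom R M N"
proof -
  interpret module R M by fact
  show ?thesis
  proof (rule module_homI)
    show "g a \<in> carrier N" if "a \<in> carrier M" for a using assms(2,3) that by (metis module_hom_mem)
    show "g (a \<oplus>\<^sub>M b) = g a \<oplus>\<^sub>N g b" if "a \<in> carrier M" "b \<in> carrier M" for a b
      using module_hom_add[OF assms(3)] assms(2)[of a] assms(2)[of b] assms(2)[of "a \<oplus>\<^sub>M b"] that
      by simp
    show "g (r \<odot>\<^sub>M a) = r \<odot>\<^sub>N g a" if "r \<in> carrier R" "a \<in> carrier M" for r a
      using module_hom_smult[OF assms(3)] assms(2)[of a] assms(2)[of "r \<odot>\<^sub>M a"] that by simp
  qed
qed

lemma module_hom_zero:
  assumes "module R M" "module R N" "f \<in> module_hom R M N"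
  shows "f \<zero>\<^sub>M = \<zero>\<^sub>N"
proof -
  interpret mod_hom R M N f using assms by (simp add: mod_hom_def mod_hom_axioms_def)
  show ?thesis by simp
qed

lemma module_hom_diff:
  assumes "module R M" "module R N" "f \<in> module_hom R M N" "a \<in> carrier M" "b \<in> carrier M"
  shows "f (a \<ominus>\<^sub>M b) = f a \<ominus>\<^sub>N f b"
proof -
  interpret mod_hom R M N f using assms by (simp add: mod_hom_def mod_hom_axioms_def)
  show ?thesis using assms by simp
qed

lemma (in module) diff_eq_zero_iff: "a \<in> carrier M \<Longrightarrow> b \<in> carrier M \<Longrightarrow> a \<ominus>\<^sub>M b = \<zero>\<^sub>M \<longleftrightarrow> a = b"
proof
  assume ab: "a \<in> carrier M" "b \<in> carrier M"
  have "(a \<ominus>\<^sub>M b) \<oplus>\<^sub>M b = a" using ab by (simp add: a_minus_def M.a_assoc M.l_neg)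
  then show "a = b" if "a \<ominus>\<^sub>M b = \<zero>\<^sub>M" using that ab by simp
  show "a \<ominus>\<^sub>M b = \<zero>\<^sub>M" if "a = b" using that ab by (simp add: a_minus_def M.r_neg)
qed

lemma module_hom_eq_iff:
  assumes "module R M" "module R N" "f \<in> module_hom R M N" "a \<in> carrier M" "b \<in> carrier M"
  shows "f a = f b \<longleftrightarrow> f (a \<ominus>\<^sub>M b) = \<zero>\<^sub>N" using module.diff_eq_zero_iff[OF assms(2), of "f a" "f b"]
    module_hom_mem[OF assms(3,4)] module_hom_mem[OF assms(3,5)]
  by (simp add: module_hom_diff[OF assms])

lemma module_hom_injI:
  assumes "module R M" "module R N" "f \<in> module_hom R M N"
    and "\<And>a. a \<in> carrier M \<Longrightarrow> f a = \<zero>\<^sub>N \<Longrightarrow> a = \<zero>\<^sub>M"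
  shows "inj_on f (carrier M)"
proof (rule inj_onI)
  interpret module R M by fact
  fix a b assume ab: "a \<in> carrier M" "b \<in> carrier M" "f a = f b"
  then have "f (a \<ominus>\<^sub>M b) = \<zero>\<^sub>N" using module_hom_eq_iff[OF assms(1-3)] by simp
  then show "a = b" using assms(4)[of "a \<ominus>\<^sub>M b"] ab diff_eq_zero_iff by simp
qed

lemma module_hom_id: "(\<lambda>a. a) \<in> module_hom R M M" by (auto simp: module_hom_def)

lemma module_hom_comp:
  assumes "f \<in> module_hom R M N" "g \<in> module_hom R N L"
  shows "(\<lambda>a. g (f a)) \<in> module_hom R M L" using assms by (auto simp: module_hom_def Pi_def)

lemma module_hom_inv_into:
  assumes "module R M" "f \<in> module_hom R M N" "bij_betw f (carrier M) (carrier N)"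
  shows "inv_into (carrier M) f \<in> module_hom R N M"
proof -
  interpret module R M by fact
  let ?g = "inv_into (carrier M) f"
  have g: "?g b \<in> carrier M" "f (?g b) = b" if "b \<in> carrier N" for b
    using assms(3) that by (auto simp: bij_betw_def inv_into_into f_inv_into_f)
  have u: "?g (f a) = a" if "a \<in> carrier M" for a using assms(3) that by (auto simp: bij_betw_def)
  show ?thesis
  proof (rule module_homI)
    show "?g (a \<oplus>\<^sub>N b) = ?g a \<oplus>\<^sub>M ?g b" if "a \<in> carrier N" "b \<in> carrier N" for a b
      using u[of "?g a \<oplus>\<^sub>M ?g b"] module_hom_add[OF assms(2)] g that by simp
    show "?g (r \<odot>\<^sub>N a) = r \<odot>\<^sub>M ?g a" if "r \<in> carrier R" "a \<in> carrier N" for r a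
      using u[of "r \<odot>\<^sub>M ?g a"] module_hom_smult[OF assms(2)] g that by simp
  qed (use g in auto)
qed

text \<open>The universal property of a quotient without a quotient construction: any preimage
  chosen by \<open>inv_into\<close> serves, because two preimages differ by an element of the
  kernel, which \<open>h\<close> kills. Most maps out of a module below come from this
  lemma.\<close>

lemma module_hom_factor_surj:
  assumes M: "module R L" "module R Z" "module R M"
    and t: "t \<in> module_hom R L Z" "t ` carrier L = carrier Z" and h: "h \<in> module_hom R L M"
    and ker: "\<And>l. l \<in> carrier L \<Longrightarrow> t l = \<zero>\<^sub>Z \<Longrightarrow> h l = \<zero>\<^sub>M"
  obtains g where "g \<in> module_hom R Z M" "\<And>l. l \<in> carrier L \<Longrightarrow> g (t l) = h l"
proof -
  interpret module R L by fact
  let ?g = "\<lambda>y. h (inv_into (carrier L) t y)"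
  have gt: "?g (t l) = h l" if l: "l \<in> carrier L" for l
  proof -
    have i: "inv_into (carrier L) t (t l) \<in> carrier L" "t (inv_into (carrier L) t (t l)) = t l"
      using inv_into_into[of "t l" t "carrier L"] f_inv_into_f[of "t l" t "carrier L"] l by blast+
    then have "t (inv_into (carrier L) t (t l) \<ominus>\<^sub>L l) = \<zero>\<^sub>Z"
      using module_hom_eq_iff[OF M(1,2) t(1) i(1) l] by simp
    then show ?thesis using ker module_hom_eq_iff[OF M(1,3) h i(1) l] i(1) l by simp
  qed
  have "?g \<in> module_hom R Z M"
  proof (rule module_homI)
    fix a assume "a \<in> carrier Z"
    then obtain l where l: "l \<in> carrier L" "a = t l" using t(2) by auto
    show "?g a \<in> carrier M" using l gt module_hom_mem[OF h] by simp
    show "?g (r \<odot>\<^sub>Z a) = r \<odot>\<^sub>M ?g a" if "r \<in> carrier R" for r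
      using l that gt[of "r \<odot>\<^sub>L l"] gt[of l] module_hom_smult[OF h] module_hom_smult[OF t(1)] by simp
    fix b assume "b \<in> carrier Z"
    then obtain k where k: "k \<in> carrier L" "b = t k" using t(2) by auto
    show "?g (a \<oplus>\<^sub>Z b) = ?g a \<oplus>\<^sub>M ?g b"
      using l k gt[of "l \<oplus>\<^sub>L k"] gt[of l] gt[of k] module_hom_add[OF h] module_hom_add[OF t(1)]
      by simp
  qed
  then show ?thesis using gt that by blast
qed

text \<open>The dual of \<open>module_hom_factor_surj\<close>. Preimages under \<open>f\<close> are
  unique, so comparing images under \<open>f\<close> yields additivity and linearity of
  \<open>g\<close>.\<close>

lemma module_hom_factor_inj:
  assumes M: "module R P" "module R Y" "module R L"
    and f: "f \<in> module_hom R Y L" "inj_on f (carrier Y)"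
    and p: "p \<in> module_hom R P L" "p ` carrier P \<subseteq> f ` carrier Y"
  obtains g where "g \<in> module_hom R P Y" "\<And>a. a \<in> carrier P \<Longrightarrow> f (g a) = p a"
proof -
  interpret P: module R P by fact
  interpret Y: module R Y by fact
  let ?g = "\<lambda>a. inv_into (carrier Y) f (p a)"
  have g: "?g a \<in> carrier Y" "f (?g a) = p a" if "a \<in> carrier P" for a
    using p(2) that by (metis image_subset_iff inv_into_into f_inv_into_f)+
  have "?g \<in> module_hom R P Y"
  proof (rule module_homI)
    fix a assume a: "a \<in> carrier P"
    show "?g a \<in> carrier Y" using a g by simp
    show "?g (r \<odot>\<^sub>P a) = r \<odot>\<^sub>Y ?g a" if r: "r \<in> carrier R" for r
      using inj_onD[OF f(2), of "?g (r \<odot>\<^sub>P a)" "r \<odot>\<^sub>Y ?g a"] g[of "r \<odot>\<^sub>P a"] g[of a] a r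
        module_hom_smult[OF f(1)] module_hom_smult[OF p(1)] by simp
    fix b assume b: "b \<in> carrier P"
    show "?g (a \<oplus>\<^sub>P b) = ?g a \<oplus>\<^sub>Y ?g b"
      using inj_onD[OF f(2), of "?g (a \<oplus>\<^sub>P b)" "?g a \<oplus>\<^sub>Y ?g b"] g[of "a \<oplus>\<^sub>P b"] g[of a] g[of b] a b
        module_hom_add[OF f(1)] module_hom_add[OF p(1)] by simp
  qed
  then show ?thesis using g that by blast
qed

lemma module_isomorphic_refl: "module_isomorphic R M M"
  unfolding module_isomorphic_def by (rule bexI[of _ "\<lambda>a. a"]) (auto simp: module_hom_id bij_betw_def)

lemma module_isomorphic_sym:
  assumes "module R M" "module_isomorphic R M N"
  shows "module_isomorphic R N M" using assms module_hom_inv_into[OF assms(1)] bij_betw_inv_into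
  unfolding module_isomorphic_def by blast

lemma module_isomorphic_trans:
  assumes "module_isomorphic R M N" "module_isomorphic R N L"
  shows "module_isomorphic R M L"
proof -
  obtain f g where "f \<in> module_hom R M N" "bij_betw f (carrier M) (carrier N)"
    "g \<in> module_hom R N L" "bij_betw g (carrier N) (carrier L)"
    using assms unfolding module_isomorphic_def by auto
  then show ?thesis unfolding module_isomorphic_def
    using bij_betw_trans[of f "carrier M" "carrier N" g "carrier L"] module_hom_comp[of f R M N g L]
    by (intro bexI[of _ "\<lambda>a. g (f a)"]) (auto simp: comp_def)
qed

lemma module_isomorphic_card: "module_isomorphic R M N \<Longrightarrow> card (carrier M) = card (carrier N)"
  unfolding module_isomorphic_def by (auto dest: bij_betw_same_card)


section \<open>Quotients of modules on the natural numbers\<close>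

text \<open>Transport of structure along \<open>t\<close>, computed on preimages chosen by
  \<open>inv_into\<close>. If the fibres of \<open>t\<close> are the classes of a congruence, this
  is the quotient module, with \<open>t\<close> naming the classes by elements of any convenient
  type.\<close>

definition image_module :: "('m \<Rightarrow> 'n) \<Rightarrow> ('r, 'm) module \<Rightarrow> ('r, 'n) module" where
  "image_module t M = \<lparr>carrier = t ` carrier M, mult = undefined, one = undefined, zero = t \<zero>\<^sub>M,
     add = (\<lambda>a b. t (inv_into (carrier M) t a \<oplus>\<^sub>M inv_into (carrier M) t b)),
     smult = (\<lambda>r a. t (r \<odot>\<^sub>M inv_into (carrier M) t a))\<rparr>"

lemma image_module:
  assumes M: "module R M"
    and add: "\<And>a a' b b'. \<lbrakk>a \<in> carrier M; a' \<in> carrier M; b \<in> carrier M; b' \<in> carrier M;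
      t a = t a'; t b = t b'\<rbrakk> \<Longrightarrow> t (a \<oplus>\<^sub>M b) = t (a' \<oplus>\<^sub>M b')"
    and smult: "\<And>r a a'. \<lbrakk>r \<in> carrier R; a \<in> carrier M; a' \<in> carrier M; t a = t a'\<rbrakk> \<Longrightarrow>
      t (r \<odot>\<^sub>M a) = t (r \<odot>\<^sub>M a')"
  shows "module R (image_module t M)" "t \<in> module_hom R M (image_module t M)"
    "t ` carrier M = carrier (image_module t M)"
proof -
  interpret module R M by fact
  let ?I = "image_module t M"
  have i: "inv_into (carrier M) t (t a) \<in> carrier M" "t (inv_into (carrier M) t (t a)) = t a"
    if "a \<in> carrier M" for a
    using inv_into_into[of "t a" t "carrier M"] f_inv_into_f[of "t a" t "carrier M"] that by blast+
  have a: "t a \<oplus>\<^bsub>?I\<^esub> t b = t (a \<oplus>\<^sub>M b)" if "a \<in> carrier M" "b \<in> carrier M" for a b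
    using add[OF i(1)[OF that(1)] that(1) i(1)[OF that(2)] that(2) i(2)[OF that(1)] i(2)[OF that(2)]]
    by (simp add: image_module_def)
  have s: "r \<odot>\<^bsub>?I\<^esub> t a = t (r \<odot>\<^sub>M a)" if "r \<in> carrier R" "a \<in> carrier M" for r a
    using smult[OF that(1) i(1)[OF that(2)] that(2) i(2)[OF that(2)]]
    by (simp add: image_module_def)
  have c: "carrier ?I = t ` carrier M" and z: "\<zero>\<^bsub>?I\<^esub> = t \<zero>\<^sub>M" by (simp_all add: image_module_def)
  have "abelian_group ?I"
  proof (rule abelian_groupI)
    show "\<zero>\<^bsub>?I\<^esub> \<in> carrier ?I" by (simp add: c z)
    fix x' assume "x' \<in> carrier ?I"
    then obtain x where x: "x \<in> carrier M" "x' = t x" using c by auto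
    show "\<zero>\<^bsub>?I\<^esub> \<oplus>\<^bsub>?I\<^esub> x' = x'" using x by (simp add: z a)
    have "t (\<ominus>\<^sub>M x) \<oplus>\<^bsub>?I\<^esub> x' = \<zero>\<^bsub>?I\<^esub>" using x by (simp add: z a M.l_neg)
    then show "\<exists>y\<in>carrier ?I. y \<oplus>\<^bsub>?I\<^esub> x' = \<zero>\<^bsub>?I\<^esub>" using x c by blast
    fix y' assume "y' \<in> carrier ?I"
    then obtain y where y: "y \<in> carrier M" "y' = t y" using c by auto
    show "x' \<oplus>\<^bsub>?I\<^esub> y' \<in> carrier ?I" using x y by (simp add: a c)
    show "x' \<oplus>\<^bsub>?I\<^esub> y' = y' \<oplus>\<^bsub>?I\<^esub> x'" using x y by (simp add: a M.a_comm)
    fix z' assume "z' \<in> carrier ?I"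
    then obtain z where z: "z \<in> carrier M" "z' = t z" using c by auto
    show "x' \<oplus>\<^bsub>?I\<^esub> y' \<oplus>\<^bsub>?I\<^esub> z' = x' \<oplus>\<^bsub>?I\<^esub> (y' \<oplus>\<^bsub>?I\<^esub> z')" using x y z by (simp add: a M.a_assoc)
  qed
  then show "module R ?I"
  proof (rule moduleI[OF is_cring])
    fix x' assume "x' \<in> carrier ?I"
    then obtain x where x: "x \<in> carrier M" "x' = t x" using c by auto
    show "\<one>\<^sub>R \<odot>\<^bsub>?I\<^esub> x' = x'" using x by (simp add: s)
    fix r assume r: "r \<in> carrier R"
    show "r \<odot>\<^bsub>?I\<^esub> x' \<in> carrier ?I" using x r by (simp add: s c)
    show "r \<odot>\<^bsub>?I\<^esub> (x' \<oplus>\<^bsub>?I\<^esub> y') = r \<odot>\<^bsub>?I\<^esub> x' \<oplus>\<^bsub>?I\<^esub> r \<odot>\<^bsub>?I\<^esub> y'" if y': "y' \<in> carrier ?I" for y'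
    proof -
      obtain y where y: "y \<in> carrier M" "y' = t y" using y' c by auto
      then show ?thesis using x r by (simp add: s a smult_r_distr)
    qed
    fix q assume q: "q \<in> carrier R"
    show "(r \<oplus>\<^sub>R q) \<odot>\<^bsub>?I\<^esub> x' = r \<odot>\<^bsub>?I\<^esub> x' \<oplus>\<^bsub>?I\<^esub> q \<odot>\<^bsub>?I\<^esub> x'"
      "(r \<otimes>\<^sub>R q) \<odot>\<^bsub>?I\<^esub> x' = r \<odot>\<^bsub>?I\<^esub> (q \<odot>\<^bsub>?I\<^esub> x')"
      using x r q by (simp_all add: s a smult_l_distr smult_assoc1)
  qed
  show "t \<in> module_hom R M ?I" by (rule module_homI) (simp_all add: c a s)
  show "t ` carrier M = carrier ?I" by (simp add: c)
qed

text \<open>Isoclasses contain only modules on the natural numbers, so quotients have to be produced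
  on that type. This is possible because a finite module has finitely many cosets.\<close>

lemma quotient_module_exists:
  fixes R :: "('r, 'c) ring_scheme" and L :: "('r, 'm) module"
  assumes M: "module R L" "finite (carrier L)" and U: "Module.submodule U R L"
  obtains Z :: "('r, nat) module" and t where "module R Z" "t \<in> module_hom R L Z"
    "t ` carrier L = carrier Z" "\<And>l. l \<in> carrier L \<Longrightarrow> t l = \<zero>\<^sub>Z \<longleftrightarrow> l \<in> U"
proof -
  interpret module R L by fact
  note U' = submoduleE[OF U]
  have U0: "\<zero>\<^sub>L \<in> U" using subgroup.one_closed[OF Module.submodule.axioms(1)[OF U]] by simp
  have Ud: "a \<ominus>\<^sub>L b \<in> U" if "a \<in> U" "b \<in> U" for a b
    unfolding a_minus_def by (rule U'(5)[OF that(1) U'(3)[OF that(2)]])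
  \<comment> \<open>A coset is a subset of the finite carrier, so an injection of the power set into
    the naturals numbers the cosets; \<open>t a\<close> is the number of the coset of
    \<open>a\<close>.\<close>
  obtain e :: "_ \<Rightarrow> nat" where e: "inj_on e (Pow (carrier L))"
    using finite_imp_inj_to_nat_seg[of "Pow (carrier L)"] M(2) by auto
  define t where "t a = e {b \<in> carrier L. b \<ominus>\<^sub>L a \<in> U}" for a
  have t: "t a = t b \<longleftrightarrow> a \<ominus>\<^sub>L b \<in> U" if ab: "a \<in> carrier L" "b \<in> carrier L" for a b
  proof
    assume "t a = t b"
    then have "{c \<in> carrier L. c \<ominus>\<^sub>L a \<in> U} = {c \<in> carrier L. c \<ominus>\<^sub>L b \<in> U}"
      using e unfolding t_def by (auto dest: inj_onD)
    moreover have "a \<in> {c \<in> carrier L. c \<ominus>\<^sub>L a \<in> U}" using ab U0 by (simp add: a_minus_def M.r_neg)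
    ultimately show "a \<ominus>\<^sub>L b \<in> U" by auto
  next
    assume u: "a \<ominus>\<^sub>L b \<in> U"
    have "c \<ominus>\<^sub>L a \<in> U \<longleftrightarrow> c \<ominus>\<^sub>L b \<in> U" if c: "c \<in> carrier L" for c
    proof -
      have "c \<ominus>\<^sub>L b = (c \<ominus>\<^sub>L a) \<oplus>\<^sub>L (a \<ominus>\<^sub>L b)"
        using c ab by (simp add: a_minus_def M.a_assoc M.r_neg1)
      moreover have "c \<ominus>\<^sub>L a = (c \<ominus>\<^sub>L b) \<ominus>\<^sub>L (a \<ominus>\<^sub>L b)"
      proof -
        have "\<ominus>\<^sub>L (a \<ominus>\<^sub>L b) = b \<ominus>\<^sub>L a" using ab by (simp add: a_minus_def M.minus_add M.a_comm)
        then show ?thesis using c ab by (simp add: a_minus_def M.a_assoc M.r_neg1)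
      qed
      ultimately
      show ?thesis using u U'(5)[of "c \<ominus>\<^sub>L a" "a \<ominus>\<^sub>L b"] Ud[of "c \<ominus>\<^sub>L b" "a \<ominus>\<^sub>L b"] by auto
    qed
    then have "{c \<in> carrier L. c \<ominus>\<^sub>L a \<in> U} = {c \<in> carrier L. c \<ominus>\<^sub>L b \<in> U}" by blast
    then show "t a = t b" by (simp add: t_def)
  qed
  have "t (a \<oplus>\<^sub>L b) = t (a' \<oplus>\<^sub>L b')"
    if ab: "a \<in> carrier L" "a' \<in> carrier L" "b \<in> carrier L" "b' \<in> carrier L"
      "t a = t a'" "t b = t b'" for a a' b b'
  proof -
    have "(a \<oplus>\<^sub>L b) \<ominus>\<^sub>L (a' \<oplus>\<^sub>L b') = (a \<ominus>\<^sub>L a') \<oplus>\<^sub>L (b \<ominus>\<^sub>L b')"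
      using ab by (simp add: a_minus_def M.minus_add M.a_ac)
    then show ?thesis using ab t U'(5) by simp
  qed
  moreover have "t (r \<odot>\<^sub>L a) = t (r \<odot>\<^sub>L a')"
    if ab: "r \<in> carrier R" "a \<in> carrier L" "a' \<in> carrier L" "t a = t a'" for r a a'
  proof -
    have "(r \<odot>\<^sub>L a) \<ominus>\<^sub>L (r \<odot>\<^sub>L a') = r \<odot>\<^sub>L (a \<ominus>\<^sub>L a')"
      using ab by (simp add: a_minus_def smult_r_distr smult_r_minus)
    then show ?thesis using ab t U'(4) by simp
  qed
  ultimately have *: "module R (image_module t L)" "t \<in> module_hom R L (image_module t L)"
    "t ` carrier L = carrier (image_module t L)" using image_module[OF M(1), of t] by blast+
  have "t l = \<zero>\<^bsub>image_module t L\<^esub> \<longleftrightarrow> l \<in> U" if "l \<in> carrier L" for l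
    using t[OF that M.zero_closed] that M.minus_equality[of "\<zero>\<^sub>L" "\<zero>\<^sub>L"]
    by (simp add: image_module_def a_minus_def)
  then show ?thesis using that * by blast
qed

text \<open>The quotient by the zero submodule, formed only to move a finite module to the natural
  numbers.\<close>

lemma nat_module_exists:
  fixes R :: "('r, 'c) ring_scheme" and L :: "('r, 'm) module"
  assumes M: "module R L" "finite (carrier L)"
  obtains Z :: "('r, nat) module" and t where "module R Z" "finite (carrier Z)"
    "t \<in> module_hom R L Z" "bij_betw t (carrier L) (carrier Z)"
proof -
  interpret module R L by fact
  have "Module.submodule {\<zero>\<^sub>L} R L" by (rule submoduleI) auto
  then obtain Z :: "('r, nat) module" and t where Z: "module R Z" "t \<in> module_hom R L Z"
    "t ` carrier L = carrier Z" "\<And>l. l \<in> carrier L \<Longrightarrow> t l = \<zero>\<^sub>Z \<longleftrightarrow> l \<in> {\<zero>\<^sub>L}"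
    using quotient_module_exists[OF M] by metis
  moreover have "bij_betw t (carrier L) (carrier Z)"
    unfolding bij_betw_def using Z module_hom_injI[OF M(1) Z(1,2)] by auto
  moreover have "finite (carrier Z)" using Z(3) M(2) by (metis finite_imageI)
  ultimately show ?thesis using that by blast
qed

lemma kernel_submodule:
  assumes "module R M" "module R N" "f \<in> module_hom R M N"
  shows "Module.submodule {a \<in> carrier M. f a = \<zero>\<^sub>N} R M"
proof -
  interpret mod_hom R M N f using assms by (simp add: mod_hom_def mod_hom_axioms_def)
  show ?thesis by (rule M.submoduleI) auto
qed

lemma image_submodule:
  assumes "module R M" "module R N" "f \<in> module_hom R M N"
  shows "Module.submodule (f ` carrier M) R N"
proof -
  interpret mod_hom R M N f using assms by (simp add: mod_hom_def mod_hom_axioms_def)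
  show ?thesis
  proof (rule N.submoduleI)
    have "f \<zero>\<^sub>M \<in> f ` carrier M" by (rule imageI) simp
    then show "\<zero>\<^sub>N \<in> f ` carrier M" by simp
    fix b assume "b \<in> f ` carrier M"
    then obtain b' where b: "b' \<in> carrier M" "b = f b'" by auto
    have "f (\<ominus>\<^sub>M b') \<in> f ` carrier M" by (rule imageI) (simp add: b)
    then show "\<ominus>\<^sub>N b \<in> f ` carrier M" using b by simp
    show "r \<odot>\<^sub>N b \<in> f ` carrier M" if "r \<in> carrier R" for r
    proof -
      have "f (r \<odot>\<^sub>M b') \<in> f ` carrier M" by (rule imageI) (simp add: b that)
      then show ?thesis using b that by simp
    qed
    fix a assume "a \<in> f ` carrier M"
    then obtain a' where a: "a' \<in> carrier M" "a = f a'" by auto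
    have "f (a' \<oplus>\<^sub>M b') \<in> f ` carrier M" by (rule imageI) (simp add: a b)
    then show "a \<oplus>\<^sub>N b \<in> f ` carrier M" using a b by simp
  qed (use f_im in auto)
qed

lemma submodule_module: "module R M \<Longrightarrow> Module.submodule U R M \<Longrightarrow> module R (M\<lparr>carrier := U\<rparr>)"
  by (rule Module.submodule.submodule_is_module)

section \<open>Counting short exact sequences\<close>

text \<open>A fixed middle term and extensional maps make the short exact sequences a finite set
  that can be counted; in \<open>extensions\<close> the middle term varies and the maps are
  arbitrary off the carriers.\<close>

definition exact_pairs :: "('r, 'c) ring_scheme \<Rightarrow> ('r, 'n) module \<Rightarrow> ('r, 'l) module \<Rightarrow>
    ('r, 'm) module \<Rightarrow> (('n \<Rightarrow> 'l) \<times> ('l \<Rightarrow> 'm)) set" where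
  "exact_pairs R N L M = {(f, g). f \<in> Hom R N L \<and> g \<in> Hom R L M \<and> short_exact R N L M f g}"

definition module_aut :: "('r, 'c) ring_scheme \<Rightarrow> ('r, 'm) module \<Rightarrow> ('m \<Rightarrow> 'm) set" where
  "module_aut R L = {\<phi> \<in> Hom R L L. bij_betw \<phi> (carrier L) (carrier L)}"

lemma exact_pairsI:
  assumes "f \<in> Hom R N L" "g \<in> Hom R L M" "inj_on f (carrier N)" "g ` carrier L = carrier M"
    and "\<And>a. a \<in> carrier N \<Longrightarrow> g (f a) = \<zero>\<^sub>M"
    and "\<And>l. l \<in> carrier L \<Longrightarrow> g l = \<zero>\<^sub>M \<Longrightarrow> l \<in> f ` carrier N"
  shows "(f, g) \<in> exact_pairs R N L M"
  using assms module_hom_mem[of f R N L] by (auto simp: exact_pairs_def short_exact_def Hom_def)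

lemma exact_pairsD:
  assumes "(f, g) \<in> exact_pairs R N L M"
  shows "f \<in> Hom R N L" "g \<in> Hom R L M" "f \<in> module_hom R N L" "g \<in> module_hom R L M"
    "inj_on f (carrier N)" "g ` carrier L = carrier M"
    "\<And>a. a \<in> carrier N \<Longrightarrow> f a \<in> carrier L \<and> g (f a) = \<zero>\<^sub>M"
    "f ` carrier N = {l \<in> carrier L. g l = \<zero>\<^sub>M}"
  using assms unfolding exact_pairs_def short_exact_def Hom_def by auto

lemma Hom_restrict: "module R M \<Longrightarrow> f \<in> module_hom R M N \<Longrightarrow> restrict f (carrier M) \<in> Hom R M N"
  unfolding Hom_def by (auto intro: module_hom_cong[of R M f])

lemma Hom_eqI: "f \<in> Hom R M N \<Longrightarrow> g \<in> Hom R M N' \<Longrightarrow> (\<And>a. a \<in> carrier M \<Longrightarrow> f a = g a) \<Longrightarrow> f = g"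
  unfolding Hom_def by (auto intro: extensionalityI)

lemma Hom_module_hom: "f \<in> Hom R M N \<Longrightarrow> f \<in> module_hom R M N" by (simp add: Hom_def)

lemma finite_Hom:
  assumes "finite (carrier M)" "finite (carrier N)"
  shows "finite (Hom R M N)"
proof (rule finite_subset)
  show "Hom R M N \<subseteq> carrier M \<rightarrow>\<^sub>E carrier N" by (auto simp: Hom_def module_hom_def PiE_def)
  show "finite (carrier M \<rightarrow>\<^sub>E carrier N)" using assms by (simp add: finite_PiE)
qed

lemma finite_exact_pairs:
  assumes "finite (carrier N)" "finite (carrier L)" "finite (carrier M)"
  shows "finite (exact_pairs R N L M)" by (rule finite_subset[of _ "Hom R N L \<times> Hom R L M"])
    (auto simp: exact_pairs_def finite_Hom assms)

lemma finite_module_aut: "finite (carrier L) \<Longrightarrow> finite (module_aut R L)"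
  unfolding module_aut_def by (simp add: finite_Hom)

lemma module_aut_card_pos:
  assumes "module R L" "finite (carrier L)"
  shows "card (module_aut R L) > 0"
proof -
  have "restrict (\<lambda>a. a) (carrier L) \<in> module_aut R L"
    unfolding module_aut_def using Hom_restrict[OF assms(1) module_hom_id]
    by (auto simp: bij_betw_def inj_on_def)
  then show ?thesis using finite_module_aut[OF assms(2)] card_gt_0_iff by blast
qed

lemma Hom_card_pos:
  assumes "module R M" "module R N" "finite (carrier M)" "finite (carrier N)"
  shows "card (Hom R M N) > 0"
proof -
  interpret M: module R M by fact
  interpret N: module R N by fact
  have "(\<lambda>_. \<zero>\<^sub>N) \<in> module_hom R M N" by (auto simp: module_hom_def)
  from Hom_restrict[OF assms(1) this] show ?thesis
    using finite_Hom[OF assms(3,4)] card_gt_0_iff by blast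
qed

lemma module_hom_plus:
  assumes "module R M" "module R N" "f \<in> module_hom R M N" "g \<in> module_hom R M N"
  shows "(\<lambda>a. f a \<oplus>\<^sub>N g a) \<in> module_hom R M N"
proof -
  interpret N: module R N by fact
  note m = module_hom_mem[OF assms(3)] module_hom_mem[OF assms(4)]
  show ?thesis
    by (rule module_homI) (simp_all add: m module_hom_add[OF assms(3)] module_hom_add[OF assms(4)]
        module_hom_smult[OF assms(3)] module_hom_smult[OF assms(4)] N.smult_r_distr N.M.a_ac)
qed

lemma module_hom_minus:
  assumes "module R M" "module R N" "f \<in> module_hom R M N" "g \<in> module_hom R M N"
  shows "(\<lambda>a. f a \<ominus>\<^sub>N g a) \<in> module_hom R M N"
proof -
  interpret N: module R N by fact
  note m = module_hom_mem[OF assms(3)] module_hom_mem[OF assms(4)]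
  show ?thesis
    by (rule module_homI) (simp_all add: m module_hom_add[OF assms(3)] module_hom_add[OF assms(4)]
        module_hom_smult[OF assms(3)] module_hom_smult[OF assms(4)] N.smult_r_distr N.M.a_ac
        a_minus_def N.smult_r_minus N.M.minus_add)
qed

text \<open>A bijection given as a relation. In the counts below the matching maps are known only
  through equations on carriers, and one direction is a factorisation that exists without a
  formula.\<close>

lemma card_eq_by_relation:
  assumes "\<And>a. a \<in> A \<Longrightarrow> \<exists>b\<in>B. \<rho> a b" "\<And>b. b \<in> B \<Longrightarrow> \<exists>a\<in>A. \<rho> a b"
    and "\<And>a b b'. \<lbrakk>a \<in> A; b \<in> B; b' \<in> B; \<rho> a b; \<rho> a b'\<rbrakk> \<Longrightarrow> b = b'"
    and "\<And>a a' b. \<lbrakk>a \<in> A; a' \<in> A; b \<in> B; \<rho> a b; \<rho> a' b\<rbrakk> \<Longrightarrow> a = a'"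
  shows "card A = card B"
proof -
  obtain F where F: "\<And>a. a \<in> A \<Longrightarrow> F a \<in> B \<and> \<rho> a (F a)" using assms(1) by metis
  have "bij_betw F A B" unfolding bij_betw_def
  proof
    show "inj_on F A" using F assms(4) by (metis inj_onI)
    show "F ` A = B" using F assms(2,3) by blast
  qed
  then show ?thesis by (rule bij_betw_same_card)
qed

text \<open>The automorphisms of \<open>L\<close> that carry one extension to another form a torsor under
  \<open>\<theta> \<mapsto> 1 + f' \<theta> g\<close>.\<close>

lemma card_aut_carrying:
  assumes mods: "module R N" "module R L" "module R M" and fin: "finite (carrier L)"
    and E: "(f, g) \<in> exact_pairs R N L M" "(f', g') \<in> exact_pairs R N L M"
    and \<psi>: "\<psi> \<in> module_aut R L" "\<And>a. a \<in> carrier N \<Longrightarrow> \<psi> (f a) = f' a"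
      "\<And>l. l \<in> carrier L \<Longrightarrow> g' (\<psi> l) = g l"
  shows "card {\<phi> \<in> module_aut R L. (\<forall>a\<in>carrier N. \<phi> (f a) = f' a) \<and>
    (\<forall>l\<in>carrier L. g' (\<phi> l) = g l)} = card (Hom R M N)" (is "card ?F = _")
proof (rule card_eq_by_relation[symmetric, where
      \<rho> = "\<lambda>\<theta> \<phi>. \<forall>l\<in>carrier L. \<phi> l = \<psi> l \<oplus>\<^sub>L f' (\<theta> (g l))"])
  interpret N: module R N by fact
  interpret L: module R L by fact
  interpret M: module R M by fact
  note e = exact_pairsD[OF E(1)] and e' = exact_pairsD[OF E(2)]
  have \<psi>h: "\<psi> \<in> module_hom R L L" "bij_betw \<psi> (carrier L) (carrier L)"
    using \<psi>(1) by (auto simp: module_aut_def Hom_def)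
  have mem: "g l \<in> carrier M" "\<psi> l \<in> carrier L" if "l \<in> carrier L" for l
    using module_hom_mem[OF e(4) that] module_hom_mem[OF \<psi>h(1) that] .
  fix \<theta> assume \<theta>: "\<theta> \<in> Hom R M N"
  then have \<theta>h: "\<theta> \<in> module_hom R M N" by (rule Hom_module_hom)
  let ?\<phi> = "\<lambda>l. \<psi> l \<oplus>\<^sub>L f' (\<theta> (g l))"
  have \<theta>m: "\<theta> (g l) \<in> carrier N" "f' (\<theta> (g l)) \<in> carrier L" if "l \<in> carrier L" for l
    using module_hom_mem[OF \<theta>h] mem e'(7) that by auto
  have h: "?\<phi> \<in> module_hom R L L"
    by (intro module_hom_plus mods \<psi>h module_hom_comp[OF module_hom_comp[OF e(4) \<theta>h] e'(3)])
  have g\<phi>: "g' (?\<phi> l) = g l" if "l \<in> carrier L" for l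
    using that module_hom_add[OF e'(4), of "\<psi> l" "f' (\<theta> (g l))"] \<psi>(3) mem \<theta>m e'(7) by simp
  have z: "\<theta> \<zero>\<^sub>M = \<zero>\<^sub>N" "f' \<zero>\<^sub>N = \<zero>\<^sub>L" "\<psi> \<zero>\<^sub>L = \<zero>\<^sub>L" "g' \<zero>\<^sub>L = \<zero>\<^sub>M"
    using module_hom_zero[OF mods(3,1) \<theta>h] module_hom_zero[OF mods(1,2) e'(3)]
      module_hom_zero[OF mods(2,2) \<psi>h(1)] module_hom_zero[OF mods(2,3) e'(4)] .
  have "inj_on ?\<phi> (carrier L)"
  proof (rule module_hom_injI[OF mods(2,2) h])
    fix l assume l: "l \<in> carrier L" "?\<phi> l = \<zero>\<^sub>L"
    then have "g l = \<zero>\<^sub>M" using g\<phi>[OF l(1)] z by simp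
    then have "\<psi> l = \<psi> \<zero>\<^sub>L" using l mem z by simp
    then show "l = \<zero>\<^sub>L" using \<psi>h(2) l by (auto simp: bij_betw_def dest: inj_onD)
  qed
  moreover from this have "?\<phi> ` carrier L = carrier L"
    using endo_inj_surj[OF fin, of ?\<phi>] module_hom_closed[OF h] by auto
  ultimately have bij: "bij_betw ?\<phi> (carrier L) (carrier L)" by (simp add: bij_betw_def)
  have "bij_betw (restrict ?\<phi> (carrier L)) (carrier L) (carrier L)"
    using bij by (rule bij_betw_cong[THEN iffD1, rotated]) simp
  then have "restrict ?\<phi> (carrier L) \<in> module_aut R L"
    using Hom_restrict[OF mods(2) h] by (simp add: module_aut_def)
  moreover have "restrict ?\<phi> (carrier L) (f a) = f' a" if "a \<in> carrier N" for a
    using e(7)[OF that] e'(7)[OF that] z \<psi>(2)[OF that] by simp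
  ultimately have "restrict ?\<phi> (carrier L) \<in> ?F" using g\<phi> by simp
  then show "\<exists>\<phi>\<in>?F. \<forall>l\<in>carrier L. \<phi> l = \<psi> l \<oplus>\<^sub>L f' (\<theta> (g l))" by (rule bexI[rotated]) auto
  fix \<theta>' assume \<theta>': "\<theta>' \<in> Hom R M N"
  fix \<phi> assume "\<phi> \<in> ?F" "\<forall>l\<in>carrier L. \<phi> l = ?\<phi> l" "\<forall>l\<in>carrier L. \<phi> l = \<psi> l \<oplus>\<^sub>L f' (\<theta>' (g l))"
  then have *: "\<psi> l \<oplus>\<^sub>L f' (\<theta> (g l)) = \<psi> l \<oplus>\<^sub>L f' (\<theta>' (g l))" if "l \<in> carrier L" for l
    using that by metis
  have \<theta>'m: "\<theta>' (g l) \<in> carrier N" "f' (\<theta>' (g l)) \<in> carrier L" if "l \<in> carrier L" for l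
    using module_hom_mem[OF Hom_module_hom[OF \<theta>']] mem e'(7) that by auto
  have "f' (\<theta> (g l)) = f' (\<theta>' (g l))" if "l \<in> carrier L" for l
    using *[OF that] mem \<theta>m \<theta>'m that by simp
  then have "\<theta> (g l) = \<theta>' (g l)" if "l \<in> carrier L" for l using e'(5) that \<theta>m \<theta>'m by (meson inj_onD)
  then have "\<theta> m = \<theta>' m" if "m \<in> carrier M" for m using that unfolding e(6)[symmetric] by auto
  then show "\<theta> = \<theta>'" by (rule Hom_eqI[OF \<theta> \<theta>'])
next
  interpret N: module R N by fact
  interpret L: module R L by fact
  interpret M: module R M by fact
  note e = exact_pairsD[OF E(1)] and e' = exact_pairsD[OF E(2)]
  have \<psi>h: "\<psi> \<in> module_hom R L L" using \<psi>(1) by (auto simp: module_aut_def Hom_def)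
  fix \<phi> assume "\<phi> \<in> ?F"
  then have \<phi>: "\<phi> \<in> module_hom R L L" "\<And>a. a \<in> carrier N \<Longrightarrow> \<phi> (f a) = f' a"
    "\<And>l. l \<in> carrier L \<Longrightarrow> g' (\<phi> l) = g l" by (auto simp: module_aut_def Hom_def)
  \<comment> \<open>The difference of \<open>\<phi>\<close> and \<open>\<psi>\<close> is killed by
    \<open>g'\<close>, hence factors through \<open>f'\<close>, and it vanishes on the image of
    \<open>f\<close>, hence factors through \<open>g\<close>. The map from M to N left in the middle
    is the sought \<open>\<theta>\<close>.\<close>
  let ?d = "\<lambda>l. \<phi> l \<ominus>\<^sub>L \<psi> l"
  have mem: "\<phi> l \<in> carrier L" "\<psi> l \<in> carrier L" if "l \<in> carrier L" for l
    using module_hom_mem[OF \<phi>(1)] module_hom_mem[OF \<psi>h] that by auto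
  have d: "?d \<in> module_hom R L L" by (intro module_hom_minus mods \<phi> \<psi>h)
  have "g' (?d l) = \<zero>\<^sub>M" if "l \<in> carrier L" for l
    using module_hom_diff[OF mods(2,3) e'(4)] mem that \<phi>(3) \<psi>(3) module_hom_mem[OF e(4)]
    by (simp add: a_minus_def M.M.r_neg)
  then have "?d ` carrier L \<subseteq> f' ` carrier N" using e'(8) module_hom_mem[OF d] by auto
  from module_hom_factor_inj[OF mods(2,1,2) e'(3,5) d this]
  obtain d' where d': "d' \<in> module_hom R L N" "\<And>l. l \<in> carrier L \<Longrightarrow> f' (d' l) = ?d l" by metis
  have "d' l = \<zero>\<^sub>N" if l: "l \<in> carrier L" "g l = \<zero>\<^sub>M" for l
  proof -
    obtain a where a: "a \<in> carrier N" "l = f a" using e(8) l by auto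
    have "f' (d' l) = f' \<zero>\<^sub>N"
      using d'(2)[OF l(1)] a \<phi>(2) \<psi>(2) e'(7) module_hom_zero[OF mods(1,2) e'(3)]
      by (simp add: a_minus_def L.M.r_neg)
    then show ?thesis using e'(5) module_hom_mem[OF d'(1) l(1)] by (auto dest: inj_onD)
  qed
  from module_hom_factor_surj[OF mods(2,3,1) e(4,6) d'(1) this]
  obtain \<theta> where \<theta>: "\<theta> \<in> module_hom R M N" "\<And>l. l \<in> carrier L \<Longrightarrow> \<theta> (g l) = d' l" by metis
  have "\<phi> l = \<psi> l \<oplus>\<^sub>L f' (restrict \<theta> (carrier M) (g l))" if "l \<in> carrier L" for l
  proof -
    have "\<psi> l \<oplus>\<^sub>L ?d l = \<phi> l" using mem that by (simp add: a_minus_def L.M.a_lcomm L.M.r_neg)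
    then show ?thesis using that \<theta>(2) d'(2) module_hom_mem[OF e(4) that] by simp
  qed
  then show "\<exists>\<theta>\<in>Hom R M N. \<forall>l\<in>carrier L. \<phi> l = \<psi> l \<oplus>\<^sub>L f' (\<theta> (g l))"
    using Hom_restrict[OF mods(3) \<theta>(1)] by blast
next
  fix \<theta> \<phi> \<phi>'
  assume "\<phi> \<in> ?F" "\<phi>' \<in> ?F" "\<forall>l\<in>carrier L. \<phi> l = \<psi> l \<oplus>\<^sub>L f' (\<theta> (g l))"
    "\<forall>l\<in>carrier L. \<phi>' l = \<psi> l \<oplus>\<^sub>L f' (\<theta> (g l))"
  then show "\<phi> = \<phi>'" by (intro Hom_eqI[of \<phi> R L L \<phi>' L]) (auto simp: module_aut_def)
qed

text \<open>The group of automorphisms of \<open>L\<close> acts on the exact pairs; orbits are the extension classes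
  and all stabilisers have the size of \<open>Hom(M, N)\<close>.\<close>

lemma card_orbit_exact_pairs:
  assumes mods: "module R N" "module R L" "module R M"
    and fin: "finite (carrier N)" "finite (carrier L)" "finite (carrier M)"
    and E: "(f, g) \<in> exact_pairs R N L M"
  shows "card {(f', g') \<in> exact_pairs R N L M. \<exists>\<phi>\<in>module_aut R L.
      (\<forall>a\<in>carrier N. \<phi> (f a) = f' a) \<and> (\<forall>l\<in>carrier L. g' (\<phi> l) = g l)} * card (Hom R M N)
    = card (module_aut R L)" (is "card ?O * _ = _")
proof -
  let ?F = "\<lambda>f' g'. {\<phi> \<in> module_aut R L. (\<forall>a\<in>carrier N. \<phi> (f a) = f' a) \<and>
    (\<forall>l\<in>carrier L. g' (\<phi> l) = g l)}"
  note e = exact_pairsD[OF E]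
  have finO: "finite ?O" using finite_exact_pairs[OF fin, of R] by (rule rev_finite_subset) auto
  \<comment> \<open>An automorphism \<open>\<phi>\<close> carries \<open>(f, g)\<close> to exactly
    one exact pair, \<open>\<phi>\<close> after f and g after the inverse of \<open>\<phi>\<close>.
    The sets \<open>?F\<close> therefore partition the automorphism group along the orbit.\<close>
  have "module_aut R L \<subseteq> (\<Union>(f', g')\<in>?O. ?F f' g')"
  proof
    fix \<phi> assume \<phi>: "\<phi> \<in> module_aut R L"
    then have \<phi>h: "\<phi> \<in> module_hom R L L" and bij: "bij_betw \<phi> (carrier L) (carrier L)"
      by (auto simp: module_aut_def Hom_def)
    let ?i = "inv_into (carrier L) \<phi>"
    note ih = module_hom_inv_into[OF mods(2) \<phi>h bij]
    have ii: "?i l \<in> carrier L" "\<phi> (?i l) = l" "?i (\<phi> l) = l" "\<phi> l \<in> carrier L" if "l \<in> carrier L" for l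
      using bij that module_hom_mem[OF ih] module_hom_mem[OF \<phi>h]
      by (auto simp: bij_betw_def f_inv_into_f)
    let ?f = "restrict (\<lambda>a. \<phi> (f a)) (carrier N)" and ?g = "restrict (\<lambda>l. g (?i l)) (carrier L)"
    have "(?f, ?g) \<in> exact_pairs R N L M"
    proof (rule exact_pairsI)
      show "?f \<in> Hom R N L" "?g \<in> Hom R L M"
        by (intro Hom_restrict mods module_hom_comp[OF e(3) \<phi>h] module_hom_comp[OF ih e(4)])+
      show "inj_on ?f (carrier N)" using e(5,7) bij by (auto simp: inj_on_def bij_betw_def)
      show "?g ` carrier L = carrier M"
      proof -
        have "?g ` carrier L = g ` (?i ` carrier L)" by auto
        also have "?i ` carrier L = carrier L"
          using bij_betw_inv_into[OF bij] by (simp add: bij_betw_def)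
        finally show ?thesis using e(6) by simp
      qed
      show "?g (?f a) = \<zero>\<^sub>M" if "a \<in> carrier N" for a using that e(7) ii by simp
      show "l \<in> ?f ` carrier N" if l: "l \<in> carrier L" "?g l = \<zero>\<^sub>M" for l
      proof -
        have "?i l \<in> f ` carrier N" using e(8) l ii by simp
        then obtain a where "a \<in> carrier N" "?i l = f a" by auto
        then show ?thesis using ii(2)[OF l(1)] by (auto intro!: image_eqI[of _ _ a])
      qed
    qed
    moreover have "\<phi> \<in> ?F ?f ?g" using \<phi> ii by simp
    ultimately show "\<phi> \<in> (\<Union>(f', g')\<in>?O. ?F f' g')" by (intro UN_I[of "(?f, ?g)"]) blast+
  qed
  then have "module_aut R L = (\<Union>(f', g')\<in>?O. ?F f' g')" by blast
  then have "card (module_aut R L) = card (\<Union>p\<in>?O. ?F (fst p) (snd p))"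
    by (simp add: case_prod_unfold)
  also have "\<dots> = (\<Sum>p\<in>?O. card (?F (fst p) (snd p)))"
  proof (rule card_UN_disjoint[OF finO])
    show "\<forall>p\<in>?O. finite (?F (fst p) (snd p))" by (auto intro: rev_finite_subset[OF finite_module_aut[OF fin(2), of R]])
    show "\<forall>p\<in>?O. \<forall>p'\<in>?O. p \<noteq> p' \<longrightarrow> ?F (fst p) (snd p) \<inter> ?F (fst p') (snd p') = {}"
    proof (intro ballI impI, rule ccontr)
      fix p p' assume p: "p \<in> ?O" "p' \<in> ?O" "p \<noteq> p'"
        "?F (fst p) (snd p) \<inter> ?F (fst p') (snd p') \<noteq> {}"
      obtain f1 g1 f2 g2 where pp: "p = (f1, g1)" "p' = (f2, g2)" by (cases p, cases p')
      then obtain \<phi> where \<phi>: "\<phi> \<in> ?F f1 g1" "\<phi> \<in> ?F f2 g2"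
        using p(4) unfolding pp fst_conv snd_conv by blast
      have E12: "(f1, g1) \<in> exact_pairs R N L M" "(f2, g2) \<in> exact_pairs R N L M" using p pp by auto
      note e1 = exact_pairsD[OF E12(1)] and e2 = exact_pairsD[OF E12(2)]
      have s: "\<phi> ` carrier L = carrier L" using \<phi> by (auto simp: module_aut_def bij_betw_def)
      have "f1 = f2" using \<phi> by (intro Hom_eqI[OF e1(1) e2(1)]) (metis (mono_tags, lifting) mem_Collect_eq)
      moreover have "g1 = g2"
      proof (rule Hom_eqI[OF e1(2) e2(2)])
        fix l assume "l \<in> carrier L"
        then obtain l' where "l' \<in> carrier L" "l = \<phi> l'" using s by (metis imageE)
        then show "g1 l = g2 l" using \<phi> by simp
      qed
      ultimately show False using p(3) pp by simp
    qed
  qed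
  also have "\<dots> = (\<Sum>p\<in>?O. card (Hom R M N))"
  proof (rule sum.cong[OF refl])
    fix p assume p: "p \<in> ?O"
    obtain f' g' where pp: "p = (f', g')" by (cases p)
    then obtain \<psi> where "\<psi> \<in> module_aut R L" "\<And>a. a \<in> carrier N \<Longrightarrow> \<psi> (f a) = f' a"
      "\<And>l. l \<in> carrier L \<Longrightarrow> g' (\<psi> l) = g l" "(f', g') \<in> exact_pairs R N L M" using p by auto
    then show "card (?F (fst p) (snd p)) = card (Hom R M N)"
      using card_aut_carrying[OF mods fin(2) E, of f' g' \<psi>] pp by simp
  qed
  finally show ?thesis by simp
qed

section \<open>Associativity of the count of short exact sequences\<close>

text \<open>The kernel stays on the type of L, so that inclusion is the identity function and
  restricting a homomorphism does not change it as a function.\<close>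

definition ker_module :: "('r, 'l) module \<Rightarrow> ('r, 'm) module \<Rightarrow> ('l \<Rightarrow> 'm) \<Rightarrow> ('r, 'l) module" where
  "ker_module L M h = L\<lparr>carrier := {l \<in> carrier L. h l = \<zero>\<^sub>M}\<rparr>"

lemma ker_module_simps [simp]: "carrier (ker_module L M h) = {l \<in> carrier L. h l = \<zero>\<^sub>M}"
  "zero (ker_module L M h) = zero L" "add (ker_module L M h) = add L"
  "smult (ker_module L M h) = smult L" by (simp_all add: ker_module_def)

lemma module_ker_module:
  "module R L \<Longrightarrow> module R M \<Longrightarrow> h \<in> module_hom R L M \<Longrightarrow> module R (ker_module L M h)"
  unfolding ker_module_def by (intro submodule_module kernel_submodule)

lemma module_hom_ker_module: "f \<in> module_hom R L Z \<Longrightarrow> f \<in> module_hom R (ker_module L M h) Z"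
  by (auto simp: module_hom_def Pi_def)

lemma module_hom_into_ker_module: "f \<in> module_hom R Y L \<Longrightarrow> (\<And>y. y \<in> carrier Y \<Longrightarrow> h (f y) = \<zero>\<^sub>M) \<Longrightarrow>
    f \<in> module_hom R Y (ker_module L M h)" by (auto simp: module_hom_def Pi_def)

text \<open>A triple \<open>(p, h, \<phi>)\<close> encodes a filtration of \<open>L\<close> with subquotients \<open>P\<close>, \<open>N\<close> and \<open>M\<close>,
  together with identifications of these.\<close>

definition filtrations :: "('r, 'c) ring_scheme \<Rightarrow> ('r, 'p) module \<Rightarrow> ('r, 'l) module \<Rightarrow>
    ('r, 'n) module \<Rightarrow> ('r, 'm) module \<Rightarrow> (('p \<Rightarrow> 'l) \<times> ('l \<Rightarrow> 'm) \<times> ('l \<Rightarrow> 'n)) set" where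
  "filtrations R P L N M = {(p, h, \<phi>). p \<in> Hom R P L \<and> inj_on p (carrier P) \<and>
     h \<in> Hom R L M \<and> h ` carrier L = carrier M \<and> \<phi> \<in> Hom R (ker_module L M h) N \<and>
     \<phi> ` {l \<in> carrier L. h l = \<zero>\<^sub>M} = carrier N \<and>
     p ` carrier P = {l \<in> carrier L. h l = \<zero>\<^sub>M \<and> \<phi> l = \<zero>\<^sub>N}}"

lemma filtrationsD:
  assumes "(p, h, \<phi>) \<in> filtrations R P L N M"
  shows "p \<in> Hom R P L" "inj_on p (carrier P)" "h \<in> Hom R L M" "h ` carrier L = carrier M"
    "\<phi> \<in> Hom R (ker_module L M h) N" "\<phi> ` {l \<in> carrier L. h l = \<zero>\<^sub>M} = carrier N"
    "p ` carrier P = {l \<in> carrier L. h l = \<zero>\<^sub>M \<and> \<phi> l = \<zero>\<^sub>N}"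
    "p \<in> module_hom R P L" "h \<in> module_hom R L M" "\<phi> \<in> module_hom R (ker_module L M h) N"
  using assms by (auto simp: filtrations_def Hom_def)

lemma finite_filtrations:
  assumes "finite (carrier P)" "finite (carrier L)" "finite (carrier N)" "finite (carrier M)"
  shows "finite (filtrations R P L N M)"
proof (rule finite_subset)
  let ?A = "\<Union>h\<in>Hom R L M. Hom R P L \<times> {h} \<times> Hom R (ker_module L M h) N"
  show "filtrations R P L N M \<subseteq> ?A" by (auto simp: filtrations_def)
  show "finite ?A" using finite_Hom[OF assms(2,4), of R] finite_Hom[OF assms(1,2), of R]
      finite_Hom[of "ker_module L M _" N R] assms by auto
qed

text \<open>With \<open>p\<close> fixed and \<open>Z\<close> its cokernel, a sequence 0 -> N -> Z ->
  M -> 0 is pulled back along \<open>t\<close>: \<open>h\<close> is \<open>g\<close> after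
  \<open>t\<close>, and \<open>\<phi>\<close> sends an element of the kernel of \<open>h\<close> to
  the element of N that \<open>f\<close> maps to its class. This determines \<open>f\<close> and
  \<open>g\<close> in turn, since \<open>t\<close> and \<open>\<phi>\<close> are onto.\<close>

lemma card_filtrations_quotient:
  fixes R :: "('r, 'c) ring_scheme" and P :: "('r, 'p) module" and L :: "('r, 'l) module"
    and N :: "('r, 'n) module" and M :: "('r, 'm) module" and Z :: "('r, 'z) module"
  assumes mods: "module R P" "module R L" "module R N" "module R M" "module R Z"
    and E: "(p, t) \<in> exact_pairs R P L Z"
  shows "card (exact_pairs R N Z M) = card {\<tau> \<in> filtrations R P L N M. fst \<tau> = p}"
proof -
  interpret N: module R N by fact
  note e = exact_pairsD[OF E]
  let ?K = "\<lambda>h. ker_module L M h"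
  have tm: "t l \<in> carrier Z" if "l \<in> carrier L" for l using module_hom_mem[OF e(4) that] .
  have z0: "t \<zero>\<^sub>L = \<zero>\<^sub>Z" by (rule module_hom_zero[OF mods(2,5) e(4)])
  define \<rho> where "\<rho> a \<tau> \<longleftrightarrow> (\<forall>l\<in>carrier L. fst (snd \<tau>) l = snd a (t l)) \<and>
    (\<forall>l\<in>carrier L. fst (snd \<tau>) l = \<zero>\<^sub>M \<longrightarrow> fst a (snd (snd \<tau>) l) = t l)"
    for a :: "('n \<Rightarrow> 'z) \<times> ('z \<Rightarrow> 'm)" and \<tau> :: "('p \<Rightarrow> 'l) \<times> ('l \<Rightarrow> 'm) \<times> ('l \<Rightarrow> 'n)"
  show ?thesis
  proof (rule card_eq_by_relation[where \<rho> = \<rho>])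
    fix a assume "a \<in> exact_pairs R N Z M"
    then obtain f g where a: "a = (f, g)" "(f, g) \<in> exact_pairs R N Z M" by (cases a) simp
    note d = exact_pairsD[OF a(2)]
    define h where "h = restrict (\<lambda>l. g (t l)) (carrier L)"
    have h: "h \<in> Hom R L M" unfolding h_def
      by (rule Hom_restrict[OF mods(2) module_hom_comp[OF e(4) d(4)]])
    have hl: "h l = g (t l)" if "l \<in> carrier L" for l using that by (simp add: h_def)
    note K = module_ker_module[OF mods(2,4) Hom_module_hom[OF h]]
    have "t ` carrier (?K h) \<subseteq> f ` carrier N" unfolding d(8) using hl tm by auto
    from module_hom_factor_inj[OF K mods(3,5) d(3,5) module_hom_ker_module[OF e(4)] this]
    obtain \<phi> where \<phi>: "\<phi> \<in> module_hom R (?K h) N" "\<And>l. l \<in> carrier (?K h) \<Longrightarrow> f (\<phi> l) = t l" by blast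
    define \<phi>' where "\<phi>' = restrict \<phi> (carrier (?K h))"
    have \<phi>': "\<phi>' \<in> Hom R (?K h) N" unfolding \<phi>'_def by (rule Hom_restrict[OF K \<phi>(1)])
    have f\<phi>: "f (\<phi>' l) = t l" "\<phi>' l \<in> carrier N" if "l \<in> carrier L" "h l = \<zero>\<^sub>M" for l
      using \<phi>(2)[of l] module_hom_mem[OF \<phi>(1), of l] that by (auto simp: \<phi>'_def)
    have "(p, h, \<phi>') \<in> filtrations R P L N M" unfolding filtrations_def mem_Collect_eq prod.case
    proof (intro conjI)
      show "p \<in> Hom R P L" "inj_on p (carrier P)" by (fact e(1), fact e(5))
      show "h \<in> Hom R L M" "\<phi>' \<in> Hom R (?K h) N" by (fact h, fact \<phi>')
      have "h ` carrier L = g ` t ` carrier L" using hl by (auto simp: image_image)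
      then show "h ` carrier L = carrier M" using d(6) e(6) by simp
      show "\<phi>' ` {l \<in> carrier L. h l = \<zero>\<^sub>M} = carrier N"
      proof (intro equalityI subsetI)
        fix n assume n: "n \<in> carrier N"
        then have "f n \<in> t ` carrier L" using d(7) e(6) by simp
        then obtain l where l: "l \<in> carrier L" "f n = t l" by auto
        then have "h l = \<zero>\<^sub>M" using hl d(7)[OF n] by simp
        then have "f (\<phi>' l) = f n" "\<phi>' l \<in> carrier N" using f\<phi> l by auto
        then have "\<phi>' l = n" using inj_onD[OF d(5)] n by simp
        then show "n \<in> \<phi>' ` {l \<in> carrier L. h l = \<zero>\<^sub>M}" using l \<open>h l = \<zero>\<^sub>M\<close> by auto
      qed (use f\<phi> in auto)
      have "t l = \<zero>\<^sub>Z \<longleftrightarrow> h l = \<zero>\<^sub>M \<and> \<phi>' l = \<zero>\<^sub>N" if l: "l \<in> carrier L" for l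
      proof -
        have 1: "h l = \<zero>\<^sub>M" if "t l = \<zero>\<^sub>Z"
          using that hl[OF l] module_hom_zero[OF mods(5,4) d(4)] by simp
        have 2: "t l = \<zero>\<^sub>Z \<longleftrightarrow> \<phi>' l = \<zero>\<^sub>N" if "h l = \<zero>\<^sub>M"
        proof -
          have "f (\<phi>' l) = f \<zero>\<^sub>N \<longleftrightarrow> \<phi>' l = \<zero>\<^sub>N"
            by (rule inj_on_eq_iff[OF d(5) f\<phi>(2)[OF l that] N.M.zero_closed])
          then show ?thesis using f\<phi>(1)[OF l that] module_hom_zero[OF mods(3,5) d(3)] by simp
        qed
        show ?thesis using 1 2 by blast
      qed
      then show "p ` carrier P = {l \<in> carrier L. h l = \<zero>\<^sub>M \<and> \<phi>' l = \<zero>\<^sub>N}" unfolding e(8) by blast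
    qed
    moreover have "\<rho> a (p, h, \<phi>')" unfolding \<rho>_def a using hl f\<phi> by simp
    ultimately show "\<exists>\<tau>\<in>{\<tau> \<in> filtrations R P L N M. fst \<tau> = p}. \<rho> a \<tau>" by force
  next
    fix \<tau> assume "\<tau> \<in> {\<tau> \<in> filtrations R P L N M. fst \<tau> = p}"
    then obtain h \<phi> where \<tau>: "\<tau> = (p, h, \<phi>)" "(p, h, \<phi>) \<in> filtrations R P L N M" by (cases \<tau>) auto
    note d = filtrationsD[OF \<tau>(2)]
    note K = module_ker_module[OF mods(2,4) d(9)]
    have ker: "t l = \<zero>\<^sub>Z \<longleftrightarrow> h l = \<zero>\<^sub>M \<and> \<phi> l = \<zero>\<^sub>N" if "l \<in> carrier L" for l
      using that e(8) d(7) by blast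
    obtain g where g: "g \<in> module_hom R Z M" "\<And>l. l \<in> carrier L \<Longrightarrow> g (t l) = h l"
      using module_hom_factor_surj[OF mods(2,5,4) e(4,6) d(9)] ker by blast
    have sur: "\<phi> ` carrier (?K h) = carrier N" using d(6) by simp
    obtain f where f: "f \<in> module_hom R N Z" "\<And>l. l \<in> carrier (?K h) \<Longrightarrow> f (\<phi> l) = t l"
    proof (rule module_hom_factor_surj[OF K mods(3,5) d(10) sur module_hom_ker_module[OF e(4)]])
      show "t l = \<zero>\<^sub>Z" if "l \<in> carrier (?K h)" "\<phi> l = \<zero>\<^sub>N" for l using that ker[of l] by simp
    qed blast
    have fl: "f (\<phi> l) = t l" "\<phi> l \<in> carrier N" if "l \<in> carrier L" "h l = \<zero>\<^sub>M" for l
      using that f(2)[of l] module_hom_mem[OF d(10), of l] by auto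
    have N: "\<exists>l\<in>carrier L. h l = \<zero>\<^sub>M \<and> n = \<phi> l" if "n \<in> carrier N" for n using that d(6) by auto
    let ?f = "restrict f (carrier N)" and ?g = "restrict g (carrier Z)"
    have "(?f, ?g) \<in> exact_pairs R N Z M"
    proof (rule exact_pairsI)
      show "?f \<in> Hom R N Z" "?g \<in> Hom R Z M"
        by (rule Hom_restrict[OF mods(3) f(1)], rule Hom_restrict[OF mods(5) g(1)])
      have "inj_on f (carrier N)"
      proof (rule module_hom_injI[OF mods(3,5) f(1)])
        fix n assume n: "n \<in> carrier N" "f n = \<zero>\<^sub>Z"
        then obtain l where l: "l \<in> carrier L" "h l = \<zero>\<^sub>M" "n = \<phi> l" using N by blast
        then show "n = \<zero>\<^sub>N" using fl[OF l(1,2)] n ker[OF l(1)] by simp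
      qed
      then show "inj_on ?f (carrier N)" by (simp add: inj_on_def)
      have "g ` carrier Z = h ` carrier L" unfolding e(6)[symmetric] image_image using g(2) by simp
      then show "?g ` carrier Z = carrier M" using d(4) by simp
      show "?g (?f n) = \<zero>\<^sub>M" if n: "n \<in> carrier N" for n
      proof -
        obtain l where l: "l \<in> carrier L" "h l = \<zero>\<^sub>M" "n = \<phi> l" using N n by blast
        then show ?thesis using fl[OF l(1,2)] g(2)[OF l(1)] tm[OF l(1)] n by simp
      qed
      show "y \<in> ?f ` carrier N" if y: "y \<in> carrier Z" "?g y = \<zero>\<^sub>M" for y
      proof -
        obtain l where l: "l \<in> carrier L" "y = t l" using y(1) e(6) by auto
        then have h: "h l = \<zero>\<^sub>M" using g(2) y by simp
        then show ?thesis using fl[OF l(1) h] l by (intro image_eqI[of _ _ "\<phi> l"]) auto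
      qed
    qed
    moreover have "\<rho> (?f, ?g) \<tau>" unfolding \<rho>_def \<tau> using g(2) tm fl by simp
    ultimately show "\<exists>a\<in>exact_pairs R N Z M. \<rho> a \<tau>" by blast
  next
    fix a \<tau> \<tau>'
    assume "\<tau> \<in> {\<tau> \<in> filtrations R P L N M. fst \<tau> = p}" "\<tau>' \<in> {\<tau> \<in> filtrations R P L N M. fst \<tau> = p}"
      and aE: "a \<in> exact_pairs R N Z M" and \<rho>: "\<rho> a \<tau>" "\<rho> a \<tau>'"
    then obtain h \<phi> h' \<phi>' where \<tau>: "\<tau> = (p, h, \<phi>)" "(p, h, \<phi>) \<in> filtrations R P L N M"
        "\<tau>' = (p, h', \<phi>')" "(p, h', \<phi>') \<in> filtrations R P L N M" by (cases \<tau>; cases \<tau>') auto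
    obtain f g where a: "a = (f, g)" by (cases a)
    note d = exact_pairsD[OF aE[unfolded a]]
    note c = filtrationsD[OF \<tau>(2)] and c' = filtrationsD[OF \<tau>(4)]
    have hh: "h = h'" using \<rho> unfolding \<rho>_def \<tau> by (intro Hom_eqI[OF c(3) c'(3)]) simp
    have "\<phi> = \<phi>'"
    proof (rule Hom_eqI[OF c(5)[unfolded hh] c'(5)])
      fix l assume l: "l \<in> carrier (?K h')"
      have "f (\<phi> l) = t l" using \<rho>(1) l unfolding \<rho>_def \<tau> a hh by auto
      moreover have "f (\<phi>' l) = t l" using \<rho>(2) l unfolding \<rho>_def \<tau> a by auto
      ultimately have "f (\<phi> l) = f (\<phi>' l)" by simp
      then show "\<phi> l = \<phi>' l"
        using inj_onD[OF d(5)] module_hom_mem[OF c(10)[unfolded hh] l] module_hom_mem[OF c'(10) l] by simp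
    qed
    then show "\<tau> = \<tau>'" using hh \<tau> by simp
  next
    fix a a' \<tau>
    assume "\<tau> \<in> {\<tau> \<in> filtrations R P L N M. fst \<tau> = p}"
      and aE: "a \<in> exact_pairs R N Z M" "a' \<in> exact_pairs R N Z M" and \<rho>: "\<rho> a \<tau>" "\<rho> a' \<tau>"
    then obtain h \<phi> where \<tau>: "\<tau> = (p, h, \<phi>)" "(p, h, \<phi>) \<in> filtrations R P L N M" by (cases \<tau>) auto
    obtain f g f' g' where a: "a = (f, g)" "a' = (f', g')" by (cases a, cases a')
    note d = exact_pairsD[OF aE(1)[unfolded a]] and d' = exact_pairsD[OF aE(2)[unfolded a]]
    note c = filtrationsD[OF \<tau>(2)]
    have "g = g'"
    proof (rule Hom_eqI[OF d(2) d'(2)])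
      fix y assume "y \<in> carrier Z"
      then obtain l where "l \<in> carrier L" "y = t l" using e(6) by auto
      then show "g y = g' y" using \<rho> unfolding \<rho>_def \<tau> a by simp
    qed
    moreover have "f = f'"
    proof (rule Hom_eqI[OF d(1) d'(1)])
      fix n assume "n \<in> carrier N"
      then obtain l where "l \<in> carrier L" "h l = \<zero>\<^sub>M" "n = \<phi> l" using c(6) by auto
      then show "f n = f' n" using \<rho> unfolding \<rho>_def \<tau> a by simp
    qed
    ultimately show "a = a'" using a by simp
  qed
qed

text \<open>The mirror image with \<open>h\<close> fixed and \<open>Y\<close> its kernel: a sequence
  0 -> P -> Y -> N -> 0 is pushed into L along \<open>j\<close>, and \<open>\<phi>\<close> is read
  off on the image of \<open>j\<close>, which is the kernel of \<open>h\<close>.\<close>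

lemma card_filtrations_sub:
  fixes R :: "('r, 'c) ring_scheme" and P :: "('r, 'p) module" and L :: "('r, 'l) module"
    and N :: "('r, 'n) module" and M :: "('r, 'm) module" and Y :: "('r, 'z) module"
  assumes mods: "module R P" "module R L" "module R N" "module R M" "module R Y"
    and E: "(j, h) \<in> exact_pairs R Y L M"
  shows "card (exact_pairs R P Y N) = card {\<tau> \<in> filtrations R P L N M. fst (snd \<tau>) = h}"
proof -
  note e = exact_pairsD[OF E]
  let ?K = "ker_module L M h"
  note K = module_ker_module[OF mods(2,4) e(4)]
  have jK: "j ` carrier Y = carrier ?K" using e(8) by simp
  have jh: "j \<in> module_hom R Y ?K" using e(7) by (intro module_hom_into_ker_module e(3)) auto
  define \<rho> where "\<rho> a \<tau> \<longleftrightarrow> (\<forall>x\<in>carrier P. fst \<tau> x = j (fst a x)) \<and>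
    (\<forall>y\<in>carrier Y. snd (snd \<tau>) (j y) = snd a y)"
    for a :: "('p \<Rightarrow> 'z) \<times> ('z \<Rightarrow> 'n)" and \<tau> :: "('p \<Rightarrow> 'l) \<times> ('l \<Rightarrow> 'm) \<times> ('l \<Rightarrow> 'n)"
  show ?thesis
  proof (rule card_eq_by_relation[where \<rho> = \<rho>])
    fix a assume "a \<in> exact_pairs R P Y N"
    then obtain f g where a: "a = (f, g)" "(f, g) \<in> exact_pairs R P Y N" by (cases a) simp
    note d = exact_pairsD[OF a(2)]
    define p where "p = restrict (\<lambda>x. j (f x)) (carrier P)"
    have p: "p \<in> Hom R P L" unfolding p_def
      by (rule Hom_restrict[OF mods(1) module_hom_comp[OF d(3) e(3)]])
    have px: "p x = j (f x)" if "x \<in> carrier P" for x using that by (simp add: p_def)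
    obtain \<phi> where \<phi>: "\<phi> \<in> module_hom R ?K N" "\<And>y. y \<in> carrier Y \<Longrightarrow> \<phi> (j y) = g y"
    proof (rule module_hom_factor_surj[OF mods(5) K mods(3) jh jK d(4)])
      fix y assume y: "y \<in> carrier Y" "j y = \<zero>\<^bsub>?K\<^esub>"
      interpret Y: module R Y by fact
      have "j y = j \<zero>\<^sub>Y" using y module_hom_zero[OF mods(5,2) e(3)] by simp
      then have "y = \<zero>\<^sub>Y" using inj_onD[OF e(5)] y by simp
      then show "g y = \<zero>\<^sub>N" using module_hom_zero[OF mods(5,3) d(4)] by simp
    qed blast
    define \<phi>' where "\<phi>' = restrict \<phi> (carrier ?K)"
    have \<phi>': "\<phi>' \<in> Hom R ?K N" unfolding \<phi>'_def by (rule Hom_restrict[OF K \<phi>(1)])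
    have \<phi>j: "\<phi>' (j y) = g y" if "y \<in> carrier Y" for y
      using \<phi>(2)[OF that] e(7)[OF that] by (simp add: \<phi>'_def)
    have KY: "\<exists>y\<in>carrier Y. l = j y" if "l \<in> carrier L" "h l = \<zero>\<^sub>M" for l using that e(8) by auto
    have "(p, h, \<phi>') \<in> filtrations R P L N M" unfolding filtrations_def mem_Collect_eq prod.case
    proof (intro conjI)
      show "p \<in> Hom R P L" "h \<in> Hom R L M" "h ` carrier L = carrier M" "\<phi>' \<in> Hom R ?K N"
        by (fact p, fact e(2), fact e(6), fact \<phi>')
      show "inj_on p (carrier P)"
        using inj_onD[OF e(5)] inj_onD[OF d(5)] d(7) px by (intro inj_onI) simp
      have "\<phi>' ` j ` carrier Y = g ` carrier Y" unfolding image_image using \<phi>j by simp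
      then show "\<phi>' ` {l \<in> carrier L. h l = \<zero>\<^sub>M} = carrier N" using e(8) d(6) by simp
      show "p ` carrier P = {l \<in> carrier L. h l = \<zero>\<^sub>M \<and> \<phi>' l = \<zero>\<^sub>N}"
      proof (intro equalityI subsetI)
        fix l assume "l \<in> p ` carrier P"
        then obtain x where x: "x \<in> carrier P" "l = p x" by auto
        then show "l \<in> {l \<in> carrier L. h l = \<zero>\<^sub>M \<and> \<phi>' l = \<zero>\<^sub>N}"
          using px[OF x(1)] d(7)[OF x(1)] e(7)[of "f x"] \<phi>j[of "f x"] by simp
      next
        fix l assume l: "l \<in> {l \<in> carrier L. h l = \<zero>\<^sub>M \<and> \<phi>' l = \<zero>\<^sub>N}"
        then obtain y where y: "y \<in> carrier Y" "l = j y" using KY by blast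
        then have "y \<in> f ` carrier P" unfolding d(8) using l \<phi>j by simp
        then obtain x where "x \<in> carrier P" "y = f x" by auto
        then show "l \<in> p ` carrier P" using y px by (intro image_eqI[of _ _ x]) auto
      qed
    qed
    moreover have "\<rho> a (p, h, \<phi>')" unfolding \<rho>_def a using px \<phi>j by simp
    ultimately show "\<exists>\<tau>\<in>{\<tau> \<in> filtrations R P L N M. fst (snd \<tau>) = h}. \<rho> a \<tau>" by force
  next
    fix \<tau> assume "\<tau> \<in> {\<tau> \<in> filtrations R P L N M. fst (snd \<tau>) = h}"
    then obtain p \<phi> where \<tau>: "\<tau> = (p, h, \<phi>)" "(p, h, \<phi>) \<in> filtrations R P L N M" by (cases \<tau>) auto
    note d = filtrationsD[OF \<tau>(2)]
    have sub: "p ` carrier P \<subseteq> j ` carrier Y" unfolding d(7) e(8) by blast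
    obtain f where f: "f \<in> module_hom R P Y" "\<And>x. x \<in> carrier P \<Longrightarrow> j (f x) = p x"
      using module_hom_factor_inj[OF mods(1,5,2) e(3,5) d(8) sub] by blast
    have fm: "f x \<in> carrier Y" if "x \<in> carrier P" for x by (rule module_hom_mem[OF f(1) that])
    let ?f = "restrict f (carrier P)" and ?g = "restrict (\<lambda>y. \<phi> (j y)) (carrier Y)"
    have p0: "h (p x) = \<zero>\<^sub>M \<and> \<phi> (p x) = \<zero>\<^sub>N" if "x \<in> carrier P" for x using d(7) that by blast
    have "(?f, ?g) \<in> exact_pairs R P Y N"
    proof (rule exact_pairsI)
      show "?f \<in> Hom R P Y" "?g \<in> Hom R Y N"
        by (rule Hom_restrict[OF mods(1) f(1)], rule Hom_restrict[OF mods(5) module_hom_comp[OF jh d(10)]])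
      show "inj_on ?f (carrier P)"
        using inj_onD[OF d(2)] f(2) by (intro inj_onI) (metis restrict_apply')
      have "(\<lambda>y. \<phi> (j y)) ` carrier Y = \<phi> ` j ` carrier Y" by (simp add: image_image)
      then show "?g ` carrier Y = carrier N" using e(8) d(6) by simp
      show "?g (?f x) = \<zero>\<^sub>N" if "x \<in> carrier P" for x
        using that p0[OF that] f(2)[OF that] fm[OF that] by simp
      show "y \<in> ?f ` carrier P" if y: "y \<in> carrier Y" "?g y = \<zero>\<^sub>N" for y
      proof -
        have "j y \<in> p ` carrier P" unfolding d(7) using y e(7)[OF y(1)] by simp
        then obtain x where x: "x \<in> carrier P" "j y = j (f x)" using f(2) by auto
        then have "y = f x" using inj_onD[OF e(5)] y fm by simp
        then show ?thesis using x by auto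
      qed
    qed
    moreover have "\<rho> (?f, ?g) \<tau>" unfolding \<rho>_def \<tau> using f(2) by simp
    ultimately show "\<exists>a\<in>exact_pairs R P Y N. \<rho> a \<tau>" by blast
  next
    fix a \<tau> \<tau>'
    assume "\<tau> \<in> {\<tau> \<in> filtrations R P L N M. fst (snd \<tau>) = h}" "\<tau>' \<in> {\<tau> \<in> filtrations R P L N M. fst (snd \<tau>) = h}"
      and \<rho>: "\<rho> a \<tau>" "\<rho> a \<tau>'"
    then obtain p \<phi> p' \<phi>' where \<tau>: "\<tau> = (p, h, \<phi>)" "(p, h, \<phi>) \<in> filtrations R P L N M"
        "\<tau>' = (p', h, \<phi>')" "(p', h, \<phi>') \<in> filtrations R P L N M" by (cases \<tau>; cases \<tau>') auto
    note c = filtrationsD[OF \<tau>(2)] and c' = filtrationsD[OF \<tau>(4)]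
    have "p = p'" using \<rho> unfolding \<rho>_def \<tau> by (intro Hom_eqI[OF c(1) c'(1)]) simp
    moreover have "\<phi> = \<phi>'"
    proof (rule Hom_eqI[OF c(5) c'(5)])
      fix l assume "l \<in> carrier ?K"
      then obtain y where "y \<in> carrier Y" "l = j y" using jK by (metis imageE)
      then show "\<phi> l = \<phi>' l" using \<rho> unfolding \<rho>_def \<tau> by simp
    qed
    ultimately show "\<tau> = \<tau>'" using \<tau> by simp
  next
    fix a a' \<tau>
    assume "\<tau> \<in> {\<tau> \<in> filtrations R P L N M. fst (snd \<tau>) = h}"
      and aE: "a \<in> exact_pairs R P Y N" "a' \<in> exact_pairs R P Y N" and \<rho>: "\<rho> a \<tau>" "\<rho> a' \<tau>"
    obtain f g f' g' where a: "a = (f, g)" "a' = (f', g')" by (cases a, cases a')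
    note d = exact_pairsD[OF aE(1)[unfolded a]] and d' = exact_pairsD[OF aE(2)[unfolded a]]
    have "g = g'" using \<rho> unfolding \<rho>_def a by (intro Hom_eqI[OF d(2) d'(2)]) simp
    moreover have "f = f'"
    proof (rule Hom_eqI[OF d(1) d'(1)])
      fix x assume x: "x \<in> carrier P"
      then have "j (f x) = j (f' x)" using \<rho> unfolding \<rho>_def a by simp
      then show "f x = f' x" using inj_onD[OF e(5)] d(7)[OF x] d'(7)[OF x] by simp
    qed
    ultimately show "a = a'" using a by simp
  qed
qed

text \<open>Uniqueness of cokernels; it ensures that a filtration is counted over only one isoclass
  of the quotient L/P.\<close>

lemma exact_pairs_same_sub_iso:
  assumes mods: "module R L" "module R Z" "module R Z'"
    and E: "(p, t) \<in> exact_pairs R P L Z" and E': "(p, t') \<in> exact_pairs R P L Z'"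
  obtains \<alpha> where "\<alpha> \<in> module_hom R Z Z'" "bij_betw \<alpha> (carrier Z) (carrier Z')"
    "\<And>l. l \<in> carrier L \<Longrightarrow> \<alpha> (t l) = t' l"
proof -
  note e = exact_pairsD[OF E] and d = exact_pairsD[OF E']
  have ker: "t l = \<zero>\<^sub>Z \<longleftrightarrow> t' l = \<zero>\<^bsub>Z'\<^esub>" if "l \<in> carrier L" for l using that e(8) d(8) by blast
  obtain \<alpha> where \<alpha>: "\<alpha> \<in> module_hom R Z Z'" "\<And>l. l \<in> carrier L \<Longrightarrow> \<alpha> (t l) = t' l"
    using module_hom_factor_surj[OF mods(1,2,3) e(4,6) d(4)] ker by blast
  have "inj_on \<alpha> (carrier Z)"
  proof (rule module_hom_injI[OF mods(2,3) \<alpha>(1)])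
    fix y assume y: "y \<in> carrier Z" "\<alpha> y = \<zero>\<^bsub>Z'\<^esub>"
    then obtain l where "l \<in> carrier L" "y = t l" using e(6) by auto
    then show "y = \<zero>\<^sub>Z" using y \<alpha>(2) ker by simp
  qed
  moreover have "\<alpha> ` t ` carrier L = t' ` carrier L" unfolding image_image using \<alpha>(2) by simp
  ultimately have "bij_betw \<alpha> (carrier Z) (carrier Z')" using e(6) d(6) by (simp add: bij_betw_def)
  then show ?thesis using that \<alpha> by blast
qed

text \<open>The quotient maps completing a given \<open>p\<close> form a torsor under Aut Z. This
  accounts for the division by |Aut| in the sums over isoclasses.\<close>

lemma card_exact_pairs_same_sub:
  assumes mods: "module R P" "module R L" "module R Z" and E: "(p, t) \<in> exact_pairs R P L Z"
  shows "card {t'. (p, t') \<in> exact_pairs R P L Z} = card (module_aut R Z)"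
proof (rule card_eq_by_relation[symmetric, where \<rho> = "\<lambda>\<alpha> t'. \<forall>l\<in>carrier L. \<alpha> (t l) = t' l"])
  note e = exact_pairsD[OF E]
  have tm: "t l \<in> carrier Z" if "l \<in> carrier L" for l using module_hom_mem[OF e(4) that] .
  {
    fix \<alpha> assume "\<alpha> \<in> module_aut R Z"
    then have \<alpha>: "\<alpha> \<in> module_hom R Z Z" "bij_betw \<alpha> (carrier Z) (carrier Z)"
      by (auto simp: module_aut_def Hom_def)
    let ?t = "restrict (\<lambda>l. \<alpha> (t l)) (carrier L)"
    have z: "\<alpha> y = \<zero>\<^sub>Z \<longleftrightarrow> y = \<zero>\<^sub>Z" if y: "y \<in> carrier Z" for y
    proof -
      interpret Z: module R Z by fact
      show ?thesis using module_hom_zero[OF mods(3,3) \<alpha>(1)] \<alpha>(2) y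
        by (metis Z.M.zero_closed bij_betw_def inj_onD)
    qed
    have "(p, ?t) \<in> exact_pairs R P L Z"
    proof (rule exact_pairsI)
      show "p \<in> Hom R P L" "inj_on p (carrier P)" by (fact e(1), fact e(5))
      show "?t \<in> Hom R L Z" by (rule Hom_restrict[OF mods(2) module_hom_comp[OF e(4) \<alpha>(1)]])
      have "(\<lambda>l. \<alpha> (t l)) ` carrier L = \<alpha> ` t ` carrier L" by (simp add: image_image)
      then show "?t ` carrier L = carrier Z" using e(6) \<alpha>(2) by (simp add: bij_betw_def)
      show "?t (p a) = \<zero>\<^sub>Z" if "a \<in> carrier P" for a using e(7)[OF that] z tm by force
      show "l \<in> p ` carrier P" if "l \<in> carrier L" "?t l = \<zero>\<^sub>Z" for l
        unfolding e(8) using that z tm by simp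
    qed
    then show "\<exists>t'\<in>{t'. (p, t') \<in> exact_pairs R P L Z}. \<forall>l\<in>carrier L. \<alpha> (t l) = t' l" by force
  }
  {
    fix t' assume "t' \<in> {t'. (p, t') \<in> exact_pairs R P L Z}"
    then have "(p, t') \<in> exact_pairs R P L Z" by simp
    from exact_pairs_same_sub_iso[OF mods(2,3,3) E this]
    obtain \<alpha> where \<alpha>: "\<alpha> \<in> module_hom R Z Z" "\<And>l. l \<in> carrier L \<Longrightarrow> \<alpha> (t l) = t' l"
      and bij: "bij_betw \<alpha> (carrier Z) (carrier Z)" by blast
    from bij have "bij_betw (restrict \<alpha> (carrier Z)) (carrier Z) (carrier Z)"
      by (rule bij_betw_cong[THEN iffD1, rotated]) simp
    then have "restrict \<alpha> (carrier Z) \<in> module_aut R Z"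
      using Hom_restrict[OF mods(3) \<alpha>(1)] by (simp add: module_aut_def)
    then show "\<exists>\<alpha>\<in>module_aut R Z. \<forall>l\<in>carrier L. \<alpha> (t l) = t' l"
      using \<alpha>(2) tm by (intro bexI[of _ "restrict \<alpha> (carrier Z)"]) auto
  }
  show "b = b'" if "b \<in> {t'. (p, t') \<in> exact_pairs R P L Z}" "b' \<in> {t'. (p, t') \<in> exact_pairs R P L Z}"
    "\<forall>l\<in>carrier L. a (t l) = b l" "\<forall>l\<in>carrier L. a (t l) = b' l" for a b b'
    using that exact_pairsD(2)[of p b R P L Z] exact_pairsD(2)[of p b' R P L Z]
    by (intro Hom_eqI[of b R L Z b' Z]) auto
  show "a = a'" if a: "a \<in> module_aut R Z" "a' \<in> module_aut R Z"
    "\<forall>l\<in>carrier L. a (t l) = b l" "\<forall>l\<in>carrier L. a' (t l) = b l" for a a' b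
  proof (rule Hom_eqI[of a R Z Z a' Z])
    show "a \<in> Hom R Z Z" "a' \<in> Hom R Z Z" using a by (auto simp: module_aut_def)
    fix y assume "y \<in> carrier Z"
    then obtain l where "l \<in> carrier L" "y = t l" using e(6) by auto
    then show "a y = a' y" using a by simp
  qed
qed

text \<open>Uniqueness of kernels, for the grouping of filtrations by the submodule with quotient
  M.\<close>

lemma exact_pairs_same_quotient_iso:
  assumes mods: "module R Y'" "module R Y" "module R L"
    and E: "(j, h) \<in> exact_pairs R Y L M" and E': "(j', h) \<in> exact_pairs R Y' L M"
  obtains \<alpha> where "\<alpha> \<in> module_hom R Y' Y" "bij_betw \<alpha> (carrier Y') (carrier Y)"
    "\<And>y. y \<in> carrier Y' \<Longrightarrow> j (\<alpha> y) = j' y"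
proof -
  note e = exact_pairsD[OF E] and d = exact_pairsD[OF E']
  have im: "j' ` carrier Y' \<subseteq> j ` carrier Y" using e(8) d(8) by blast
  obtain \<alpha> where \<alpha>: "\<alpha> \<in> module_hom R Y' Y" "\<And>y. y \<in> carrier Y' \<Longrightarrow> j (\<alpha> y) = j' y"
    using module_hom_factor_inj[OF mods e(3,5) d(3) im] by blast
  have \<alpha>m: "\<alpha> y \<in> carrier Y" if "y \<in> carrier Y'" for y by (rule module_hom_mem[OF \<alpha>(1) that])
  have "inj_on \<alpha> (carrier Y')" using inj_onD[OF d(5)] \<alpha>(2) by (intro inj_onI) metis
  moreover have "\<alpha> ` carrier Y' = carrier Y"
  proof (intro equalityI subsetI)
    fix y assume y: "y \<in> carrier Y"
    then have "j y \<in> j' ` carrier Y'" using e(7) unfolding d(8) by simp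
    then obtain y' where y': "y' \<in> carrier Y'" "j y = j (\<alpha> y')" using \<alpha>(2) by auto
    then have "y = \<alpha> y'" using inj_onD[OF e(5)] y \<alpha>m by simp
    then show "y \<in> \<alpha> ` carrier Y'" using y' by simp
  qed (use \<alpha>m in auto)
  ultimately show ?thesis using that \<alpha> by (simp add: bij_betw_def)
qed

text \<open>Dually, the inclusions completing a given \<open>h\<close> form a torsor under Aut Y,
  acting by precomposition.\<close>

lemma card_exact_pairs_same_quotient:
  assumes mods: "module R Y" "module R L" "module R M" and E: "(j, h) \<in> exact_pairs R Y L M"
  shows "card {j'. (j', h) \<in> exact_pairs R Y L M} = card (module_aut R Y)"
proof (rule card_eq_by_relation[symmetric, where \<rho> = "\<lambda>\<alpha> j'. \<forall>y\<in>carrier Y. j (\<alpha> y) = j' y"])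
  note e = exact_pairsD[OF E]
  {
    fix \<alpha> assume "\<alpha> \<in> module_aut R Y"
    then have \<alpha>: "\<alpha> \<in> module_hom R Y Y" "bij_betw \<alpha> (carrier Y) (carrier Y)"
      by (auto simp: module_aut_def Hom_def)
    let ?j = "restrict (\<lambda>y. j (\<alpha> y)) (carrier Y)"
    have \<alpha>m: "\<alpha> y \<in> carrier Y" if "y \<in> carrier Y" for y by (rule module_hom_mem[OF \<alpha>(1) that])
    have "(?j, h) \<in> exact_pairs R Y L M"
    proof (rule exact_pairsI)
      show "h \<in> Hom R L M" "h ` carrier L = carrier M" by (fact e(2), fact e(6))
      show "?j \<in> Hom R Y L" by (rule Hom_restrict[OF mods(1) module_hom_comp[OF \<alpha>(1) e(3)]])
      show "inj_on ?j (carrier Y)"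
      proof (rule inj_onI)
        fix a b assume ab: "a \<in> carrier Y" "b \<in> carrier Y" "?j a = ?j b"
        then have "\<alpha> a = \<alpha> b" using inj_onD[OF e(5)] \<alpha>m by simp
        then show "a = b" using \<alpha>(2) ab unfolding bij_betw_def by (auto dest: inj_onD)
      qed
      show "h (?j a) = \<zero>\<^sub>M" if "a \<in> carrier Y" for a using e(7)[OF \<alpha>m[OF that]] that by simp
      have im: "?j ` carrier Y = j ` \<alpha> ` carrier Y" by (auto simp: image_image)
      show "l \<in> ?j ` carrier Y" if "l \<in> carrier L" "h l = \<zero>\<^sub>M" for l
        unfolding im using that e(8) \<alpha>(2) by (simp add: bij_betw_def)
    qed
    then show "\<exists>j'\<in>{j'. (j', h) \<in> exact_pairs R Y L M}. \<forall>y\<in>carrier Y. j (\<alpha> y) = j' y" by force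
  }
  {
    fix j' assume "j' \<in> {j'. (j', h) \<in> exact_pairs R Y L M}"
    then have "(j', h) \<in> exact_pairs R Y L M" by simp
    from exact_pairs_same_quotient_iso[OF mods(1,1,2) E this]
    obtain \<alpha> where \<alpha>: "\<alpha> \<in> module_hom R Y Y" "\<And>y. y \<in> carrier Y \<Longrightarrow> j (\<alpha> y) = j' y"
      and bij: "bij_betw \<alpha> (carrier Y) (carrier Y)" by blast
    from bij have "bij_betw (restrict \<alpha> (carrier Y)) (carrier Y) (carrier Y)"
      by (rule bij_betw_cong[THEN iffD1, rotated]) simp
    then have "restrict \<alpha> (carrier Y) \<in> module_aut R Y"
      using Hom_restrict[OF mods(1) \<alpha>(1)] by (simp add: module_aut_def)
    then show "\<exists>\<alpha>\<in>module_aut R Y. \<forall>y\<in>carrier Y. j (\<alpha> y) = j' y"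
      using \<alpha>(2) by (intro bexI[of _ "restrict \<alpha> (carrier Y)"]) auto
  }
  show "b = b'" if "b \<in> {j'. (j', h) \<in> exact_pairs R Y L M}" "b' \<in> {j'. (j', h) \<in> exact_pairs R Y L M}"
    "\<forall>y\<in>carrier Y. j (a y) = b y" "\<forall>y\<in>carrier Y. j (a y) = b' y" for a b b'
    using that exact_pairsD(1)[of b h R Y L M] exact_pairsD(1)[of b' h R Y L M]
    by (intro Hom_eqI[of b R Y L b' L]) auto
  show "a = a'" if a: "a \<in> module_aut R Y" "a' \<in> module_aut R Y"
    "\<forall>y\<in>carrier Y. j (a y) = b y" "\<forall>y\<in>carrier Y. j (a' y) = b y" for a a' b
  proof (rule Hom_eqI[of a R Y Y a' Y])
    show h: "a \<in> Hom R Y Y" "a' \<in> Hom R Y Y" using a by (auto simp: module_aut_def)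
    fix y assume y: "y \<in> carrier Y"
    then have "j (a y) = j (a' y)" using a by simp
    then show "a y = a' y" using inj_onD[OF e(5)] module_hom_mem[OF Hom_module_hom[OF h(1)] y]
      module_hom_mem[OF Hom_module_hom[OF h(2)] y] by simp
  qed
qed

section \<open>Algebras given by structure constants\<close>

text \<open>Copies the shape of \<open>hall_algebra\<close> literally, with index set, scalars,
  constants and unit as parameters. The Hall algebra is then an instance by mere unfolding, and the
  ring axioms can be proved without modules.\<close>

definition sc_algebra :: "'b set \<Rightarrow> real set \<Rightarrow> ('b \<Rightarrow> 'b \<Rightarrow> 'b \<Rightarrow> real) \<Rightarrow> 'b \<Rightarrow> ('b \<Rightarrow> real) ring" where
  "sc_algebra I F h e = \<lparr> carrier = {\<phi>. (\<forall>C. \<phi> C \<in> F) \<and> finite {C. \<phi> C \<noteq> 0} \<and> {C. \<phi> C \<noteq> 0} \<subseteq> I},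
     mult = (\<lambda>\<phi> \<psi> C. if C \<in> I
       then \<Sum>A\<in>{A. \<phi> A \<noteq> 0}. \<Sum>B\<in>{B. \<psi> B \<noteq> 0}. \<phi> A * \<psi> B * h A B C else 0),
     one = (\<lambda>C. if C = e then 1 else 0), zero = (\<lambda>_. 0), add = (\<lambda>\<phi> \<psi> C. \<phi> C + \<psi> C)\<rparr>"

text \<open>The index set may be infinite, so \<open>h_assoc\<close> cannot sum over all of it.
  \<open>V\<close> and \<open>Y\<close> are arbitrary finite sets that contain the supports of the
  intermediate products, and the value of the sums does not depend on them.\<close>

locale structure_constants =
  fixes I :: "'b set" and F :: "real set" and h :: "'b \<Rightarrow> 'b \<Rightarrow> 'b \<Rightarrow> real" and e :: 'b
  assumes F: "0 \<in> F" "1 \<in> F" "\<And>a b. a \<in> F \<Longrightarrow> b \<in> F \<Longrightarrow> a + b \<in> F"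
      "\<And>a b. a \<in> F \<Longrightarrow> b \<in> F \<Longrightarrow> a * b \<in> F" "\<And>a. a \<in> F \<Longrightarrow> - a \<in> F"
    and h_in: "\<And>A B C. A \<in> I \<Longrightarrow> B \<in> I \<Longrightarrow> C \<in> I \<Longrightarrow> h A B C \<in> F"
    and h_fin: "\<And>A B. A \<in> I \<Longrightarrow> B \<in> I \<Longrightarrow> finite {C \<in> I. h A B C \<noteq> 0}"
    and h_assoc: "\<And>A B Z C V Y. \<lbrakk>A \<in> I; B \<in> I; Z \<in> I; C \<in> I;
        finite V; V \<subseteq> I; {C \<in> I. h A B C \<noteq> 0} \<subseteq> V; finite Y; Y \<subseteq> I; {C \<in> I. h B Z C \<noteq> 0} \<subseteq> Y\<rbrakk> \<Longrightarrow>
        (\<Sum>D\<in>V. h A B D * h D Z C) = (\<Sum>D\<in>Y. h B Z D * h A D C)" and e_in: "e \<in> I"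
    and e_left: "\<And>B C. B \<in> I \<Longrightarrow> C \<in> I \<Longrightarrow> h e B C = (if C = B then 1 else 0)"
    and e_right: "\<And>B C. B \<in> I \<Longrightarrow> C \<in> I \<Longrightarrow> h B e C = (if C = B then 1 else 0)"
begin

abbreviation "H \<equiv> sc_algebra I F h e"

lemma F_sum: "(\<And>a. a \<in> A \<Longrightarrow> g a \<in> F) \<Longrightarrow> sum g A \<in> F"
  by (induction A rule: infinite_finite_induct) (auto simp: F)

text \<open>The defining sum runs over the exact supports, which change under every operation;
  larger finite ranges allow several products to be compared term by term.\<close>

lemma mult_eq:
  assumes "finite S" "{A. \<phi> A \<noteq> 0} \<subseteq> S" "finite T" "{A. \<psi> A \<noteq> 0} \<subseteq> T"
  shows "(\<phi> \<otimes>\<^sub>H \<psi>) C = (if C \<in> I then \<Sum>A\<in>S. \<Sum>B\<in>T. \<phi> A * \<psi> B * h A B C else 0)"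
proof -
  have "(\<Sum>A\<in>{A. \<phi> A \<noteq> 0}. \<Sum>B\<in>{B. \<psi> B \<noteq> 0}. \<phi> A * \<psi> B * h A B C)
    = (\<Sum>A\<in>{A. \<phi> A \<noteq> 0}. \<Sum>B\<in>T. \<phi> A * \<psi> B * h A B C)"
    using assms by (intro sum.cong refl sum.mono_neutral_left) auto
  also have "\<dots> = (\<Sum>A\<in>S. \<Sum>B\<in>T. \<phi> A * \<psi> B * h A B C)"
    using assms by (intro sum.mono_neutral_left) auto
  finally show ?thesis by (simp add: sc_algebra_def)
qed

lemma carrierD: "\<phi> \<in> carrier H \<Longrightarrow> \<phi> C \<in> F" "\<phi> \<in> carrier H \<Longrightarrow> finite {C. \<phi> C \<noteq> 0}"
  "\<phi> \<in> carrier H \<Longrightarrow> {C. \<phi> C \<noteq> 0} \<subseteq> I" "\<phi> \<in> carrier H \<Longrightarrow> C \<notin> I \<Longrightarrow> \<phi> C = 0"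
  by (auto simp: sc_algebra_def)

lemma carrierI: "(\<And>C. \<phi> C \<in> F) \<Longrightarrow> finite S \<Longrightarrow> S \<subseteq> I \<Longrightarrow> (\<And>C. C \<notin> S \<Longrightarrow> \<phi> C = 0) \<Longrightarrow> \<phi> \<in> carrier H"
  by (auto simp: sc_algebra_def intro: finite_subset[of _ S])

lemma add_carrier: "\<phi> \<in> carrier H \<Longrightarrow> \<psi> \<in> carrier H \<Longrightarrow> (\<lambda>C. \<phi> C + \<psi> C) \<in> carrier H"
  using carrierD[of \<phi>] carrierD[of \<psi>]
  by (intro carrierI[where S = "{C. \<phi> C \<noteq> 0} \<union> {C. \<psi> C \<noteq> 0}"]) (simp_all add: F)

lemma smult_carrier: "c \<in> F \<Longrightarrow> \<phi> \<in> carrier H \<Longrightarrow> (\<lambda>C. c * \<phi> C) \<in> carrier H"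
  using carrierD[of \<phi>] by (intro carrierI[where S = "{C. \<phi> C \<noteq> 0}"]) (simp_all add: F)

lemma mult_support:
  assumes "\<phi> \<in> carrier H" "\<psi> \<in> carrier H"
  shows "(\<phi> \<otimes>\<^sub>H \<psi>) C \<noteq> 0 \<Longrightarrow> C \<in> I \<and> (\<exists>A B. \<phi> A \<noteq> 0 \<and> \<psi> B \<noteq> 0 \<and> h A B C \<noteq> 0)"
proof -
  assume n: "(\<phi> \<otimes>\<^sub>H \<psi>) C \<noteq> 0"
  then have C: "C \<in> I" by (simp add: sc_algebra_def split: if_splits)
  with n have "(\<Sum>A\<in>{A. \<phi> A \<noteq> 0}. \<Sum>B\<in>{B. \<psi> B \<noteq> 0}. \<phi> A * \<psi> B * h A B C) \<noteq> 0"
    by (simp add: sc_algebra_def)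
  then obtain A where "\<phi> A \<noteq> 0" "(\<Sum>B\<in>{B. \<psi> B \<noteq> 0}. \<phi> A * \<psi> B * h A B C) \<noteq> 0"
    by (auto elim: sum.not_neutral_contains_not_neutral)
  then obtain B where "\<psi> B \<noteq> 0" "\<phi> A * \<psi> B * h A B C \<noteq> 0"
    by (auto elim: sum.not_neutral_contains_not_neutral)
  then show ?thesis using C \<open>\<phi> A \<noteq> 0\<close> by auto
qed

lemma mult_closed:
  assumes "\<phi> \<in> carrier H" "\<psi> \<in> carrier H"
  shows "\<phi> \<otimes>\<^sub>H \<psi> \<in> carrier H"
proof (rule carrierI[where S = "\<Union>A\<in>{A. \<phi> A \<noteq> 0}. \<Union>B\<in>{B. \<psi> B \<noteq> 0}. {C \<in> I. h A B C \<noteq> 0}"])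
  note a = carrierD[OF assms(1)] and b = carrierD[OF assms(2)]
  show "(\<phi> \<otimes>\<^sub>H \<psi>) C \<in> F" for C unfolding mult_eq[OF a(2) subset_refl b(2) subset_refl]
    using a b by (auto intro!: F_sum F h_in)
  show "finite (\<Union>A\<in>{A. \<phi> A \<noteq> 0}. \<Union>B\<in>{B. \<psi> B \<noteq> 0}. {C \<in> I. h A B C \<noteq> 0})"
    using a b by (intro finite_UN_I h_fin) auto
  show "(\<phi> \<otimes>\<^sub>H \<psi>) C = 0" if "C \<notin> (\<Union>A\<in>{A. \<phi> A \<noteq> 0}. \<Union>B\<in>{B. \<psi> B \<noteq> 0}. {C \<in> I. h A B C \<noteq> 0})" for C
    using mult_support[OF assms, of C] that by blast
qed auto

lemma mult_assoc:
  assumes "\<phi> \<in> carrier H" "\<psi> \<in> carrier H" "\<chi> \<in> carrier H"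
  shows "(\<phi> \<otimes>\<^sub>H \<psi>) \<otimes>\<^sub>H \<chi> = \<phi> \<otimes>\<^sub>H (\<psi> \<otimes>\<^sub>H \<chi>)"
proof
  fix C
  note a = carrierD[OF assms(1)] and b = carrierD[OF assms(2)] and c = carrierD[OF assms(3)]
  let ?S = "{A. \<phi> A \<noteq> 0}" and ?T = "{A. \<psi> A \<noteq> 0}" and ?U = "{A. \<chi> A \<noteq> 0}"
  \<comment> \<open>\<open>V\<close> and \<open>Y\<close> contain every index that can occur in the
    two inner products, so that \<open>h_assoc\<close> applies to all triples of basis elements with
    the same two ranges.\<close>
  define V where "V = (\<Union>A\<in>?S. \<Union>B\<in>?T. {C \<in> I. h A B C \<noteq> 0})"
  define Y where "Y = (\<Union>A\<in>?T. \<Union>B\<in>?U. {C \<in> I. h A B C \<noteq> 0})"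
  have V: "finite V" "V \<subseteq> I" "{C. (\<phi> \<otimes>\<^sub>H \<psi>) C \<noteq> 0} \<subseteq> V"
    unfolding V_def using a b mult_support[OF assms(1,2)] by (auto intro!: finite_UN_I h_fin)
  have Y: "finite Y" "Y \<subseteq> I" "{C. (\<psi> \<otimes>\<^sub>H \<chi>) C \<noteq> 0} \<subseteq> Y"
    unfolding Y_def using b c mult_support[OF assms(2,3)] by (auto intro!: finite_UN_I h_fin)
  show "((\<phi> \<otimes>\<^sub>H \<psi>) \<otimes>\<^sub>H \<chi>) C = (\<phi> \<otimes>\<^sub>H (\<psi> \<otimes>\<^sub>H \<chi>)) C"
  proof (cases "C \<in> I")
    case False
    then show ?thesis by (simp add: sc_algebra_def)
  next
    case C: True
    have *: "(\<Sum>D\<in>V. h A B D * h D Z C) = (\<Sum>D\<in>Y. h B Z D * h A D C)"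
      if z: "Z \<in> ?U" "A \<in> ?S" "B \<in> ?T" for Z A B
    proof (rule h_assoc)
      show "{C \<in> I. h A B C \<noteq> 0} \<subseteq> V" "{C \<in> I. h B Z C \<noteq> 0} \<subseteq> Y"
        using z unfolding V_def Y_def by blast+
    qed (use z a(3) b(3) c(3) C V Y in auto)
    have "((\<phi> \<otimes>\<^sub>H \<psi>) \<otimes>\<^sub>H \<chi>) C = (\<Sum>D\<in>V. \<Sum>Z\<in>?U. (\<phi> \<otimes>\<^sub>H \<psi>) D * \<chi> Z * h D Z C)"
      using mult_eq[OF V(1,3) c(2) subset_refl] C by simp
    also have "\<dots> = (\<Sum>D\<in>V. \<Sum>Z\<in>?U. (\<Sum>A\<in>?S. \<Sum>B\<in>?T. \<phi> A * \<psi> B * h A B D) * \<chi> Z * h D Z C)"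
      using mult_eq[OF a(2) subset_refl b(2) subset_refl] V(2) by (intro sum.cong refl) auto
    also have "\<dots> = (\<Sum>D\<in>V. \<Sum>Z\<in>?U. \<Sum>A\<in>?S. \<Sum>B\<in>?T. \<phi> A * \<psi> B * \<chi> Z * (h A B D * h D Z C))"
      by (simp add: sum_distrib_left sum_distrib_right mult_ac)
    also have "\<dots> = (\<Sum>Z\<in>?U. \<Sum>D\<in>V. \<Sum>A\<in>?S. \<Sum>B\<in>?T. \<phi> A * \<psi> B * \<chi> Z * (h A B D * h D Z C))"
      by (rule sum.swap)
    also have "\<dots> = (\<Sum>Z\<in>?U. \<Sum>A\<in>?S. \<Sum>D\<in>V. \<Sum>B\<in>?T. \<phi> A * \<psi> B * \<chi> Z * (h A B D * h D Z C))"
      by (intro sum.cong refl sum.swap)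
    also have "\<dots> = (\<Sum>Z\<in>?U. \<Sum>A\<in>?S. \<Sum>B\<in>?T. \<Sum>D\<in>V. \<phi> A * \<psi> B * \<chi> Z * (h A B D * h D Z C))"
      by (intro sum.cong refl sum.swap)
    also have "\<dots> = (\<Sum>Z\<in>?U. \<Sum>A\<in>?S. \<Sum>B\<in>?T. \<phi> A * \<psi> B * \<chi> Z * (\<Sum>D\<in>V. h A B D * h D Z C))"
      by (simp add: sum_distrib_left)
    also have "\<dots> = (\<Sum>Z\<in>?U. \<Sum>A\<in>?S. \<Sum>B\<in>?T. \<phi> A * \<psi> B * \<chi> Z * (\<Sum>D\<in>Y. h B Z D * h A D C))"
      using * by (intro sum.cong refl) simp
    also have "\<dots> = (\<Sum>Z\<in>?U. \<Sum>A\<in>?S. \<Sum>B\<in>?T. \<Sum>D\<in>Y. \<phi> A * (\<psi> B * \<chi> Z * h B Z D) * h A D C)"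
      by (simp add: sum_distrib_left mult_ac)
    also have "\<dots> = (\<Sum>A\<in>?S. \<Sum>Z\<in>?U. \<Sum>B\<in>?T. \<Sum>D\<in>Y. \<phi> A * (\<psi> B * \<chi> Z * h B Z D) * h A D C)"
      by (rule sum.swap)
    also have "\<dots> = (\<Sum>A\<in>?S. \<Sum>B\<in>?T. \<Sum>Z\<in>?U. \<Sum>D\<in>Y. \<phi> A * (\<psi> B * \<chi> Z * h B Z D) * h A D C)"
      by (intro sum.cong refl sum.swap)
    also have "\<dots> = (\<Sum>A\<in>?S. \<Sum>B\<in>?T. \<Sum>D\<in>Y. \<Sum>Z\<in>?U. \<phi> A * (\<psi> B * \<chi> Z * h B Z D) * h A D C)"
      by (intro sum.cong refl sum.swap)
    also have "\<dots> = (\<Sum>A\<in>?S. \<Sum>D\<in>Y. \<Sum>B\<in>?T. \<Sum>Z\<in>?U. \<phi> A * (\<psi> B * \<chi> Z * h B Z D) * h A D C)"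
      by (intro sum.cong refl sum.swap)
    also have "\<dots> = (\<Sum>A\<in>?S. \<Sum>D\<in>Y. \<phi> A * (\<Sum>B\<in>?T. \<Sum>Z\<in>?U. \<psi> B * \<chi> Z * h B Z D) * h A D C)"
      by (simp add: sum_distrib_left sum_distrib_right)
    also have "\<dots> = (\<Sum>A\<in>?S. \<Sum>D\<in>Y. \<phi> A * (\<psi> \<otimes>\<^sub>H \<chi>) D * h A D C)"
      using mult_eq[OF b(2) subset_refl c(2) subset_refl] Y(2) by (intro sum.cong refl) auto
    also have "\<dots> = (\<phi> \<otimes>\<^sub>H (\<psi> \<otimes>\<^sub>H \<chi>)) C" using mult_eq[OF a(2) subset_refl Y(1,3)] C by simp
    finally show ?thesis .
  qed
qed

lemma one_carrier: "\<one>\<^sub>H \<in> carrier H"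
  by (rule carrierI[of _ "{e}"]) (auto simp: sc_algebra_def F e_in)

lemma one_mult: "\<phi> \<in> carrier H \<Longrightarrow> \<one>\<^sub>H \<otimes>\<^sub>H \<phi> = \<phi>"
proof
  fix C assume p: "\<phi> \<in> carrier H"
  note a = carrierD[OF p]
  have "(\<one>\<^sub>H \<otimes>\<^sub>H \<phi>) C = (if C \<in> I then \<Sum>A\<in>{e}. \<Sum>B\<in>{B. \<phi> B \<noteq> 0}. \<one>\<^sub>H A * \<phi> B * h A B C else 0)"
    by (rule mult_eq) (use a in \<open>auto simp: sc_algebra_def split: if_splits\<close>)
  also have "\<dots> = (if C \<in> I then \<Sum>B\<in>{B. \<phi> B \<noteq> 0}. \<phi> B * (if C = B then 1 else 0) else 0)"
    using a(3) by (auto simp: sc_algebra_def e_left intro!: sum.cong)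
  also have "\<dots> = \<phi> C" using a by (auto simp: if_distrib sum.delta' cong: if_cong)
  finally show "(\<one>\<^sub>H \<otimes>\<^sub>H \<phi>) C = \<phi> C" .
qed

lemma mult_one: "\<phi> \<in> carrier H \<Longrightarrow> \<phi> \<otimes>\<^sub>H \<one>\<^sub>H = \<phi>"
proof
  fix C assume p: "\<phi> \<in> carrier H"
  note a = carrierD[OF p]
  have "(\<phi> \<otimes>\<^sub>H \<one>\<^sub>H) C = (if C \<in> I then \<Sum>B\<in>{B. \<phi> B \<noteq> 0}. \<Sum>A\<in>{e}. \<phi> B * \<one>\<^sub>H A * h B A C else 0)"
    by (rule mult_eq) (use a in \<open>auto simp: sc_algebra_def split: if_splits\<close>)
  also have "\<dots> = (if C \<in> I then \<Sum>B\<in>{B. \<phi> B \<noteq> 0}. \<phi> B * (if C = B then 1 else 0) else 0)"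
    using a(3) by (auto simp: sc_algebra_def e_right intro!: sum.cong)
  also have "\<dots> = \<phi> C" using a by (auto simp: if_distrib sum.delta' cong: if_cong)
  finally show "(\<phi> \<otimes>\<^sub>H \<one>\<^sub>H) C = \<phi> C" .
qed

lemma mult_add_left:
  assumes "\<phi> \<in> carrier H" "\<psi> \<in> carrier H" "\<chi> \<in> carrier H"
  shows "(\<lambda>C. \<phi> C + \<psi> C) \<otimes>\<^sub>H \<chi> = (\<lambda>C. (\<phi> \<otimes>\<^sub>H \<chi>) C + (\<psi> \<otimes>\<^sub>H \<chi>) C)"
proof
  fix C
  note a = carrierD[OF assms(1)] and b = carrierD[OF assms(2)] and c = carrierD[OF assms(3)]
  let ?S = "{A. \<phi> A \<noteq> 0} \<union> {A. \<psi> A \<noteq> 0}"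
  have S: "finite ?S" using a b by simp
  have "((\<lambda>C. \<phi> C + \<psi> C) \<otimes>\<^sub>H \<chi>) C =
      (if C \<in> I then \<Sum>A\<in>?S. \<Sum>B\<in>{A. \<chi> A \<noteq> 0}. (\<phi> A + \<psi> A) * \<chi> B * h A B C else 0)"
    by (rule mult_eq[OF S _ c(2)]) auto
  moreover have "(\<phi> \<otimes>\<^sub>H \<chi>) C = (if C \<in> I then \<Sum>A\<in>?S. \<Sum>B\<in>{A. \<chi> A \<noteq> 0}. \<phi> A * \<chi> B * h A B C else 0)"
    by (rule mult_eq[OF S _ c(2)]) auto
  moreover have "(\<psi> \<otimes>\<^sub>H \<chi>) C = (if C \<in> I then \<Sum>A\<in>?S. \<Sum>B\<in>{A. \<chi> A \<noteq> 0}. \<psi> A * \<chi> B * h A B C else 0)"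
    by (rule mult_eq[OF S _ c(2)]) auto
  ultimately show "((\<lambda>C. \<phi> C + \<psi> C) \<otimes>\<^sub>H \<chi>) C = (\<phi> \<otimes>\<^sub>H \<chi>) C + (\<psi> \<otimes>\<^sub>H \<chi>) C"
    by (simp add: sum.distrib distrib_right)
qed

lemma mult_add_right:
  assumes "\<phi> \<in> carrier H" "\<psi> \<in> carrier H" "\<chi> \<in> carrier H"
  shows "\<chi> \<otimes>\<^sub>H (\<lambda>C. \<phi> C + \<psi> C) = (\<lambda>C. (\<chi> \<otimes>\<^sub>H \<phi>) C + (\<chi> \<otimes>\<^sub>H \<psi>) C)"
proof
  fix C
  note a = carrierD[OF assms(1)] and b = carrierD[OF assms(2)] and c = carrierD[OF assms(3)]
  let ?S = "{A. \<phi> A \<noteq> 0} \<union> {A. \<psi> A \<noteq> 0}"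
  have S: "finite ?S" using a b by simp
  have "(\<chi> \<otimes>\<^sub>H (\<lambda>C. \<phi> C + \<psi> C)) C =
      (if C \<in> I then \<Sum>B\<in>{A. \<chi> A \<noteq> 0}. \<Sum>A\<in>?S. \<chi> B * (\<phi> A + \<psi> A) * h B A C else 0)"
    by (rule mult_eq[OF c(2) _ S]) auto
  moreover have "(\<chi> \<otimes>\<^sub>H \<phi>) C = (if C \<in> I then \<Sum>B\<in>{A. \<chi> A \<noteq> 0}. \<Sum>A\<in>?S. \<chi> B * \<phi> A * h B A C else 0)"
    by (rule mult_eq[OF c(2) _ S]) auto
  moreover have "(\<chi> \<otimes>\<^sub>H \<psi>) C = (if C \<in> I then \<Sum>B\<in>{A. \<chi> A \<noteq> 0}. \<Sum>A\<in>?S. \<chi> B * \<psi> A * h B A C else 0)"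
    by (rule mult_eq[OF c(2) _ S]) auto
  ultimately show "(\<chi> \<otimes>\<^sub>H (\<lambda>C. \<phi> C + \<psi> C)) C = (\<chi> \<otimes>\<^sub>H \<phi>) C + (\<chi> \<otimes>\<^sub>H \<psi>) C"
    by (simp add: sum.distrib distrib_left distrib_right)
qed

lemma mult_smult_left: "(\<lambda>C. c * \<phi> C) \<otimes>\<^sub>H \<chi> = (\<lambda>C. c * (\<phi> \<otimes>\<^sub>H \<chi>) C)"
  \<comment> \<open>Scaling keeps the support unless c = 0, when the sum becomes empty.\<close>
  by (cases "c = 0") (auto simp: sc_algebra_def sum_distrib_left mult_ac)

lemma mult_smult_right: "\<chi> \<otimes>\<^sub>H (\<lambda>C. c * \<phi> C) = (\<lambda>C. c * (\<chi> \<otimes>\<^sub>H \<phi>) C)"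
  by (cases "c = 0") (auto simp: sc_algebra_def sum_distrib_left mult_ac)

lemma ring: "ring H"
proof (rule ringI)
  have add: "\<phi> \<oplus>\<^sub>H \<psi> = (\<lambda>C. \<phi> C + \<psi> C)" for \<phi> \<psi> by (simp add: sc_algebra_def)
  have zero: "\<zero>\<^sub>H = (\<lambda>_. 0)" by (simp add: sc_algebra_def)
  show "abelian_group H"
  proof (rule abelian_groupI)
    show "\<zero>\<^sub>H \<in> carrier H" by (simp add: sc_algebra_def F)
    fix \<phi> assume "\<phi> \<in> carrier H"
    then show "\<exists>\<psi>\<in>carrier H. \<psi> \<oplus>\<^sub>H \<phi> = \<zero>\<^sub>H"
      by (intro bexI[of _ "\<lambda>C. (-1) * \<phi> C"] smult_carrier F) (auto simp: add zero)
  qed (auto simp: add zero add_carrier)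
  show "monoid H"
    by (rule monoidI) (auto simp: mult_closed one_carrier mult_assoc one_mult mult_one)
qed (simp_all add: mult_add_left mult_add_right sc_algebra_def[of I F h e, THEN arg_cong[where f = add]])

lemma basis_mult:
  assumes "A \<in> I" "B \<in> I"
  shows "(\<lambda>C. if C = A then 1 else 0) \<otimes>\<^sub>H (\<lambda>C. if C = B then 1 else 0) =
    (\<lambda>C. if C \<in> I then h A B C else 0)"
proof
  fix C
  show "((\<lambda>C. if C = A then 1 else 0) \<otimes>\<^sub>H (\<lambda>C. if C = B then 1 else 0)) C =
    (if C \<in> I then h A B C else 0)" by (subst mult_eq[of "{A}" _ "{B}"]) (auto split: if_splits)
qed

lemma basis_carrier: "A \<in> I \<Longrightarrow> (\<lambda>C. if C = A then 1 else 0) \<in> carrier H"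
  by (rule carrierI[of _ "{A}"]) (auto simp: F)

end

section \<open>Modules over a finite local ring with \<open>x\<^sup>2 = 0\<close>\<close>

text \<open>Rank-nullity as a count: each fibre is a translate of the kernel. All dimension
  arguments below are products of cardinalities obtained from this lemma.\<close>

lemma card_hom_image:
  assumes "module R M" "module R N" "f \<in> module_hom R M N" "finite (carrier M)"
  shows "card (carrier M) = card (f ` carrier M) * card {a \<in> carrier M. f a = \<zero>\<^sub>N}"
proof -
  interpret M: module R M by fact
  interpret N: module R N by fact
  have fib: "card {a \<in> carrier M. f a = y} = card {a \<in> carrier M. f a = \<zero>\<^sub>N}" if y: "y \<in> f ` carrier M" for y
  proof -
    obtain b where b: "b \<in> carrier M" "y = f b" using y by auto
    have s: "(a \<ominus>\<^sub>M b) \<oplus>\<^sub>M b = a" "(a \<oplus>\<^sub>M b) \<ominus>\<^sub>M b = a" if "a \<in> carrier M" for a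
      using that b by (simp_all add: a_minus_def M.M.a_assoc M.M.l_neg M.M.r_neg)
    have "bij_betw (\<lambda>a. a \<ominus>\<^sub>M b) {a \<in> carrier M. f a = y} {a \<in> carrier M. f a = \<zero>\<^sub>N}"
    proof (rule bij_betw_byWitness[where f' = "\<lambda>a. a \<oplus>\<^sub>M b"])
      show "(\<lambda>a. a \<ominus>\<^sub>M b) ` {a \<in> carrier M. f a = y} \<subseteq> {a \<in> carrier M. f a = \<zero>\<^sub>N}"
      proof
        fix c assume "c \<in> (\<lambda>a. a \<ominus>\<^sub>M b) ` {a \<in> carrier M. f a = y}"
        then obtain a where a: "a \<in> carrier M" "f a = y" "c = a \<ominus>\<^sub>M b" by auto
        then show "c \<in> {a \<in> carrier M. f a = \<zero>\<^sub>N}"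
          using b module_hom_eq_iff[OF assms(1-3) a(1) b(1)] by simp
      qed
      show "(\<lambda>a. a \<oplus>\<^sub>M b) ` {a \<in> carrier M. f a = \<zero>\<^sub>N} \<subseteq> {a \<in> carrier M. f a = y}"
      proof
        fix c assume "c \<in> (\<lambda>a. a \<oplus>\<^sub>M b) ` {a \<in> carrier M. f a = \<zero>\<^sub>N}"
        then obtain a where a: "a \<in> carrier M" "f a = \<zero>\<^sub>N" "c = a \<oplus>\<^sub>M b" by auto
        then show "c \<in> {a \<in> carrier M. f a = y}"
          using b module_hom_add[OF assms(3) a(1) b(1)] module_hom_mem[OF assms(3) b(1)] by simp
      qed
    qed (use s in auto)
    then show ?thesis by (rule bij_betw_same_card)
  qed
  have "card (carrier M) = (\<Sum>y\<in>f ` carrier M. card {a \<in> carrier M. f a = y})"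
    using sum.image_gen[OF assms(4), of "\<lambda>_. 1::nat" f] by simp
  also have "\<dots> = (\<Sum>y\<in>f ` carrier M. card {a \<in> carrier M. f a = \<zero>\<^sub>N})"
    using fib by (intro sum.cong refl)
  finally show ?thesis by simp
qed

lemma regular_module_simps [simp]:
  "carrier (regular_module R) = carrier R" "zero (regular_module R) = zero R"
  "add (regular_module R) = add R" "smult (regular_module R) = mult R"
  by (simp_all add: regular_module_def)

lemma direct_sum_simps [simp]: "carrier (direct_sum M N) = carrier M \<times> carrier N"
  "zero (direct_sum M N) = (\<zero>\<^sub>M, \<zero>\<^sub>N)"
  "add (direct_sum M N) = (\<lambda>v w. (fst v \<oplus>\<^sub>M fst w, snd v \<oplus>\<^sub>N snd w))"
  "smult (direct_sum M N) = (\<lambda>c v. (c \<odot>\<^sub>M fst v, c \<odot>\<^sub>N snd v))" by (simp_all add: direct_sum_def)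

lemma (in cring) module_regular_module: "module R (regular_module R)"
proof (rule moduleI[OF is_cring])
  show "abelian_group (regular_module R)"
    by (rule abelian_groupI) (auto simp: a_ac intro: add.l_inv_ex)
qed (auto simp: l_distr r_distr m_assoc)

lemma (in module) smult_zero_in_iff: "a \<in> Units R \<Longrightarrow> m \<in> carrier M \<Longrightarrow> a \<odot>\<^sub>M m = \<zero>\<^sub>M \<longleftrightarrow> m = \<zero>\<^sub>M"
proof
  assume a: "a \<in> Units R" "m \<in> carrier M" "a \<odot>\<^sub>M m = \<zero>\<^sub>M"
  have "m = (inv a \<otimes> a) \<odot>\<^sub>M m" using a by simp
  also have "\<dots> = inv a \<odot>\<^sub>M (a \<odot>\<^sub>M m)" by (rule smult_assoc1) (use a in auto)
  finally show "m = \<zero>\<^sub>M" using a by simp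
qed auto

text \<open>This is Ry + U. It serves to enlarge a candidate for a complement by one
  element.\<close>

lemma (in module) cyclic_plus_submodule:
  assumes U: "Module.submodule U R M" and y: "y \<in> carrier M"
  shows "Module.submodule {t \<odot>\<^sub>M y \<oplus>\<^sub>M u | t u. t \<in> carrier R \<and> u \<in> U} R M" (is "Module.submodule ?W R M")
proof (rule submoduleI)
  note s = submoduleE[OF U]
  have Uc: "u \<in> carrier M" if "u \<in> U" for u using s(1) that by blast
  have U0: "\<zero>\<^sub>M \<in> U" using subgroup.one_closed[OF Module.submodule.axioms(1)[OF U]] by simp
  have I: "t \<odot>\<^sub>M y \<oplus>\<^sub>M u \<in> ?W" if "t \<in> carrier R" "u \<in> U" for t u using that by blast
  show "?W \<subseteq> carrier M" using y Uc by auto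
  show "\<zero>\<^sub>M \<in> ?W" using I[of \<zero> "\<zero>\<^sub>M"] U0 y by simp
  fix a assume "a \<in> ?W"
  then obtain t u where a: "t \<in> carrier R" "u \<in> U" "a = t \<odot>\<^sub>M y \<oplus>\<^sub>M u" by blast
  have "\<ominus>\<^sub>M a = (\<ominus> t) \<odot>\<^sub>M y \<oplus>\<^sub>M (\<ominus>\<^sub>M u)" using a y Uc by (simp add: M.minus_add smult_l_minus)
  then show "\<ominus>\<^sub>M a \<in> ?W" using I[of "\<ominus> t" "\<ominus>\<^sub>M u"] a(1) s(3)[OF a(2)] by simp
  show "r \<odot>\<^sub>M a \<in> ?W" if r: "r \<in> carrier R" for r
  proof -
    have "r \<odot>\<^sub>M a = (r \<otimes> t) \<odot>\<^sub>M y \<oplus>\<^sub>M (r \<odot>\<^sub>M u)"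
      using a y r Uc by (simp add: smult_r_distr smult_assoc1)
    then show ?thesis using I[of "r \<otimes> t" "r \<odot>\<^sub>M u"] a(1) r s(4)[OF r a(2)] by simp
  qed
  fix b assume "b \<in> ?W"
  then obtain t' u' where b: "t' \<in> carrier R" "u' \<in> U" "b = t' \<odot>\<^sub>M y \<oplus>\<^sub>M u'" by blast
  have "a \<oplus>\<^sub>M b = (t \<oplus> t') \<odot>\<^sub>M y \<oplus>\<^sub>M (u \<oplus>\<^sub>M u')"
    using a b y Uc by (simp add: smult_l_distr M.a_ac)
  then show "a \<oplus>\<^sub>M b \<in> ?W" using I[of "t \<oplus> t'" "u \<oplus>\<^sub>M u'"] a(1) b(1) s(5)[OF a(2) b(2)] by simp
qed

lemma (in module) submodule_zero_mem: "Module.submodule U R M \<Longrightarrow> \<zero>\<^sub>M \<in> U"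
  using subgroup.one_closed[OF Module.submodule.axioms(1)] by fastforce

text \<open>k[x]/(x^2) through its ring-theoretic features: finite, commutative and local with
  maximal ideal generated by an element of square zero. Modules are then studied by units and
  multiples of x, without bases.\<close>

locale dual_ring = cring R for R (structure) +
  fixes x
  assumes finite_R: "finite (carrier R)"
    and x_in [simp]: "x \<in> carrier R" and xx: "x \<otimes> x = \<zero>" and x_nz: "x \<noteq> \<zero>"
    and local_R: "\<And>r. r \<in> carrier R \<Longrightarrow> r \<in> Units R \<or> (\<exists>s\<in>carrier R. r = x \<otimes> s)"
begin

definition xim :: "('a, 'm) module \<Rightarrow> 'm set" where "xim M = (\<lambda>m. x \<odot>\<^sub>M m) ` carrier M"

lemma x_hom: "module R M \<Longrightarrow> (\<lambda>m. x \<odot>\<^sub>M m) \<in> module_hom R M M"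
proof -
  assume "module R M"
  then interpret M: module R M .
  show ?thesis
    by (rule module_homI) (auto simp: M.smult_r_distr simp flip: M.smult_assoc1 simp: m_comm)
qed

lemma x_x_smult: "module R M \<Longrightarrow> m \<in> carrier M \<Longrightarrow> x \<odot>\<^sub>M (x \<odot>\<^sub>M m) = \<zero>\<^sub>M"
proof -
  assume "module R M" and m: "m \<in> carrier M"
  then interpret M: module R M by simp
  show ?thesis using M.smult_assoc1[of x x m] m xx by simp
qed

lemma x_smult_comm:
  assumes "module R M" "m \<in> carrier M" "r \<in> carrier R"
  shows "x \<odot>\<^sub>M (r \<odot>\<^sub>M m) = r \<odot>\<^sub>M (x \<odot>\<^sub>M m)"
proof -
  interpret M: module R M by fact
  show ?thesis using assms M.smult_assoc1[of x r m] M.smult_assoc1[of r x m] by (simp add: m_comm)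
qed

text \<open>Such an m splits off: it generates either a free module, which is injective because R is
  self-injective, or a submodule of a semisimple module. The elementary form of the argument takes U
  maximal among the submodules that meet Rm trivially and shows that Rm + U is everything.\<close>

lemma complement_exists:
  assumes M: "module R M" "finite (carrier M)" and m: "m \<in> carrier M"
    and c: "x \<odot>\<^sub>M m \<noteq> \<zero>\<^sub>M \<or> (\<forall>a\<in>carrier M. x \<odot>\<^sub>M a = \<zero>\<^sub>M)"
  obtains U where "Module.submodule U R M" "\<forall>r\<in>carrier R. r \<odot>\<^sub>M m \<in> U \<longrightarrow> r \<odot>\<^sub>M m = \<zero>\<^sub>M"
    "\<forall>a\<in>carrier M. \<exists>r\<in>carrier R. \<exists>u\<in>U. a = r \<odot>\<^sub>M m \<oplus>\<^sub>M u"
proof -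
  interpret M: module R M by fact
  let ?A = "{U. Module.submodule U R M \<and> (\<forall>r\<in>carrier R. r \<odot>\<^sub>M m \<in> U \<longrightarrow> r \<odot>\<^sub>M m = \<zero>\<^sub>M)}"
  have "?A \<subseteq> Pow (carrier M)" by (auto dest!: M.submoduleE(1))
  then have fin: "finite ?A" using M(2) finite_subset by blast
  have "Module.submodule {\<zero>\<^sub>M} R M" by (rule M.submoduleI) auto
  then have "{\<zero>\<^sub>M} \<in> ?A" by simp
  then have ne: "?A \<noteq> {}" by (rule ex_in_conv[THEN iffD1, OF exI])
  from finite_has_maximal[OF fin ne]
  obtain U where U: "U \<in> ?A" and max0: "\<forall>W\<in>?A. U \<le> W \<longrightarrow> U = W" by (rule bexE)
  have max: "U = W" if "W \<in> ?A" "U \<subseteq> W" for W using bspec[OF max0 that(1)] that(2) by (rule mp)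
  from U have sub: "Module.submodule U R M" by simp
  have triv: "r \<odot>\<^sub>M m = \<zero>\<^sub>M" if "r \<in> carrier R" "r \<odot>\<^sub>M m \<in> U" for r using U that by simp
  note s = M.submoduleE[OF sub]
  have Uc: "u \<in> carrier M" if "u \<in> U" for u using s(1) that by blast
  define D where "D = {t \<odot>\<^sub>M m \<oplus>\<^sub>M u | t u. t \<in> carrier R \<and> u \<in> U}"
  have subD: "Module.submodule D R M" unfolding D_def by (rule M.cyclic_plus_submodule[OF sub m])
  note d = M.submoduleE[OF subD]
  have D0: "\<zero>\<^sub>M \<in> D" by (rule M.submodule_zero_mem[OF subD])
  have UD: "U \<subseteq> D"
  proof
    fix u assume u: "u \<in> U"
    then have "u = \<zero> \<odot>\<^sub>M m \<oplus>\<^sub>M u" using Uc m by simp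
    then show "u \<in> D" unfolding D_def using u by blast
  qed
  have mD: "t \<odot>\<^sub>M m \<in> D" if "t \<in> carrier R" for t
  proof -
    have "t \<odot>\<^sub>M m = t \<odot>\<^sub>M m \<oplus>\<^sub>M \<zero>\<^sub>M" using that m by simp
    then show ?thesis unfolding D_def using that M.submodule_zero_mem[OF sub] by blast
  qed
  have "a \<in> D" if a: "a \<in> carrier M" for a
  proof (rule ccontr)
    assume aD: "a \<notin> D"
    \<comment> \<open>Either \<open>a\<close> itself or \<open>x \<odot> a\<close> will do, since x
      kills the latter. So y is a nonzero class of M/D that x annihilates.\<close>
    obtain y where y: "y \<in> carrier M" "y \<notin> D" "x \<odot>\<^sub>M y \<in> D"
    proof (cases "x \<odot>\<^sub>M a \<in> D")
      case True
      then show ?thesis using that[of a] a aD by simp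
    next
      case False
      then show ?thesis using that[of "x \<odot>\<^sub>M a"] a D0 x_x_smult[OF M(1) a] by simp
    qed
    then obtain r u where ru: "r \<in> carrier R" "u \<in> U" "x \<odot>\<^sub>M y = r \<odot>\<^sub>M m \<oplus>\<^sub>M u"
      unfolding D_def by blast
    \<comment> \<open>The Rm-part of x y is divisible by x inside Rm. If x = 0 on M, that part lies
      in U and vanishes. Otherwise x kills x y, so x r m lies in U and is 0, which makes r a nonunit
      because x m is not 0.\<close>
    have "\<exists>s\<in>carrier R. r \<odot>\<^sub>M m = x \<odot>\<^sub>M (s \<odot>\<^sub>M m)" using c
    proof
      assume all: "\<forall>a\<in>carrier M. x \<odot>\<^sub>M a = \<zero>\<^sub>M"
      then have "r \<odot>\<^sub>M m \<oplus>\<^sub>M u = \<zero>\<^sub>M" using ru y by metis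
      then have "r \<odot>\<^sub>M m = \<ominus>\<^sub>M u" using M.M.minus_equality[of "r \<odot>\<^sub>M m" u] ru m Uc by simp
      then have "r \<odot>\<^sub>M m = \<zero>\<^sub>M" using triv[OF ru(1)] s(3)[OF ru(2)] by simp
      then show ?thesis using all m by (intro bexI[of _ \<zero>]) auto
    next
      assume xm: "x \<odot>\<^sub>M m \<noteq> \<zero>\<^sub>M"
      have "\<zero>\<^sub>M = x \<odot>\<^sub>M (r \<odot>\<^sub>M m \<oplus>\<^sub>M u)" using x_x_smult[OF M(1) y(1)] ru(3) by simp
      also have "\<dots> = x \<odot>\<^sub>M (r \<odot>\<^sub>M m) \<oplus>\<^sub>M x \<odot>\<^sub>M u" using ru m Uc by (simp add: M.smult_r_distr)
      finally have "x \<odot>\<^sub>M (r \<odot>\<^sub>M m) = \<ominus>\<^sub>M (x \<odot>\<^sub>M u)"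
        using M.M.minus_equality[of "x \<odot>\<^sub>M (r \<odot>\<^sub>M m)" "x \<odot>\<^sub>M u"] ru m Uc by simp
      moreover have "\<ominus>\<^sub>M (x \<odot>\<^sub>M u) \<in> U" by (intro s(3) s(4) ru x_in)
      moreover have xr: "x \<odot>\<^sub>M (r \<odot>\<^sub>M m) = (x \<otimes> r) \<odot>\<^sub>M m" using ru m by (simp add: M.smult_assoc1)
      ultimately have z: "x \<odot>\<^sub>M (r \<odot>\<^sub>M m) = \<zero>\<^sub>M" using triv[of "x \<otimes> r"] ru by simp
      have "r \<notin> Units R"
        using z xm M.smult_zero_in_iff[of r "x \<odot>\<^sub>M m"] x_smult_comm[OF M(1) m ru(1)] m by auto
      then obtain s where "s \<in> carrier R" "r = x \<otimes> s" using local_R[OF ru(1)] by blast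
      then show ?thesis using m by (intro bexI[of _ s]) (auto simp: M.smult_assoc1)
    qed
    then obtain s' where s': "s' \<in> carrier R" "r \<odot>\<^sub>M m = x \<odot>\<^sub>M (s' \<odot>\<^sub>M m)" by blast
    \<comment> \<open>Subtracting the quotient by x just found leaves y outside D but moves x y into
      U.\<close>
    define y' where "y' = y \<ominus>\<^sub>M s' \<odot>\<^sub>M m"
    have y': "y' \<in> carrier M" using y m s' by (simp add: y'_def)
    have "y' \<oplus>\<^sub>M s' \<odot>\<^sub>M m = y" using y m s' by (simp add: y'_def a_minus_def M.M.a_assoc M.M.l_neg)
    then have y'D: "y' \<notin> D" using y(2) d(5)[of y' "s' \<odot>\<^sub>M m"] mD[OF s'(1)] by auto
    have "x \<odot>\<^sub>M y' = x \<odot>\<^sub>M y \<ominus>\<^sub>M x \<odot>\<^sub>M (s' \<odot>\<^sub>M m)"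
      unfolding y'_def using module_hom_diff[OF M(1,1) x_hom[OF M(1)] y(1), of "s' \<odot>\<^sub>M m"] s' m by simp
    also have "\<dots> = (r \<odot>\<^sub>M m \<oplus>\<^sub>M u) \<ominus>\<^sub>M r \<odot>\<^sub>M m" by (simp only: ru(3) s'(2))
    also have "\<dots> = u" using M.smult_closed[OF ru(1) m] Uc[OF ru(2)]
      by (simp add: a_minus_def M.M.a_comm[of "r \<odot>\<^sub>M m" u] M.M.a_assoc M.M.r_neg)
    finally have xy': "x \<odot>\<^sub>M y' \<in> U" using ru by simp
    \<comment> \<open>W = Ry' + U still meets Rm trivially, contradicting the maximality of U: in an
      element t y' + u of Rm a unit t would put y' into D, and otherwise t y' is a multiple of x y'
      and lies in U.\<close>
    define W where "W = {t \<odot>\<^sub>M y' \<oplus>\<^sub>M u | t u. t \<in> carrier R \<and> u \<in> U}"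
    have "r \<odot>\<^sub>M m = \<zero>\<^sub>M" if r: "r \<in> carrier R" "r \<odot>\<^sub>M m \<in> W" for r
    proof -
      obtain t u where tu: "t \<in> carrier R" "u \<in> U" "r \<odot>\<^sub>M m = t \<odot>\<^sub>M y' \<oplus>\<^sub>M u"
        using r unfolding W_def by blast
      from local_R[OF tu(1)] show ?thesis
      proof
        assume t: "t \<in> Units R"
        have "t \<odot>\<^sub>M y' = r \<odot>\<^sub>M m \<oplus>\<^sub>M \<ominus>\<^sub>M u"
          unfolding tu(3) using M.M.a_assoc[of "t \<odot>\<^sub>M y'" u "\<ominus>\<^sub>M u"] M.M.r_neg[OF Uc[OF tu(2)]]
            M.M.a_inv_closed[OF Uc[OF tu(2)]] M.smult_closed[OF tu(1) y'] Uc[OF tu(2)] by simp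
        also have "\<dots> \<in> D" using d(5)[OF mD[OF r(1)], of "\<ominus>\<^sub>M u"] s(3)[OF tu(2)] UD by blast
        finally have "inv t \<odot>\<^sub>M (t \<odot>\<^sub>M y') \<in> D" using d(4) t by simp
        moreover have "inv t \<odot>\<^sub>M (t \<odot>\<^sub>M y') = (inv t \<otimes> t) \<odot>\<^sub>M y'"
          using t tu(1) y' by (intro M.smult_assoc1[symmetric]) auto
        ultimately show ?thesis using y'D y' t by simp
      next
        assume "\<exists>s\<in>carrier R. t = x \<otimes> s"
        then obtain s2 where s2: "s2 \<in> carrier R" "t = x \<otimes> s2" by blast
        then have "t \<odot>\<^sub>M y' = s2 \<odot>\<^sub>M (x \<odot>\<^sub>M y')"
          using y' x_smult_comm[OF M(1) y' s2(1)] by (simp add: M.smult_assoc1)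
        then have "t \<odot>\<^sub>M y' \<in> U" using s(4)[OF s2(1) xy'] by simp
        then have "r \<odot>\<^sub>M m \<in> U" using tu s(5) by simp
        then show ?thesis using triv r by simp
      qed
    qed
    then have "W \<in> ?A" using M.cyclic_plus_submodule[OF sub y'] unfolding W_def by blast
    moreover have "U \<subseteq> W"
    proof
      fix u assume u: "u \<in> U"
      then have "u = \<zero> \<odot>\<^sub>M y' \<oplus>\<^sub>M u" using Uc y' by simp
      then show "u \<in> W" unfolding W_def using u by blast
    qed
    ultimately have "U = W" by (rule max)
    have "y' = \<one> \<odot>\<^sub>M y' \<oplus>\<^sub>M \<zero>\<^sub>M" using y' by simp
    then have "y' \<in> W" unfolding W_def using M.submodule_zero_mem[OF sub] by blast
    then show False using \<open>U = W\<close> y'D UD by blast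
  qed
  then show ?thesis using that[OF sub] triv unfolding D_def by blast
qed

lemma split_map_hom:
  assumes "module R U" "module R M" "m \<in> carrier M" "f \<in> module_hom R U M"
  shows "(\<lambda>(r, u). r \<odot>\<^sub>M m \<oplus>\<^sub>M f u) \<in> module_hom R (direct_sum (regular_module R) U) M"
proof -
  interpret M: module R M by fact
  interpret U: module R U by fact
  show ?thesis by (rule module_homI)
      (use assms(3) module_hom_mem[OF assms(4)] in \<open>auto simp: M.smult_l_distr M.smult_r_distr
        M.smult_assoc1 module_hom_add[OF assms(4)] module_hom_smult[OF assms(4)] M.M.a_ac\<close>)
qed

text \<open>If x m is not 0, then m generates a free module: a nonunit r = x s kills m only if s is
  a nonunit as well, and then r is a multiple of x^2 = 0.\<close>

lemma ann_regular:
  assumes "module R M" "m \<in> carrier M" "x \<odot>\<^sub>M m \<noteq> \<zero>\<^sub>M" "r \<in> carrier R"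
  shows "r \<odot>\<^sub>M m = \<zero>\<^sub>M \<longleftrightarrow> r = \<zero>" "x \<odot>\<^sub>M (r \<odot>\<^sub>M m) = \<zero>\<^sub>M \<longleftrightarrow> x \<otimes> r = \<zero>"
proof -
  interpret M: module R M by fact
  have 1: "x \<odot>\<^sub>M (s \<odot>\<^sub>M m) = \<zero>\<^sub>M \<Longrightarrow> x \<otimes> s = \<zero>" if s: "s \<in> carrier R" for s
  proof -
    assume z: "x \<odot>\<^sub>M (s \<odot>\<^sub>M m) = \<zero>\<^sub>M"
    then have "s \<notin> Units R"
      using M.smult_zero_in_iff[of s "x \<odot>\<^sub>M m"] x_smult_comm[OF assms(1,2) s] assms by auto
    then obtain s' where "s' \<in> carrier R" "s = x \<otimes> s'" using local_R[OF s] by blast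
    then show "x \<otimes> s = \<zero>" by (simp add: m_assoc[symmetric] xx)
  qed
  show "x \<odot>\<^sub>M (r \<odot>\<^sub>M m) = \<zero>\<^sub>M \<longleftrightarrow> x \<otimes> r = \<zero>"
    using 1[OF assms(4)] M.smult_assoc1[of x r m] assms by auto
  show "r \<odot>\<^sub>M m = \<zero>\<^sub>M \<longleftrightarrow> r = \<zero>"
  proof
    assume z: "r \<odot>\<^sub>M m = \<zero>\<^sub>M"
    then have "r \<notin> Units R" using M.smult_zero_in_iff[of r m] assms by auto
    then obtain s where s: "s \<in> carrier R" "r = x \<otimes> s" using local_R assms by blast
    then show "r = \<zero>" using 1[of s] z assms by (simp add: M.smult_assoc1)
  qed (use assms in auto)
qed

text \<open>A unit kills only 0, and every nonunit is a multiple of x and kills m; so m generates a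
  copy of R/(x).\<close>

lemma ann_simple:
  assumes "module R M" "m \<in> carrier M" "x \<odot>\<^sub>M m = \<zero>\<^sub>M" "m \<noteq> \<zero>\<^sub>M" "r \<in> carrier R"
  shows "r \<odot>\<^sub>M m = \<zero>\<^sub>M \<longleftrightarrow> (\<exists>s\<in>carrier R. r = x \<otimes> s)" "x \<odot>\<^sub>M (r \<odot>\<^sub>M m) = \<zero>\<^sub>M"
proof -
  interpret M: module R M by fact
  show "x \<odot>\<^sub>M (r \<odot>\<^sub>M m) = \<zero>\<^sub>M" using x_smult_comm[OF assms(1,2,5)] assms by simp
  have "r \<odot>\<^sub>M m = \<zero>\<^sub>M" if s: "s \<in> carrier R" "r = x \<otimes> s" for s
    using x_smult_comm[OF assms(1,2) s(1)] assms s by (simp add: M.smult_assoc1)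
  moreover have "r \<notin> Units R" if "r \<odot>\<^sub>M m = \<zero>\<^sub>M"
    using M.smult_zero_in_iff[of r m] assms that by auto
  ultimately show "r \<odot>\<^sub>M m = \<zero>\<^sub>M \<longleftrightarrow> (\<exists>s\<in>carrier R. r = x \<otimes> s)" using local_R[OF assms(5)] by blast
qed

text \<open>M is the direct sum of Rm and U, but Rm is only R modulo the annihilator of m. Counting
  along the surjection from R + U onto M turns the annihilators into correction factors, for M and
  for xM alike.\<close>

lemma card_split:
  assumes M: "module R M" "finite (carrier M)" and m: "m \<in> carrier M"
    and U: "Module.submodule U R M" and triv: "\<forall>r\<in>carrier R. r \<odot>\<^sub>M m \<in> U \<longrightarrow> r \<odot>\<^sub>M m = \<zero>\<^sub>M"
    and span: "\<forall>a\<in>carrier M. \<exists>r\<in>carrier R. \<exists>u\<in>U. a = r \<odot>\<^sub>M m \<oplus>\<^sub>M u"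
  shows "card (carrier R) * card U = card (carrier M) * card {r \<in> carrier R. r \<odot>\<^sub>M m = \<zero>\<^sub>M}"
    "card (carrier R) * card (xim (M\<lparr>carrier := U\<rparr>)) =
      card (xim M) * card {r \<in> carrier R. x \<odot>\<^sub>M (r \<odot>\<^sub>M m) = \<zero>\<^sub>M}"
    "\<And>r u. r \<in> carrier R \<Longrightarrow> u \<in> U \<Longrightarrow> r \<odot>\<^sub>M m \<oplus>\<^sub>M u = \<zero>\<^sub>M \<longleftrightarrow> r \<odot>\<^sub>M m = \<zero>\<^sub>M \<and> u = \<zero>\<^sub>M"
proof -
  interpret M: module R M by fact
  let ?U = "M\<lparr>carrier := U\<rparr>"
  note Um = submodule_module[OF M(1) U]
  note s = M.submoduleE[OF U]
  have Uc: "u \<in> carrier M" if "u \<in> U" for u using s(1) that by blast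
  have finU: "finite U" using s(1) M(2) finite_subset by blast
  have inc: "(\<lambda>u. u) \<in> module_hom R ?U M" by (rule module_homI) (auto simp: Uc)
  note t = split_map_hom[OF Um M(1) m inc]
  let ?t = "\<lambda>(r, u). r \<odot>\<^sub>M m \<oplus>\<^sub>M u"
  note D = direct_sum_is_module[OF module_regular_module Um]
  have zero: "r \<odot>\<^sub>M m \<oplus>\<^sub>M u = \<zero>\<^sub>M \<longleftrightarrow> r \<odot>\<^sub>M m = \<zero>\<^sub>M \<and> u = \<zero>\<^sub>M"
    if ru: "r \<in> carrier R" "u \<in> U" for r u
  proof
    assume z: "r \<odot>\<^sub>M m \<oplus>\<^sub>M u = \<zero>\<^sub>M"
    then have "r \<odot>\<^sub>M m = \<ominus>\<^sub>M u" using M.M.minus_equality[of "r \<odot>\<^sub>M m" u] ru m Uc by simp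
    then have "r \<odot>\<^sub>M m = \<zero>\<^sub>M" using bspec[OF triv ru(1)] s(3)[OF ru(2)] by simp
    then show "r \<odot>\<^sub>M m = \<zero>\<^sub>M \<and> u = \<zero>\<^sub>M" using z Uc ru by simp
  qed auto
  then show "\<And>r u. r \<in> carrier R \<Longrightarrow> u \<in> U \<Longrightarrow> r \<odot>\<^sub>M m \<oplus>\<^sub>M u = \<zero>\<^sub>M \<longleftrightarrow> r \<odot>\<^sub>M m = \<zero>\<^sub>M \<and> u = \<zero>\<^sub>M" .
  have im: "?t ` (carrier R \<times> U) = carrier M"
  proof (intro equalityI subsetI)
    fix a assume "a \<in> carrier M"
    then obtain r u where "r \<in> carrier R" "u \<in> U" "a = r \<odot>\<^sub>M m \<oplus>\<^sub>M u" using span by blast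
    then show "a \<in> ?t ` (carrier R \<times> U)" by (intro image_eqI[of _ _ "(r, u)"]) auto
  qed (use m Uc in auto)
  have "card (carrier R \<times> U) = card (carrier M) * card {a \<in> carrier R \<times> U. ?t a = \<zero>\<^sub>M}"
    using card_hom_image[OF D M(1) t] finite_R finU im by simp
  also have "{a \<in> carrier R \<times> U. ?t a = \<zero>\<^sub>M} = {r \<in> carrier R. r \<odot>\<^sub>M m = \<zero>\<^sub>M} \<times> {\<zero>\<^sub>M}"
    using zero M.submodule_zero_mem[OF U] m by auto
  finally show "card (carrier R) * card U = card (carrier M) * card {r \<in> carrier R. r \<odot>\<^sub>M m = \<zero>\<^sub>M}"
    by (simp add: card_cartesian_product)
  let ?xt = "\<lambda>a. x \<odot>\<^sub>M ?t a"
  note xt = module_hom_comp[OF t x_hom[OF M(1)]]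
  have imx: "?xt ` (carrier R \<times> U) = xim M"
    unfolding xim_def im[symmetric] by (simp add: image_image)
  have zx: "x \<odot>\<^sub>M (r \<odot>\<^sub>M m \<oplus>\<^sub>M u) = \<zero>\<^sub>M \<longleftrightarrow> x \<odot>\<^sub>M (r \<odot>\<^sub>M m) = \<zero>\<^sub>M \<and> x \<odot>\<^sub>M u = \<zero>\<^sub>M"
    if ru: "r \<in> carrier R" "u \<in> U" for r u
    using zero[of "x \<otimes> r" "x \<odot>\<^sub>M u"] ru s(4)[OF x_in ru(2)] m Uc
    by (simp add: M.smult_r_distr M.smult_assoc1)
  have "card (carrier R \<times> U) = card (xim M) * card {a \<in> carrier R \<times> U. ?xt a = \<zero>\<^sub>M}"
    using card_hom_image[OF D M(1) xt] finite_R finU imx by simp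
  also have "{a \<in> carrier R \<times> U. ?xt a = \<zero>\<^sub>M} =
      {r \<in> carrier R. x \<odot>\<^sub>M (r \<odot>\<^sub>M m) = \<zero>\<^sub>M} \<times> {u \<in> U. x \<odot>\<^sub>M u = \<zero>\<^sub>M}" using zx by auto
  finally have 1: "card (carrier R) * card U = card (xim M) *
      (card {r \<in> carrier R. x \<odot>\<^sub>M (r \<odot>\<^sub>M m) = \<zero>\<^sub>M} * card {u \<in> U. x \<odot>\<^sub>M u = \<zero>\<^sub>M})"
    by (simp add: card_cartesian_product)
  have 2: "card U = card (xim ?U) * card {u \<in> U. x \<odot>\<^sub>M u = \<zero>\<^sub>M}"
    using card_hom_image[OF Um Um x_hom[OF Um]] finU by (simp add: xim_def)
  have 3: "card {u \<in> U. x \<odot>\<^sub>M u = \<zero>\<^sub>M} > 0"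
  proof -
    have "\<zero>\<^sub>M \<in> {u \<in> U. x \<odot>\<^sub>M u = \<zero>\<^sub>M}" using M.submodule_zero_mem[OF U] by simp
    then show ?thesis using finU by (auto simp: card_gt_0_iff)
  qed
  show "card (carrier R) * card (xim ?U) =
      card (xim M) * card {r \<in> carrier R. x \<odot>\<^sub>M (r \<odot>\<^sub>M m) = \<zero>\<^sub>M}"
    using 1 2 3 by (simp add: mult.assoc[symmetric])
qed

lemma xim_card_1_iff:
  assumes "module R M" "finite (carrier M)"
  shows "card (xim M) = 1 \<longleftrightarrow> (\<forall>a\<in>carrier M. x \<odot>\<^sub>M a = \<zero>\<^sub>M)"
proof -
  interpret M: module R M by fact
  have "x \<odot>\<^sub>M \<zero>\<^sub>M = \<zero>\<^sub>M" by simp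
  then have z: "\<zero>\<^sub>M \<in> xim M" unfolding xim_def by (metis M.M.zero_closed imageI)
  show ?thesis
  proof
    assume "card (xim M) = 1"
    then obtain b where "xim M = {b}" by (auto simp: card_1_singleton_iff)
    then show "\<forall>a\<in>carrier M. x \<odot>\<^sub>M a = \<zero>\<^sub>M" using z unfolding xim_def by auto
  next
    assume "\<forall>a\<in>carrier M. x \<odot>\<^sub>M a = \<zero>\<^sub>M"
    then have "xim M = {\<zero>\<^sub>M}" using z unfolding xim_def by auto
    then show "card (xim M) = 1" by simp
  qed
qed

lemma nonzero_element:
  assumes "module R M" "card (carrier M) \<noteq> 1" obtains m where "m \<in> carrier M" "m \<noteq> \<zero>\<^sub>M"
proof -
  interpret M: module R M by fact
  have "carrier M \<noteq> {\<zero>\<^sub>M}" using assms(2) by auto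
  then show ?thesis using that M.M.zero_closed by blast
qed

text \<open>Both modules split off a cyclic summand of the same type, free if |xM| > 1 and simple
  otherwise. The complements again share both invariants, so they are isomorphic by induction, and
  the isomorphism extends by sending m to n.\<close>

lemma isomorphic_by_card:
  assumes "module R M" "finite (carrier M)" "module R N" "finite (carrier N)"
    and "card (carrier M) = card (carrier N)" "card (xim M) = card (xim N)"
  shows "module_isomorphic R M N" using assms
proof (induction "card (carrier M)" arbitrary: M N rule: less_induct)
  case less
  note M = less.prems(1,2) and N = less.prems(3,4)
  interpret M: module R M by fact
  interpret N: module R N by fact
  show ?case
  proof (cases "card (carrier M) = 1")
    case True
    then obtain a b where "carrier M = {a}" "carrier N = {b}"
      using less.prems(5) by (metis card_1_singletonE)
    then have "carrier M = {\<zero>\<^sub>M}" "carrier N = {\<zero>\<^sub>N}"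
      using M.M.zero_closed N.M.zero_closed by auto
    then show ?thesis unfolding module_isomorphic_def
      by (intro bexI[of _ "\<lambda>_. \<zero>\<^sub>N"] module_homI) (auto simp: bij_betw_def)
  next
    case False
    \<comment> \<open>|xM| = |xN| makes x vanish on M exactly if it vanishes on N, so generators of
      the same type, and hence with the same annihilators, exist in both.\<close>
    obtain m n where mn: "m \<in> carrier M" "n \<in> carrier N"
      "x \<odot>\<^sub>M m \<noteq> \<zero>\<^sub>M \<or> (\<forall>a\<in>carrier M. x \<odot>\<^sub>M a = \<zero>\<^sub>M)"
      "x \<odot>\<^sub>N n \<noteq> \<zero>\<^sub>N \<or> (\<forall>a\<in>carrier N. x \<odot>\<^sub>N a = \<zero>\<^sub>N)" "m \<noteq> \<zero>\<^sub>M"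
      "\<And>r. r \<in> carrier R \<Longrightarrow> r \<odot>\<^sub>M m = \<zero>\<^sub>M \<longleftrightarrow> r \<odot>\<^sub>N n = \<zero>\<^sub>N"
      "\<And>r. r \<in> carrier R \<Longrightarrow> x \<odot>\<^sub>M (r \<odot>\<^sub>M m) = \<zero>\<^sub>M \<longleftrightarrow> x \<odot>\<^sub>N (r \<odot>\<^sub>N n) = \<zero>\<^sub>N"
    proof (cases "card (xim M) = 1")
      case True
      then have all: "\<forall>a\<in>carrier M. x \<odot>\<^sub>M a = \<zero>\<^sub>M" "\<forall>a\<in>carrier N. x \<odot>\<^sub>N a = \<zero>\<^sub>N"
        using xim_card_1_iff[OF M] xim_card_1_iff[OF N] less.prems(6) by auto
      obtain m where "m \<in> carrier M" "m \<noteq> \<zero>\<^sub>M" by (rule nonzero_element[OF M(1) False])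
      moreover obtain n where "n \<in> carrier N" "n \<noteq> \<zero>\<^sub>N"
        using nonzero_element[OF N(1)] False less.prems(5) by auto
      ultimately show ?thesis
        using that[of m n] all ann_simple(1)[OF M(1), of m] ann_simple(1)[OF N(1), of n] by simp
    next
      case f: False
      then obtain m n where "m \<in> carrier M" "x \<odot>\<^sub>M m \<noteq> \<zero>\<^sub>M" "n \<in> carrier N" "x \<odot>\<^sub>N n \<noteq> \<zero>\<^sub>N"
        using xim_card_1_iff[OF M] xim_card_1_iff[OF N] less.prems(6) by auto
      moreover from this have "m \<noteq> \<zero>\<^sub>M" using M.smult_r_null[OF x_in] by metis
      ultimately show ?thesis
        using that[of m n] ann_regular[OF M(1), of m] ann_regular[OF N(1), of n] by simp
    qed
    obtain U where U: "Module.submodule U R M" "\<forall>r\<in>carrier R. r \<odot>\<^sub>M m \<in> U \<longrightarrow> r \<odot>\<^sub>M m = \<zero>\<^sub>M"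
      "\<forall>a\<in>carrier M. \<exists>r\<in>carrier R. \<exists>u\<in>U. a = r \<odot>\<^sub>M m \<oplus>\<^sub>M u"
      using complement_exists[OF M mn(1,3)] by blast
    obtain V where V: "Module.submodule V R N" "\<forall>r\<in>carrier R. r \<odot>\<^sub>N n \<in> V \<longrightarrow> r \<odot>\<^sub>N n = \<zero>\<^sub>N"
      "\<forall>a\<in>carrier N. \<exists>r\<in>carrier R. \<exists>u\<in>V. a = r \<odot>\<^sub>N n \<oplus>\<^sub>N u"
      using complement_exists[OF N mn(2,4)] by blast
    note cU = card_split[OF M mn(1) U] and cV = card_split[OF N mn(2) V]
    let ?U = "M\<lparr>carrier := U\<rparr>" and ?V = "N\<lparr>carrier := V\<rparr>"
    have Us: "U \<subseteq> carrier M" "V \<subseteq> carrier N" using M.submoduleE(1)[OF U(1)] N.submoduleE(1)[OF V(1)] .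
    have fU: "finite U" "finite V" using Us M(2) N(2) finite_subset by auto
    have Rpos: "card (carrier R) > 0" using finite_R by (auto simp: card_gt_0_iff)
    have ann: "{r \<in> carrier R. r \<odot>\<^sub>N n = \<zero>\<^sub>N} = {r \<in> carrier R. r \<odot>\<^sub>M m = \<zero>\<^sub>M}"
      "{r \<in> carrier R. x \<odot>\<^sub>N (r \<odot>\<^sub>N n) = \<zero>\<^sub>N} = {r \<in> carrier R. x \<odot>\<^sub>M (r \<odot>\<^sub>M m) = \<zero>\<^sub>M}"
      using mn(6,7) by auto
    have "card (carrier R) * card U = card (carrier R) * card V"
      using cU(1) cV(1) less.prems(5) unfolding ann by simp
    then have c1: "card U = card V" using Rpos by simp
    have "card (carrier R) * card (xim ?U) = card (carrier R) * card (xim ?V)"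
      using cU(2) cV(2) less.prems(6) unfolding ann by simp
    then have c2: "card (xim ?U) = card (xim ?V)" using Rpos by simp
    \<comment> \<open>A proper annihilator means that Rm is nonzero, so the complement is strictly
      smaller and the induction hypothesis applies.\<close>
    have "\<one> \<notin> {r \<in> carrier R. r \<odot>\<^sub>M m = \<zero>\<^sub>M}" using mn(1,5) by simp
    then have "{r \<in> carrier R. r \<odot>\<^sub>M m = \<zero>\<^sub>M} \<subset> carrier R" using one_closed by blast
    then have "card {r \<in> carrier R. r \<odot>\<^sub>M m = \<zero>\<^sub>M} < card (carrier R)"
      using finite_R psubset_card_mono by blast
    moreover have "card (carrier M) > 0" using M(2) M.M.zero_closed by (auto simp: card_gt_0_iff)
    ultimately have "card (carrier M) * card {r \<in> carrier R. r \<odot>\<^sub>M m = \<zero>\<^sub>M} <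
      card (carrier M) * card (carrier R)" by simp
    then have "card (carrier R) * card U < card (carrier R) * card (carrier M)"
      unfolding cU(1) mult.commute[of "card (carrier R)" "card (carrier M)"] .
    then have "card U < card (carrier M)" unfolding mult_less_cancel1 ..
    then have "module_isomorphic R ?U ?V"
      using less.hyps[of ?U ?V] submodule_module[OF M(1) U(1)] submodule_module[OF N(1) V(1)] fU c1 c2
      by simp
    then obtain \<theta> where \<theta>: "\<theta> \<in> module_hom R ?U ?V" "bij_betw \<theta> U V"
      unfolding module_isomorphic_def by auto
    have \<theta>m: "\<theta> u \<in> V" "\<theta> u \<in> carrier N" if "u \<in> U" for u
      using module_hom_mem[OF \<theta>(1)] that Us by auto
    have \<theta>N: "\<theta> \<in> module_hom R ?U N" by (rule module_homI)
        (use \<theta>m module_hom_add[OF \<theta>(1)] module_hom_smult[OF \<theta>(1)] in auto)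
    have inc: "(\<lambda>u. u) \<in> module_hom R ?U M" by (rule module_homI) (use Us in auto)
    note Um = submodule_module[OF M(1) U(1)]
    note t = split_map_hom[OF Um M(1) mn(1) inc] and h = split_map_hom[OF Um N(1) mn(2) \<theta>N]
    note D = direct_sum_is_module[OF module_regular_module Um]
    have im: "(\<lambda>(r, u). r \<odot>\<^sub>M m \<oplus>\<^sub>M u) ` carrier (direct_sum (regular_module R) ?U) = carrier M"
    proof (intro equalityI subsetI)
      fix a assume "a \<in> carrier M"
      then obtain r u where "r \<in> carrier R" "u \<in> U" "a = r \<odot>\<^sub>M m \<oplus>\<^sub>M u" using U(3) by blast
      then show "a \<in> (\<lambda>(r, u). r \<odot>\<^sub>M m \<oplus>\<^sub>M u) ` carrier (direct_sum (regular_module R) ?U)"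
        by (intro image_eqI[of _ _ "(r, u)"]) auto
    qed (use mn(1) Us in auto)
    have \<theta>0: "\<theta> u = \<zero>\<^sub>N \<longleftrightarrow> u = \<zero>\<^sub>M" if "u \<in> U" for u
    proof -
      have "\<theta> \<zero>\<^sub>M = \<zero>\<^sub>N" using module_hom_zero[OF Um N(1) \<theta>N] by simp
      then show ?thesis using \<theta>(2) that M.submodule_zero_mem[OF U(1)] unfolding bij_betw_def
        by (metis inj_onD)
    qed
    have zz: "r \<odot>\<^sub>M m \<oplus>\<^sub>M u = \<zero>\<^sub>M \<longleftrightarrow> r \<odot>\<^sub>N n \<oplus>\<^sub>N \<theta> u = \<zero>\<^sub>N" if "r \<in> carrier R" "u \<in> U" for r u
      using cU(3)[OF that] cV(3)[OF that(1) \<theta>m(1)[OF that(2)]] mn(6)[OF that(1)] \<theta>0[OF that(2)] by simp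
    obtain g where g: "g \<in> module_hom R M N" "\<And>a. a \<in> carrier (direct_sum (regular_module R) ?U) \<Longrightarrow>
        g ((\<lambda>(r, u). r \<odot>\<^sub>M m \<oplus>\<^sub>M u) a) = (\<lambda>(r, u). r \<odot>\<^sub>N n \<oplus>\<^sub>N \<theta> u) a"
    proof (rule module_hom_factor_surj[OF D M(1) N(1) t im h])
      show "(\<lambda>(r, u). r \<odot>\<^sub>N n \<oplus>\<^sub>N \<theta> u) l = \<zero>\<^sub>N"
        if "l \<in> carrier (direct_sum (regular_module R) ?U)"
          "(\<lambda>(r, u). r \<odot>\<^sub>M m \<oplus>\<^sub>M u) l = \<zero>\<^sub>M" for l using that zz by auto
    qed blast
    have gru: "g (r \<odot>\<^sub>M m \<oplus>\<^sub>M u) = r \<odot>\<^sub>N n \<oplus>\<^sub>N \<theta> u" if "r \<in> carrier R" "u \<in> U" for r u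
      using g(2)[of "(r, u)"] that by simp
    have "inj_on g (carrier M)"
    proof (rule module_hom_injI[OF M(1) N(1) g(1)])
      fix a assume a: "a \<in> carrier M" "g a = \<zero>\<^sub>N"
      then obtain r u where ru: "r \<in> carrier R" "u \<in> U" "a = r \<odot>\<^sub>M m \<oplus>\<^sub>M u" using U(3) by blast
      then show "a = \<zero>\<^sub>M" using zz[OF ru(1,2)] gru[OF ru(1,2)] a by simp
    qed
    moreover have "g ` carrier M = carrier N"
    proof (intro equalityI subsetI)
      fix b assume "b \<in> carrier N"
      then obtain r v where rv: "r \<in> carrier R" "v \<in> V" "b = r \<odot>\<^sub>N n \<oplus>\<^sub>N v" using V(3) by blast
      then obtain u where u: "u \<in> U" "v = \<theta> u" using \<theta>(2) by (auto simp: bij_betw_def)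
      then have "b = g (r \<odot>\<^sub>M m \<oplus>\<^sub>M u)" using gru rv by simp
      then show "b \<in> g ` carrier M" using rv u mn(1) Us by auto
    next
      fix b assume "b \<in> g ` carrier M"
      then show "b \<in> carrier N" using module_hom_mem[OF g(1)] by auto
    qed
    ultimately show ?thesis unfolding module_isomorphic_def bij_betw_def using g(1) by blast
  qed
qed

end

section \<open>The Hall algebra is a ring\<close>

text \<open>Double counting of pairs of y over D and \<open>\<tau>\<close> with
  \<open>s \<tau> = r y\<close>, weighted by 1 / a D. A fixed y has n D partners, while the partners
  of a fixed \<open>\<tau>\<close> all lie over one D and have total weight 1.\<close>

lemma sum_weighted_fibres:
  fixes n a :: "'d \<Rightarrow> nat"
  assumes V: "finite V" and T: "finite T" and E: "\<And>D. D \<in> V \<Longrightarrow> finite (E D)"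
    and n: "\<And>D y. D \<in> V \<Longrightarrow> y \<in> E D \<Longrightarrow> n D = card {\<tau> \<in> T. s \<tau> = r y}"
    and one: "\<And>\<tau>. \<tau> \<in> T \<Longrightarrow> \<exists>D\<in>V. card {y \<in> E D. s \<tau> = r y} = a D \<and> a D > 0 \<and>
      (\<forall>D'\<in>V. D' \<noteq> D \<longrightarrow> {y \<in> E D'. s \<tau> = r y} = {})"
  shows "(\<Sum>D\<in>V. real (n D) * real (card (E D)) / real (a D)) = real (card T)"
proof -
  let ?c = "\<lambda>D \<tau>. card {y \<in> E D. s \<tau> = r y}"
  have 1: "n D * card (E D) = (\<Sum>\<tau>\<in>T. ?c D \<tau>)" if D: "D \<in> V" for D
  proof -
    have "n D * card (E D) = (\<Sum>y\<in>E D. n D)" by simp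
    also have "\<dots> = (\<Sum>y\<in>E D. \<Sum>\<tau>\<in>T. if s \<tau> = r y then 1 else 0)"
      using T n[OF D] by (intro sum.cong refl) (simp add: sum.If_cases Int_def)
    also have "\<dots> = (\<Sum>\<tau>\<in>T. \<Sum>y\<in>E D. if s \<tau> = r y then 1 else 0)" by (rule sum.swap)
    finally show ?thesis using E[OF D] by (simp add: sum.If_cases Int_def)
  qed
  have 2: "(\<Sum>D\<in>V. real (?c D \<tau>) / real (a D)) = 1" if \<tau>: "\<tau> \<in> T" for \<tau>
  proof -
    obtain D where D: "D \<in> V" "?c D \<tau> = a D" "a D > 0"
      "\<And>D'. D' \<in> V \<Longrightarrow> D' \<noteq> D \<Longrightarrow> {y \<in> E D'. s \<tau> = r y} = {}" using one[OF \<tau>] by blast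
    have "(\<Sum>D'\<in>V. real (?c D' \<tau>) / real (a D')) = (\<Sum>D'\<in>V. if D' = D then 1 else 0)"
    proof (intro sum.cong refl)
      fix D' assume D': "D' \<in> V"
      show "real (?c D' \<tau>) / real (a D') = (if D' = D then 1 else 0)"
      proof (cases "D' = D")
        case False
        then show ?thesis unfolding D(4)[OF D' False] by simp
      qed (use D(2,3) in simp)
    qed
    then show ?thesis using D(1) V by simp
  qed
  have "(\<Sum>D\<in>V. real (n D) * real (card (E D)) / real (a D)) = (\<Sum>D\<in>V. \<Sum>\<tau>\<in>T. real (?c D \<tau>) / real (a D))"
    by (intro sum.cong refl) (simp only: 1 of_nat_sum sum_divide_distrib of_nat_mult[symmetric])
  also have "\<dots> = (\<Sum>\<tau>\<in>T. \<Sum>D\<in>V. real (?c D \<tau>) / real (a D))" by (rule sum.swap)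
  finally show ?thesis using 2 by simp
qed

lemma card_pairs_fst: "card {y \<in> E. p = fst y} = card {t. (p, t) \<in> E}"
proof -
  have "{y \<in> E. p = fst y} = Pair p ` {t. (p, t) \<in> E}" by force
  then show ?thesis by (simp add: card_image inj_on_def)
qed

lemma card_pairs_snd: "card {y \<in> E. h = snd y} = card {j. (j, h) \<in> E}"
proof -
  have "{y \<in> E. h = snd y} = (\<lambda>j. (j, h)) ` {j. (j, h) \<in> E}" by force
  then show ?thesis by (simp add: card_image inj_on_def)
qed

text \<open>Over a finite field, finite-dimensional means finite. The assumption lets the Hall
  algebra be treated by counting; dimension returns only with the grading.\<close>

locale ialg_dual = dual_ring "ialg k" x for k :: "('a, 'c) ring_scheme" and x +
  assumes fd_iff: "\<And>M :: 'a imod. M \<in> fd_modules k \<longleftrightarrow> module (ialg k) M \<and> finite (carrier M)"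
begin

abbreviation "\<Lambda> \<equiv> ialg k"

lemma fdD: "M \<in> fd_modules k \<Longrightarrow> module \<Lambda> M" "M \<in> fd_modules k \<Longrightarrow> finite (carrier M)"
  by (simp_all add: fd_iff)

lemma fdI: "module \<Lambda> (M :: 'a imod) \<Longrightarrow> finite (carrier M) \<Longrightarrow> M \<in> fd_modules k" by (simp add: fd_iff)

lemma short_exact_extensionD:
  assumes "(f, L, g) \<in> extensions k M N"
  shows "L \<in> fd_modules k" "f \<in> module_hom \<Lambda> N L" "g \<in> module_hom \<Lambda> L M"
    "inj_on f (carrier N)" "g ` carrier L = carrier M" "f ` carrier N = {l \<in> carrier L. g l = \<zero>\<^sub>M}"
  using assms by (auto simp: extensions_def short_exact_def)

lemma ext_equivI:
  assumes "(f, L, g) \<in> extensions k M N" "(f', L', g') \<in> extensions k M N"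
    "\<phi> \<in> module_hom \<Lambda> L L'" "bij_betw \<phi> (carrier L) (carrier L')"
    "\<And>a. a \<in> carrier N \<Longrightarrow> \<phi> (f a) = f' a" "\<And>l. l \<in> carrier L \<Longrightarrow> g' (\<phi> l) = g l"
  shows "((f, L, g), (f', L', g')) \<in> ext_equiv k M N" unfolding ext_equiv_def using assms by blast

lemma ext_equivE:
  assumes "((f, L, g), (f', L', g')) \<in> ext_equiv k M N"
  obtains \<phi> where "(f, L, g) \<in> extensions k M N" "(f', L', g') \<in> extensions k M N"
    "\<phi> \<in> module_hom \<Lambda> L L'" "bij_betw \<phi> (carrier L) (carrier L')"
    "\<And>a. a \<in> carrier N \<Longrightarrow> \<phi> (f a) = f' a" "\<And>l. l \<in> carrier L \<Longrightarrow> g' (\<phi> l) = g l"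
  using assms unfolding ext_equiv_def by blast

lemma equiv_ext_equiv: "equiv (extensions k M N) (ext_equiv k M N)"
proof (rule equivI)
  show "ext_equiv k M N \<subseteq> extensions k M N \<times> extensions k M N" by (auto simp: ext_equiv_def)
  show "refl_on (extensions k M N) (ext_equiv k M N)" unfolding refl_on_def
  proof
    fix E assume E: "E \<in> extensions k M N"
    obtain f L g where e: "E = (f, L, g)" by (cases E)
    show "(E, E) \<in> ext_equiv k M N" unfolding e
      by (rule ext_equivI[where \<phi> = "\<lambda>a. a"]) (use E e in \<open>simp_all add: module_hom_id bij_betw_def\<close>)
  qed
  show "sym (ext_equiv k M N)"
  proof (rule symI)
    fix E E' assume EE: "(E, E') \<in> ext_equiv k M N"
    obtain f L g f' L' g' where e: "E = (f, L, g)" "E' = (f', L', g')" by (cases E, cases E')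
    from EE obtain \<phi> where \<phi>: "(f, L, g) \<in> extensions k M N" "(f', L', g') \<in> extensions k M N"
      "\<phi> \<in> module_hom \<Lambda> L L'" "bij_betw \<phi> (carrier L) (carrier L')"
      "\<And>a. a \<in> carrier N \<Longrightarrow> \<phi> (f a) = f' a" "\<And>l. l \<in> carrier L \<Longrightarrow> g' (\<phi> l) = g l"
      unfolding e by (rule ext_equivE) simp
    note s = short_exact_extensionD[OF \<phi>(1)]
    note Lm = fdD(1)[OF s(1)]
    let ?i = "inv_into (carrier L) \<phi>"
    have i: "?i (\<phi> l) = l" if "l \<in> carrier L" for l using \<phi>(4) that by (simp add: bij_betw_def)
    show "(E', E) \<in> ext_equiv k M N" unfolding e
    proof (rule ext_equivI[OF \<phi>(2,1) module_hom_inv_into[OF Lm \<phi>(3,4)] bij_betw_inv_into[OF \<phi>(4)]])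
      show "?i (f' a) = f a" if "a \<in> carrier N" for a
        using i[OF module_hom_mem[OF s(2) that]] \<phi>(5)[OF that] by simp
      show "g (?i l) = g' l" if l: "l \<in> carrier L'" for l
      proof -
        obtain l' where "l' \<in> carrier L" "l = \<phi> l'" using l \<phi>(4) by (auto simp: bij_betw_def)
        then show ?thesis using i \<phi>(6) by simp
      qed
    qed
  qed
  show "trans (ext_equiv k M N)"
  proof (rule transI)
    fix E E' E'' assume EE: "(E, E') \<in> ext_equiv k M N" "(E', E'') \<in> ext_equiv k M N"
    obtain f L g f' L' g' f'' L'' g'' where e: "E = (f, L, g)" "E' = (f', L', g')" "E'' = (f'', L'', g'')"
      by (cases E, cases E', cases E'')
    from EE(1) obtain \<phi> where \<phi>: "(f, L, g) \<in> extensions k M N" "(f', L', g') \<in> extensions k M N"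
      "\<phi> \<in> module_hom \<Lambda> L L'" "bij_betw \<phi> (carrier L) (carrier L')"
      "\<And>a. a \<in> carrier N \<Longrightarrow> \<phi> (f a) = f' a" "\<And>l. l \<in> carrier L \<Longrightarrow> g' (\<phi> l) = g l"
      unfolding e by (rule ext_equivE) simp
    from EE(2) obtain \<psi> where \<psi>: "(f', L', g') \<in> extensions k M N" "(f'', L'', g'') \<in> extensions k M N"
      "\<psi> \<in> module_hom \<Lambda> L' L''" "bij_betw \<psi> (carrier L') (carrier L'')"
      "\<And>a. a \<in> carrier N \<Longrightarrow> \<psi> (f' a) = f'' a" "\<And>l. l \<in> carrier L' \<Longrightarrow> g'' (\<psi> l) = g' l"
      unfolding e by (rule ext_equivE) simp
    show "(E, E'') \<in> ext_equiv k M N" unfolding e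
    proof (rule ext_equivI[OF \<phi>(1) \<psi>(2) module_hom_comp[OF \<phi>(3) \<psi>(3)]])
      show "bij_betw (\<lambda>a. \<psi> (\<phi> a)) (carrier L) (carrier L'')"
        using bij_betw_trans[OF \<phi>(4) \<psi>(4)] by (simp add: comp_def)
    qed (use \<phi> \<psi> module_hom_mem[OF \<phi>(3)] in simp_all)
  qed
qed

lemma exact_pairs_extension:
  "L \<in> fd_modules k \<Longrightarrow> (f, g) \<in> exact_pairs \<Lambda> N L M \<Longrightarrow> (f, L, g) \<in> extensions k M N"
  by (auto simp: exact_pairs_def extensions_def)

text \<open>Every class in \<open>Ext1_mid\<close> thereby has representatives with the prescribed
  middle term and extensional maps, so that the classes become a quotient of the finite set of exact
  pairs.\<close>

lemma extension_transport:
  assumes "(f, L, g) \<in> extensions k M N" "module_isomorphic \<Lambda> L L'"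
    and fd: "M \<in> fd_modules k" "N \<in> fd_modules k" "L' \<in> fd_modules k"
  obtains f' g' where "(f', g') \<in> exact_pairs \<Lambda> N L' M" "((f, L, g), (f', L', g')) \<in> ext_equiv k M N"
proof -
  note s = short_exact_extensionD[OF assms(1)]
  note Lm = fdD(1)[OF s(1)]
  obtain \<psi> where \<psi>: "\<psi> \<in> module_hom \<Lambda> L L'" "bij_betw \<psi> (carrier L) (carrier L')"
    using assms(2) by (auto simp: module_isomorphic_def)
  let ?i = "inv_into (carrier L) \<psi>"
  note ih = module_hom_inv_into[OF Lm \<psi>]
  have i: "?i (\<psi> l) = l" "\<psi> l \<in> carrier L'" if "l \<in> carrier L" for l
    using \<psi>(2) that module_hom_mem[OF \<psi>(1)] by (simp_all add: bij_betw_def)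
  have j: "\<psi> (?i l) = l" "?i l \<in> carrier L" if "l \<in> carrier L'" for l
    using \<psi>(2) that module_hom_mem[OF ih] by (simp_all add: bij_betw_def f_inv_into_f)
  have fm: "f a \<in> carrier L" "g (f a) = \<zero>\<^sub>M" if "a \<in> carrier N" for a using s(6) that by auto
  let ?f = "restrict (\<lambda>a. \<psi> (f a)) (carrier N)" and ?g = "restrict (\<lambda>l. g (?i l)) (carrier L')"
  have E: "(?f, ?g) \<in> exact_pairs \<Lambda> N L' M"
  proof (rule exact_pairsI)
    show "?f \<in> Hom \<Lambda> N L'" "?g \<in> Hom \<Lambda> L' M"
      by (rule Hom_restrict[OF fdD(1)[OF fd(2)] module_hom_comp[OF s(2) \<psi>(1)]],
          rule Hom_restrict[OF fdD(1)[OF fd(3)] module_hom_comp[OF ih s(3)]])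
    show "inj_on ?f (carrier N)"
    proof (rule inj_onI)
      fix a b assume ab: "a \<in> carrier N" "b \<in> carrier N" "?f a = ?f b"
      then have "?i (\<psi> (f a)) = ?i (\<psi> (f b))" by simp
      then have "f a = f b" using i fm ab by simp
      then show "a = b" using inj_onD[OF s(4)] ab by simp
    qed
    show "?g ` carrier L' = carrier M"
    proof -
      have "?g ` carrier L' = g ` ?i ` carrier L'" by (simp add: image_image)
      also have "?i ` carrier L' = carrier L" using bij_betw_inv_into[OF \<psi>(2)] by (simp add: bij_betw_def)
      finally show ?thesis using s(5) by simp
    qed
    show "?g (?f a) = \<zero>\<^sub>M" if "a \<in> carrier N" for a using that fm i by simp
    show "l \<in> ?f ` carrier N" if l: "l \<in> carrier L'" "?g l = \<zero>\<^sub>M" for l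
    proof -
      have "?i l \<in> f ` carrier N" using s(6) j l by simp
      then obtain a where a: "a \<in> carrier N" "?i l = f a" by auto
      then have "l = ?f a" using j(1)[OF l(1)] by simp
      then show ?thesis using a by blast
    qed
  qed
  moreover have "((f, L, g), (?f, L', ?g)) \<in> ext_equiv k M N"
    by (rule ext_equivI[OF assms(1) exact_pairs_extension[OF fd(3) E] \<psi>]) (use i in simp_all)
  ultimately show ?thesis using that by blast
qed

text \<open>Riedtmann's formula.\<close>

lemma card_Ext1_mid:
  assumes fd: "M \<in> fd_modules k" "N \<in> fd_modules k" "L \<in> fd_modules k"
  shows "card (Ext1_mid k M N L) * card (module_aut \<Lambda> L) =
    card (exact_pairs \<Lambda> N L M) * card (Hom \<Lambda> M N)" "finite (Ext1_mid k M N L)"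
proof -
  let ?E = "exact_pairs \<Lambda> N L M"
  define cl where "cl p = ext_equiv k M N `` {(fst p, L, snd p)}" for p :: "(nat \<Rightarrow> nat) \<times> (nat \<Rightarrow> nat)"
  note eq = equiv_ext_equiv[of M N]
  have finE: "finite ?E" using finite_exact_pairs fd fdD(2) by blast
  have ext: "(fst p, L, snd p) \<in> extensions k M N" if "p \<in> ?E" for p
    using that exact_pairs_extension[OF fd(3), of "fst p" "snd p"] by simp
  have im: "cl ` ?E = Ext1_mid k M N L"
  proof (intro equalityI subsetI)
    fix \<epsilon> assume "\<epsilon> \<in> cl ` ?E"
    then obtain p where p: "p \<in> ?E" "\<epsilon> = cl p" by auto
    have "\<epsilon> \<in> Ext1 k M N" unfolding p Ext1_def cl_def by (rule quotientI[OF ext[OF p(1)]])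
    moreover have "(fst p, L, snd p) \<in> \<epsilon>"
      unfolding p cl_def using equiv_class_self[OF eq ext[OF p(1)]] .
    ultimately show "\<epsilon> \<in> Ext1_mid k M N L"
      unfolding Ext1_mid_def using module_isomorphic_refl[of \<Lambda> L] by blast
  next
    fix \<epsilon> assume "\<epsilon> \<in> Ext1_mid k M N L"
    then obtain f L' g where \<epsilon>: "\<epsilon> \<in> Ext1 k M N" "(f, L', g) \<in> \<epsilon>" "module_isomorphic \<Lambda> L' L"
      unfolding Ext1_mid_def by blast
    from \<epsilon>(1) obtain y where y: "y \<in> extensions k M N" "\<epsilon> = ext_equiv k M N `` {y}"
      unfolding Ext1_def by (rule quotientE) simp
    then have "(y, (f, L', g)) \<in> ext_equiv k M N" using \<epsilon>(2) by simp
    then have e1: "\<epsilon> = ext_equiv k M N `` {(f, L', g)}" "(f, L', g) \<in> extensions k M N"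
      using equiv_class_eq_iff[OF eq] y by auto
    obtain f' g' where fg: "(f', g') \<in> ?E" "((f, L', g), (f', L, g')) \<in> ext_equiv k M N"
      using extension_transport[OF e1(2) \<epsilon>(3) fd] .
    then have "\<epsilon> = cl (f', g')" unfolding cl_def e1(1) using equiv_class_eq[OF eq] by simp
    then show "\<epsilon> \<in> cl ` ?E" using fg by blast
  qed
  then show "finite (Ext1_mid k M N L)" using finE by (metis finite_imageI)
  \<comment> \<open>The fibres of \<open>cl\<close> are the orbits of Aut L counted in
    \<open>card_orbit_exact_pairs\<close>, so they all have the same size.\<close>
  have fib: "card {p \<in> ?E. cl p = \<epsilon>} * card (Hom \<Lambda> M N) = card (module_aut \<Lambda> L)"
    if \<epsilon>: "\<epsilon> \<in> cl ` ?E" for \<epsilon>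
  proof -
    obtain f g where fg: "(f, g) \<in> ?E" "\<epsilon> = cl (f, g)" using \<epsilon> by auto
    note d = exact_pairsD[OF fg(1)]
    have "{p \<in> ?E. cl p = \<epsilon>} = {(f', g') \<in> ?E. \<exists>\<phi>\<in>module_aut \<Lambda> L.
      (\<forall>a\<in>carrier N. \<phi> (f a) = f' a) \<and> (\<forall>l\<in>carrier L. g' (\<phi> l) = g l)}" (is "_ = ?O")
    proof (intro equalityI subsetI)
      fix p assume "p \<in> {p \<in> ?E. cl p = \<epsilon>}"
      then have p: "p \<in> ?E" "cl (f, g) = cl p" using fg by auto
      then have "((f, L, g), (fst p, L, snd p)) \<in> ext_equiv k M N"
        unfolding cl_def using eq_equiv_class_iff[OF eq ext[OF fg(1)] ext[OF p(1)]] by simp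
      then obtain \<phi> where \<phi>: "\<phi> \<in> module_hom \<Lambda> L L" "bij_betw \<phi> (carrier L) (carrier L)"
        "\<And>a. a \<in> carrier N \<Longrightarrow> \<phi> (f a) = fst p a" "\<And>l. l \<in> carrier L \<Longrightarrow> snd p (\<phi> l) = g l"
        by (rule ext_equivE) simp
      have "bij_betw (restrict \<phi> (carrier L)) (carrier L) (carrier L)"
        using \<phi>(2) by (rule bij_betw_cong[THEN iffD1, rotated]) simp
      then have "restrict \<phi> (carrier L) \<in> module_aut \<Lambda> L"
        using Hom_restrict[OF fdD(1)[OF fd(3)] \<phi>(1)] by (simp add: module_aut_def)
      moreover have "\<forall>a\<in>carrier N. restrict \<phi> (carrier L) (f a) = fst p a" using \<phi>(3) d(7) by simp
      moreover have "\<forall>l\<in>carrier L. snd p (restrict \<phi> (carrier L) l) = g l" using \<phi>(4) by simp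
      ultimately have "\<exists>\<phi>\<in>module_aut \<Lambda> L. (\<forall>a\<in>carrier N. \<phi> (f a) = fst p a) \<and>
        (\<forall>l\<in>carrier L. snd p (\<phi> l) = g l)" by (intro bexI[of _ "restrict \<phi> (carrier L)"] conjI)
      then show "p \<in> ?O" using p(1) by (simp add: case_prod_unfold)
    next
      fix p assume "p \<in> ?O"
      then obtain f' g' \<phi> where p: "p = (f', g')" "(f', g') \<in> ?E" "\<phi> \<in> module_aut \<Lambda> L"
        "\<forall>a\<in>carrier N. \<phi> (f a) = f' a" "\<forall>l\<in>carrier L. g' (\<phi> l) = g l" by blast
      then have "((f, L, g), (f', L, g')) \<in> ext_equiv k M N"
        using exact_pairs_extension[OF fd(3)] fg(1)
        by (intro ext_equivI[where \<phi> = \<phi>]) (auto simp: module_aut_def Hom_def)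
      then have "cl (f, g) = cl p" unfolding cl_def p using equiv_class_eq[OF eq] by simp
      then show "p \<in> {p \<in> ?E. cl p = \<epsilon>}" using p fg by simp
    qed
    then show ?thesis
      using card_orbit_exact_pairs[OF fdD(1)[OF fd(2)] fdD(1)[OF fd(3)] fdD(1)[OF fd(1)]
          fdD(2)[OF fd(2)] fdD(2)[OF fd(3)] fdD(2)[OF fd(1)] fg(1)] by simp
  qed
  have "card ?E * card (Hom \<Lambda> M N) = (\<Sum>\<epsilon>\<in>cl ` ?E. card {p \<in> ?E. cl p = \<epsilon>}) * card (Hom \<Lambda> M N)"
    using sum.image_gen[OF finE, of "\<lambda>_. 1::nat" cl] by simp
  also have "\<dots> = (\<Sum>\<epsilon>\<in>cl ` ?E. card (module_aut \<Lambda> L))"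
    unfolding sum_distrib_right using fib by (intro sum.cong refl)
  finally show "card (Ext1_mid k M N L) * card (module_aut \<Lambda> L) = card ?E * card (Hom \<Lambda> M N)"
    using im by simp
qed

text \<open>Equality of isoclasses would say nothing if both were empty; a copy of the finite module
  M on the naturals is a member and excludes this.\<close>

lemma isoclass_eq_iff:
  fixes M :: "('a list set, 'm) module" and N :: "('a list set, 'n) module"
  assumes "module \<Lambda> M" "finite (carrier M)" "module \<Lambda> N"
  shows "isoclass k M = isoclass k N \<longleftrightarrow> module_isomorphic \<Lambda> M N"
proof
  obtain Z :: "'a imod" and t where Z: "module \<Lambda> Z" "finite (carrier Z)" "t \<in> module_hom \<Lambda> M Z"
    "bij_betw t (carrier M) (carrier Z)" using nat_module_exists[OF assms(1,2)] .
  then have MZ: "module_isomorphic \<Lambda> M Z" by (auto simp: module_isomorphic_def)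
  note ZM = module_isomorphic_sym[OF assms(1) MZ]
  assume "isoclass k M = isoclass k N"
  moreover have "Z \<in> isoclass k M" using fdI[OF Z(1,2)] ZM by (simp add: isoclass_def)
  ultimately have "module_isomorphic \<Lambda> Z N" by (simp add: isoclass_def)
  then show "module_isomorphic \<Lambda> M N" by (rule module_isomorphic_trans[OF MZ])
next
  assume MN: "module_isomorphic \<Lambda> M N"
  note NM = module_isomorphic_sym[OF assms(1) MN]
  show "isoclass k M = isoclass k N"
  proof -
    have "module_isomorphic \<Lambda> Z M \<longleftrightarrow> module_isomorphic \<Lambda> Z N" for Z :: "'a imod"
      using module_isomorphic_trans[OF _ MN] module_isomorphic_trans[OF _ NM] by blast
    then show ?thesis by (simp add: isoclass_def)
  qed
qed

lemma isoclass_in_isoclasses: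
  fixes M :: "('a list set, 'm) module"
  assumes "module \<Lambda> M" "finite (carrier M)"
  shows "isoclass k M \<in> isoclasses k"
proof -
  obtain Z :: "'a imod" and t where Z: "module \<Lambda> Z" "finite (carrier Z)" "t \<in> module_hom \<Lambda> M Z"
    "bij_betw t (carrier M) (carrier Z)" using nat_module_exists[OF assms] .
  then have "module_isomorphic \<Lambda> M Z" by (auto simp: module_isomorphic_def)
  then have "isoclass k M = isoclass k Z" using isoclass_eq_iff[OF assms Z(1)] by simp
  then show ?thesis using fdI[OF Z(1,2)] by (simp add: isoclasses_def)
qed

lemma rep_mem: "C \<in> isoclasses k \<Longrightarrow> rep C \<in> C" and rep_fd: "C \<in> isoclasses k \<Longrightarrow> rep C \<in> fd_modules k"
  and isoclass_rep: "C \<in> isoclasses k \<Longrightarrow> isoclass k (rep C) = C"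
proof -
  assume "C \<in> isoclasses k"
  then obtain M where M: "M \<in> fd_modules k" "C = isoclass k M" by (auto simp: isoclasses_def)
  then have "M \<in> C" using module_isomorphic_refl[of \<Lambda> M] by (simp add: isoclass_def)
  then show r: "rep C \<in> C" unfolding rep_def by (rule someI)
  then show r': "rep C \<in> fd_modules k" using M by (simp add: isoclass_def)
  have "module_isomorphic \<Lambda> (rep C) M" using r M by (simp add: isoclass_def)
  then show "isoclass k (rep C) = C"
    using isoclass_eq_iff[OF fdD[OF r'] fdD(1)[OF M(1)]] M(2) by simp
qed

lemma rep_isomorphic_iff:
  "C \<in> isoclasses k \<Longrightarrow> D \<in> isoclasses k \<Longrightarrow> module_isomorphic \<Lambda> (rep C) (rep D) \<longleftrightarrow> C = D"
  using isoclass_eq_iff[OF fdD[OF rep_fd] fdD(1)[OF rep_fd], of C D] isoclass_rep by simp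

text \<open>By Riedtmann's formula the factor |Hom| cancels. The remaining quotient mentions no
  extension classes and is the form in which double counting works.\<close>

lemma hall_const_eq:
  assumes "A \<in> isoclasses k" "B \<in> isoclasses k" "C \<in> isoclasses k"
  shows "hall_const k A B C =
    real (card (exact_pairs \<Lambda> (rep B) (rep C) (rep A))) / real (card (module_aut \<Lambda> (rep C)))"
proof -
  note r = rep_fd[OF assms(1)] rep_fd[OF assms(2)] rep_fd[OF assms(3)]
  have "card (module_aut \<Lambda> (rep C)) > 0" "card (Hom \<Lambda> (rep A) (rep B)) > 0"
    using module_aut_card_pos[OF fdD[OF r(3)]] Hom_card_pos[OF fdD(1)[OF r(1)] fdD(1)[OF r(2)] fdD(2)[OF r(1)] fdD(2)[OF r(2)]] .
  then show ?thesis using card_Ext1_mid(1)[OF r, THEN arg_cong[where f = real]]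
    unfolding hall_const_def by (simp add: frac_eq_eq)
qed

lemma exact_pairs_card:
  assumes "(f, g) \<in> exact_pairs \<Lambda> N L M" "module \<Lambda> L" "module \<Lambda> M" "finite (carrier L)"
  shows "card (carrier L) = card (carrier M) * card (carrier N)"
proof -
  note d = exact_pairsD[OF assms(1)]
  have "card (carrier N) = card {l \<in> carrier L. g l = \<zero>\<^sub>M}"
    unfolding d(8)[symmetric] by (rule card_image[OF d(5), symmetric])
  then show ?thesis using card_hom_image[OF assms(2,3) d(4) assms(4)] d(6) by simp
qed

lemma hall_const_nonzeroD:
  assumes "A \<in> isoclasses k" "B \<in> isoclasses k" "C \<in> isoclasses k" "hall_const k A B C \<noteq> 0"
  shows "card (carrier (rep C)) = card (carrier (rep A)) * card (carrier (rep B))"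
    "exact_pairs \<Lambda> (rep B) (rep C) (rep A) \<noteq> {}"
proof -
  show ne: "exact_pairs \<Lambda> (rep B) (rep C) (rep A) \<noteq> {}"
    using assms(4) unfolding hall_const_eq[OF assms(1-3)] by auto
  then show "card (carrier (rep C)) = card (carrier (rep A)) * card (carrier (rep B))"
    using exact_pairs_card[OF _ fdD(1)[OF rep_fd[OF assms(3)]] fdD(1)[OF rep_fd[OF assms(1)]] fdD(2)[OF rep_fd[OF assms(3)]]]
    by auto
qed

text \<open>With |M| prescribed, only |xM| between 0 and |M| is left to choose.\<close>

lemma finite_isoclasses_card: "finite {C \<in> isoclasses k. card (carrier (rep C)) = n}"
proof (rule inj_on_finite)
  let ?i = "\<lambda>C. card (xim (rep C :: 'a imod))"
  show "inj_on ?i {C \<in> isoclasses k. card (carrier (rep C)) = n}"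
  proof (rule inj_onI)
    fix C D assume CD: "C \<in> {C \<in> isoclasses k. card (carrier (rep C)) = n}"
      "D \<in> {C \<in> isoclasses k. card (carrier (rep C)) = n}" "?i C = ?i D"
    then have "module_isomorphic \<Lambda> (rep C) (rep D)"
      using isomorphic_by_card[OF fdD[OF rep_fd[of C]] fdD[OF rep_fd[of D]]] by simp
    then show "C = D" using rep_isomorphic_iff CD by simp
  qed
  show "?i ` {C \<in> isoclasses k. card (carrier (rep C)) = n} \<subseteq> {..n}"
    using card_image_le[OF fdD(2)[OF rep_fd]] by (auto simp: xim_def)
qed simp

text \<open>Filtrations grouped by the isoclass D of L/P. Each one is seen once for every
  identification of L/P with the representative, hence |Aut D| times.\<close>

lemma sum_over_quotients:
  assumes mods: "module \<Lambda> (P :: 'a imod)" "module \<Lambda> (L :: 'a imod)" "module \<Lambda> (N :: 'a imod)" "module \<Lambda> (M :: 'a imod)"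
    and fin: "finite (carrier P)" "finite (carrier L)" "finite (carrier N)" "finite (carrier M)"
    and V: "finite V" "V \<subseteq> isoclasses k"
      "\<And>D. D \<in> isoclasses k \<Longrightarrow> exact_pairs \<Lambda> N (rep D) M \<noteq> {} \<Longrightarrow> D \<in> V"
  shows "(\<Sum>D\<in>V. real (card (exact_pairs \<Lambda> N (rep D) M)) * real (card (exact_pairs \<Lambda> P L (rep D)))
      / real (card (module_aut \<Lambda> (rep D)))) = real (card (filtrations \<Lambda> P L N M))"
proof -
  let ?T = "filtrations \<Lambda> P L N M"
  have finT: "finite ?T" by (rule finite_filtrations[OF fin(1,2,3,4)])
  have Dm: "module \<Lambda> (rep D)" "finite (carrier (rep D))" if "D \<in> V" for D
    using that V(2) fdD[OF rep_fd] by auto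
  show ?thesis
  proof (rule sum_weighted_fibres[OF V(1) finT, where s = "fst" and r = fst])
    show "finite (exact_pairs \<Lambda> P L (rep D))" if "D \<in> V" for D by (rule finite_exact_pairs) (use fin Dm(2)[OF that] in auto)
    show "card (exact_pairs \<Lambda> N (rep D) M) = card {\<tau> \<in> ?T. fst \<tau> = fst y}" if "D \<in> V" "y \<in> exact_pairs \<Lambda> P L (rep D)" for D y
      using card_filtrations_quotient[OF mods Dm(1)[OF that(1)], of "fst y" "snd y"] that(2) by simp
    fix \<tau> assume \<tau>: "\<tau> \<in> ?T"
    obtain p h \<phi> where \<tau>': "\<tau> = (p, h, \<phi>)" by (cases \<tau>)
    note d = filtrationsD[OF \<tau>[unfolded \<tau>']]
    \<comment> \<open>The quotient of L by the image of \<open>p\<close>, moved to the naturals,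
      determines the one isoclass over which this filtration is counted.\<close>
    obtain Z :: "'a imod" and t where Z: "module \<Lambda> Z" "t \<in> module_hom \<Lambda> L Z"
      "t ` carrier L = carrier Z" "\<And>l. l \<in> carrier L \<Longrightarrow> t l = \<zero>\<^sub>Z \<longleftrightarrow> l \<in> p ` carrier P"
      using quotient_module_exists[OF mods(2) fin(2) image_submodule[OF mods(1,2) d(8)]] by blast
    have Zf: "finite (carrier Z)" using Z(3) fin(2) by (metis finite_imageI)
    define D where "D = isoclass k Z"
    have D: "D \<in> isoclasses k" unfolding D_def by (rule isoclass_in_isoclasses[OF Z(1) Zf])
    note rD = fdD[OF rep_fd[OF D]]
    have "module_isomorphic \<Lambda> Z (rep D)"
      using isoclass_eq_iff[OF Z(1) Zf rD(1)] isoclass_rep[OF D] unfolding D_def by simp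
    then obtain i where i: "i \<in> module_hom \<Lambda> Z (rep D)" "bij_betw i (carrier Z) (carrier (rep D))"
      by (auto simp: module_isomorphic_def)
    have i0: "i y = \<zero>\<^bsub>rep D\<^esub> \<longleftrightarrow> y = \<zero>\<^sub>Z" if "y \<in> carrier Z" for y
    proof -
      interpret Z: module \<Lambda> Z by fact
      have "inj_on i (carrier Z)" using i(2) by (simp add: bij_betw_def)
      from inj_on_eq_iff[OF this that Z.M.zero_closed] show ?thesis
        using module_hom_zero[OF Z(1) rD(1) i(1)] by simp
    qed
    have tm: "t l \<in> carrier Z" if "l \<in> carrier L" for l by (rule module_hom_mem[OF Z(2) that])
    let ?t = "restrict (\<lambda>l. i (t l)) (carrier L)"
    have E: "(p, ?t) \<in> exact_pairs \<Lambda> P L (rep D)"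
    proof (rule exact_pairsI)
      show "p \<in> Hom \<Lambda> P L" "inj_on p (carrier P)" by (fact d(1), fact d(2))
      show "?t \<in> Hom \<Lambda> L (rep D)" by (rule Hom_restrict[OF mods(2) module_hom_comp[OF Z(2) i(1)]])
      have "?t ` carrier L = i ` t ` carrier L" by (simp add: image_image)
      then show "?t ` carrier L = carrier (rep D)" using Z(3) i(2) by (simp add: bij_betw_def)
      show "?t (p a) = \<zero>\<^bsub>rep D\<^esub>" if "a \<in> carrier P" for a
        using that i0 tm Z(4) module_hom_mem[OF d(8) that] by simp
      show "l \<in> p ` carrier P" if "l \<in> carrier L" "?t l = \<zero>\<^bsub>rep D\<^esub>" for l
        using that i0 tm Z(4) by simp
    qed
    have cD: "card {y \<in> exact_pairs \<Lambda> P L (rep D). fst \<tau> = fst y} = card (module_aut \<Lambda> (rep D))"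
      unfolding \<tau>' fst_conv card_pairs_fst by (rule card_exact_pairs_same_sub[OF mods(1,2) rD(1) E])
    \<comment> \<open>The filtration \<open>\<tau>\<close> itself shows that this count is nonzero;
      this places D in V.\<close>
    have "card (exact_pairs \<Lambda> N (rep D) M) = card {\<tau> \<in> ?T. fst \<tau> = p}"
      by (rule card_filtrations_quotient[OF mods rD(1) E])
    moreover have "card {\<tau> \<in> ?T. fst \<tau> = p} \<noteq> 0"
    proof -
      have "\<tau> \<in> {\<tau> \<in> ?T. fst \<tau> = p}" using \<tau> \<tau>' by simp
      then have "{\<tau> \<in> ?T. fst \<tau> = p} \<noteq> {}" by blast
      moreover have "finite {\<tau> \<in> ?T. fst \<tau> = p}" by (rule rev_finite_subset[OF finT]) blast
      ultimately show ?thesis by (simp only: card_0_eq not_False_eq_True)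
    qed
    ultimately have "card (exact_pairs \<Lambda> N (rep D) M) \<noteq> 0" by simp
    then have "exact_pairs \<Lambda> N (rep D) M \<noteq> {}" by auto
    then have DV: "D \<in> V" using V(3) D by simp
    have other: "{y \<in> exact_pairs \<Lambda> P L (rep D'). fst \<tau> = fst y} = {}" if D': "D' \<in> V" "D' \<noteq> D" for D'
    proof (rule ccontr)
      assume "\<not> ?thesis"
      then obtain t' where "(p, t') \<in> exact_pairs \<Lambda> P L (rep D')" using \<tau>' by auto
      from exact_pairs_same_sub_iso[OF mods(2) rD(1) Dm(1)[OF D'(1)] E this]
      have "module_isomorphic \<Lambda> (rep D) (rep D')" unfolding module_isomorphic_def by blast
      then show False using rep_isomorphic_iff[OF D, of D'] D' V(2) by blast
    qed
    show "\<exists>D\<in>V. card {y \<in> exact_pairs \<Lambda> P L (rep D). fst \<tau> = fst y} = card (module_aut \<Lambda> (rep D)) \<and>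
        card (module_aut \<Lambda> (rep D)) > 0 \<and> (\<forall>D'\<in>V. D' \<noteq> D \<longrightarrow> {y \<in> exact_pairs \<Lambda> P L (rep D'). fst \<tau> = fst y} = {})"
      using cD DV other module_aut_card_pos[OF rD] by (intro bexI[of _ D]) auto
  qed
qed

text \<open>The same filtrations grouped by the isoclass D of the kernel of \<open>h\<close>; the
  weight 1/|Aut D| removes the choice of an inclusion of the representative.\<close>

lemma sum_over_subs:
  assumes mods: "module \<Lambda> (P :: 'a imod)" "module \<Lambda> (L :: 'a imod)" "module \<Lambda> (N :: 'a imod)" "module \<Lambda> (M :: 'a imod)"
    and fin: "finite (carrier P)" "finite (carrier L)" "finite (carrier N)" "finite (carrier M)"
    and V: "finite V" "V \<subseteq> isoclasses k"
      "\<And>D. D \<in> isoclasses k \<Longrightarrow> exact_pairs \<Lambda> P (rep D) N \<noteq> {} \<Longrightarrow> D \<in> V"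
  shows "(\<Sum>D\<in>V. real (card (exact_pairs \<Lambda> P (rep D) N)) * real (card (exact_pairs \<Lambda> (rep D) L M))
      / real (card (module_aut \<Lambda> (rep D)))) = real (card (filtrations \<Lambda> P L N M))"
proof -
  let ?T = "filtrations \<Lambda> P L N M"
  have finT: "finite ?T" by (rule finite_filtrations[OF fin(1,2,3,4)])
  have Dm: "module \<Lambda> (rep D)" "finite (carrier (rep D))" if "D \<in> V" for D
    using that V(2) fdD[OF rep_fd] by auto
  show ?thesis
  proof (rule sum_weighted_fibres[OF V(1) finT, where s = "\<lambda>\<tau>. fst (snd \<tau>)" and r = snd])
    show "finite (exact_pairs \<Lambda> (rep D) L M)" if "D \<in> V" for D by (rule finite_exact_pairs) (use fin Dm(2)[OF that] in auto)
    show "card (exact_pairs \<Lambda> P (rep D) N) = card {\<tau> \<in> ?T. (\<lambda>\<tau>. fst (snd \<tau>)) \<tau> = snd y}" if "D \<in> V" "y \<in> exact_pairs \<Lambda> (rep D) L M" for D y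
      using card_filtrations_sub[OF mods Dm(1)[OF that(1)], of "fst y" "snd y"] that(2) by simp
    fix \<tau> assume \<tau>: "\<tau> \<in> ?T"
    obtain p h \<phi> where \<tau>': "\<tau> = (p, h, \<phi>)" by (cases \<tau>)
    note d = filtrationsD[OF \<tau>[unfolded \<tau>']]
    let ?K = "ker_module L M h"
    note K = module_ker_module[OF mods(2,4) d(9)]
    have Kf: "finite (carrier ?K)" using fin(2) by simp
    define D where "D = isoclass k ?K"
    have D: "D \<in> isoclasses k" unfolding D_def by (rule isoclass_in_isoclasses[OF K Kf])
    note rD = fdD[OF rep_fd[OF D]]
    have "module_isomorphic \<Lambda> ?K (rep D)"
      using isoclass_eq_iff[OF K Kf rD(1)] isoclass_rep[OF D] unfolding D_def by simp
    then have "module_isomorphic \<Lambda> (rep D) ?K" by (rule module_isomorphic_sym[OF K])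
    then obtain i where i: "i \<in> module_hom \<Lambda> (rep D) ?K" "bij_betw i (carrier (rep D)) (carrier ?K)"
      by (auto simp: module_isomorphic_def)
    have im: "i y \<in> carrier L" "h (i y) = \<zero>\<^sub>M" if "y \<in> carrier (rep D)" for y
      using module_hom_mem[OF i(1) that] by auto
    have iL: "i \<in> module_hom \<Lambda> (rep D) L"
      by (rule module_homI) (use im module_hom_add[OF i(1)] module_hom_smult[OF i(1)] in auto)
    let ?j = "restrict i (carrier (rep D))"
    have E: "(?j, h) \<in> exact_pairs \<Lambda> (rep D) L M"
    proof (rule exact_pairsI)
      show "h \<in> Hom \<Lambda> L M" "h ` carrier L = carrier M" by (fact d(3), fact d(4))
      show "?j \<in> Hom \<Lambda> (rep D) L" by (rule Hom_restrict[OF rD(1) iL])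
      show "inj_on ?j (carrier (rep D))" using i(2) by (simp add: bij_betw_def inj_on_def)
      show "h (?j a) = \<zero>\<^sub>M" if "a \<in> carrier (rep D)" for a using that im by simp
      have "?j ` carrier (rep D) = carrier ?K" using i(2) by (simp add: bij_betw_def)
      then show "l \<in> ?j ` carrier (rep D)" if "l \<in> carrier L" "h l = \<zero>\<^sub>M" for l using that by simp
    qed
    have cD: "card {y \<in> exact_pairs \<Lambda> (rep D) L M. fst (snd \<tau>) = snd y} = card (module_aut \<Lambda> (rep D))"
      unfolding \<tau>' fst_conv snd_conv card_pairs_snd by (rule card_exact_pairs_same_quotient[OF rD(1) mods(2,4) E])
    have "card (exact_pairs \<Lambda> P (rep D) N) = card {\<tau> \<in> ?T. fst (snd \<tau>) = h}"
      by (rule card_filtrations_sub[OF mods rD(1) E])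
    moreover have "card {\<tau> \<in> ?T. fst (snd \<tau>) = h} \<noteq> 0"
    proof -
      have "\<tau> \<in> {\<tau> \<in> ?T. fst (snd \<tau>) = h}" using \<tau> \<tau>' by simp
      then have "{\<tau> \<in> ?T. fst (snd \<tau>) = h} \<noteq> {}" by blast
      moreover have "finite {\<tau> \<in> ?T. fst (snd \<tau>) = h}" by (rule rev_finite_subset[OF finT]) blast
      ultimately show ?thesis by (simp only: card_0_eq not_False_eq_True)
    qed
    ultimately have "card (exact_pairs \<Lambda> P (rep D) N) \<noteq> 0" by simp
    then have "exact_pairs \<Lambda> P (rep D) N \<noteq> {}" by auto
    then have DV: "D \<in> V" using V(3) D by simp
    have other: "{y \<in> exact_pairs \<Lambda> (rep D') L M. fst (snd \<tau>) = snd y} = {}" if D': "D' \<in> V" "D' \<noteq> D" for D'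
    proof (rule ccontr)
      assume "\<not> ?thesis"
      then obtain j' where "(j', h) \<in> exact_pairs \<Lambda> (rep D') L M" using \<tau>' by auto
      from exact_pairs_same_quotient_iso[OF Dm(1)[OF D'(1)] rD(1) mods(2) E this]
      have "module_isomorphic \<Lambda> (rep D') (rep D)" unfolding module_isomorphic_def by blast
      then show False using rep_isomorphic_iff[of D' D] D D' V(2) by blast
    qed
    show "\<exists>D\<in>V. card {y \<in> exact_pairs \<Lambda> (rep D) L M. fst (snd \<tau>) = snd y} = card (module_aut \<Lambda> (rep D)) \<and>
        card (module_aut \<Lambda> (rep D)) > 0 \<and>
        (\<forall>D'\<in>V. D' \<noteq> D \<longrightarrow> {y \<in> exact_pairs \<Lambda> (rep D') L M. fst (snd \<tau>) = snd y} = {})"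
      using cD DV other module_aut_card_pos[OF rD] by (intro bexI[of _ D]) auto
  qed
qed

lemma hall_const_assoc:
  assumes I: "A \<in> isoclasses k" "B \<in> isoclasses k" "Z \<in> isoclasses k" "C \<in> isoclasses k"
    and V: "finite V" "V \<subseteq> isoclasses k" "{C \<in> isoclasses k. hall_const k A B C \<noteq> 0} \<subseteq> V"
    and Y: "finite Y" "Y \<subseteq> isoclasses k" "{C \<in> isoclasses k. hall_const k B Z C \<noteq> 0} \<subseteq> Y"
  shows "(\<Sum>D\<in>V. hall_const k A B D * hall_const k D Z C) = (\<Sum>D\<in>Y. hall_const k B Z D * hall_const k A D C)"
proof -
  let ?T = "filtrations \<Lambda> (rep Z) (rep C) (rep B) (rep A)"
  note r = rep_fd[OF I(1)] rep_fd[OF I(2)] rep_fd[OF I(3)] rep_fd[OF I(4)]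
  note m = fdD(1)[OF r(3)] fdD(1)[OF r(4)] fdD(1)[OF r(2)] fdD(1)[OF r(1)]
    and f = fdD(2)[OF r(3)] fdD(2)[OF r(4)] fdD(2)[OF r(2)] fdD(2)[OF r(1)]
  have nz: "hall_const k A' B' D \<noteq> 0"
    if "A' \<in> isoclasses k" "B' \<in> isoclasses k" "D \<in> isoclasses k" "exact_pairs \<Lambda> (rep B') (rep D) (rep A') \<noteq> {}" for A' B' D
  proof -
    have "card (exact_pairs \<Lambda> (rep B') (rep D) (rep A')) > 0"
      using that finite_exact_pairs[of "rep B'" "rep D" "rep A'" \<Lambda>] fdD(2)[OF rep_fd]
      by (simp add: card_gt_0_iff)
    then show ?thesis
      using module_aut_card_pos[OF fdD[OF rep_fd[OF that(3)]]] unfolding hall_const_eq[OF that(1-3)] by simp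
  qed
  have "(\<Sum>D\<in>V. hall_const k A B D * hall_const k D Z C) =
    (\<Sum>D\<in>V. real (card (exact_pairs \<Lambda> (rep B) (rep D) (rep A))) * real (card (exact_pairs \<Lambda> (rep Z) (rep C) (rep D)))
      / real (card (module_aut \<Lambda> (rep D))) / real (card (module_aut \<Lambda> (rep C))))"
    using V(2) I by (intro sum.cong refl) (auto simp: hall_const_eq)
  also have "\<dots> = real (card ?T) / real (card (module_aut \<Lambda> (rep C)))"
    unfolding sum_divide_distrib[symmetric]
    by (subst sum_over_quotients[OF m f V(1,2)]) (use V(3) nz[OF I(1,2)] in auto)
  also have "\<dots> = (\<Sum>D\<in>Y. real (card (exact_pairs \<Lambda> (rep Z) (rep D) (rep B))) * real (card (exact_pairs \<Lambda> (rep D) (rep C) (rep A)))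
      / real (card (module_aut \<Lambda> (rep D))) / real (card (module_aut \<Lambda> (rep C))))"
    unfolding sum_divide_distrib[symmetric]
    by (subst sum_over_subs[OF m f Y(1,2)]) (use Y(3) nz[OF I(2,3)] in auto)
  also have "\<dots> = (\<Sum>D\<in>Y. hall_const k B Z D * hall_const k A D C)"
    using Y(2) I by (intro sum.cong refl) (auto simp: hall_const_eq)
  finally show ?thesis .
qed

end

lemma Qv_closed:
  shows Qv_add: "a \<in> Qv k \<Longrightarrow> b \<in> Qv k \<Longrightarrow> a + b \<in> Qv k"
    and Qv_mult: "a \<in> Qv k \<Longrightarrow> b \<in> Qv k \<Longrightarrow> a * b \<in> Qv k" and Qv_uminus: "a \<in> Qv k \<Longrightarrow> - a \<in> Qv k"
    and Qv_Rats: "r \<in> \<rat> \<Longrightarrow> r \<in> Qv k" and Qv_vpar: "vpar k \<in> Qv k"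
    and Qv_inverse: "a \<in> Qv k \<Longrightarrow> inverse a \<in> Qv k"
proof -
  let ?v = "vpar k" and ?q = "real (card (carrier k))"
  have v: "?v * ?v = ?q" by (simp add: vpar_def)
  have I: "r + s * ?v \<in> Qv k" if "r \<in> \<rat>" "s \<in> \<rat>" for r s using that by (auto simp: Qv_def)
  show rat: "r \<in> Qv k" if "r \<in> \<rat>" for r using I[of r 0] that by simp
  show "?v \<in> Qv k" using I[of 0 1] by simp
  {
    assume "a \<in> Qv k" "b \<in> Qv k"
    then obtain r s r' s' where a: "a = r + s * ?v" "b = r' + s' * ?v" and
      q: "r \<in> \<rat>" "s \<in> \<rat>" "r' \<in> \<rat>" "s' \<in> \<rat>" by (auto simp: Qv_def)
    have "a + b = (r + r') + (s + s') * ?v" using a by (simp add: algebra_simps)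
    then show "a + b \<in> Qv k" using I[of "r + r'" "s + s'"] q by simp
    have "a * b = (r * r' + s * s' * (?v * ?v)) + (r * s' + s * r') * ?v" using a by (simp add: algebra_simps)
    then show "a * b \<in> Qv k" using I[of "r * r' + s * s' * ?q" "r * s' + s * r'"] q unfolding v by simp
  }
  {
    assume "a \<in> Qv k"
    then obtain r s where a: "a = r + s * ?v" and q: "r \<in> \<rat>" "s \<in> \<rat>" by (auto simp: Qv_def)
    have "- a = - r + (- s) * ?v" using a by simp
    then show "- a \<in> Qv k" using I[of "- r" "- s"] q by simp
    show "inverse a \<in> Qv k"
    \<comment> \<open>The inverse comes from multiplying by the conjugate r - s v. If the conjugate
      is 0, then a = 2 r is rational already.\<close>
    proof (cases "r = s * ?v")
      case True
      then have "a = 2 * r" using a by simp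
      then show ?thesis using q by (intro rat) auto
    next
      case False
      let ?n = "r * r - s * s * ?q"
      have n: "?n = a * (r - s * ?v)" unfolding a v[symmetric] by (simp add: algebra_simps)
      show ?thesis
      proof (cases "a = 0")
        case False
        have "inverse a = (r - s * ?v) / (a * (r - s * ?v))"
          using False \<open>r \<noteq> s * ?v\<close> by (simp add: divide_inverse)
        also have "\<dots> = r / ?n + (- s / ?n) * ?v"
          unfolding n[symmetric] by (simp add: diff_divide_distrib)
        finally have "inverse a = r / ?n + (- s / ?n) * ?v" .
        then show ?thesis using I[of "r / ?n" "- s / ?n"] q by simp
      qed (use rat in auto)
    qed
  }
qed

lemma Qv_divide: "a \<in> Qv k \<Longrightarrow> b \<in> Qv k \<Longrightarrow> a / b \<in> Qv k"
  unfolding divide_inverse by (intro Qv_mult Qv_inverse)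

lemma (in cring) module_zero_module: "module R zero_module"
  by (rule moduleI[OF is_cring]; (rule abelian_groupI)?) (auto simp: zero_module_def)

lemma zero_module_simps [simp]: "carrier zero_module = {()}" by (simp add: zero_module_def)

context ialg_dual
begin

abbreviation "\<I> \<equiv> isoclasses k"
abbreviation "\<H> \<equiv> hall_algebra k"

lemma rep_card_1:
  assumes "card (carrier M) = 1" "module \<Lambda> M"
  shows "carrier M = {\<zero>\<^sub>M}"
proof -
  interpret M: module \<Lambda> M by fact
  obtain a where "carrier M = {a}" using assms(1) by (rule card_1_singletonE)
  then show ?thesis using M.M.zero_closed by auto
qed

lemma hall_algebra_sc: "\<H> = sc_algebra \<I> (Qv k) (hall_const k) (isoclass k zero_module)"
  unfolding hall_algebra_def sc_algebra_def hall_basis_def by (rule refl)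

lemma zero_class: "isoclass k zero_module \<in> \<I>"
  by (rule isoclass_in_isoclasses[OF module_zero_module]) simp

lemma rep_zero_class: "carrier (rep (isoclass k zero_module :: 'a imod set)) = {\<zero>\<^bsub>rep (isoclass k zero_module :: 'a imod set)\<^esub>}"
proof -
  let ?O = "rep (isoclass k zero_module) :: 'a imod"
  have "module_isomorphic \<Lambda> ?O zero_module" using rep_mem[OF zero_class] by (simp add: isoclass_def)
  then have "card (carrier ?O) = 1" using module_isomorphic_card by fastforce
  then show ?thesis using rep_card_1 fdD(1)[OF rep_fd[OF zero_class]] by blast
qed

lemma zero_pairs:
  assumes M: "module \<Lambda> M" and O: "module \<Lambda> Y" "carrier Y = {\<zero>\<^sub>Y}"
  shows "(restrict (\<lambda>a. a) (carrier M), restrict (\<lambda>_. \<zero>\<^sub>Y) (carrier M)) \<in> exact_pairs \<Lambda> M M Y"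
    "(restrict (\<lambda>_. \<zero>\<^sub>M) (carrier Y), restrict (\<lambda>a. a) (carrier M)) \<in> exact_pairs \<Lambda> Y M M"
proof -
  interpret M: module \<Lambda> M by fact
  interpret Y: module \<Lambda> Y by fact
  have h: "(\<lambda>_. \<zero>\<^sub>Y) \<in> module_hom \<Lambda> M Y" "(\<lambda>_. \<zero>\<^sub>M) \<in> module_hom \<Lambda> Y M"
    by (rule module_homI; simp)+
  note H = Hom_restrict[OF M h(1)] Hom_restrict[OF O(1) h(2)] Hom_restrict[OF M module_hom_id]
  show "(restrict (\<lambda>a. a) (carrier M), restrict (\<lambda>_. \<zero>\<^sub>Y) (carrier M)) \<in> exact_pairs \<Lambda> M M Y"
    using M.M.zero_closed by (intro exact_pairsI H) (auto simp: O(2) inj_on_def intro: image_eqI)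
  show "(restrict (\<lambda>_. \<zero>\<^sub>M) (carrier Y), restrict (\<lambda>a. a) (carrier M)) \<in> exact_pairs \<Lambda> Y M M"
    by (intro exact_pairsI H) (simp_all add: O(2) inj_on_def)
qed

text \<open>The map onto the zero module is forced, so an exact pair amounts to an isomorphism from
  the representative of B to that of C: |Aut C| of them if B = C and none otherwise.\<close>

lemma hall_const_unit_left:
  assumes "B \<in> \<I>" "C \<in> \<I>"
  shows "hall_const k (isoclass k zero_module) B C = (if C = B then 1 else 0)"
proof -
  let ?O = "rep (isoclass k zero_module :: 'a imod set)"
  note O = fdD[OF rep_fd[OF zero_class]] and b = fdD[OF rep_fd[OF assms(1)]] and c = fdD[OF rep_fd[OF assms(2)]]
  let ?E = "exact_pairs \<Lambda> (rep B) (rep C) ?O" and ?z = "restrict (\<lambda>_. \<zero>\<^bsub>?O\<^esub>) (carrier (rep C))"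
  note id = zero_pairs(1)[OF c(1) O(1) rep_zero_class]
  have z: "?z = snd y" if "y \<in> ?E" for y
  proof -
    note d = exact_pairsD[of "fst y" "snd y", unfolded prod.collapse, OF that] and e = exact_pairsD[OF id]
    show ?thesis
      by (rule Hom_eqI[OF e(2) d(2)]) (use module_hom_mem[OF d(4)] rep_zero_class in auto)
  qed
  then have "{y \<in> ?E. ?z = snd y} = ?E" by blast
  then have c': "card ?E = card {j. (j, ?z) \<in> ?E}" using card_pairs_snd[of ?E ?z] by simp
  show ?thesis
  proof (cases "C = B")
    case True
    then have "card ?E = card (module_aut \<Lambda> (rep C))"
      using card_exact_pairs_same_quotient[OF c(1,1) O(1) id] c' by simp
    then show ?thesis using hall_const_eq[OF zero_class assms] True module_aut_card_pos[OF c] by simp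
  next
    case False
    have "(j, ?z) \<notin> ?E" for j
    proof
      assume "(j, ?z) \<in> ?E"
      from exact_pairs_same_quotient_iso[OF b(1) c(1,1) id this]
      have "module_isomorphic \<Lambda> (rep B) (rep C)" unfolding module_isomorphic_def by blast
      then show False using rep_isomorphic_iff assms False by blast
    qed
    then show ?thesis using c' hall_const_eq[OF zero_class assms] False by simp
  qed
qed

text \<open>Dual to \<open>hall_const_unit_left\<close>: here the inclusion of the zero module is
  forced and the quotient map varies.\<close>

lemma hall_const_unit_right:
  assumes "B \<in> \<I>" "C \<in> \<I>"
  shows "hall_const k B (isoclass k zero_module) C = (if C = B then 1 else 0)"
proof -
  let ?O = "rep (isoclass k zero_module :: 'a imod set)"
  note O = fdD[OF rep_fd[OF zero_class]] and b = fdD[OF rep_fd[OF assms(1)]] and c = fdD[OF rep_fd[OF assms(2)]]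
  let ?E = "exact_pairs \<Lambda> ?O (rep C) (rep B)" and ?z = "restrict (\<lambda>_. \<zero>\<^bsub>rep C\<^esub>) (carrier ?O)"
  note id = zero_pairs(2)[OF c(1) O(1) rep_zero_class]
  have z: "?z = fst y" if "y \<in> ?E" for y
  proof -
    note d = exact_pairsD[of "fst y" "snd y", unfolded prod.collapse, OF that] and e = exact_pairsD[OF id]
    show ?thesis
    proof (rule Hom_eqI[OF e(1) d(1)])
      fix a assume a: "a \<in> carrier ?O"
      then have "a = \<zero>\<^bsub>?O\<^esub>" using rep_zero_class by blast
      then show "?z a = fst y a" using a module_hom_zero[OF O(1) c(1) d(3)] by simp
    qed
  qed
  then have "{y \<in> ?E. ?z = fst y} = ?E" by blast
  then have c': "card ?E = card {t. (?z, t) \<in> ?E}" using card_pairs_fst[of ?E ?z] by simp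
  show ?thesis
  proof (cases "C = B")
    case True
    then have "card ?E = card (module_aut \<Lambda> (rep C))"
      using card_exact_pairs_same_sub[OF O(1) c(1,1) id] c' by simp
    then show ?thesis using hall_const_eq[OF assms(1) zero_class assms(2)] True module_aut_card_pos[OF c] by simp
  next
    case False
    have "(?z, t) \<notin> ?E" for t
    proof
      assume "(?z, t) \<in> ?E"
      from exact_pairs_same_sub_iso[OF c(1,1) b(1) id this]
      have "module_isomorphic \<Lambda> (rep C) (rep B)" unfolding module_isomorphic_def by blast
      then show False using rep_isomorphic_iff assms False by blast
    qed
    then show ?thesis using c' hall_const_eq[OF assms(1) zero_class assms(2)] False by simp
  qed
qed

lemma hall_const_finite:
  assumes "A \<in> \<I>" "B \<in> \<I>"
  shows "finite {C \<in> \<I>. hall_const k A B C \<noteq> 0}"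
  by (rule finite_subset[OF _ finite_isoclasses_card[of "card (carrier (rep A)) * card (carrier (rep B))"]])
    (use hall_const_nonzeroD(1)[OF assms] in blast)

text \<open>The rewrite makes the facts about algebras given by structure constants speak of
  \<open>hall_algebra k\<close> itself.\<close>

sublocale SC: structure_constants \<I> "Qv k" "hall_const k" "isoclass k zero_module"
  rewrites "sc_algebra \<I> (Qv k) (hall_const k) (isoclass k zero_module) = \<H>"
proof -
  show "structure_constants \<I> (Qv k) (hall_const k) (isoclass k zero_module)"
  proof
    show "hall_const k A B C \<in> Qv k" for A B C by (rule Qv_Rats) (simp add: hall_const_def)
  qed (simp_all add: Qv_Rats Qv_add Qv_mult Qv_uminus hall_const_finite zero_class hall_const_unit_left
      hall_const_unit_right hall_const_assoc)
qed (simp add: hall_algebra_sc)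

sublocale H: ring \<H> by (rule SC.ring)

end

section \<open>Products in the Hall algebra\<close>

context dual_ring
begin

lemma regular_hom:
  assumes "module R M" "m \<in> carrier M"
  shows "(\<lambda>r. r \<odot>\<^sub>M m) \<in> module_hom R (regular_module R) M"
proof -
  interpret M: module R M by fact
  show ?thesis by (rule module_homI) (use assms(2) in \<open>auto simp: M.smult_l_distr M.smult_assoc1\<close>)
qed

text \<open>The order of the residue field, read off inside the ring: multiplication by x has kernel
  (x), so (x) is in bijection with R/(x). It is identified with |k| in
  \<open>card_gen_image\<close>.\<close>

definition q where "q = card (xim (regular_module R))"

lemma xim_regular: "xim (regular_module R) = {x \<otimes> s | s. s \<in> carrier R}" by (auto simp: xim_def)

lemma x_mult_zero_iff: "r \<in> carrier R \<Longrightarrow> x \<otimes> r = \<zero> \<longleftrightarrow> (\<exists>s\<in>carrier R. r = x \<otimes> s)"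
proof
  assume r: "r \<in> carrier R" "x \<otimes> r = \<zero>"
  have "r \<notin> Units R"
  proof
    assume u: "r \<in> Units R"
    have "x = (x \<otimes> r) \<otimes> inv r" using u r(1) by (simp add: m_assoc)
    then show False using r u x_nz by simp
  qed
  then show "\<exists>s\<in>carrier R. r = x \<otimes> s" using local_R r by blast
next
  show "r \<in> carrier R \<Longrightarrow> \<exists>s\<in>carrier R. r = x \<otimes> s \<Longrightarrow> x \<otimes> r = \<zero>" by (auto simp: m_assoc[symmetric] xx)
qed

lemma card_R: "card (carrier R) = q * q"
proof -
  have e: "{a \<in> carrier R. x \<otimes> a = \<zero>} = xim (regular_module R)"
    unfolding xim_regular using x_mult_zero_iff by auto
  show ?thesis
    using card_hom_image[OF module_regular_module module_regular_module x_hom[OF module_regular_module]] finite_R e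
    by (simp add: q_def xim_def)
qed

lemma q_gt_1: "q > 1"
proof -
  have "\<zero> \<in> xim (regular_module R)" "x \<in> xim (regular_module R)"
    unfolding xim_def by (auto intro: image_eqI[of _ _ \<zero>] image_eqI[of _ _ \<one>])
  then have "{\<zero>, x} \<subseteq> xim (regular_module R)" by simp
  then have "card {\<zero>, x} \<le> q"
    unfolding q_def by (rule card_mono[rotated]) (simp add: xim_def finite_R)
  then show ?thesis using x_nz by auto
qed

lemma card_cyclic:
  assumes "module R M" "m \<in> carrier M"
  shows "x \<odot>\<^sub>M m \<noteq> \<zero>\<^sub>M \<Longrightarrow> card ((\<lambda>r. r \<odot>\<^sub>M m) ` carrier R) = q * q"
    "x \<odot>\<^sub>M m = \<zero>\<^sub>M \<Longrightarrow> m \<noteq> \<zero>\<^sub>M \<Longrightarrow> card ((\<lambda>r. r \<odot>\<^sub>M m) ` carrier R) = q"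
proof -
  have c: "q * q = card ((\<lambda>r. r \<odot>\<^sub>M m) ` carrier R) * card {r \<in> carrier R. r \<odot>\<^sub>M m = \<zero>\<^sub>M}"
    using card_hom_image[OF module_regular_module assms(1) regular_hom[OF assms]] finite_R card_R by simp
  {
    assume xm: "x \<odot>\<^sub>M m \<noteq> \<zero>\<^sub>M"
    have "{r \<in> carrier R. r \<odot>\<^sub>M m = \<zero>\<^sub>M} = {\<zero>}" using ann_regular(1)[OF assms xm] by auto
    then show "card ((\<lambda>r. r \<odot>\<^sub>M m) ` carrier R) = q * q" using c by simp
  }
  {
    assume xm: "x \<odot>\<^sub>M m = \<zero>\<^sub>M" "m \<noteq> \<zero>\<^sub>M"
    have "{r \<in> carrier R. r \<odot>\<^sub>M m = \<zero>\<^sub>M} = xim (regular_module R)"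
      unfolding xim_regular using ann_simple(1)[OF assms xm] by auto
    then show "card ((\<lambda>r. r \<odot>\<^sub>M m) ` carrier R) = q" using c q_gt_1 by (simp add: q_def[symmetric])
  }
qed

lemma cyclicI:
  assumes "module R M" "m \<in> carrier M" "finite (carrier M)"
    "card ((\<lambda>r. r \<odot>\<^sub>M m) ` carrier R) = card (carrier M)"
  shows "(\<lambda>r. r \<odot>\<^sub>M m) ` carrier R = carrier M"
proof (rule card_subset_eq[OF assms(3) _ assms(4)])
  show "(\<lambda>r. r \<odot>\<^sub>M m) ` carrier R \<subseteq> carrier M"
    using module_hom_mem[OF regular_hom[OF assms(1,2)]] by auto
qed

text \<open>A homomorphism is determined by the image of the generator, and every element killed by
  the annihilator of m occurs as such an image.\<close>

lemma card_Hom_cyclic: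
  assumes "module R M" "module R N" "m \<in> carrier M" "(\<lambda>r. r \<odot>\<^sub>M m) ` carrier R = carrier M"
  shows "card (Hom R M N) = card {n \<in> carrier N. \<forall>r\<in>carrier R. r \<odot>\<^sub>M m = \<zero>\<^sub>M \<longrightarrow> r \<odot>\<^sub>N n = \<zero>\<^sub>N}"
proof (rule card_eq_by_relation[where \<rho> = "\<lambda>\<theta> n. \<theta> m = n"])
  interpret M: module R M by fact
  interpret N: module R N by fact
  fix \<theta> assume "\<theta> \<in> Hom R M N"
  then have \<theta>: "\<theta> \<in> module_hom R M N" by (rule Hom_module_hom)
  have "r \<odot>\<^sub>N \<theta> m = \<zero>\<^sub>N" if "r \<in> carrier R" "r \<odot>\<^sub>M m = \<zero>\<^sub>M" for r
    using module_hom_smult[OF \<theta> that(1) assms(3)] that module_hom_zero[OF assms(1,2) \<theta>] by simp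
  then show "\<exists>b\<in>{n \<in> carrier N. \<forall>r\<in>carrier R. r \<odot>\<^sub>M m = \<zero>\<^sub>M \<longrightarrow> r \<odot>\<^sub>N n = \<zero>\<^sub>N}. \<theta> m = b"
    using module_hom_mem[OF \<theta> assms(3)] by auto
next
  fix n assume "n \<in> {n \<in> carrier N. \<forall>r\<in>carrier R. r \<odot>\<^sub>M m = \<zero>\<^sub>M \<longrightarrow> r \<odot>\<^sub>N n = \<zero>\<^sub>N}"
  then have n: "n \<in> carrier N" "\<And>r. r \<in> carrier R \<Longrightarrow> r \<odot>\<^sub>M m = \<zero>\<^sub>M \<Longrightarrow> r \<odot>\<^sub>N n = \<zero>\<^sub>N" by auto
  interpret M: module R M by fact
  interpret N: module R N by fact
  have im: "(\<lambda>r. r \<odot>\<^sub>M m) ` carrier (regular_module R) = carrier M" using assms(4) by simp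
  obtain \<theta> where \<theta>: "\<theta> \<in> module_hom R M N" "\<And>r. r \<in> carrier (regular_module R) \<Longrightarrow> \<theta> (r \<odot>\<^sub>M m) = r \<odot>\<^sub>N n"
  proof (rule module_hom_factor_surj[OF module_regular_module assms(1,2) regular_hom[OF assms(1,3)] im regular_hom[OF assms(2) n(1)]])
    show "l \<odot>\<^sub>N n = \<zero>\<^sub>N" if "l \<in> carrier (regular_module R)" "l \<odot>\<^sub>M m = \<zero>\<^sub>M" for l
      using n(2)[of l] that by simp
  qed blast
  have "\<theta> m = n" using \<theta>(2)[of \<one>] assms(3) n by simp
  then show "\<exists>\<theta>\<in>Hom R M N. \<theta> m = n"
    using Hom_restrict[OF assms(1) \<theta>(1)] assms(3) by (intro bexI[of _ "restrict \<theta> (carrier M)"]) auto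
next
  fix \<theta> \<theta>' n assume t: "\<theta> \<in> Hom R M N" "\<theta>' \<in> Hom R M N" "\<theta> m = n" "\<theta>' m = n"
  show "\<theta> = \<theta>'"
  proof (rule Hom_eqI[OF t(1,2)])
    fix a assume "a \<in> carrier M"
    then obtain r where "r \<in> carrier R" "a = r \<odot>\<^sub>M m" using assms(4) by auto
    then show "\<theta> a = \<theta>' a"
      using module_hom_smult[OF Hom_module_hom[OF t(1)]] module_hom_smult[OF Hom_module_hom[OF t(2)]] t assms(3) by simp
  qed
qed simp

lemma xim_direct_sum: "xim (direct_sum M N) = xim M \<times> xim N"
  unfolding xim_def by (auto simp: image_def)

lemma xim_isomorphic:
  assumes "module R M" "module R N" "module_isomorphic R M N"
  shows "card (xim M) = card (xim N)"
proof -
  obtain f where f: "f \<in> module_hom R M N" "bij_betw f (carrier M) (carrier N)"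
    using assms(3) by (auto simp: module_isomorphic_def)
  have "f ` xim M = (\<lambda>m. x \<odot>\<^sub>N f m) ` carrier M"
    unfolding xim_def image_image using module_hom_smult[OF f(1) x_in] by (intro image_cong) auto
  also have "\<dots> = (\<lambda>m. x \<odot>\<^sub>N m) ` f ` carrier M" by (simp add: image_image)
  also have "\<dots> = xim N" using f(2) by (simp add: bij_betw_def xim_def)
  finally have "f ` xim M = xim N" .
  moreover have "inj_on f (xim M)"
  proof (rule inj_on_subset)
    show "inj_on f (carrier M)" using f(2) by (simp add: bij_betw_def)
    show "xim M \<subseteq> carrier M" using module_hom_mem[OF x_hom[OF assms(1)]] by (auto simp: xim_def)
  qed
  ultimately show ?thesis by (metis card_image)
qed

lemma xim_card_pos: "module R M \<Longrightarrow> finite (carrier M) \<Longrightarrow> card (xim M) > 0"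
proof -
  assume "module R M" and f: "finite (carrier M)"
  then interpret M: module R M by simp
  show ?thesis unfolding xim_def using f M.M.zero_closed by (auto simp: card_gt_0_iff)
qed

lemma module_card_pos: "module R M \<Longrightarrow> finite (carrier M) \<Longrightarrow> card (carrier M) > 0"
proof -
  assume "module R M" and f: "finite (carrier M)"
  then interpret M: module R M by simp
  show ?thesis using f M.M.zero_closed by (auto simp: card_gt_0_iff)
qed

end

section \<open>Extensions with cyclic quotient, and isoclasses indexed by two cardinalities\<close>

context ialg_dual
begin

text \<open>L is generated by N and one lift l of m, so the class depends only on the elements of N
  that r l equals for r annihilating m. The equivalence sends l to l' and restricts to the identity
  of N.\<close>

lemma cyclic_extension_equiv:
  assumes fd: "M \<in> fd_modules k" "N \<in> fd_modules k"
    and m: "m \<in> carrier M" "(\<lambda>r. r \<odot>\<^sub>M m) ` carrier \<Lambda> = carrier M"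
    and E: "(f, L, g) \<in> extensions k M N" "(f', L', g') \<in> extensions k M N"
    and l: "l \<in> carrier L" "g l = m" "l' \<in> carrier L'" "g' l' = m"
    and ann: "\<And>r. r \<in> carrier \<Lambda> \<Longrightarrow> r \<odot>\<^sub>M m = \<zero>\<^sub>M \<Longrightarrow>
      \<exists>n\<in>carrier N. f n = r \<odot>\<^sub>L l \<and> f' n = r \<odot>\<^bsub>L'\<^esub> l'"
  shows "((f, L, g), (f', L', g')) \<in> ext_equiv k M N"
proof -
  note s = short_exact_extensionD[OF E(1)] and s' = short_exact_extensionD[OF E(2)]
  note Mm = fdD(1)[OF fd(1)] and Nm = fdD(1)[OF fd(2)] and Lm = fdD(1)[OF s(1)] and Lm' = fdD(1)[OF s'(1)]
  interpret M: module \<Lambda> M by (fact Mm)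
  interpret N: module \<Lambda> N by (fact Nm)
  interpret L: module \<Lambda> L by (fact Lm)
  interpret L': module \<Lambda> L' by (fact Lm')
  have fm: "f n \<in> carrier L" "g (f n) = \<zero>\<^sub>M" if "n \<in> carrier N" for n using s(6) that by auto
  have fm': "f' n \<in> carrier L'" "g' (f' n) = \<zero>\<^sub>M" if "n \<in> carrier N" for n using s'(6) that by auto
  let ?D = "direct_sum (regular_module \<Lambda>) N"
  have span: "\<exists>r n. r \<in> carrier \<Lambda> \<and> n \<in> carrier N \<and> y = r \<odot>\<^sub>L l \<oplus>\<^sub>L f n" if y: "y \<in> carrier L" for y
  proof -
    have "g y \<in> (\<lambda>r. r \<odot>\<^sub>M m) ` carrier \<Lambda>" unfolding m(2) by (rule module_hom_mem[OF s(3) y])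
    then obtain r where r: "r \<in> carrier \<Lambda>" "g y = r \<odot>\<^sub>M m" by auto
    have "g (r \<odot>\<^sub>L l) = g y" using module_hom_smult[OF s(3) r(1) l(1)] r l by simp
    then have "g (y \<ominus>\<^sub>L r \<odot>\<^sub>L l) = \<zero>\<^sub>M"
      using module_hom_eq_iff[OF Lm Mm s(3) y L.smult_closed[OF r(1) l(1)]] by simp
    then have "y \<ominus>\<^sub>L r \<odot>\<^sub>L l \<in> f ` carrier N" unfolding s(6) using y r l by simp
    then obtain n where n: "n \<in> carrier N" "y \<ominus>\<^sub>L r \<odot>\<^sub>L l = f n" by auto
    have "y = r \<odot>\<^sub>L l \<oplus>\<^sub>L (y \<ominus>\<^sub>L r \<odot>\<^sub>L l)"
      using y r l by (simp add: a_minus_def L.M.a_lcomm L.M.r_neg)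
    then show ?thesis using r n by auto
  qed
  have span': "\<exists>r n. r \<in> carrier \<Lambda> \<and> n \<in> carrier N \<and> y = r \<odot>\<^bsub>L'\<^esub> l' \<oplus>\<^bsub>L'\<^esub> f' n" if y: "y \<in> carrier L'" for y
  proof -
    have "g' y \<in> (\<lambda>r. r \<odot>\<^sub>M m) ` carrier \<Lambda>" unfolding m(2) by (rule module_hom_mem[OF s'(3) y])
    then obtain r where r: "r \<in> carrier \<Lambda>" "g' y = r \<odot>\<^sub>M m" by auto
    have "g' (r \<odot>\<^bsub>L'\<^esub> l') = g' y" using module_hom_smult[OF s'(3) r(1) l(3)] r l by simp
    then have "g' (y \<ominus>\<^bsub>L'\<^esub> r \<odot>\<^bsub>L'\<^esub> l') = \<zero>\<^sub>M"
      using module_hom_eq_iff[OF Lm' Mm s'(3) y L'.smult_closed[OF r(1) l(3)]] by simp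
    then have "y \<ominus>\<^bsub>L'\<^esub> r \<odot>\<^bsub>L'\<^esub> l' \<in> f' ` carrier N" unfolding s'(6) using y r l by simp
    then obtain n where n: "n \<in> carrier N" "y \<ominus>\<^bsub>L'\<^esub> r \<odot>\<^bsub>L'\<^esub> l' = f' n" by auto
    have "y = r \<odot>\<^bsub>L'\<^esub> l' \<oplus>\<^bsub>L'\<^esub> (y \<ominus>\<^bsub>L'\<^esub> r \<odot>\<^bsub>L'\<^esub> l')"
      using y r l by (simp add: a_minus_def L'.M.a_lcomm L'.M.r_neg)
    then show ?thesis using r n by auto
  qed
  note D = direct_sum_is_module[OF module_regular_module Nm]
  note t = split_map_hom[OF Nm Lm l(1) s(2)] and h = split_map_hom[OF Nm Lm' l(3) s'(2)]
  have im: "(\<lambda>(r, u). r \<odot>\<^sub>L l \<oplus>\<^sub>L f u) ` carrier ?D = carrier L"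
  proof (intro equalityI subsetI)
    fix y assume "y \<in> carrier L"
    then obtain r n where "r \<in> carrier \<Lambda>" "n \<in> carrier N" "y = r \<odot>\<^sub>L l \<oplus>\<^sub>L f n" using span by blast
    then show "y \<in> (\<lambda>(r, u). r \<odot>\<^sub>L l \<oplus>\<^sub>L f u) ` carrier ?D"
      by (intro image_eqI[of _ _ "(r, n)"]) auto
  qed (use l fm in auto)
  have gg: "g (r \<odot>\<^sub>L l \<oplus>\<^sub>L f n) = r \<odot>\<^sub>M m" if "r \<in> carrier \<Lambda>" "n \<in> carrier N" for r n
    using module_hom_add[OF s(3) L.smult_closed[OF that(1) l(1)] fm(1)[OF that(2)]]
      module_hom_smult[OF s(3) that(1) l(1)] fm(2)[OF that(2)] l that m(1) by simp
  have gg': "g' (r \<odot>\<^bsub>L'\<^esub> l' \<oplus>\<^bsub>L'\<^esub> f' n) = r \<odot>\<^sub>M m" if "r \<in> carrier \<Lambda>" "n \<in> carrier N" for r n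
    using module_hom_add[OF s'(3) L'.smult_closed[OF that(1) l(3)] fm'(1)[OF that(2)]]
      module_hom_smult[OF s'(3) that(1) l(3)] fm'(2)[OF that(2)] l that m(1) by simp
  \<comment> \<open>A relation r l + f n = 0 forces r to kill m. By \<open>ann\<close>, r l and r l'
    come from the same n' in N, and n' + n = 0 by injectivity of \<open>f\<close>; so the relation
    also holds in L'.\<close>
  have ker: "r \<odot>\<^bsub>L'\<^esub> l' \<oplus>\<^bsub>L'\<^esub> f' n = \<zero>\<^bsub>L'\<^esub>"
    if rn: "r \<in> carrier \<Lambda>" "n \<in> carrier N" "r \<odot>\<^sub>L l \<oplus>\<^sub>L f n = \<zero>\<^sub>L" for r n
  proof -
    have "r \<odot>\<^sub>M m = \<zero>\<^sub>M" using gg[OF rn(1,2)] rn(3) module_hom_zero[OF Lm Mm s(3)] by simp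
    then obtain n' where n': "n' \<in> carrier N" "f n' = r \<odot>\<^sub>L l" "f' n' = r \<odot>\<^bsub>L'\<^esub> l'" using ann rn(1) by blast
    have "f (n' \<oplus>\<^sub>N n) = f \<zero>\<^sub>N"
      using module_hom_add[OF s(2) n'(1) rn(2)] n' rn(3) module_hom_zero[OF Nm Lm s(2)] by simp
    then have "n' \<oplus>\<^sub>N n = \<zero>\<^sub>N" using inj_onD[OF s(4)] n' rn by simp
    then show ?thesis
      using module_hom_add[OF s'(2) n'(1) rn(2)] n' module_hom_zero[OF Nm Lm' s'(2)] by simp
  qed
  obtain \<phi> where \<phi>: "\<phi> \<in> module_hom \<Lambda> L L'" "\<And>a. a \<in> carrier ?D \<Longrightarrow>
    \<phi> ((\<lambda>(r, u). r \<odot>\<^sub>L l \<oplus>\<^sub>L f u) a) = (\<lambda>(r, u). r \<odot>\<^bsub>L'\<^esub> l' \<oplus>\<^bsub>L'\<^esub> f' u) a"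
  proof (rule module_hom_factor_surj[OF D Lm Lm' t im h])
    show "(\<lambda>(r, u). r \<odot>\<^bsub>L'\<^esub> l' \<oplus>\<^bsub>L'\<^esub> f' u) a = \<zero>\<^bsub>L'\<^esub>"
      if "a \<in> carrier ?D" "(\<lambda>(r, u). r \<odot>\<^sub>L l \<oplus>\<^sub>L f u) a = \<zero>\<^sub>L" for a using that ker by auto
  qed blast
  have \<phi>': "\<phi> (r \<odot>\<^sub>L l \<oplus>\<^sub>L f n) = r \<odot>\<^bsub>L'\<^esub> l' \<oplus>\<^bsub>L'\<^esub> f' n" if "r \<in> carrier \<Lambda>" "n \<in> carrier N" for r n
    using \<phi>(2)[of "(r, n)"] that by simp
  have \<phi>f: "\<phi> (f n) = f' n" if "n \<in> carrier N" for n using \<phi>'[of "\<zero>\<^sub>\<Lambda>" n] that l fm fm' by simp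
  have g\<phi>: "g' (\<phi> y) = g y" if y: "y \<in> carrier L" for y
  proof -
    obtain r n where "r \<in> carrier \<Lambda>" "n \<in> carrier N" "y = r \<odot>\<^sub>L l \<oplus>\<^sub>L f n" using span[OF y] by blast
    then show ?thesis using \<phi>' gg gg' by simp
  qed
  have "inj_on \<phi> (carrier L)"
  proof (rule module_hom_injI[OF Lm Lm' \<phi>(1)])
    fix y assume y: "y \<in> carrier L" "\<phi> y = \<zero>\<^bsub>L'\<^esub>"
    then have "g y = \<zero>\<^sub>M" using g\<phi>[OF y(1)] module_hom_zero[OF Lm' Mm s'(3)] by simp
    then have "y \<in> f ` carrier N" unfolding s(6) using y by simp
    then obtain n where n: "n \<in> carrier N" "y = f n" by auto
    then have "f' n = f' \<zero>\<^sub>N" using \<phi>f y module_hom_zero[OF Nm Lm' s'(2)] by simp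
    then have "n = \<zero>\<^sub>N" using inj_onD[OF s'(4)] n by simp
    then show "y = \<zero>\<^sub>L" using n module_hom_zero[OF Nm Lm s(2)] by simp
  qed
  moreover have "\<phi> ` carrier L = carrier L'"
  proof (intro equalityI subsetI)
    fix y assume "y \<in> carrier L'"
    then obtain r n where rn: "r \<in> carrier \<Lambda>" "n \<in> carrier N" "y = r \<odot>\<^bsub>L'\<^esub> l' \<oplus>\<^bsub>L'\<^esub> f' n" using span' by blast
    have "r \<odot>\<^sub>L l \<oplus>\<^sub>L f n \<in> carrier L" using rn l fm by simp
    then show "y \<in> \<phi> ` carrier L" using \<phi>'[OF rn(1,2)] rn(3) by (metis imageI)
  next
    fix y assume "y \<in> \<phi> ` carrier L"
    then show "y \<in> carrier L'" using module_hom_mem[OF \<phi>(1)] by auto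
  qed
  ultimately have "bij_betw \<phi> (carrier L) (carrier L')" by (simp add: bij_betw_def)
  then show ?thesis by (rule ext_equivI[OF E \<phi>(1)]) (use \<phi>f g\<phi> in auto)
qed

text \<open>The direct sum moved to the natural numbers. When Ext vanishes, it represents the only
  class, and its invariants decide the product.\<close>

lemma split_extension:
  assumes "M \<in> fd_modules k" "N \<in> fd_modules k" obtains f L g where "(f, L, g) \<in> extensions k M N"
    "card (carrier L) = card (carrier M) * card (carrier N)" "card (xim L) = card (xim M) * card (xim N)"
proof -
  note m = fdD(1)[OF assms(1)] and n = fdD(1)[OF assms(2)]
  interpret M: module \<Lambda> M by (fact m)
  interpret N: module \<Lambda> N by (fact n)
  let ?D = "direct_sum N M"
  note D = direct_sum_is_module[OF n m]
  have Df: "finite (carrier ?D)" using fdD(2) assms by simp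
  obtain Z :: "'a imod" and t where Z: "module \<Lambda> Z" "finite (carrier Z)" "t \<in> module_hom \<Lambda> ?D Z"
    "bij_betw t (carrier ?D) (carrier Z)" using nat_module_exists[OF D Df] .
  let ?i = "inv_into (carrier ?D) t"
  note ih = module_hom_inv_into[OF D Z(3,4)]
  have i: "?i (t a) = a" if "a \<in> carrier ?D" for a using Z(4) that by (simp add: bij_betw_def)
  have tm: "t a \<in> carrier Z" if "a \<in> carrier ?D" for a by (rule module_hom_mem[OF Z(3) that])
  have im: "?i y \<in> carrier ?D" "t (?i y) = y" if "y \<in> carrier Z" for y
    using module_hom_mem[OF ih that] Z(4) that by (simp_all add: bij_betw_def f_inv_into_f)
  have f: "(\<lambda>a. t (a, \<zero>\<^sub>M)) \<in> module_hom \<Lambda> N Z"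
    by (rule module_hom_comp[OF _ Z(3), of "\<lambda>a. (a, \<zero>\<^sub>M)"]) (rule module_homI; simp)
  have g: "(\<lambda>y. snd (?i y)) \<in> module_hom \<Lambda> Z M"
    by (rule module_hom_comp[OF ih, of snd]) (rule module_homI; auto)
  have E: "((\<lambda>a. t (a, \<zero>\<^sub>M)), Z, (\<lambda>y. snd (?i y))) \<in> extensions k M N"
    unfolding extensions_def short_exact_def mem_Collect_eq prod.case
  proof (intro conjI f g fdI Z)
    show "inj_on (\<lambda>a. t (a, \<zero>\<^sub>M)) (carrier N)"
    proof (rule inj_onI)
      fix a b assume ab: "a \<in> carrier N" "b \<in> carrier N" "t (a, \<zero>\<^sub>M) = t (b, \<zero>\<^sub>M)"
      then have "?i (t (a, \<zero>\<^sub>M)) = ?i (t (b, \<zero>\<^sub>M))" by simp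
      then show "a = b" using i[of "(a, \<zero>\<^sub>M)"] i[of "(b, \<zero>\<^sub>M)"] ab by simp
    qed
    show "(\<lambda>y. snd (?i y)) ` carrier Z = carrier M"
    proof (intro equalityI subsetI)
      fix b assume b: "b \<in> carrier M"
      then show "b \<in> (\<lambda>y. snd (?i y)) ` carrier Z"
        using i[of "(\<zero>\<^sub>N, b)"] tm[of "(\<zero>\<^sub>N, b)"] by (intro image_eqI[of _ _ "t (\<zero>\<^sub>N, b)"]) auto
    qed (use module_hom_mem[OF g] in auto)
    show "(\<lambda>a. t (a, \<zero>\<^sub>M)) ` carrier N = {l \<in> carrier Z. snd (?i l) = \<zero>\<^sub>M}"
    proof (intro equalityI subsetI)
      fix y assume "y \<in> (\<lambda>a. t (a, \<zero>\<^sub>M)) ` carrier N"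
      then show "y \<in> {l \<in> carrier Z. snd (?i l) = \<zero>\<^sub>M}" using i tm by auto
    next
      fix y assume y: "y \<in> {l \<in> carrier Z. snd (?i l) = \<zero>\<^sub>M}"
      then have "y = t (fst (?i y), \<zero>\<^sub>M)" "fst (?i y) \<in> carrier N"
        using im[of y] by (auto simp: prod_eq_iff mem_Times_iff) (metis prod.collapse)
      then show "y \<in> (\<lambda>a. t (a, \<zero>\<^sub>M)) ` carrier N" by blast
    qed
  qed
  have iso: "module_isomorphic \<Lambda> ?D Z" using Z(3,4) by (auto simp: module_isomorphic_def)
  show ?thesis
  proof (rule that[OF E])
    show "card (carrier Z) = card (carrier M) * card (carrier N)"
      using module_isomorphic_card[OF iso] by (simp add: card_cartesian_product mult.commute)
    show "card (xim Z) = card (xim M) * card (xim N)"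
      using xim_isomorphic[OF D Z(1) iso] by (simp add: xim_direct_sum card_cartesian_product mult.commute)
  qed
qed

text \<open>The form in which vanishing of Ext enters: with a single class, \<open>Ext1_mid\<close>
  is a singleton for one isoclass of L and empty for all others.\<close>

lemma card_Ext1_mid_unique:
  assumes fd: "L \<in> fd_modules k" "N \<in> fd_modules k" and E: "(f, L0, g) \<in> extensions k M N"
    and uniq: "\<And>f' L' g'. (f', L', g') \<in> extensions k M N \<Longrightarrow> ((f, L0, g), (f', L', g')) \<in> ext_equiv k M N"
  shows "card (Ext1_mid k M N L) = (if module_isomorphic \<Lambda> L0 L then 1 else 0)"
proof -
  note eq = equiv_ext_equiv[of M N]
  let ?c = "ext_equiv k M N `` {(f, L0, g)}"
  have 1: "\<epsilon> = ?c" if \<epsilon>: "\<epsilon> \<in> Ext1 k M N" for \<epsilon>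
  proof -
    obtain y where y: "y \<in> extensions k M N" "\<epsilon> = ext_equiv k M N `` {y}"
      using \<epsilon> unfolding Ext1_def by (rule quotientE) simp
    obtain f' L' g' where "y = (f', L', g')" by (cases y)
    then show ?thesis using uniq[of f' L' g'] y equiv_class_eq[OF eq] by simp
  qed
  have c: "?c \<in> Ext1 k M N" unfolding Ext1_def by (rule quotientI[OF E])
  have iff: "?c \<in> Ext1_mid k M N L \<longleftrightarrow> module_isomorphic \<Lambda> L0 L"
  proof
    assume "module_isomorphic \<Lambda> L0 L"
    then show "?c \<in> Ext1_mid k M N L"
      unfolding Ext1_mid_def using c equiv_class_self[OF eq E] by blast
  next
    assume "?c \<in> Ext1_mid k M N L"
    then obtain f' L' g' where e: "((f, L0, g), (f', L', g')) \<in> ext_equiv k M N" "module_isomorphic \<Lambda> L' L"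
      unfolding Ext1_mid_def by blast
    from e(1) obtain \<phi> where "\<phi> \<in> module_hom \<Lambda> L0 L'" "bij_betw \<phi> (carrier L0) (carrier L')"
      by (rule ext_equivE) simp
    then have "module_isomorphic \<Lambda> L0 L'" by (auto simp: module_isomorphic_def)
    then show "module_isomorphic \<Lambda> L0 L" using e(2) by (rule module_isomorphic_trans)
  qed
  have sub: "Ext1_mid k M N L \<subseteq> {?c}" using 1 unfolding Ext1_mid_def by blast
  show ?thesis
  proof (cases "module_isomorphic \<Lambda> L0 L")
    case True
    then have "Ext1_mid k M N L = {?c}" using iff sub by blast
    then show ?thesis using True by simp
  next
    case False
    then have "Ext1_mid k M N L = {}" using iff sub by blast
    then show ?thesis using False by simp
  qed
qed

text \<open>By \<open>isomorphic_iff\<close> this is a single isoclass, or empty if no module has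
  these invariants. As no isoclass is empty, \<open>cls a b \<in> \<I>\<close> says that such a
  module exists.\<close>

definition cls :: "nat \<Rightarrow> nat \<Rightarrow> 'a imod set" where
  "cls a b = {M \<in> fd_modules k. card (carrier M) = a \<and> card (xim M) = b}"

definition bas :: "nat \<Rightarrow> nat \<Rightarrow> 'a hall" where "bas a b = (\<lambda>C. if C = cls a b then 1 else 0)"

lemma isomorphic_iff:
  assumes "module \<Lambda> M" "finite (carrier M)" "module \<Lambda> N" "finite (carrier N)"
  shows "module_isomorphic \<Lambda> M N \<longleftrightarrow> card (carrier M) = card (carrier N) \<and> card (xim M) = card (xim N)"
  using isomorphic_by_card[OF assms] xim_isomorphic[OF assms(1,3)] module_isomorphic_card by blast

lemma isoclass_cls:
  assumes "module \<Lambda> M" "finite (carrier M)"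
  shows "isoclass k M = cls (card (carrier M)) (card (xim M))"
  unfolding isoclass_def cls_def using isomorphic_iff[OF fdD _ assms(2)] assms fd_iff by blast

lemma hall_basis_bas:
  "module \<Lambda> M \<Longrightarrow> finite (carrier M) \<Longrightarrow> hall_basis k M = bas (card (carrier M)) (card (xim M))"
  by (simp add: hall_basis_def bas_def isoclass_cls)

lemma class_cls: "C \<in> \<I> \<Longrightarrow> C = cls (card (carrier (rep C))) (card (xim (rep C)))"
  using isoclass_cls[OF fdD[OF rep_fd]] isoclass_rep by simp

lemma class_eq_cls_iff: "C \<in> \<I> \<Longrightarrow> C = cls a b \<longleftrightarrow> card (carrier (rep C)) = a \<and> card (xim (rep C)) = b"
  using class_cls[of C] rep_mem[of C] by (auto simp: cls_def)

lemma cls_in: "module \<Lambda> M \<Longrightarrow> finite (carrier M) \<Longrightarrow> cls (card (carrier M)) (card (xim M)) \<in> \<I>"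
  using isoclass_in_isoclasses isoclass_cls by metis

lemma rep_cls: "cls a b \<in> \<I> \<Longrightarrow> card (carrier (rep (cls a b))) = a \<and> card (xim (rep (cls a b))) = b"
  using class_eq_cls_iff[of "cls a b" a b] by simp

lemma bas_mult:
  assumes "cls a b \<in> \<I>" "cls a' b' \<in> \<I>"
  shows "bas a b \<otimes>\<^sub>\<H> bas a' b' = (\<lambda>C. if C \<in> \<I> then hall_const k (cls a b) (cls a' b') C else 0)"
  unfolding bas_def by (rule SC.basis_mult[OF assms])

lemma bas_carrier: "cls a b \<in> \<I> \<Longrightarrow> bas a b \<in> carrier \<H>" unfolding bas_def by (rule SC.basis_carrier)

end

section \<open>Left multiplication by the class of the regular module and by that of the simple
  module\<close>

context ialg_dual
begin

lemma regular_in: "cls (q * q) q \<in> \<I>"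
  using cls_in[OF module_regular_module] finite_R by (simp add: card_R flip: q_def)

lemma cls_mult_in:
  assumes "cls a b \<in> \<I>" "cls a' b' \<in> \<I>"
  shows "cls (a * a') (b * b') \<in> \<I>"
proof -
  note m = fdD[OF rep_fd[OF assms(1)]] fdD[OF rep_fd[OF assms(2)]]
  show ?thesis
    using cls_in[OF direct_sum_is_module[OF m(1,3)]] m(2,4) rep_cls[OF assms(1)] rep_cls[OF assms(2)]
    by (simp add: card_cartesian_product xim_direct_sum)
qed

text \<open>The regular module is projective: lifting its generator leaves no relation to satisfy,
  so the split class is the only one. A homomorphism to N is an arbitrary element of N, whence the
  denominator a.\<close>

lemma hall_const_regular:
  assumes "cls a b \<in> \<I>" "C \<in> \<I>"
  shows "hall_const k (cls (q * q) q) (cls a b) C = (if C = cls (q * q * a) (q * b) then 1 else 0) / real a"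
proof -
  define M N where MN: "M = rep (cls (q * q) q)" "N = rep (cls a b)"
  let ?L = "rep C"
  note fd = rep_fd[OF regular_in, folded MN] rep_fd[OF assms(1), folded MN] rep_fd[OF assms(2)]
  note Mm = fdD[OF fd(1)] and Nm = fdD[OF fd(2)] and Lm = fdD[OF fd(3)]
  note cM = rep_cls[OF regular_in, folded MN] and cN = rep_cls[OF assms(1), folded MN]
  have "\<not> (\<forall>a\<in>carrier M. x \<odot>\<^sub>M a = \<zero>\<^sub>M)" using xim_card_1_iff[OF Mm] cM q_gt_1 by simp
  then obtain m where m: "m \<in> carrier M" "x \<odot>\<^sub>M m \<noteq> \<zero>\<^sub>M" by blast
  have cyc: "(\<lambda>r. r \<odot>\<^sub>M m) ` carrier \<Lambda> = carrier M"
    by (rule cyclicI[OF Mm(1) m(1) Mm(2)]) (simp add: card_cyclic(1)[OF Mm(1) m] cM)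
  note ann = ann_regular(1)[OF Mm(1) m]
  interpret N: module \<Lambda> N by (fact Nm(1))
  obtain f L0 g where E: "(f, L0, g) \<in> extensions k M N"
    "card (carrier L0) = card (carrier M) * card (carrier N)" "card (xim L0) = card (xim M) * card (xim N)"
    using split_extension[OF fd(1,2)] .
  note s = short_exact_extensionD[OF E(1)]
  have uniq: "((f, L0, g), (f', L', g')) \<in> ext_equiv k M N" if E': "(f', L', g') \<in> extensions k M N" for f' L' g'
  proof -
    note s' = short_exact_extensionD[OF E']
    interpret L0: module \<Lambda> L0 by (rule fdD(1)[OF s(1)])
    interpret L': module \<Lambda> L' by (rule fdD(1)[OF s'(1)])
    have ml: "m \<in> g ` carrier L0" "m \<in> g' ` carrier L'" using m(1) s(5) s'(5) by simp_all
    from ml(1) obtain l where l1: "m = g l" "l \<in> carrier L0" by (rule imageE)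
    from ml(2) obtain l' where l2: "m = g' l'" "l' \<in> carrier L'" by (rule imageE)
    note l = l1(2) l1(1)[symmetric] l2(2) l2(1)[symmetric]
    show ?thesis
    proof (rule cyclic_extension_equiv[OF fd(1,2) m(1) cyc E(1) E' l])
      fix r assume "r \<in> carrier \<Lambda>" "r \<odot>\<^sub>M m = \<zero>\<^sub>M"
      then have "r = \<zero>\<^sub>\<Lambda>" using ann by simp
      then show "\<exists>n\<in>carrier N. f n = r \<odot>\<^bsub>L0\<^esub> l \<and> f' n = r \<odot>\<^bsub>L'\<^esub> l'"
        using l module_hom_zero[OF Nm(1) L0.module_axioms s(2)] module_hom_zero[OF Nm(1) L'.module_axioms s'(2)]
        by (intro bexI[of _ "\<zero>\<^sub>N"]) auto
    qed
  qed
  have "{n \<in> carrier N. \<forall>r\<in>carrier \<Lambda>. r \<odot>\<^sub>M m = \<zero>\<^sub>M \<longrightarrow> r \<odot>\<^sub>N n = \<zero>\<^sub>N} = carrier N"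
    using ann by auto
  then have hom: "card (Hom \<Lambda> M N) = a" using card_Hom_cyclic[OF Mm(1) Nm(1) m(1) cyc] cN by simp
  have "module_isomorphic \<Lambda> L0 ?L \<longleftrightarrow> C = cls (q * q * a) (q * b)"
    using isomorphic_iff[OF fdD[OF s(1)] Lm] class_eq_cls_iff[OF assms(2)] E(2,3) cM cN by auto
  moreover have "card (Ext1_mid k M N ?L) = (if module_isomorphic \<Lambda> L0 ?L then 1 else 0)"
    by (rule card_Ext1_mid_unique[OF fd(3,2) E(1)]) (rule uniq)
  ultimately show ?thesis unfolding hall_const_def MN[symmetric] hom by simp
qed

lemma regular_mult:
  assumes "cls a b \<in> \<I>"
  shows "bas (q * q) q \<otimes>\<^sub>\<H> bas a b = (\<lambda>C. (1 / real a) * bas (q * q * a) (q * b) C)"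
proof
  fix C
  show "(bas (q * q) q \<otimes>\<^sub>\<H> bas a b) C = (1 / real a) * bas (q * q * a) (q * b) C"
  proof (cases "C \<in> \<I>")
    case True
    then show ?thesis
      unfolding bas_mult[OF regular_in assms] using hall_const_regular[OF assms True] by (simp add: bas_def)
  next
    case False
    then have "C \<noteq> cls (q * q * a) (q * b)" using cls_mult_in[OF regular_in assms] by metis
    then show ?thesis unfolding bas_mult[OF regular_in assms] using False by (simp add: bas_def)
  qed
qed

lemma simple_generator:
  assumes "module \<Lambda> M" "finite (carrier M)" "card (carrier M) = q" "card (xim M) = 1"
  obtains m where "m \<in> carrier M" "m \<noteq> \<zero>\<^sub>M" "x \<odot>\<^sub>M m = \<zero>\<^sub>M"
    "(\<lambda>r. r \<odot>\<^sub>M m) ` carrier \<Lambda> = carrier M"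
proof -
  interpret M: module \<Lambda> M by fact
  have "\<not> carrier M \<subseteq> {\<zero>\<^sub>M}"
  proof
    assume "carrier M \<subseteq> {\<zero>\<^sub>M}"
    then have "card (carrier M) \<le> 1" using card_mono[of "{\<zero>\<^sub>M}" "carrier M"] by simp
    then show False using assms(3) q_gt_1 by simp
  qed
  then obtain m where m: "m \<in> carrier M" "m \<noteq> \<zero>\<^sub>M" by blast
  have xm: "x \<odot>\<^sub>M m = \<zero>\<^sub>M" using xim_card_1_iff[OF assms(1,2)] assms(4) m(1) by blast
  have "(\<lambda>r. r \<odot>\<^sub>M m) ` carrier \<Lambda> = carrier M"
    by (rule cyclicI[OF assms(1) m(1) assms(2)]) (simp add: card_cyclic(2)[OF assms(1) m(1) xm m(2)] assms(3))
  then show ?thesis using that m xm by blast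
qed

text \<open>The extension of \<open>S\<close> by \<open>N\<close> in which \<open>x\<close> carries a lift of the generator to a given \<open>n\<close>,
  constructed as a pushout of \<open>0 \<rightarrow> x\<Lambda> \<rightarrow> \<Lambda> \<rightarrow> S \<rightarrow> 0\<close>.\<close>

lemma extension_of_simple_exists:
  assumes fd: "M \<in> fd_modules k" "N \<in> fd_modules k"
    and m: "m \<in> carrier M" "m \<noteq> \<zero>\<^sub>M" "x \<odot>\<^sub>M m = \<zero>\<^sub>M" "(\<lambda>r. r \<odot>\<^sub>M m) ` carrier \<Lambda> = carrier M"
    and n: "n \<in> carrier N" "x \<odot>\<^sub>N n = \<zero>\<^sub>N"
  obtains f L g l where "(f, L, g) \<in> extensions k M N" "l \<in> carrier L" "g l = m" "x \<odot>\<^sub>L l = f n"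
proof -
  note Mm = fdD(1)[OF fd(1)] and Nm = fdD(1)[OF fd(2)]
  interpret M: module \<Lambda> M by (fact Mm)
  interpret N: module \<Lambda> N by (fact Nm)
  let ?R = "regular_module \<Lambda>"
  let ?D = "direct_sum ?R N"
  note D = direct_sum_is_module[OF module_regular_module Nm]
  have Df: "finite (carrier ?D)" using finite_R fdD(2)[OF fd(2)] by simp
  interpret D: module \<Lambda> ?D by (fact D)
  \<comment> \<open>Dividing by the image of \<open>?u\<close> imposes x (1, 0) = (0, n), so that
    the class of (1, 0) is the required lift of m.\<close>
  let ?u = "\<lambda>r. (x \<otimes>\<^sub>\<Lambda> r, \<ominus>\<^sub>N (r \<odot>\<^sub>N n))"
  have u: "?u \<in> module_hom \<Lambda> ?R ?D" by (rule module_homI)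
      (use n in \<open>auto simp: r_distr N.smult_l_distr N.smult_assoc1 N.M.minus_add m_ac N.smult_r_minus\<close>)
  obtain Z :: "'a imod" and t where Z: "module \<Lambda> Z" "t \<in> module_hom \<Lambda> ?D Z" "t ` carrier ?D = carrier Z"
    "\<And>a. a \<in> carrier ?D \<Longrightarrow> t a = \<zero>\<^sub>Z \<longleftrightarrow> a \<in> ?u ` carrier ?R"
    using quotient_module_exists[OF D Df image_submodule[OF module_regular_module D u]] by blast
  have Zf: "finite (carrier Z)" using Z(3) Df by (metis finite_imageI)
  interpret Z: module \<Lambda> Z by (fact Z(1))
  have tz: "t a = \<zero>\<^sub>Z \<longleftrightarrow> (\<exists>r\<in>carrier \<Lambda>. a = ?u r)" if "a \<in> carrier ?D" for a
    using Z(4)[OF that] by auto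
  have tm: "t a \<in> carrier Z" if "a \<in> carrier ?D" for a by (rule module_hom_mem[OF Z(2) that])
  let ?f = "\<lambda>a. t (\<zero>\<^sub>\<Lambda>, a)"
  have f: "?f \<in> module_hom \<Lambda> N Z"
    by (rule module_hom_comp[OF _ Z(2), of "\<lambda>a. (\<zero>\<^sub>\<Lambda>, a)"]) (rule module_homI; simp)
  have h: "(\<lambda>a. fst a \<odot>\<^sub>M m) \<in> module_hom \<Lambda> ?D M"
    by (rule module_homI) (use m(1) in \<open>auto simp: M.smult_l_distr M.smult_assoc1\<close>)
  note ann = ann_simple(1)[OF Mm m(1,3,2)]
  obtain g where g: "g \<in> module_hom \<Lambda> Z M" "\<And>a. a \<in> carrier ?D \<Longrightarrow> g (t a) = fst a \<odot>\<^sub>M m"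
  proof (rule module_hom_factor_surj[OF D Z(1) Mm Z(2,3) h])
    show "fst a \<odot>\<^sub>M m = \<zero>\<^sub>M" if a: "a \<in> carrier ?D" "t a = \<zero>\<^sub>Z" for a
    proof -
      obtain r where "r \<in> carrier \<Lambda>" "a = ?u r" using tz[OF a(1)] a(2) by blast
      then show ?thesis using ann[of "x \<otimes>\<^sub>\<Lambda> r"] by auto
    qed
  qed blast
  \<comment> \<open>N embeds because (0, a) = \<open>?u r\<close> forces x r = 0, so r is a multiple
    of x and kills n; this is where x n = 0 enters.\<close>
  have f0: "a = \<zero>\<^sub>N" if a: "a \<in> carrier N" "?f a = \<zero>\<^sub>Z" for a
  proof -
    obtain r where r: "r \<in> carrier \<Lambda>" "(\<zero>\<^sub>\<Lambda>, a) = ?u r" using tz[of "(\<zero>\<^sub>\<Lambda>, a)"] a by auto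
    then obtain s where "s \<in> carrier \<Lambda>" "r = x \<otimes>\<^sub>\<Lambda> s" using x_mult_zero_iff[OF r(1)] by auto
    then have "r \<odot>\<^sub>N n = \<zero>\<^sub>N" using n x_smult_comm[OF Nm n(1), of s] by (simp add: N.smult_assoc1)
    then show ?thesis using r N.M.minus_equality[of "\<zero>\<^sub>N" "\<zero>\<^sub>N"] by simp
  qed
  have E: "(?f, Z, g) \<in> extensions k M N"
    unfolding extensions_def short_exact_def mem_Collect_eq prod.case
  proof (intro conjI f g fdI Z(1) Zf)
    show "inj_on ?f (carrier N)" by (rule module_hom_injI[OF Nm Z(1) f]) (rule f0)
    show "g ` carrier Z = carrier M"
    proof -
      have "g ` carrier Z = (\<lambda>a. fst a \<odot>\<^sub>M m) ` carrier ?D"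
        unfolding Z(3)[symmetric] image_image using g(2) by (rule image_cong[OF refl])
      also have "\<dots> = (\<lambda>r. r \<odot>\<^sub>M m) ` fst ` carrier ?D" by (simp only: image_image)
      also have "fst ` carrier ?D = carrier \<Lambda>" using N.M.zero_closed by (auto simp: fst_image_times)
      finally show ?thesis using m(4) by simp
    qed
    show "?f ` carrier N = {l \<in> carrier Z. g l = \<zero>\<^sub>M}"
    proof (intro equalityI subsetI)
      fix y assume "y \<in> ?f ` carrier N"
      then obtain a where a: "a \<in> carrier N" "y = t (\<zero>\<^sub>\<Lambda>, a)" by auto
      then show "y \<in> {l \<in> carrier Z. g l = \<zero>\<^sub>M}" using g(2)[of "(\<zero>\<^sub>\<Lambda>, a)"] tm[of "(\<zero>\<^sub>\<Lambda>, a)"] m(1) by simp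
    next
      fix y assume y: "y \<in> {l \<in> carrier Z. g l = \<zero>\<^sub>M}"
      then have "y \<in> t ` carrier ?D" using Z(3) by simp
      then obtain r a where ra: "r \<in> carrier \<Lambda>" "a \<in> carrier N" "y = t (r, a)" by auto
      then have "r \<odot>\<^sub>M m = \<zero>\<^sub>M" using g(2)[of "(r, a)"] y by simp
      then obtain s where s: "s \<in> carrier \<Lambda>" "r = x \<otimes>\<^sub>\<Lambda> s" using ann[OF ra(1)] by blast
      have sn: "s \<odot>\<^sub>N n \<in> carrier N" using s n by simp
      have eq: "(r, a) = ?u s \<oplus>\<^bsub>?D\<^esub> (\<zero>\<^sub>\<Lambda>, a \<oplus>\<^sub>N s \<odot>\<^sub>N n)"
        using s sn ra(2) by (simp add: N.M.a_comm[of a] N.M.r_neg1)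
      have "t (r, a) = t (?u s) \<oplus>\<^sub>Z t (\<zero>\<^sub>\<Lambda>, a \<oplus>\<^sub>N s \<odot>\<^sub>N n)"
        unfolding eq by (rule module_hom_add[OF Z(2)]) (use s sn ra(2) in auto)
      also have "t (?u s) = \<zero>\<^sub>Z" using tz[of "?u s"] s sn by auto
      finally have "y = ?f (a \<oplus>\<^sub>N s \<odot>\<^sub>N n)" using ra tm[of "(\<zero>\<^sub>\<Lambda>, a \<oplus>\<^sub>N s \<odot>\<^sub>N n)"] sn by simp
      then show "y \<in> ?f ` carrier N" using ra(2) sn by blast
    qed
  qed
  have l: "t (\<one>\<^sub>\<Lambda>, \<zero>\<^sub>N) \<in> carrier Z" by (rule tm) simp
  have gl: "g (t (\<one>\<^sub>\<Lambda>, \<zero>\<^sub>N)) = m" using g(2)[of "(\<one>\<^sub>\<Lambda>, \<zero>\<^sub>N)"] m(1) by simp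
  have "x \<odot>\<^sub>Z t (\<one>\<^sub>\<Lambda>, \<zero>\<^sub>N) = t (x, \<zero>\<^sub>N)"
    using module_hom_smult[OF Z(2) x_in, of "(\<one>\<^sub>\<Lambda>, \<zero>\<^sub>N)"] by simp
  also have "(x, \<zero>\<^sub>N) = ?u \<one>\<^sub>\<Lambda> \<oplus>\<^bsub>?D\<^esub> (\<zero>\<^sub>\<Lambda>, n)" using n by (simp add: N.M.l_neg)
  also have "t \<dots> = t (?u \<one>\<^sub>\<Lambda>) \<oplus>\<^sub>Z ?f n" by (rule module_hom_add[OF Z(2)]) (use n in auto)
  also have "t (?u \<one>\<^sub>\<Lambda>) = \<zero>\<^sub>Z"
  proof -
    have "?u \<one>\<^sub>\<Lambda> \<in> carrier ?D" using n by simp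
    from tz[OF this] show ?thesis using one_closed by blast
  qed
  finally have "x \<odot>\<^sub>Z t (\<one>\<^sub>\<Lambda>, \<zero>\<^sub>N) = ?f n" using module_hom_mem[OF f n(1)] by simp
  then show ?thesis using that[OF E l gl] by blast
qed

text \<open>As x kills N and L is generated by N and l, the image of x on L is generated by x l = f
  n. It is therefore zero or a copy of the simple module, according to n.\<close>

lemma extension_of_simple_xim:
  assumes fd: "M \<in> fd_modules k" "N \<in> fd_modules k" and xN: "\<forall>n\<in>carrier N. x \<odot>\<^sub>N n = \<zero>\<^sub>N"
    and m: "m \<in> carrier M" "(\<lambda>r. r \<odot>\<^sub>M m) ` carrier \<Lambda> = carrier M"
    and E: "(f, L, g) \<in> extensions k M N" and l: "l \<in> carrier L" "g l = m"
    and n: "n \<in> carrier N" "x \<odot>\<^sub>L l = f n"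
  shows "card (xim L) = (if n = \<zero>\<^sub>N then 1 else q)" "card (carrier L) = card (carrier M) * card (carrier N)"
proof -
  note s = short_exact_extensionD[OF E]
  note Mm = fdD(1)[OF fd(1)] and Nm = fdD(1)[OF fd(2)] and Lm = fdD(1)[OF s(1)]
  interpret M: module \<Lambda> M by (fact Mm)
  interpret N: module \<Lambda> N by (fact Nm)
  interpret L: module \<Lambda> L by (fact Lm)
  have fm: "f a \<in> carrier L" if "a \<in> carrier N" for a by (rule module_hom_mem[OF s(2) that])
  have "card {l \<in> carrier L. g l = \<zero>\<^sub>M} = card (carrier N)"
    unfolding s(6)[symmetric] by (rule card_image[OF s(4)])
  then show "card (carrier L) = card (carrier M) * card (carrier N)"
    using card_hom_image[OF Lm Mm s(3) fdD(2)[OF s(1)]] s(5) by simp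
  have rl: "x \<odot>\<^sub>L (r \<odot>\<^sub>L l) = f (r \<odot>\<^sub>N n)" if "r \<in> carrier \<Lambda>" for r
    using x_smult_comm[OF Lm l(1) that] n module_hom_smult[OF s(2) that n(1)] by simp
  have "xim L = f ` (\<lambda>r. r \<odot>\<^sub>N n) ` carrier \<Lambda>"
  proof (intro equalityI subsetI)
    fix y assume "y \<in> xim L"
    then obtain y' where y: "y' \<in> carrier L" "y = x \<odot>\<^sub>L y'" by (auto simp: xim_def)
    have "g y' \<in> (\<lambda>r. r \<odot>\<^sub>M m) ` carrier \<Lambda>" unfolding m(2) by (rule module_hom_mem[OF s(3) y(1)])
    then obtain r where r: "r \<in> carrier \<Lambda>" "g y' = r \<odot>\<^sub>M m" by auto
    have rlc: "r \<odot>\<^sub>L l \<in> carrier L" using r l by simp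
    have "g (r \<odot>\<^sub>L l) = g y'" using module_hom_smult[OF s(3) r(1) l(1)] r l by simp
    then have "g (y' \<ominus>\<^sub>L r \<odot>\<^sub>L l) = \<zero>\<^sub>M" using module_hom_eq_iff[OF Lm Mm s(3) y(1) rlc] by simp
    then have "y' \<ominus>\<^sub>L r \<odot>\<^sub>L l \<in> f ` carrier N" unfolding s(6) using y rlc by simp
    then obtain a where a: "a \<in> carrier N" "y' \<ominus>\<^sub>L r \<odot>\<^sub>L l = f a" by auto
    have "x \<odot>\<^sub>L (y' \<ominus>\<^sub>L r \<odot>\<^sub>L l) = f (x \<odot>\<^sub>N a)"
      using a module_hom_smult[OF s(2) x_in a(1)] by simp
    also have "\<dots> = \<zero>\<^sub>L" using xN a(1) module_hom_zero[OF Nm Lm s(2)] by simp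
    finally have "x \<odot>\<^sub>L y' = x \<odot>\<^sub>L (r \<odot>\<^sub>L l)"
      using module_hom_eq_iff[OF Lm Lm x_hom[OF Lm] y(1) rlc] by simp
    then show "y \<in> f ` (\<lambda>r. r \<odot>\<^sub>N n) ` carrier \<Lambda>" using y rl r by auto
  next
    fix y assume "y \<in> f ` (\<lambda>r. r \<odot>\<^sub>N n) ` carrier \<Lambda>"
    then obtain r where "r \<in> carrier \<Lambda>" "y = f (r \<odot>\<^sub>N n)" by auto
    then show "y \<in> xim L" unfolding xim_def using rl l by (intro image_eqI[of _ _ "r \<odot>\<^sub>L l"]) auto
  qed
  moreover have "inj_on f ((\<lambda>r. r \<odot>\<^sub>N n) ` carrier \<Lambda>)"
    by (rule inj_on_subset[OF s(4)]) (use n(1) in auto)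
  ultimately have c: "card (xim L) = card ((\<lambda>r. r \<odot>\<^sub>N n) ` carrier \<Lambda>)" by (simp add: card_image)
  show "card (xim L) = (if n = \<zero>\<^sub>N then 1 else q)"
  proof (cases "n = \<zero>\<^sub>N")
    case True
    then have "(\<lambda>r. r \<odot>\<^sub>N n) ` carrier \<Lambda> = {\<zero>\<^sub>N}" using zero_closed by (auto intro: image_eqI[of _ _ "\<zero>\<^sub>\<Lambda>"])
    then show ?thesis using c True by simp
  next
    case False
    then show ?thesis using c card_cyclic(2)[OF Nm n(1)] xN n(1) by simp
  qed
qed

lemma simple_extension_lift:
  assumes N: "module \<Lambda> N" and E: "(f, L, g) \<in> extensions k M N"
    and m: "m \<in> carrier M" "x \<odot>\<^sub>M m = \<zero>\<^sub>M"
  obtains l n where "l \<in> carrier L" "g l = m" "n \<in> carrier N" "x \<odot>\<^sub>L l = f n"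
proof -
  note s = short_exact_extensionD[OF E]
  interpret L: module \<Lambda> L by (rule fdD(1)[OF s(1)])
  have "m \<in> g ` carrier L" using m(1) s(5) by simp
  then obtain l where l: "l \<in> carrier L" "g l = m" by auto
  have "g (x \<odot>\<^sub>L l) = \<zero>\<^sub>M" using module_hom_smult[OF s(3) x_in l(1)] l m(2) by simp
  then have "x \<odot>\<^sub>L l \<in> f ` carrier N" unfolding s(6) using l by simp
  then show ?thesis using that l by auto
qed

text \<open>The annihilator of m is (x), so the single relation x l = f n determines the
  class.\<close>

lemma simple_extension_equiv:
  assumes fd: "M \<in> fd_modules k" "N \<in> fd_modules k"
    and m: "m \<in> carrier M" "m \<noteq> \<zero>\<^sub>M" "x \<odot>\<^sub>M m = \<zero>\<^sub>M" "(\<lambda>r. r \<odot>\<^sub>M m) ` carrier \<Lambda> = carrier M"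
    and E: "(f, L, g) \<in> extensions k M N" "(f', L', g') \<in> extensions k M N"
    and l: "l \<in> carrier L" "g l = m" "l' \<in> carrier L'" "g' l' = m"
    and n: "n \<in> carrier N" "x \<odot>\<^sub>L l = f n" "x \<odot>\<^bsub>L'\<^esub> l' = f' n"
  shows "((f, L, g), (f', L', g')) \<in> ext_equiv k M N"
proof (rule cyclic_extension_equiv[OF fd m(1,4) E l])
  note s = short_exact_extensionD[OF E(1)] and s' = short_exact_extensionD[OF E(2)]
  interpret N: module \<Lambda> N by (rule fdD(1)[OF fd(2)])
  interpret L: module \<Lambda> L by (rule fdD(1)[OF s(1)])
  interpret L': module \<Lambda> L' by (rule fdD(1)[OF s'(1)])
  fix r assume "r \<in> carrier \<Lambda>" "r \<odot>\<^sub>M m = \<zero>\<^sub>M"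
  then obtain t where t: "t \<in> carrier \<Lambda>" "r = x \<otimes>\<^sub>\<Lambda> t"
    using ann_simple(1)[OF fdD(1)[OF fd(1)] m(1,3,2)] by blast
  have "f (t \<odot>\<^sub>N n) = r \<odot>\<^sub>L l" "f' (t \<odot>\<^sub>N n) = r \<odot>\<^bsub>L'\<^esub> l'"
    using module_hom_smult[OF s(2) t(1) n(1)] module_hom_smult[OF s'(2) t(1) n(1)] l n t
      x_smult_comm[OF L.module_axioms l(1) t(1)] x_smult_comm[OF L'.module_axioms l(3) t(1)]
    by (simp_all add: L.smult_assoc1 L'.smult_assoc1)
  then show "\<exists>n\<in>carrier N. f n = r \<odot>\<^sub>L l \<and> f' n = r \<odot>\<^bsub>L'\<^esub> l'"
    using t n(1) by (intro bexI[of _ "t \<odot>\<^sub>N n"]) auto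
qed

text \<open>For x N = 0, Ext^1(S, N) is in bijection with N: to an extension belongs the n with x l
  = f n for any lift l of the generator. Which module stands in the middle depends on n only through
  n = 0.\<close>

lemma card_Ext1_mid_simple:
  assumes fd: "M \<in> fd_modules k" "N \<in> fd_modules k" "L \<in> fd_modules k"
    and M: "card (carrier M) = q" "card (xim M) = 1" and N: "card (xim N) = 1"
  shows "card (Ext1_mid k M N L) = card {n \<in> carrier N. card (carrier L) = q * card (carrier N) \<and>
    card (xim L) = (if n = \<zero>\<^sub>N then 1 else q)}"
proof -
  note Mm = fdD(1)[OF fd(1)] and Nm = fdD(1)[OF fd(2)] and Lm = fdD(1)[OF fd(3)]
  interpret N: module \<Lambda> N by (fact Nm)
  have xN: "\<forall>n\<in>carrier N. x \<odot>\<^sub>N n = \<zero>\<^sub>N" using xim_card_1_iff[OF fdD[OF fd(2)]] N by blast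
  obtain m where m: "m \<in> carrier M" "m \<noteq> \<zero>\<^sub>M" "x \<odot>\<^sub>M m = \<zero>\<^sub>M" "(\<lambda>r. r \<odot>\<^sub>M m) ` carrier \<Lambda> = carrier M"
    using simple_generator[OF fdD[OF fd(1)] M] .
  note eq = equiv_ext_equiv[of M N]
  define \<rho> where "\<rho> n \<epsilon> \<longleftrightarrow> (\<exists>f L' g l. (f, L', g) \<in> \<epsilon> \<and> l \<in> carrier L' \<and> g l = m \<and> x \<odot>\<^bsub>L'\<^esub> l = f n)"
    for n :: nat and \<epsilon> :: "((nat \<Rightarrow> nat) \<times> 'a imod \<times> (nat \<Rightarrow> nat)) set"
  have Ext1: "\<epsilon> = ext_equiv k M N `` {E}" "E \<in> extensions k M N" if \<epsilon>: "\<epsilon> \<in> Ext1 k M N" "E \<in> \<epsilon>" for \<epsilon> E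
  proof -
    obtain y where y: "y \<in> extensions k M N" "\<epsilon> = ext_equiv k M N `` {y}"
      using \<epsilon>(1) unfolding Ext1_def by (rule quotientE) simp
    then have "(y, E) \<in> ext_equiv k M N" using \<epsilon>(2) by simp
    then show "\<epsilon> = ext_equiv k M N `` {E}" "E \<in> extensions k M N"
      using equiv_class_eq_iff[OF eq] y by auto
  qed
  have mid: "module_isomorphic \<Lambda> L' L \<longleftrightarrow> card (carrier L) = q * card (carrier N) \<and>
      card (xim L) = (if n = \<zero>\<^sub>N then 1 else q)"
    if h: "(f, L', g) \<in> extensions k M N" "l \<in> carrier L'" "g l = m" "n \<in> carrier N" "x \<odot>\<^bsub>L'\<^esub> l = f n" for f L' g l n
    using extension_of_simple_xim[OF fd(1,2) xN m(1,4) h] M(1)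
    unfolding isomorphic_iff[OF fdD[OF short_exact_extensionD(1)[OF h(1)]] fdD[OF fd(3)]] by metis
  let ?A = "{n \<in> carrier N. card (carrier L) = q * card (carrier N) \<and>
    card (xim L) = (if n = \<zero>\<^sub>N then 1 else q)}"
  show ?thesis
  proof (rule card_eq_by_relation[where \<rho> = \<rho>, symmetric])
    fix n assume n: "n \<in> ?A"
    then have nN: "n \<in> carrier N" by simp
    obtain f L' g l where E: "(f, L', g) \<in> extensions k M N" "l \<in> carrier L'" "g l = m" "x \<odot>\<^bsub>L'\<^esub> l = f n"
      using extension_of_simple_exists[OF fd(1,2) m nN bspec[OF xN nN]] .
    let ?c = "ext_equiv k M N `` {(f, L', g)}"
    have self: "(f, L', g) \<in> ?c" by (rule equiv_class_self[OF eq E(1)])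
    moreover have "?c \<in> Ext1 k M N" unfolding Ext1_def by (rule quotientI[OF E(1)])
    moreover have "module_isomorphic \<Lambda> L' L" using mid[OF E(1-3) nN E(4)] n by simp
    ultimately have "?c \<in> Ext1_mid k M N L" unfolding Ext1_mid_def by blast
    moreover have "\<rho> n ?c" unfolding \<rho>_def using self E by blast
    ultimately show "\<exists>\<epsilon>\<in>Ext1_mid k M N L. \<rho> n \<epsilon>" by blast
  next
    fix \<epsilon> assume \<epsilon>: "\<epsilon> \<in> Ext1_mid k M N L"
    then obtain f L' g where e: "\<epsilon> \<in> Ext1 k M N" "(f, L', g) \<in> \<epsilon>" "module_isomorphic \<Lambda> L' L"
      unfolding Ext1_mid_def by blast
    note E = Ext1(2)[OF e(1,2)]
    obtain l n where l: "l \<in> carrier L'" "g l = m" and n: "n \<in> carrier N" "x \<odot>\<^bsub>L'\<^esub> l = f n"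
      by (rule simple_extension_lift[OF Nm E m(1,3)])
    have "n \<in> ?A" using mid[OF E l n] e(3) n(1) by simp
    moreover have "\<rho> n \<epsilon>" unfolding \<rho>_def using e(2) l n(2) by blast
    ultimately show "\<exists>n\<in>?A. \<rho> n \<epsilon>" by blast
  next
    fix n \<epsilon> \<epsilon>' assume n: "n \<in> ?A" and \<epsilon>: "\<epsilon> \<in> Ext1_mid k M N L" "\<epsilon>' \<in> Ext1_mid k M N L" "\<rho> n \<epsilon>" "\<rho> n \<epsilon>'"
    then have nN: "n \<in> carrier N" and e: "\<epsilon> \<in> Ext1 k M N" "\<epsilon>' \<in> Ext1 k M N" by (simp_all add: Ext1_mid_def)
    obtain f L1 g l where 1: "(f, L1, g) \<in> \<epsilon>" "l \<in> carrier L1" "g l = m" "x \<odot>\<^bsub>L1\<^esub> l = f n"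
      using \<epsilon>(3) unfolding \<rho>_def by blast
    obtain f' L2 g' l' where 2: "(f', L2, g') \<in> \<epsilon>'" "l' \<in> carrier L2" "g' l' = m" "x \<odot>\<^bsub>L2\<^esub> l' = f' n"
      using \<epsilon>(4) unfolding \<rho>_def by blast
    note E1 = Ext1[OF e(1) 1(1)] and E2 = Ext1[OF e(2) 2(1)]
    have "((f, L1, g), (f', L2, g')) \<in> ext_equiv k M N"
      by (rule simple_extension_equiv[OF fd(1,2) m E1(2) E2(2) 1(2,3) 2(2,3) nN 1(4) 2(4)])
    then show "\<epsilon> = \<epsilon>'" unfolding E1(1) E2(1) by (rule equiv_class_eq[OF eq])
  next
    fix n n' \<epsilon> assume n: "n \<in> ?A" "n' \<in> ?A" and \<epsilon>: "\<epsilon> \<in> Ext1_mid k M N L" "\<rho> n \<epsilon>" "\<rho> n' \<epsilon>"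
    then have nN: "n \<in> carrier N" "n' \<in> carrier N" and e: "\<epsilon> \<in> Ext1 k M N" by (simp_all add: Ext1_mid_def)
    obtain f L1 g l where 1: "(f, L1, g) \<in> \<epsilon>" "l \<in> carrier L1" "g l = m" "x \<odot>\<^bsub>L1\<^esub> l = f n"
      using \<epsilon>(2) unfolding \<rho>_def by blast
    obtain f' L2 g' l' where 2: "(f', L2, g') \<in> \<epsilon>" "l' \<in> carrier L2" "g' l' = m" "x \<odot>\<^bsub>L2\<^esub> l' = f' n'"
      using \<epsilon>(3) unfolding \<rho>_def by blast
    note E1 = Ext1[OF e 1(1)] and E2 = Ext1[OF e 2(1)]
    have "((f, L1, g), (f', L2, g')) \<in> ext_equiv k M N" using 2(1) unfolding E1(1) by simp
    then obtain \<phi> where \<phi>: "\<phi> \<in> module_hom \<Lambda> L1 L2" "\<And>a. a \<in> carrier N \<Longrightarrow> \<phi> (f a) = f' a"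
      "\<And>l. l \<in> carrier L1 \<Longrightarrow> g' (\<phi> l) = g l" by (rule ext_equivE) simp
    note s = short_exact_extensionD[OF E1(2)] and s' = short_exact_extensionD[OF E2(2)]
    note L2m = fdD(1)[OF s'(1)]
    interpret L1: module \<Lambda> L1 by (rule fdD(1)[OF s(1)])
    interpret L2: module \<Lambda> L2 by (rule L2m)
    have \<phi>l: "\<phi> l \<in> carrier L2" by (rule module_hom_mem[OF \<phi>(1) 1(2)])
    \<comment> \<open>Two lifts of m differ by an element of the image of N, on which x vanishes;
      hence n does not depend on the lift.\<close>
    have "g' (\<phi> l \<ominus>\<^bsub>L2\<^esub> l') = \<zero>\<^sub>M"
      using module_hom_eq_iff[OF L2m Mm s'(3) \<phi>l 2(2)] \<phi>(3)[OF 1(2)] 1 2 by simp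
    then have "\<phi> l \<ominus>\<^bsub>L2\<^esub> l' \<in> f' ` carrier N" unfolding s'(6) using \<phi>l 2 by simp
    then obtain a where a: "a \<in> carrier N" "\<phi> l \<ominus>\<^bsub>L2\<^esub> l' = f' a" by auto
    have "x \<odot>\<^bsub>L2\<^esub> (\<phi> l \<ominus>\<^bsub>L2\<^esub> l') = f' (x \<odot>\<^sub>N a)"
      using a module_hom_smult[OF s'(2) x_in a(1)] by simp
    also have "\<dots> = \<zero>\<^bsub>L2\<^esub>" using xN a(1) module_hom_zero[OF Nm L2m s'(2)] by simp
    finally have "x \<odot>\<^bsub>L2\<^esub> \<phi> l = x \<odot>\<^bsub>L2\<^esub> l'"
      using module_hom_eq_iff[OF L2m L2m x_hom[OF L2m] \<phi>l 2(2)] by simp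
    moreover have "x \<odot>\<^bsub>L2\<^esub> \<phi> l = f' n"
      using module_hom_smult[OF \<phi>(1) x_in 1(2)] 1(4) \<phi>(2)[OF nN(1)] by simp
    ultimately have "f' n = f' n'" using 2(4) by simp
    then show "n = n'" using inj_onD[OF s'(4)] nN by simp
  qed
qed

text \<open>Of the a classes in Ext^1(S, N), n = 0 gives S + N and the other a - 1 give the module
  in which x has rank one. |Hom(S, N)| = a is the denominator. For a = 1 the second class does not
  exist, but its coefficient is 0.\<close>

lemma simple_mult:
  assumes S: "cls q 1 \<in> \<I>" and N: "cls a 1 \<in> \<I>"
  shows "bas q 1 \<otimes>\<^sub>\<H> bas a 1 = (\<lambda>C. (1 / real a) * (bas (q * a) 1 C + (real a - 1) * bas (q * a) q C))"
    "a \<noteq> 1 \<Longrightarrow> cls (q * a) q \<in> \<I>"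
proof -
  define M N where MN: "M = rep (cls q 1)" "N = rep (cls a 1)"
  note fd = rep_fd[OF S, folded MN] rep_fd[OF N, folded MN]
  note Mm = fdD[OF fd(1)] and Nm = fdD[OF fd(2)]
  note cM = rep_cls[OF S, folded MN] and cN = rep_cls[OF N, folded MN]
  interpret N: module \<Lambda> N by (fact Nm(1))
  have xN: "\<forall>n\<in>carrier N. x \<odot>\<^sub>N n = \<zero>\<^sub>N" using xim_card_1_iff[OF Nm] cN by blast
  obtain m where m: "m \<in> carrier M" "m \<noteq> \<zero>\<^sub>M" "x \<odot>\<^sub>M m = \<zero>\<^sub>M" "(\<lambda>r. r \<odot>\<^sub>M m) ` carrier \<Lambda> = carrier M"
    using simple_generator[OF Mm] cM by blast
  note ann = ann_simple(1)[OF Mm(1) m(1,3,2)]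
  have apos: "a > 0" using module_card_pos[OF Nm] cN by simp
  show ex: "cls (q * a) q \<in> \<I>" if "a \<noteq> 1"
  proof -
    have "\<not> carrier N \<subseteq> {\<zero>\<^sub>N}"
    proof
      assume "carrier N \<subseteq> {\<zero>\<^sub>N}"
      then have "card (carrier N) \<le> 1" using card_mono[of "{\<zero>\<^sub>N}" "carrier N"] by simp
      then show False using \<open>a \<noteq> 1\<close> apos cN by simp
    qed
    then obtain n where n: "n \<in> carrier N" "n \<noteq> \<zero>\<^sub>N" by blast
    obtain f L g l where E: "(f, L, g) \<in> extensions k M N" "l \<in> carrier L" "g l = m" "x \<odot>\<^sub>L l = f n"
      using extension_of_simple_exists[OF fd m n(1) bspec[OF xN n(1)]] .
    have "card (xim L) = q" "card (carrier L) = q * a"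
      using extension_of_simple_xim[OF fd xN m(1,4) E(1-3) n(1) E(4)] n(2) cM cN by simp_all
    then show ?thesis using cls_in[OF fdD[OF short_exact_extensionD(1)[OF E(1)]]] by simp
  qed
  have "{n \<in> carrier N. \<forall>r\<in>carrier \<Lambda>. r \<odot>\<^sub>M m = \<zero>\<^sub>M \<longrightarrow> r \<odot>\<^sub>N n = \<zero>\<^sub>N} = carrier N"
  proof (intro equalityI subsetI CollectI conjI ballI impI)
    fix n r assume n: "n \<in> carrier N" and r: "r \<in> carrier \<Lambda>" "r \<odot>\<^sub>M m = \<zero>\<^sub>M"
    then obtain s where "s \<in> carrier \<Lambda>" "r = x \<otimes>\<^sub>\<Lambda> s" using ann by blast
    then have "r \<odot>\<^sub>N n = x \<odot>\<^sub>N (s \<odot>\<^sub>N n)" "s \<odot>\<^sub>N n \<in> carrier N"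
      using n N.smult_assoc1[OF x_in, of s n] by simp_all
    then show "r \<odot>\<^sub>N n = \<zero>\<^sub>N" using bspec[OF xN] by simp
  qed simp
  then have hom: "card (Hom \<Lambda> M N) = a" using card_Hom_cyclic[OF Mm(1) Nm(1) m(1,4)] cN by simp
  show "bas q 1 \<otimes>\<^sub>\<H> bas a 1 = (\<lambda>C. (1 / real a) * (bas (q * a) 1 C + (real a - 1) * bas (q * a) q C))"
  proof
    fix C
    have in1: "cls (q * a) 1 \<in> \<I>" using cls_mult_in[OF S N] by simp
    show "(bas q 1 \<otimes>\<^sub>\<H> bas a 1) C = (1 / real a) * (bas (q * a) 1 C + (real a - 1) * bas (q * a) q C)"
    proof (cases "C \<in> \<I>")
      case False
      then have "C \<noteq> cls (q * a) 1" "a = 1 \<or> C \<noteq> cls (q * a) q" using in1 ex by auto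
      then show ?thesis unfolding bas_mult[OF S N] using False by (auto simp: bas_def)
    next
      case C: True
      have "real (card (Ext1_mid k M N (rep C))) = bas (q * a) 1 C + (real a - 1) * bas (q * a) q C"
      proof -
        let ?A = "{n \<in> carrier N. card (carrier (rep C)) = q * a \<and>
          card (xim (rep C)) = (if n = \<zero>\<^sub>N then 1 else q)}"
        have e: "card (Ext1_mid k M N (rep C)) = card ?A"
          using card_Ext1_mid_simple[OF fd rep_fd[OF C]] cM cN by simp
        consider (s) "C = cls (q * a) 1" | (r) "C = cls (q * a) q" | (o) "C \<noteq> cls (q * a) 1" "C \<noteq> cls (q * a) q" by blast
        then show ?thesis
        proof cases
          case s
          then have c: "card (carrier (rep C)) = q * a" "card (xim (rep C)) = 1" using class_eq_cls_iff[OF C] by blast+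
          then have "?A = {\<zero>\<^sub>N}" using q_gt_1 by auto
          moreover have "C \<noteq> cls (q * a) q" using class_eq_cls_iff[OF C, of "q * a" q] c q_gt_1 by simp
          ultimately show ?thesis using e s by (simp add: bas_def)
        next
          case r
          then have c: "card (carrier (rep C)) = q * a" "card (xim (rep C)) = q" using class_eq_cls_iff[OF C] by blast+
          then have "?A = carrier N - {\<zero>\<^sub>N}" using q_gt_1 by auto
          moreover have "C \<noteq> cls (q * a) 1" using class_eq_cls_iff[OF C, of "q * a" 1] c q_gt_1 by simp
          ultimately show ?thesis using e r cN Nm(2) apos by (simp add: bas_def of_nat_diff)
        next
          case o
          then have A: "?A = {}" using class_eq_cls_iff[OF C] by (auto split: if_splits)
          have "card (Ext1_mid k M N (rep C)) = 0" unfolding e A by (rule card.empty)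
          then show ?thesis using o by (simp add: bas_def)
        qed
      qed
      then show ?thesis unfolding bas_mult[OF S N] hall_const_def MN[symmetric] hom using C by simp
    qed
  qed
qed

text \<open>The regular module is also injective, so in this order, too, only the split class
  occurs; and |Hom(S, K)| = q, the number of elements of K killed by x, equals |Hom(K, S)|.\<close>

lemma simple_regular_mult:
  assumes S: "cls q 1 \<in> \<I>"
  shows "bas q 1 \<otimes>\<^sub>\<H> bas (q * q) q = bas (q * q) q \<otimes>\<^sub>\<H> bas q 1"
proof
  fix C
  define M N where MN: "M = rep (cls q 1)" "N = rep (cls (q * q) q)"
  note fd = rep_fd[OF S, folded MN] rep_fd[OF regular_in, folded MN]
  note Mm = fdD[OF fd(1)] and Nm = fdD[OF fd(2)]
  note cM = rep_cls[OF S, folded MN] and cN = rep_cls[OF regular_in, folded MN]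
  interpret N: module \<Lambda> N by (fact Nm(1))
  obtain m where m: "m \<in> carrier M" "m \<noteq> \<zero>\<^sub>M" "x \<odot>\<^sub>M m = \<zero>\<^sub>M" "(\<lambda>r. r \<odot>\<^sub>M m) ` carrier \<Lambda> = carrier M"
    using simple_generator[OF Mm] cM by blast
  note ann = ann_simple(1)[OF Mm(1) m(1,3,2)]
  have kerN: "card {n \<in> carrier N. x \<odot>\<^sub>N n = \<zero>\<^sub>N} = q"
    using card_hom_image[OF Nm(1,1) x_hom[OF Nm(1)] Nm(2)] cN q_gt_1 by (simp add: xim_def)
  have acyc: "n \<in> xim N" if n: "n \<in> carrier N" "x \<odot>\<^sub>N n = \<zero>\<^sub>N" for n
  proof -
    have "xim N = {n \<in> carrier N. x \<odot>\<^sub>N n = \<zero>\<^sub>N}"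
      by (rule card_subset_eq) (use kerN cN Nm x_x_smult[OF Nm(1)] in \<open>auto simp: xim_def\<close>)
    then show ?thesis using n by simp
  qed
  have lift: "\<exists>l\<in>carrier L. g l = m \<and> x \<odot>\<^sub>L l = \<zero>\<^sub>L" if E: "(f, L, g) \<in> extensions k M N" for f L g
  proof -
    note s = short_exact_extensionD[OF E]
    note Lm = fdD(1)[OF s(1)]
    interpret L: module \<Lambda> L by (rule Lm)
    interpret M: module \<Lambda> M by (rule Mm(1))
    obtain l n where l: "l \<in> carrier L" "g l = m" and n: "n \<in> carrier N" "x \<odot>\<^sub>L l = f n"
      by (rule simple_extension_lift[OF Nm(1) E m(1,3)])
    have "f (x \<odot>\<^sub>N n) = f \<zero>\<^sub>N"
      using module_hom_smult[OF s(2) x_in n(1)] n(2) x_x_smult[OF Lm l(1)] module_hom_zero[OF Nm(1) Lm s(2)] by simp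
    then have "x \<odot>\<^sub>N n = \<zero>\<^sub>N" using inj_onD[OF s(4)] n by simp
    \<comment> \<open>On K the kernel of x is its image, so x l = f (x n') for some n', and
      subtracting f n' corrects the lift to one that x kills.\<close>
    then obtain n' where n': "n' \<in> carrier N" "n = x \<odot>\<^sub>N n'" using acyc[OF n(1)] by (auto simp: xim_def)
    have fn': "f n' \<in> carrier L" by (rule module_hom_mem[OF s(2) n'(1)])
    have "x \<odot>\<^sub>L f n' = x \<odot>\<^sub>L l" using module_hom_smult[OF s(2) x_in n'(1)] n' n by simp
    then have "x \<odot>\<^sub>L (l \<ominus>\<^sub>L f n') = \<zero>\<^sub>L"
      using module_hom_eq_iff[OF Lm Lm x_hom[OF Lm] l(1) fn'] by simp
    moreover have "f n' \<in> {l \<in> carrier L. g l = \<zero>\<^sub>M}" unfolding s(6)[symmetric] using n'(1) by blast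
    then have "g (l \<ominus>\<^sub>L f n') = m"
      using module_hom_diff[OF Lm Mm(1) s(3) l(1) fn'] l m(1) M.M.minus_equality[of "\<zero>\<^sub>M" "\<zero>\<^sub>M"]
      by (simp add: a_minus_def)
    ultimately show ?thesis using l fn' by (intro bexI[of _ "l \<ominus>\<^sub>L f n'"]) auto
  qed
  obtain f L0 g where E: "(f, L0, g) \<in> extensions k M N"
    "card (carrier L0) = card (carrier M) * card (carrier N)" "card (xim L0) = card (xim M) * card (xim N)"
    using split_extension[OF fd(1,2)] .
  note s = short_exact_extensionD[OF E(1)]
  have uniq: "((f, L0, g), (f', L', g')) \<in> ext_equiv k M N" if E': "(f', L', g') \<in> extensions k M N" for f' L' g'
  proof -
    note s' = short_exact_extensionD[OF E']
    obtain l l' where l: "l \<in> carrier L0" "g l = m" "l' \<in> carrier L'" "g' l' = m"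
      and xl: "x \<odot>\<^bsub>L0\<^esub> l = \<zero>\<^bsub>L0\<^esub>" "x \<odot>\<^bsub>L'\<^esub> l' = \<zero>\<^bsub>L'\<^esub>" using lift[OF E(1)] lift[OF E'] by blast
    show ?thesis by (rule simple_extension_equiv[OF fd m E(1) E' l N.M.zero_closed])
        (simp_all add: xl module_hom_zero[OF Nm(1) fdD(1)[OF s(1)] s(2)] module_hom_zero[OF Nm(1) fdD(1)[OF s'(1)] s'(2)])
  qed
  have "{n \<in> carrier N. \<forall>r\<in>carrier \<Lambda>. r \<odot>\<^sub>M m = \<zero>\<^sub>M \<longrightarrow> r \<odot>\<^sub>N n = \<zero>\<^sub>N} =
    {n \<in> carrier N. x \<odot>\<^sub>N n = \<zero>\<^sub>N}"
  proof (intro Collect_cong conj_cong refl iffI ballI impI)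
    fix n r assume n: "n \<in> carrier N" "x \<odot>\<^sub>N n = \<zero>\<^sub>N" and r: "r \<in> carrier \<Lambda>" "r \<odot>\<^sub>M m = \<zero>\<^sub>M"
    then obtain s where "s \<in> carrier \<Lambda>" "r = x \<otimes>\<^sub>\<Lambda> s" using ann by blast
    then show "r \<odot>\<^sub>N n = \<zero>\<^sub>N" using n x_smult_comm[OF Nm(1) n(1), of s] by (simp add: N.smult_assoc1)
  qed (use m(3) x_in in blast)
  then have hom: "card (Hom \<Lambda> M N) = q" using card_Hom_cyclic[OF Mm(1) Nm(1) m(1,4)] kerN by simp
  show "(bas q 1 \<otimes>\<^sub>\<H> bas (q * q) q) C = (bas (q * q) q \<otimes>\<^sub>\<H> bas q 1) C"
  proof (cases "C \<in> \<I>")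
    case True
    have iso: "module_isomorphic \<Lambda> L0 (rep C) \<longleftrightarrow> C = cls (q * q * q) (q * 1)"
      using isomorphic_iff[OF fdD[OF s(1)] fdD[OF rep_fd[OF True]]] class_eq_cls_iff[OF True] E(2,3) cM cN by auto
    have "hall_const k (cls q 1) (cls (q * q) q) C = (if C = cls (q * q * q) (q * 1) then 1 else 0) / real q"
    proof -
      have "card (Ext1_mid k M N (rep C)) = (if module_isomorphic \<Lambda> L0 (rep C) then 1 else 0)"
        by (rule card_Ext1_mid_unique[OF rep_fd[OF True] fd(2) E(1)]) (rule uniq)
      then show ?thesis unfolding hall_const_def MN[symmetric] hom using iso by simp
    qed
    then show ?thesis
      unfolding bas_mult[OF S regular_in] bas_mult[OF regular_in S] hall_const_regular[OF S True] by simp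
  next
    case False
    then show ?thesis unfolding bas_mult[OF S regular_in] bas_mult[OF regular_in S] by simp
  qed
qed

end

section \<open>Acyclic modules and commutativity of the Hall algebra\<close>

text \<open>Induction on the size of the support, removing one basis element at a time.\<close>

lemma (in structure_constants) algebra_induct [consumes 1, case_names zero add smult basis]:
  assumes \<phi>: "\<phi> \<in> carrier H" and zero: "P (\<lambda>_. 0)"
    and add: "\<And>\<phi> \<psi>. \<phi> \<in> carrier H \<Longrightarrow> \<psi> \<in> carrier H \<Longrightarrow> P \<phi> \<Longrightarrow> P \<psi> \<Longrightarrow> P (\<lambda>C. \<phi> C + \<psi> C)"
    and smult: "\<And>c \<phi>. c \<in> F \<Longrightarrow> \<phi> \<in> carrier H \<Longrightarrow> P \<phi> \<Longrightarrow> P (\<lambda>C. c * \<phi> C)"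
    and basis: "\<And>A. A \<in> I \<Longrightarrow> P (\<lambda>C. if C = A then 1 else 0)"
  shows "P \<phi>" using \<phi>
proof (induction "card {C. \<phi> C \<noteq> 0}" arbitrary: \<phi> rule: less_induct)
  case less
  note a = carrierD[OF less.prems]
  show ?case
  proof (cases "{C. \<phi> C \<noteq> 0} = {}")
    case True
    then have "\<phi> = (\<lambda>_. 0)" by auto
    then show ?thesis using zero by simp
  next
    case False
    then obtain A where A: "\<phi> A \<noteq> 0" by auto
    then have AI: "A \<in> I" using a(3) by auto
    let ?\<psi> = "\<phi>(A := 0)"
    have \<psi>: "?\<psi> \<in> carrier H" by (rule carrierI[where S = "{C. \<phi> C \<noteq> 0}"]) (use a F in auto)
    have "{C. ?\<psi> C \<noteq> 0} \<subset> {C. \<phi> C \<noteq> 0}" using A by auto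
    then have "card {C. ?\<psi> C \<noteq> 0} < card {C. \<phi> C \<noteq> 0}" using a(2) by (rule psubset_card_mono[rotated])
    then have P: "P ?\<psi>" using less.hyps \<psi> by blast
    have c: "(\<lambda>C. \<phi> A * (if C = A then 1 else 0)) \<in> carrier H"
      by (rule smult_carrier[OF a(1) basis_carrier[OF AI]])
    have "P (\<lambda>C. \<phi> A * (if C = A then 1 else 0))"
      by (rule smult[OF a(1) basis_carrier[OF AI] basis[OF AI]])
    from add[OF c \<psi> this P] show ?thesis by (rule back_subst[of P]) auto
  qed
qed

context ialg_dual
begin

text \<open>Exactness of the complex M -> M -> M given by x. One inclusion suffices, as x^2 = 0
  provides the other. This is the homological condition that behaves well in short exact
  sequences.\<close>

definition acyclic_module :: "('a list set, 'm) module \<Rightarrow> bool" where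
  "acyclic_module M \<longleftrightarrow> (\<forall>m\<in>carrier M. x \<odot>\<^sub>M m = \<zero>\<^sub>M \<longrightarrow> m \<in> xim M)"

lemma acyclic_regular: "acyclic_module (regular_module \<Lambda>)"
  unfolding acyclic_module_def xim_regular using x_mult_zero_iff by auto

lemma acyclic_direct_sum: "acyclic_module M \<Longrightarrow> acyclic_module N \<Longrightarrow> acyclic_module (direct_sum M N)"
  unfolding acyclic_module_def xim_direct_sum by auto

lemma acyclic_isomorphic:
  assumes "module \<Lambda> M" "module \<Lambda> N" "acyclic_module M" "module_isomorphic \<Lambda> M N"
  shows "acyclic_module N"
proof -
  obtain f where f: "f \<in> module_hom \<Lambda> M N" "bij_betw f (carrier M) (carrier N)"
    using assms(4) by (auto simp: module_isomorphic_def)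
  interpret M: module \<Lambda> M by fact
  show ?thesis unfolding acyclic_module_def
  proof (intro ballI impI)
    fix n assume n: "n \<in> carrier N" "x \<odot>\<^sub>N n = \<zero>\<^sub>N"
    have "n \<in> f ` carrier M" using f(2) n(1) by (simp add: bij_betw_def)
    then obtain m where m: "n = f m" "m \<in> carrier M" by (rule imageE)
    have "f (x \<odot>\<^sub>M m) = f \<zero>\<^sub>M"
      using module_hom_smult[OF f(1) x_in m(2)] m n module_hom_zero[OF assms(1,2) f(1)] by simp
    then have "x \<odot>\<^sub>M m = \<zero>\<^sub>M" using inj_onD[of f "carrier M"] f(2) m by (simp add: bij_betw_def)
    then have "m \<in> xim M" using assms(3) m(2) by (simp add: acyclic_module_def)
    then obtain m' where m': "m = x \<odot>\<^sub>M m'" "m' \<in> carrier M" unfolding xim_def by (rule imageE)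
    then have "n = x \<odot>\<^sub>N f m'" using m module_hom_smult[OF f(1) x_in m'(2)] by simp
    then show "n \<in> xim N" unfolding xim_def using module_hom_mem[OF f(1) m'(2)] by (rule image_eqI)
  qed
qed

text \<open>For acyclic \<open>P\<close> the short exact sequence \<open>0 \<rightarrow> P \<rightarrow> L \<rightarrow> M \<rightarrow> 0\<close> remains exact after applying
  \<open>x\<close>, so that \<open>L\<close> has the invariants of \<open>P \<oplus> M\<close>.\<close>

lemma xim_acyclic_sub:
  assumes P: "module \<Lambda> P" "finite (carrier P)" and L: "module \<Lambda> L" "finite (carrier L)"
    and M: "module \<Lambda> M" "finite (carrier M)"
    and ac: "acyclic_module P" and E: "short_exact \<Lambda> P L M f g"
  shows "card (xim L) = card (xim P) * card (xim M)" "card (carrier L) = card (carrier P) * card (carrier M)"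
proof -
  have f: "f \<in> module_hom \<Lambda> P L" "inj_on f (carrier P)" and g: "g \<in> module_hom \<Lambda> L M" "g ` carrier L = carrier M"
    and ex: "f ` carrier P = {l \<in> carrier L. g l = \<zero>\<^sub>M}" using E by (auto simp: short_exact_def)
  interpret P: module \<Lambda> P by fact
  interpret L: module \<Lambda> L by fact
  interpret M: module \<Lambda> M by fact
  have "card {l \<in> carrier L. g l = \<zero>\<^sub>M} = card (carrier P)"
    unfolding ex[symmetric] by (rule card_image[OF f(2)])
  then show "card (carrier L) = card (carrier P) * card (carrier M)"
    using card_hom_image[OF L(1) M(1) g(1) L(2)] g(2) by (simp add: mult.commute)
  have fm: "f p \<in> carrier L" "g (f p) = \<zero>\<^sub>M" if "p \<in> carrier P" for p using ex that by auto
  let ?h = "\<lambda>l. x \<odot>\<^sub>M g l"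
  have h: "?h \<in> module_hom \<Lambda> L M" by (rule module_hom_comp[OF g(1) x_hom[OF M(1)]])
  let ?K = "ker_module L M ?h"
  note K = module_ker_module[OF L(1) M(1) h]
  have "?h ` carrier L = xim M" unfolding xim_def g(2)[symmetric] by (simp only: image_image)
  then have c1: "card (carrier L) = card (xim M) * card (carrier ?K)"
    using card_hom_image[OF L(1) M(1) h L(2)] by simp
  have xK: "(\<lambda>l. x \<odot>\<^sub>L l) \<in> module_hom \<Lambda> ?K L" by (rule module_hom_ker_module[OF x_hom[OF L(1)]])
  have gx: "g (x \<odot>\<^sub>L l) = x \<odot>\<^sub>M g l" if "l \<in> carrier L" for l by (rule module_hom_smult[OF g(1) x_in that])
  have im: "(\<lambda>l. x \<odot>\<^sub>L l) ` carrier ?K = f ` xim P"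
  proof (intro equalityI subsetI)
    fix y assume "y \<in> (\<lambda>l. x \<odot>\<^sub>L l) ` carrier ?K"
    then obtain l where l: "l \<in> carrier L" "x \<odot>\<^sub>M g l = \<zero>\<^sub>M" "y = x \<odot>\<^sub>L l" by auto
    then have "y \<in> f ` carrier P" unfolding ex using gx by simp
    then obtain p where p: "y = f p" "p \<in> carrier P" by (rule imageE)
    have "f (x \<odot>\<^sub>P p) = f \<zero>\<^sub>P"
      using module_hom_smult[OF f(1) x_in p(2)] p l x_x_smult[OF L(1) l(1)] module_hom_zero[OF P(1) L(1) f(1)] by simp
    then have "x \<odot>\<^sub>P p = \<zero>\<^sub>P" using inj_onD[OF f(2)] p by simp
    then have "p \<in> xim P" using ac p by (simp add: acyclic_module_def)
    then show "y \<in> f ` xim P" using p by simp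
  next
    fix y assume "y \<in> f ` xim P"
    then obtain p where p: "p \<in> carrier P" "y = f (x \<odot>\<^sub>P p)" by (auto simp: xim_def)
    then have "y = x \<odot>\<^sub>L f p" using module_hom_smult[OF f(1) x_in p(1)] by simp
    moreover have "f p \<in> carrier ?K" using fm[OF p(1)] by simp
    ultimately show "y \<in> (\<lambda>l. x \<odot>\<^sub>L l) ` carrier ?K" by (rule image_eqI)
  qed
  have xs: "xim P \<subseteq> carrier P" by (auto simp: xim_def)
  have ker: "{l \<in> carrier ?K. x \<odot>\<^sub>L l = \<zero>\<^sub>L} = {l \<in> carrier L. x \<odot>\<^sub>L l = \<zero>\<^sub>L}"
  proof -
    have "x \<odot>\<^sub>M g l = \<zero>\<^sub>M" if "l \<in> carrier L" "x \<odot>\<^sub>L l = \<zero>\<^sub>L" for l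
      using gx[OF that(1)] that(2) module_hom_zero[OF L(1) M(1) g(1)] by simp
    then show ?thesis by auto
  qed
  have c2: "card (carrier ?K) = card (xim P) * card {l \<in> carrier L. x \<odot>\<^sub>L l = \<zero>\<^sub>L}"
    using card_hom_image[OF K L(1) xK] L(2) card_image[OF inj_on_subset[OF f(2) xs]]
    unfolding im ker by simp
  have c3: "card (carrier L) = card (xim L) * card {l \<in> carrier L. x \<odot>\<^sub>L l = \<zero>\<^sub>L}"
    using card_hom_image[OF L(1,1) x_hom[OF L(1)] L(2)] by (simp add: xim_def)
  have "\<zero>\<^sub>L \<in> {l \<in> carrier L. x \<odot>\<^sub>L l = \<zero>\<^sub>L}" by simp
  then have "card {l \<in> carrier L. x \<odot>\<^sub>L l = \<zero>\<^sub>L} \<noteq> 0" using L(2) card_0_eq[of "{l \<in> carrier L. x \<odot>\<^sub>L l = \<zero>\<^sub>L}"] by auto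
  then show "card (xim L) = card (xim P) * card (xim M)"
    using c1 c2 c3 by (simp add: mult.assoc[symmetric] mult.commute)
qed

lemma zero_fd: obtains Z where "Z \<in> fd_modules k" "carrier Z = {\<zero>\<^sub>Z}"
  using that[OF rep_fd[OF zero_class] rep_zero_class] .

text \<open>A free cover, built by adding one copy of the regular module for each element of A. Only
  acyclicity of the cover is recorded, and it passes to direct sums.\<close>

lemma acyclic_cover:
  assumes P: "P \<in> fd_modules k" and A: "finite A" "A \<subseteq> carrier P"
  shows "\<exists>F t. F \<in> fd_modules k \<and> acyclic_module F \<and> t \<in> module_hom \<Lambda> F P \<and> A \<subseteq> t ` carrier F"
  using A
proof (induction A rule: finite_induct)
  case empty
  obtain Z where Z: "Z \<in> fd_modules k" "carrier Z = {\<zero>\<^sub>Z}" by (rule zero_fd)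
  interpret Z: module \<Lambda> Z by (rule fdD(1)[OF Z(1)])
  interpret P: module \<Lambda> P by (rule fdD(1)[OF P])
  have "\<zero>\<^sub>Z = x \<odot>\<^sub>Z \<zero>\<^sub>Z" by simp
  then have "\<zero>\<^sub>Z \<in> xim Z" unfolding xim_def using Z.M.zero_closed by (rule image_eqI)
  then have "acyclic_module Z" using Z(2) by (simp add: acyclic_module_def)
  moreover have "(\<lambda>_. \<zero>\<^sub>P) \<in> module_hom \<Lambda> Z P" by (rule module_homI) auto
  ultimately show ?case using Z(1) by blast
next
  case (insert a A)
  then obtain F t where F: "F \<in> fd_modules k" "acyclic_module F" "t \<in> module_hom \<Lambda> F P" "A \<subseteq> t ` carrier F" by auto
  have a: "a \<in> carrier P" using insert by simp
  note Pm = fdD(1)[OF P] and Fm = fdD[OF F(1)]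
  interpret P: module \<Lambda> P by (rule Pm)
  interpret F: module \<Lambda> F by (rule Fm(1))
  let ?D = "direct_sum (regular_module \<Lambda>) F"
  note D = direct_sum_is_module[OF module_regular_module Fm(1)]
  have Df: "finite (carrier ?D)" using finite_R Fm(2) by simp
  let ?s = "\<lambda>(r, u). r \<odot>\<^sub>P a \<oplus>\<^sub>P t u"
  have s: "?s \<in> module_hom \<Lambda> ?D P" by (rule split_map_hom[OF Fm(1) Pm a F(3)])
  obtain Z :: "'a imod" and i where Z: "module \<Lambda> Z" "finite (carrier Z)" "i \<in> module_hom \<Lambda> ?D Z"
    "bij_betw i (carrier ?D) (carrier Z)" using nat_module_exists[OF D Df] .
  let ?j = "inv_into (carrier ?D) i"
  note jh = module_hom_inv_into[OF D Z(3,4)]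
  have ji: "?j (i y) = y" "i y \<in> carrier Z" if "y \<in> carrier ?D" for y
    using Z(4) that module_hom_mem[OF Z(3) that] by (simp_all add: bij_betw_def)
  have "module_isomorphic \<Lambda> ?D Z" using Z(3,4) by (auto simp: module_isomorphic_def)
  then have "acyclic_module Z" by (rule acyclic_isomorphic[OF D Z(1) acyclic_direct_sum[OF acyclic_regular F(2)]])
  moreover have "(\<lambda>y. ?s (?j y)) \<in> module_hom \<Lambda> Z P" by (rule module_hom_comp[OF jh s])
  moreover have "insert a A \<subseteq> (\<lambda>y. ?s (?j y)) ` carrier Z"
  proof
    have im: "?s y \<in> (\<lambda>y. ?s (?j y)) ` carrier Z" if y: "y \<in> carrier ?D" for y
      by (rule image_eqI[of _ _ "i y"]) (simp_all only: ji[OF y])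
    fix b assume "b \<in> insert a A"
    then consider "b = a" | "b \<in> A" by blast
    then show "b \<in> (\<lambda>y. ?s (?j y)) ` carrier Z"
    proof cases
      case 1
      have "?s (\<one>\<^sub>\<Lambda>, \<zero>\<^sub>F) = b" using 1 a module_hom_zero[OF Fm(1) Pm F(3)] by simp
      then show ?thesis using im[of "(\<one>\<^sub>\<Lambda>, \<zero>\<^sub>F)"] by simp
    next
      case 2
      then have "b \<in> t ` carrier F" using F(4) by blast
      then obtain u where u: "b = t u" "u \<in> carrier F" by (rule imageE)
      have "?s (\<zero>\<^sub>\<Lambda>, u) = b" using u a module_hom_mem[OF F(3) u(2)] by simp
      then show ?thesis using im[of "(\<zero>\<^sub>\<Lambda>, u)"] u by simp
    qed
  qed
  ultimately show ?case using fdI[OF Z(1,2)] by blast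
qed

lemma projective_lift:
  assumes "projective k P" "A \<in> fd_modules k" "B \<in> fd_modules k" "g \<in> module_hom \<Lambda> A B"
    "f \<in> module_hom \<Lambda> P B" "g ` carrier A = carrier B"
  shows "\<exists>h\<in>module_hom \<Lambda> P A. \<forall>y\<in>carrier P. g (h y) = f y"
proof -
  have "\<forall>A \<in> fd_modules k. \<forall>B \<in> fd_modules k. \<forall>g \<in> module_hom \<Lambda> A B. \<forall>f \<in> module_hom \<Lambda> P B.
    g ` carrier A = carrier B \<longrightarrow> (\<exists>h \<in> module_hom \<Lambda> P A. \<forall>y \<in> carrier P. g (h y) = f y)"
    using assms(1) unfolding projective_def by (rule conjunct2)
  from bspec[OF bspec[OF bspec[OF bspec[OF this assms(2)] assms(3)] assms(4)] assms(5)] assms(6)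
  show ?thesis by (rule mp)
qed

text \<open>A projective is a retract of an acyclic cover: an element killed by x is moved into the
  cover by the section, written there as a multiple of x, and moved back.\<close>

lemma projective_acyclic:
  assumes "projective k P"
  shows "acyclic_module P"
proof -
  have P: "P \<in> fd_modules k" using assms by (simp add: projective_def)
  note Pm = fdD[OF P]
  obtain F t where F: "F \<in> fd_modules k" "acyclic_module F" "t \<in> module_hom \<Lambda> F P" "carrier P \<subseteq> t ` carrier F"
    using acyclic_cover[OF P Pm(2) subset_refl] by blast
  have "t ` carrier F = carrier P" using F(4) module_hom_mem[OF F(3)] by auto
  then obtain h where h: "h \<in> module_hom \<Lambda> P F" "\<forall>y\<in>carrier P. t (h y) = y"
    using projective_lift[OF assms F(1) P F(3) module_hom_id] \<open>t ` carrier F = carrier P\<close> by blast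
  show ?thesis unfolding acyclic_module_def
  proof (intro ballI impI)
    fix y assume y: "y \<in> carrier P" "x \<odot>\<^sub>P y = \<zero>\<^sub>P"
    have hy: "h y \<in> carrier F" by (rule module_hom_mem[OF h(1) y(1)])
    have "x \<odot>\<^sub>F h y = \<zero>\<^sub>F"
      using module_hom_smult[OF h(1) x_in y(1)] y(2) module_hom_zero[OF Pm(1) fdD(1)[OF F(1)] h(1)] by simp
    then have "h y \<in> xim F" using F(2) hy by (simp add: acyclic_module_def)
    then obtain z where z: "h y = x \<odot>\<^sub>F z" "z \<in> carrier F" unfolding xim_def by (rule imageE)
    then have "y = x \<odot>\<^sub>P t z" using h(2) y(1) module_hom_smult[OF F(3) x_in z(2)] by metis
    then show "y \<in> xim P" unfolding xim_def using module_hom_mem[OF F(3) z(2)] by (rule image_eqI)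
  qed
qed

text \<open>Acyclicity of the first two terms of a short exact sequence implies that of the third.
  The chase is the part of the long exact homology sequence for x that is required, carried out by
  elements.\<close>

lemma pdim_acyclic:
  assumes "M \<in> pdim_le1 k"
  shows "M \<in> fd_modules k" "acyclic_module M"
proof -
  show M: "M \<in> fd_modules k" using assms by (simp add: pdim_le1_def)
  obtain P1 P0 f g where P: "projective k P1" "projective k P0" "short_exact \<Lambda> P1 P0 M f g"
    using assms unfolding pdim_le1_def by blast
  note a1 = projective_acyclic[OF P(1)] and a0 = projective_acyclic[OF P(2)]
  have fd: "P1 \<in> fd_modules k" "P0 \<in> fd_modules k" using P by (simp_all add: projective_def)
  note m = fdD(1)[OF fd(1)] fdD(1)[OF fd(2)] fdD(1)[OF M]
  have f: "f \<in> module_hom \<Lambda> P1 P0" "inj_on f (carrier P1)" and g: "g \<in> module_hom \<Lambda> P0 M" "g ` carrier P0 = carrier M"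
    and ex: "f ` carrier P1 = {l \<in> carrier P0. g l = \<zero>\<^sub>M}"
    using P(3) by (auto simp: short_exact_def)
  interpret P1: module \<Lambda> P1 by (rule m(1))
  interpret P0: module \<Lambda> P0 by (rule m(2))
  interpret M: module \<Lambda> M by (rule m(3))
  show "acyclic_module M" unfolding acyclic_module_def
  proof (intro ballI impI)
    fix y assume y: "y \<in> carrier M" "x \<odot>\<^sub>M y = \<zero>\<^sub>M"
    then have "y \<in> g ` carrier P0" using g(2) by simp
    then obtain p where p: "y = g p" "p \<in> carrier P0" by (rule imageE)
    have "g (x \<odot>\<^bsub>P0\<^esub> p) = \<zero>\<^sub>M" using module_hom_smult[OF g(1) x_in p(2)] p y by simp
    then have "x \<odot>\<^bsub>P0\<^esub> p \<in> f ` carrier P1" unfolding ex using p by simp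
    then obtain z where z: "x \<odot>\<^bsub>P0\<^esub> p = f z" "z \<in> carrier P1" by (rule imageE)
    have "f (x \<odot>\<^bsub>P1\<^esub> z) = f \<zero>\<^bsub>P1\<^esub>"
      using module_hom_smult[OF f(1) x_in z(2)] x_x_smult[OF m(2) p(2)] z(1) module_hom_zero[OF m(1,2) f(1)] by simp
    then have "x \<odot>\<^bsub>P1\<^esub> z = \<zero>\<^bsub>P1\<^esub>" using inj_onD[OF f(2)] z(2) by simp
    then have "z \<in> xim P1" using a1 z(2) by (simp add: acyclic_module_def)
    then obtain z' where z': "z = x \<odot>\<^bsub>P1\<^esub> z'" "z' \<in> carrier P1" unfolding xim_def by (rule imageE)
    have fz': "f z' \<in> carrier P0" "g (f z') = \<zero>\<^sub>M" using ex z'(2) by auto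
    have "x \<odot>\<^bsub>P0\<^esub> p = x \<odot>\<^bsub>P0\<^esub> f z'" using z z' module_hom_smult[OF f(1) x_in z'(2)] by simp
    then have "x \<odot>\<^bsub>P0\<^esub> (p \<ominus>\<^bsub>P0\<^esub> f z') = \<zero>\<^bsub>P0\<^esub>"
      using module_hom_eq_iff[OF m(2,2) x_hom[OF m(2)] p(2) fz'(1)] by simp
    then have "p \<ominus>\<^bsub>P0\<^esub> f z' \<in> xim P0" using a0 p(2) fz'(1) by (simp add: acyclic_module_def)
    then obtain w where w: "p \<ominus>\<^bsub>P0\<^esub> f z' = x \<odot>\<^bsub>P0\<^esub> w" "w \<in> carrier P0" unfolding xim_def by (rule imageE)
    have mz: "\<ominus>\<^sub>M \<zero>\<^sub>M = \<zero>\<^sub>M" by (rule M.M.minus_equality) simp_all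
    have "g (p \<ominus>\<^bsub>P0\<^esub> f z') = y"
      using module_hom_diff[OF m(2,3) g(1) p(2) fz'(1)] fz'(2) p y(1) by (simp add: a_minus_def mz)
    then have "y = x \<odot>\<^sub>M g w" using w module_hom_smult[OF g(1) x_in w(2)] by simp
    then show "y \<in> xim M" unfolding xim_def using module_hom_mem[OF g(1) w(2)] by (rule image_eqI)
  qed
qed

text \<open>An element m with x m different from 0 splits off a free summand whose complement is
  acyclic again. The image of m can be lifted arbitrarily, since m satisfies no relation, and the
  rest is lifted by induction. If x vanishes on P, acyclicity leaves P = 0.\<close>

lemma acyclic_projective:
  assumes "P \<in> fd_modules k" "acyclic_module P"
  shows "projective k P" using assms
proof (induction "card (carrier P)" arbitrary: P rule: less_induct)
  case less
  note P = less.prems(1)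
  note Pm = fdD[OF P]
  interpret P: module \<Lambda> P by (rule Pm(1))
  show ?case unfolding projective_def
  proof (intro conjI P ballI impI)
    fix A B g f assume AB: "A \<in> fd_modules k" "B \<in> fd_modules k" and g: "g \<in> module_hom \<Lambda> A B" "g ` carrier A = carrier B"
      and f: "f \<in> module_hom \<Lambda> P B"
    note Am = fdD(1)[OF AB(1)] and Bm = fdD(1)[OF AB(2)]
    interpret A: module \<Lambda> A by (rule Am)
    interpret B: module \<Lambda> B by (rule Bm)
    show "\<exists>h\<in>module_hom \<Lambda> P A. \<forall>y\<in>carrier P. g (h y) = f y"
    proof (cases "card (xim P) = 1")
      case True
      then have all: "\<forall>a\<in>carrier P. x \<odot>\<^sub>P a = \<zero>\<^sub>P" using xim_card_1_iff[OF Pm] by blast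
      have c: "y = \<zero>\<^sub>P" if y: "y \<in> carrier P" for y
      proof -
        have "y \<in> xim P" using less.prems(2) all y by (simp add: acyclic_module_def)
        then obtain z where "y = x \<odot>\<^sub>P z" "z \<in> carrier P" unfolding xim_def by (rule imageE)
        then show ?thesis using all by simp
      qed
      have "(\<lambda>_. \<zero>\<^sub>A) \<in> module_hom \<Lambda> P A" by (rule module_homI) auto
      moreover have "g \<zero>\<^sub>A = f y" if "y \<in> carrier P" for y
        using c[OF that] module_hom_zero[OF Am Bm g(1)] module_hom_zero[OF Pm(1) Bm f] by simp
      ultimately show ?thesis by (intro bexI[of _ "\<lambda>_. \<zero>\<^sub>A"] ballI)
    next
      case False
      then obtain m where m: "m \<in> carrier P" "x \<odot>\<^sub>P m \<noteq> \<zero>\<^sub>P" using xim_card_1_iff[OF Pm] by blast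
      note ann = ann_regular[OF Pm(1) m]
      obtain U where U: "Module.submodule U \<Lambda> P" "\<forall>r\<in>carrier \<Lambda>. r \<odot>\<^sub>P m \<in> U \<longrightarrow> r \<odot>\<^sub>P m = \<zero>\<^sub>P"
        "\<forall>a\<in>carrier P. \<exists>r\<in>carrier \<Lambda>. \<exists>u\<in>U. a = r \<odot>\<^sub>P m \<oplus>\<^sub>P u"
        using complement_exists[OF Pm m(1)] m(2) by metis
      note cs = card_split[OF Pm m(1) U]
      let ?U = "P\<lparr>carrier := U\<rparr>"
      have Us: "U \<subseteq> carrier P" by (rule P.submoduleE(1)[OF U(1)])
      have Uf: "finite U" using Us Pm(2) finite_subset by blast
      note Um = submodule_module[OF Pm(1) U(1)]
      have Ufd: "?U \<in> fd_modules k" by (rule fdI[OF Um]) (simp add: Uf)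
      have U0: "\<zero>\<^sub>P \<in> U" by (rule P.submodule_zero_mem[OF U(1)])
      have "{r \<in> carrier \<Lambda>. r \<odot>\<^sub>P m = \<zero>\<^sub>P} = {\<zero>\<^sub>\<Lambda>}" using ann(1) by auto
      then have "q * q * card U = card (carrier P)" using cs(1) card_R by simp
      moreover have "card U > 0" using U0 Uf by (auto simp: card_gt_0_iff)
      moreover have "q * q > 1" by (rule less_1_mult[OF q_gt_1 q_gt_1])
      ultimately have "1 * card U < card (carrier P)"
        using mult_strict_right_mono[of 1 "q * q" "card U"] by simp
      then have less: "card (carrier ?U) < card (carrier P)" by simp
      have "acyclic_module ?U" unfolding acyclic_module_def
      proof (intro ballI impI)
        fix u assume u: "u \<in> carrier ?U" "x \<odot>\<^bsub>?U\<^esub> u = \<zero>\<^bsub>?U\<^esub>"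
        then have "u \<in> xim P" using less.prems(2) Us by (auto simp: acyclic_module_def)
        then obtain z where z: "u = x \<odot>\<^sub>P z" "z \<in> carrier P" unfolding xim_def by (rule imageE)
        \<comment> \<open>Splitting z along Rm + U, the Rm-component of u = x z vanishes because u
          lies in U; hence u is x times the U-component v.\<close>
        then obtain r v where rv: "r \<in> carrier \<Lambda>" "v \<in> U" "z = r \<odot>\<^sub>P m \<oplus>\<^sub>P v" using U(3) by blast
        have vP: "v \<in> carrier P" using rv(2) Us by blast
        have "u = (x \<otimes>\<^sub>\<Lambda> r) \<odot>\<^sub>P m \<oplus>\<^sub>P x \<odot>\<^sub>P v"
          unfolding z(1) rv(3) using rv(1) m(1) vP by (simp add: P.smult_r_distr P.smult_assoc1)
        moreover have xv: "x \<odot>\<^sub>P v \<in> U" by (rule P.submoduleE(4)[OF U(1) x_in rv(2)])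
        ultimately have "(x \<otimes>\<^sub>\<Lambda> r) \<odot>\<^sub>P m \<oplus>\<^sub>P (x \<odot>\<^sub>P v \<oplus>\<^sub>P \<ominus>\<^sub>P u) = \<zero>\<^sub>P"
          using rv(1) m(1) vP P.M.r_neg[of u] z by (simp add: P.M.a_assoc[symmetric])
        moreover have "x \<odot>\<^sub>P v \<oplus>\<^sub>P \<ominus>\<^sub>P u \<in> U"
          using P.submoduleE(5)[OF U(1) xv P.submoduleE(3)[OF U(1)]] u by simp
        ultimately have "x \<odot>\<^sub>P v \<oplus>\<^sub>P \<ominus>\<^sub>P u = \<zero>\<^sub>P" using cs(3)[of "x \<otimes>\<^sub>\<Lambda> r"] rv(1) by simp
        then have "x \<odot>\<^sub>P v = u"
          using P.diff_eq_zero_iff[of "x \<odot>\<^sub>P v" u] vP z by (simp add: a_minus_def)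
        then show "u \<in> xim ?U" unfolding xim_def using rv(2) by (intro image_eqI[of _ _ v]) simp_all
      qed
      then have "projective k ?U" using less.hyps[OF less Ufd] by simp
      moreover have fU: "f \<in> module_hom \<Lambda> ?U B"
        by (rule module_homI) (simp_all add: subsetD[OF Us] module_hom_mem[OF f] module_hom_add[OF f] module_hom_smult[OF f])
      ultimately obtain h where h: "h \<in> module_hom \<Lambda> ?U A" "\<forall>u\<in>U. g (h u) = f u"
        using projective_lift[OF _ AB g(1) fU g(2)] by auto
      have hm: "h u \<in> carrier A" if "u \<in> U" for u using module_hom_mem[OF h(1)] that by simp
      have "f m \<in> g ` carrier A" unfolding g(2) by (rule module_hom_mem[OF f m(1)])
      then obtain a where a: "f m = g a" "a \<in> carrier A" by (rule imageE)
      have inc: "(\<lambda>u. u) \<in> module_hom \<Lambda> ?U P" by (rule module_homI) (use Us in auto)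
      note t = split_map_hom[OF Um Pm(1) m(1) inc] and th = split_map_hom[OF Um Am a(2) h(1)]
      note D = direct_sum_is_module[OF module_regular_module Um]
      have im: "(\<lambda>(r, u). r \<odot>\<^sub>P m \<oplus>\<^sub>P u) ` carrier (direct_sum (regular_module \<Lambda>) ?U) = carrier P"
      proof (intro equalityI subsetI)
        fix y assume "y \<in> carrier P"
        then obtain r u where "r \<in> carrier \<Lambda>" "u \<in> U" "y = r \<odot>\<^sub>P m \<oplus>\<^sub>P u" using U(3) by blast
        then show "y \<in> (\<lambda>(r, u). r \<odot>\<^sub>P m \<oplus>\<^sub>P u) ` carrier (direct_sum (regular_module \<Lambda>) ?U)"
          by (intro image_eqI[of _ _ "(r, u)"]) auto
      qed (use m(1) Us in auto)
      obtain H where H: "H \<in> module_hom \<Lambda> P A" "\<And>y. y \<in> carrier (direct_sum (regular_module \<Lambda>) ?U) \<Longrightarrow>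
          H ((\<lambda>(r, u). r \<odot>\<^sub>P m \<oplus>\<^sub>P u) y) = (\<lambda>(r, u). r \<odot>\<^sub>A a \<oplus>\<^sub>A h u) y"
      proof (rule module_hom_factor_surj[OF D Pm(1) Am t im th])
        fix l assume l: "l \<in> carrier (direct_sum (regular_module \<Lambda>) ?U)" "(\<lambda>(r, u). r \<odot>\<^sub>P m \<oplus>\<^sub>P u) l = \<zero>\<^sub>P"
        obtain r u where ru: "l = (r, u)" by (cases l)
        then have "r = \<zero>\<^sub>\<Lambda>" "u = \<zero>\<^sub>P" using l cs(3)[of r u] ann(1)[of r] by auto
        then show "(\<lambda>(r, u). r \<odot>\<^sub>A a \<oplus>\<^sub>A h u) l = \<zero>\<^sub>A"
          using ru a module_hom_zero[OF Um Am h(1)] by simp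
      qed blast
      have "g (H y) = f y" if y: "y \<in> carrier P" for y
      proof -
        obtain r u where ru: "r \<in> carrier \<Lambda>" "u \<in> U" "y = r \<odot>\<^sub>P m \<oplus>\<^sub>P u" using U(3) y by blast
        have uP: "u \<in> carrier P" using ru(2) Us by blast
        have "H y = r \<odot>\<^sub>A a \<oplus>\<^sub>A h u" using H(2)[of "(r, u)"] ru by simp
        then have "g (H y) = r \<odot>\<^sub>B g a \<oplus>\<^sub>B g (h u)"
          using module_hom_add[OF g(1) A.smult_closed[OF ru(1) a(2)] hm[OF ru(2)]] module_hom_smult[OF g(1) ru(1) a(2)] by simp
        also have "\<dots> = f y" unfolding ru(3)
          using module_hom_add[OF f P.smult_closed[OF ru(1) m(1)] uP] module_hom_smult[OF f ru(1) m(1)] a(1) h(2) ru(2) by simp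
        finally show ?thesis .
      qed
      then show ?thesis using H(1) by blast
    qed
  qed
qed

text \<open>An acyclic M is projective, so 0 -> 0 -> M -> M -> 0 is a resolution of the required
  length.\<close>

lemma pdim_iff: "M \<in> pdim_le1 k \<longleftrightarrow> M \<in> fd_modules k \<and> acyclic_module M"
proof
  assume M: "M \<in> fd_modules k \<and> acyclic_module M"
  obtain Z where Z: "Z \<in> fd_modules k" "carrier Z = {\<zero>\<^sub>Z}" by (rule zero_fd)
  interpret Z: module \<Lambda> Z by (rule fdD(1)[OF Z(1)])
  interpret M: module \<Lambda> M using M fdD(1) by blast
  have "\<zero>\<^sub>Z = x \<odot>\<^sub>Z \<zero>\<^sub>Z" by simp
  then have "\<zero>\<^sub>Z \<in> xim Z" unfolding xim_def using Z.M.zero_closed by (rule image_eqI)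
  then have "acyclic_module Z" using Z(2) by (simp add: acyclic_module_def)
  then have "projective k Z" by (rule acyclic_projective[OF Z(1)])
  moreover have "projective k M" using M acyclic_projective by blast
  moreover have "short_exact \<Lambda> Z M M (\<lambda>_. \<zero>\<^sub>M) (\<lambda>a. a)"
  proof -
    have "(\<lambda>_. \<zero>\<^sub>M) \<in> module_hom \<Lambda> Z M" by (rule module_homI) auto
    moreover have "inj_on (\<lambda>_. \<zero>\<^sub>M) (carrier Z)" unfolding Z(2) by simp
    moreover have "(\<lambda>_. \<zero>\<^sub>M) ` carrier Z = {l \<in> carrier M. l = \<zero>\<^sub>M}" unfolding Z(2) by auto
    ultimately show ?thesis by (simp add: short_exact_def module_hom_id)
  qed
  ultimately show "M \<in> pdim_le1 k" unfolding pdim_le1_def using M by blast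
qed (use pdim_acyclic in blast)

lemma hall_zero: "\<zero>\<^sub>\<H> = (\<lambda>_. 0)" and hall_add: "\<phi> \<oplus>\<^sub>\<H> \<psi> = (\<lambda>C. \<phi> C + \<psi> C)"
  and hall_one: "\<one>\<^sub>\<H> = hall_basis k zero_module" by (simp_all add: hall_algebra_def)

lemma hall_ideal_zero: "hall_ideal k = {\<zero>\<^sub>\<H>}"
proof -
  let ?S = "{(\<lambda>C. hall_basis k P C - hall_basis k P' C) | P P'.
         P \<in> pdim_le1 k \<and> P' \<in> pdim_le1 k \<and> module_isomorphic \<Lambda> P P'} \<union>
      {(\<lambda>C. hall_basis k L C - hall_basis k (direct_sum P M) C) | P L M.
         P \<in> pdim_le1 k \<and> L \<in> fd_modules k \<and> M \<in> fd_modules k \<and> (\<exists>f g. short_exact \<Lambda> P L M f g)}"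
  have "\<phi> = \<zero>\<^sub>\<H>" if "\<phi> \<in> ?S" for \<phi> using that
  proof
    assume "\<phi> \<in> {(\<lambda>C. hall_basis k P C - hall_basis k P' C) | P P'.
         P \<in> pdim_le1 k \<and> P' \<in> pdim_le1 k \<and> module_isomorphic \<Lambda> P P'}"
    then obtain P P' where P: "P \<in> fd_modules k" "P' \<in> fd_modules k" "module_isomorphic \<Lambda> P P'"
      and \<phi>: "\<phi> = (\<lambda>C. hall_basis k P C - hall_basis k P' C)" using pdim_iff by blast
    have "hall_basis k P = hall_basis k P'"
      using isoclass_eq_iff[OF fdD[OF P(1)] fdD(1)[OF P(2)]] P(3) by (simp add: hall_basis_def)
    then show ?thesis using \<phi> hall_zero by simp
  next
    assume "\<phi> \<in> {(\<lambda>C. hall_basis k L C - hall_basis k (direct_sum P M) C) | P L M.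
         P \<in> pdim_le1 k \<and> L \<in> fd_modules k \<and> M \<in> fd_modules k \<and> (\<exists>f g. short_exact \<Lambda> P L M f g)}"
    then obtain P L M f g where P: "P \<in> fd_modules k" "acyclic_module P" "L \<in> fd_modules k" "M \<in> fd_modules k" "short_exact \<Lambda> P L M f g"
      and \<phi>: "\<phi> = (\<lambda>C. hall_basis k L C - hall_basis k (direct_sum P M) C)" using pdim_iff by blast
    note m = fdD[OF P(1)] fdD[OF P(3)] fdD[OF P(4)]
    have "finite (carrier (direct_sum P M))" using m by simp
    then have "hall_basis k L = hall_basis k (direct_sum P M)" using xim_acyclic_sub[OF m P(2,5)]
      unfolding hall_basis_bas[OF m(3,4)] hall_basis_bas[OF direct_sum_is_module[OF m(1,5)] \<open>finite (carrier (direct_sum P M))\<close>]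
      by (simp add: xim_direct_sum card_cartesian_product)
    then show ?thesis using \<phi> hall_zero by simp
  qed
  then have S: "?S \<subseteq> {\<zero>\<^sub>\<H>}" by blast
  have c: "?S \<subseteq> carrier \<H>" by (rule subset_trans[OF S]) simp
  have "hall_ideal k \<subseteq> {\<zero>\<^sub>\<H>}"
    unfolding hall_ideal_def by (rule H.genideal_minimal[OF H.zeroideal S])
  moreover have "\<zero>\<^sub>\<H> \<in> hall_ideal k"
    unfolding hall_ideal_def using additive_subgroup.zero_closed[OF ideal.axioms(1)[OF H.genideal_ideal[OF c]]] .
  ultimately show ?thesis by blast
qed

section \<open>Generation by the classes of S and of the regular module, and commutativity\<close>

lemma simple_in: "cls q 1 \<in> \<I>"
proof -
  note R = module_regular_module
  \<comment> \<open>The simple module is realised as the ideal (x) of the ring.\<close>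
  let ?S = "(regular_module \<Lambda>)\<lparr>carrier := xim (regular_module \<Lambda>)\<rparr>"
  have sub: "Module.submodule (xim (regular_module \<Lambda>)) \<Lambda> (regular_module \<Lambda>)"
    unfolding xim_def by (rule image_submodule[OF R R x_hom[OF R]])
  note S = submodule_module[OF R sub]
  have fin: "finite (xim (regular_module \<Lambda>))" using finite_R by (simp add: xim_def)
  have "\<forall>a\<in>carrier ?S. x \<odot>\<^bsub>?S\<^esub> a = \<zero>\<^bsub>?S\<^esub>" unfolding xim_def using x_x_smult[OF R] by auto
  then have "card (xim ?S) = 1" using xim_card_1_iff[OF S] fin by simp
  then show ?thesis using cls_in[OF S] fin by (simp add: q_def)
qed

lemma one_bas: "\<one>\<^sub>\<H> = bas 1 1"
proof -
  have "card (xim (zero_module :: ('a list set, unit) module)) = 1"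
    using xim_card_1_iff[OF module_zero_module] by (simp add: zero_module_def)
  then show ?thesis using hall_basis_bas[OF module_zero_module] hall_one by simp
qed

lemma regular_summand:
  assumes ab: "cls a b \<in> \<I>" "b \<noteq> 1"
  obtains c d where "a = q * q * c" "b = q * d" "cls c d \<in> \<I>" "0 < c" "c < a"
proof -
  define M where MN: "M = rep (cls a b)"
  note Mm = fdD[OF rep_fd[OF ab(1)], folded MN] and cM = rep_cls[OF ab(1), folded MN]
  interpret M: module \<Lambda> M by (rule Mm(1))
  obtain m where m: "m \<in> carrier M" "x \<odot>\<^sub>M m \<noteq> \<zero>\<^sub>M" using xim_card_1_iff[OF Mm] cM ab(2) by blast
  note ann = ann_regular[OF Mm(1) m]
  obtain U where U: "Module.submodule U \<Lambda> M" "\<forall>r\<in>carrier \<Lambda>. r \<odot>\<^sub>M m \<in> U \<longrightarrow> r \<odot>\<^sub>M m = \<zero>\<^sub>M"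
    "\<forall>a\<in>carrier M. \<exists>r\<in>carrier \<Lambda>. \<exists>u\<in>U. a = r \<odot>\<^sub>M m \<oplus>\<^sub>M u"
    using complement_exists[OF Mm m(1)] m(2) by metis
  note cs = card_split[OF Mm m(1) U]
  let ?U = "M\<lparr>carrier := U\<rparr>"
  note Um = submodule_module[OF Mm(1) U(1)]
  have Uf: "finite (carrier ?U)" using M.submoduleE(1)[OF U(1)] Mm(2) finite_subset by auto
  define c d where cd: "c = card U" "d = card (xim ?U)"
  have inU: "cls c d \<in> \<I>" using cls_in[OF Um Uf] cd by simp
  have "{r \<in> carrier \<Lambda>. r \<odot>\<^sub>M m = \<zero>\<^sub>M} = {\<zero>\<^sub>\<Lambda>}" using ann(1) by auto
  then have a: "a = q * q * c" using cs(1) card_R cM cd by simp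
  have "{r \<in> carrier \<Lambda>. x \<odot>\<^sub>M (r \<odot>\<^sub>M m) = \<zero>\<^sub>M} = xim (regular_module \<Lambda>)"
    unfolding xim_regular using ann(2) x_mult_zero_iff by auto
  then have "q * q * d = b * q" using cs(2) card_R cM cd by (simp add: q_def)
  then have b: "b = q * d" using q_gt_1 by simp
  have c0: "c > 0" using module_card_pos[OF Um Uf] cd by simp
  have "q * q > 1" by (rule less_1_mult[OF q_gt_1 q_gt_1])
  then have "c < a" unfolding a using c0 by simp
  then show ?thesis using that a b inU c0 by blast
qed

text \<open>Induction on |M|. If xM is nonzero, M = K + N and [M] is a multiple of [K] [N]. If xM =
  0, the product [S] [N] with M = S + N gives [M] and a multiple of a class of the same size with
  nonzero x, which the first case, proved beforehand, handles.\<close>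

lemma hall_induct_cls:
  assumes one: "P \<one>\<^sub>\<H>"
    and add: "\<And>\<phi> \<psi>. \<phi> \<in> carrier \<H> \<Longrightarrow> \<psi> \<in> carrier \<H> \<Longrightarrow> P \<phi> \<Longrightarrow> P \<psi> \<Longrightarrow> P (\<lambda>C. \<phi> C + \<psi> C)"
    and smult: "\<And>c \<phi>. c \<in> Qv k \<Longrightarrow> \<phi> \<in> carrier \<H> \<Longrightarrow> P \<phi> \<Longrightarrow> P (\<lambda>C. c * \<phi> C)"
    and reg: "\<And>\<phi>. \<phi> \<in> carrier \<H> \<Longrightarrow> P \<phi> \<Longrightarrow> P (bas (q * q) q \<otimes>\<^sub>\<H> \<phi>)"
    and simple: "\<And>\<phi>. \<phi> \<in> carrier \<H> \<Longrightarrow> P \<phi> \<Longrightarrow> P (bas q 1 \<otimes>\<^sub>\<H> \<phi>)"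
  shows "cls a b \<in> \<I> \<Longrightarrow> P (bas a b)"
proof (induction a arbitrary: b rule: less_induct)
  case (less a)
  have step: "P (bas a b)" if ab: "cls a b \<in> \<I>" "b \<noteq> 1" for b
  proof -
    obtain c d where a: "a = q * q * c" and b: "b = q * d" and inU: "cls c d \<in> \<I>" and c0: "0 < c" and "c < a"
      using regular_summand[OF ab] .
    then have "P (bas c d)" using less.IH inU by blast
    then have "P (bas (q * q) q \<otimes>\<^sub>\<H> bas c d)" by (rule reg[OF bas_carrier[OF inU]])
    then have "P (\<lambda>C. real c * (bas (q * q) q \<otimes>\<^sub>\<H> bas c d) C)"
      using bas_carrier[OF regular_in] bas_carrier[OF inU] by (intro smult) (auto simp: Qv_Rats)
    also have "(\<lambda>C. real c * (bas (q * q) q \<otimes>\<^sub>\<H> bas c d) C) = bas a b"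
      unfolding regular_mult[OF inU] a b using c0 by auto
    finally show ?thesis .
  qed
  show ?case
  proof (cases "b = 1")
    case False
    then show ?thesis using step less.prems by blast
  next
    case b: True
    define M where MN: "M = rep (cls a 1)"
    have prem: "cls a 1 \<in> \<I>" using less.prems b by simp
    note Mm = fdD[OF rep_fd[OF prem], folded MN] and cM = rep_cls[OF prem, folded MN]
    interpret M: module \<Lambda> M by (rule Mm(1))
    have xM: "\<forall>a\<in>carrier M. x \<odot>\<^sub>M a = \<zero>\<^sub>M" using xim_card_1_iff[OF Mm] cM by blast
    show ?thesis
    proof (cases "a = 1")
      case True
      then show ?thesis using one one_bas b by simp
    next
      case a1: False
      have "card (carrier M) \<noteq> 1" using a1 cM by simp
      then obtain m where m: "m \<in> carrier M" "m \<noteq> \<zero>\<^sub>M" by (rule nonzero_element[OF Mm(1)])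
      note ann = ann_simple(1)[OF Mm(1) m(1) bspec[OF xM m(1)] m(2)]
      obtain U where U: "Module.submodule U \<Lambda> M" "\<forall>r\<in>carrier \<Lambda>. r \<odot>\<^sub>M m \<in> U \<longrightarrow> r \<odot>\<^sub>M m = \<zero>\<^sub>M"
        "\<forall>a\<in>carrier M. \<exists>r\<in>carrier \<Lambda>. \<exists>u\<in>U. a = r \<odot>\<^sub>M m \<oplus>\<^sub>M u"
        using complement_exists[OF Mm m(1)] xM by metis
      note cs = card_split[OF Mm m(1) U]
      let ?U = "M\<lparr>carrier := U\<rparr>"
      note Um = submodule_module[OF Mm(1) U(1)]
      have Us: "U \<subseteq> carrier M" by (rule M.submoduleE(1)[OF U(1)])
      have Uf: "finite (carrier ?U)" using Us Mm(2) finite_subset by auto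
      define c where c: "c = card U"
      have "card (xim ?U) = 1" using xim_card_1_iff[OF Um Uf] xM Us by auto
      then have inU: "cls c 1 \<in> \<I>" using cls_in[OF Um Uf] c by simp
      have "{r \<in> carrier \<Lambda>. r \<odot>\<^sub>M m = \<zero>\<^sub>M} = xim (regular_module \<Lambda>)" unfolding xim_regular using ann by auto
      then have "q * q * c = a * q" using cs(1) card_R cM c by (simp add: q_def)
      then have a: "a = q * c" using q_gt_1 by simp
      have c0: "c > 0" using module_card_pos[OF Um Uf] c by simp
      have "c < a" unfolding a using c0 q_gt_1 by simp
      then have "P (bas c 1)" using less.IH inU by blast
      then have Ps: "P (bas q 1 \<otimes>\<^sub>\<H> bas c 1)" by (rule simple[OF bas_carrier[OF inU]])
      have car: "bas q 1 \<otimes>\<^sub>\<H> bas c 1 \<in> carrier \<H>" by (intro H.m_closed bas_carrier simple_in inU)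
      have P1: "P (\<lambda>C. real c * (bas q 1 \<otimes>\<^sub>\<H> bas c 1) C)"
        by (rule smult[OF _ car Ps]) (simp add: Qv_Rats)
      have eq: "(\<lambda>C. real c * (bas q 1 \<otimes>\<^sub>\<H> bas c 1) C) = (\<lambda>C. bas a 1 C + (real c - 1) * bas a q C)"
        unfolding simple_mult(1)[OF simple_in inU] a using c0 by auto
      show ?thesis
      \<comment> \<open>For c = 1 no module need have the invariants (a, q), but the coefficient c -
        1 of this class vanishes.\<close>
      proof (cases "c = 1")
        case True
        then show ?thesis using P1 unfolding eq b by simp
      next
        case False
        have inq: "cls a q \<in> \<I>" using simple_mult(2)[OF simple_in inU False] a by simp
        have "P (bas a q)" using step[OF inq] q_gt_1 by simp
        then have P2: "P (\<lambda>C. - (real c - 1) * bas a q C)"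
          by (intro smult bas_carrier[OF inq]) (simp_all add: Qv_Rats)
        have "P (\<lambda>C. (bas a 1 C + (real c - 1) * bas a q C) + - (real c - 1) * bas a q C)"
        proof (rule add[OF _ _ P1[unfolded eq] P2])
          show "(\<lambda>C. bas a 1 C + (real c - 1) * bas a q C) \<in> carrier \<H>"
            unfolding eq[symmetric] by (rule SC.smult_carrier[OF _ car]) (simp add: Qv_Rats)
          show "(\<lambda>C. - (real c - 1) * bas a q C) \<in> carrier \<H>"
            by (rule SC.smult_carrier[OF _ bas_carrier[OF inq]]) (simp add: Qv_Rats)
        qed
        then show ?thesis unfolding b by (simp add: algebra_simps)
      qed
    qed
  qed
qed

lemma hall_induct:
  assumes \<phi>: "\<phi> \<in> carrier \<H>" and one: "P \<one>\<^sub>\<H>"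
    and add: "\<And>\<phi> \<psi>. \<phi> \<in> carrier \<H> \<Longrightarrow> \<psi> \<in> carrier \<H> \<Longrightarrow> P \<phi> \<Longrightarrow> P \<psi> \<Longrightarrow> P (\<lambda>C. \<phi> C + \<psi> C)"
    and smult: "\<And>c \<phi>. c \<in> Qv k \<Longrightarrow> \<phi> \<in> carrier \<H> \<Longrightarrow> P \<phi> \<Longrightarrow> P (\<lambda>C. c * \<phi> C)"
    and reg: "\<And>\<phi>. \<phi> \<in> carrier \<H> \<Longrightarrow> P \<phi> \<Longrightarrow> P (bas (q * q) q \<otimes>\<^sub>\<H> \<phi>)"
    and simple: "\<And>\<phi>. \<phi> \<in> carrier \<H> \<Longrightarrow> P \<phi> \<Longrightarrow> P (bas q 1 \<otimes>\<^sub>\<H> \<phi>)"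
  shows "P \<phi>" using \<phi>
proof (induction \<phi> rule: SC.algebra_induct)
  case zero
  show ?case using smult[OF Qv_Rats[of 0] H.one_closed one] by simp
next
  case (basis A)
  then have A: "cls (card (carrier (rep A))) (card (xim (rep A))) \<in> \<I>" using class_cls by simp
  have "P (bas (card (carrier (rep A))) (card (xim (rep A))))"
    by (rule hall_induct_cls[where P = P]; (rule one add smult reg simple A; assumption))
  then show ?case using class_cls[OF basis] by (simp add: bas_def)
qed (use add smult in blast)+

lemma commute_induct:
  assumes \<phi>: "\<phi> \<in> carrier \<H>" and \<psi>: "\<psi> \<in> carrier \<H>"
    and r: "bas (q * q) q \<otimes>\<^sub>\<H> \<psi> = \<psi> \<otimes>\<^sub>\<H> bas (q * q) q" and s: "bas q 1 \<otimes>\<^sub>\<H> \<psi> = \<psi> \<otimes>\<^sub>\<H> bas q 1"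
  shows "\<phi> \<otimes>\<^sub>\<H> \<psi> = \<psi> \<otimes>\<^sub>\<H> \<phi>"
proof (rule hall_induct[OF \<phi>, where P = "\<lambda>\<phi>. \<phi> \<otimes>\<^sub>\<H> \<psi> = \<psi> \<otimes>\<^sub>\<H> \<phi>"])
  note k = bas_carrier[OF regular_in] and s' = bas_carrier[OF simple_in]
  fix \<phi> assume p: "\<phi> \<in> carrier \<H>" "\<phi> \<otimes>\<^sub>\<H> \<psi> = \<psi> \<otimes>\<^sub>\<H> \<phi>"
  show "bas (q * q) q \<otimes>\<^sub>\<H> \<phi> \<otimes>\<^sub>\<H> \<psi> = \<psi> \<otimes>\<^sub>\<H> (bas (q * q) q \<otimes>\<^sub>\<H> \<phi>)"
    using H.m_assoc[OF k p(1) \<psi>] p(2) H.m_assoc[OF k \<psi> p(1)] r H.m_assoc[OF \<psi> k p(1)] by simp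
  show "bas q 1 \<otimes>\<^sub>\<H> \<phi> \<otimes>\<^sub>\<H> \<psi> = \<psi> \<otimes>\<^sub>\<H> (bas q 1 \<otimes>\<^sub>\<H> \<phi>)"
    using H.m_assoc[OF s' p(1) \<psi>] p(2) H.m_assoc[OF s' \<psi> p(1)] s H.m_assoc[OF \<psi> s' p(1)] by simp
qed (simp_all add: \<psi> SC.mult_add_left SC.mult_add_right SC.mult_smult_left SC.mult_smult_right)

text \<open>Two rounds of \<open>commute_induct\<close>: the generators commute with each other,
  hence with everything; therefore everything commutes with the generators, hence with
  everything.\<close>

sublocale H: cring \<H>
proof (rule cring.intro[OF H.ring_axioms], rule comm_monoid.intro[OF H.monoid_axioms], rule comm_monoid_axioms.intro)
  fix \<phi> \<psi> assume p: "\<phi> \<in> carrier \<H>" "\<psi> \<in> carrier \<H>"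
  note k = bas_carrier[OF regular_in] and s = bas_carrier[OF simple_in]
  note sk = simple_regular_mult[OF simple_in]
  have kc: "\<phi> \<otimes>\<^sub>\<H> bas (q * q) q = bas (q * q) q \<otimes>\<^sub>\<H> \<phi>" if "\<phi> \<in> carrier \<H>" for \<phi>
    by (rule commute_induct[OF that k refl sk])
  have sc: "\<phi> \<otimes>\<^sub>\<H> bas q 1 = bas q 1 \<otimes>\<^sub>\<H> \<phi>" if "\<phi> \<in> carrier \<H>" for \<phi>
    by (rule commute_induct[OF that s sk[symmetric] refl])
  show "\<phi> \<otimes>\<^sub>\<H> \<psi> = \<psi> \<otimes>\<^sub>\<H> \<phi>"
    by (rule commute_induct[OF p kc[OF p(2), symmetric] sc[OF p(2), symmetric]])
qed

end

section \<open>Commutative localisation\<close>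

text \<open>In a commutative ring the Ore condition can be met canonically by cross-multiplication.
  The locale reduces the right fractions of \<open>localisation\<close> to ordinary ones.\<close>

locale localised_cring = cring R for R (structure) +
  fixes S
  assumes S_sub: "S \<subseteq> carrier R" and one_S: "\<one> \<in> S" and mult_S: "\<lbrakk>s \<in> S; t \<in> S\<rbrakk> \<Longrightarrow> s \<otimes> t \<in> S"
begin

abbreviation "fr \<equiv> frac R S"
abbreviation "L \<equiv> localisation R S"

lemma S_carrier [simp, intro]: "s \<in> S \<Longrightarrow> s \<in> carrier R" using S_sub by auto

lemmas mult_S' [simp] = mult_S and one_S' [simp] = one_S

text \<open>The usual equality of fractions. The cancelling factor r has to stay, since elements of
  S may be zero divisors.\<close>

lemma frac_rel_iff: "((a, s), (b, t)) \<in> frac_rel R S \<longleftrightarrow>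
     a \<in> carrier R \<and> s \<in> S \<and> b \<in> carrier R \<and> t \<in> S \<and> (\<exists>r\<in>S. a \<otimes> t \<otimes> r = b \<otimes> s \<otimes> r)"
proof
  assume "((a, s), (b, t)) \<in> frac_rel R S"
  then obtain u w where h: "a \<in> carrier R" "s \<in> S" "b \<in> carrier R" "t \<in> S" "u \<in> carrier R" "w \<in> carrier R"
    and e: "s \<otimes> u = t \<otimes> w" "s \<otimes> u \<in> S" "a \<otimes> u = b \<otimes> w" by (auto simp: frac_rel_def)
  \<comment> \<open>The common denominator \<open>s \<otimes> u\<close>, which lies in S, serves as
    the cancelling factor r.\<close>
  have "a \<otimes> t \<otimes> (s \<otimes> u) = (a \<otimes> u) \<otimes> (t \<otimes> s)" using h by (simp add: m_ac)
  also have "\<dots> = b \<otimes> s \<otimes> (t \<otimes> w)" using h by (simp add: e(3) m_ac)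
  finally show "a \<in> carrier R \<and> s \<in> S \<and> b \<in> carrier R \<and> t \<in> S \<and> (\<exists>r\<in>S. a \<otimes> t \<otimes> r = b \<otimes> s \<otimes> r)"
    using h e by metis
next
  assume "a \<in> carrier R \<and> s \<in> S \<and> b \<in> carrier R \<and> t \<in> S \<and> (\<exists>r\<in>S. a \<otimes> t \<otimes> r = b \<otimes> s \<otimes> r)"
  then obtain r where h: "a \<in> carrier R" "s \<in> S" "b \<in> carrier R" "t \<in> S" "r \<in> S"
    and e: "a \<otimes> t \<otimes> r = b \<otimes> s \<otimes> r" by blast
  have "s \<otimes> (t \<otimes> r) = t \<otimes> (s \<otimes> r)" "s \<otimes> (t \<otimes> r) \<in> S" "a \<otimes> (t \<otimes> r) = b \<otimes> (s \<otimes> r)"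
    "t \<otimes> r \<in> carrier R" "s \<otimes> r \<in> carrier R" using h e by (simp_all add: m_ac)
  then show "((a, s), (b, t)) \<in> frac_rel R S" using h unfolding frac_rel_def by blast
qed

lemma frac_rel_equiv: "equiv (carrier R \<times> S) (frac_rel R S)"
proof (rule equivI)
  show "frac_rel R S \<subseteq> (carrier R \<times> S) \<times> (carrier R \<times> S)" by (auto simp: frac_rel_def)
  show "refl_on (carrier R \<times> S) (frac_rel R S)"
    by (rule refl_onI) (use one_S in \<open>auto simp: frac_rel_iff\<close>)
  show "sym (frac_rel R S)"
  proof (rule symI, clarify)
    fix a s b t assume "((a, s), (b, t)) \<in> frac_rel R S"
    then show "((b, t), (a, s)) \<in> frac_rel R S" unfolding frac_rel_iff by metis
  qed
  show "trans (frac_rel R S)"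
  proof (rule transI, clarify)
    fix a s b t c u
    assume "((a, s), (b, t)) \<in> frac_rel R S" "((b, t), (c, u)) \<in> frac_rel R S"
    then obtain r r' where h: "a \<in> carrier R" "s \<in> S" "b \<in> carrier R" "t \<in> S" "c \<in> carrier R" "u \<in> S"
        "r \<in> S" "r' \<in> S" and e: "a \<otimes> t \<otimes> r = b \<otimes> s \<otimes> r" "b \<otimes> u \<otimes> r' = c \<otimes> t \<otimes> r'"
      unfolding frac_rel_iff by blast
    have "a \<otimes> u \<otimes> (t \<otimes> (r \<otimes> r')) = (a \<otimes> t \<otimes> r) \<otimes> (u \<otimes> r')" using h by (simp add: m_ac)
    also have "\<dots> = (b \<otimes> u \<otimes> r') \<otimes> (s \<otimes> r)" using h by (simp add: e(1) m_ac)
    also have "\<dots> = c \<otimes> s \<otimes> (t \<otimes> (r \<otimes> r'))" using h by (simp add: e(2) m_ac)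
    finally have "\<exists>\<rho>\<in>S. a \<otimes> u \<otimes> \<rho> = c \<otimes> s \<otimes> \<rho>" using h by (intro bexI[of _ "t \<otimes> (r \<otimes> r')"]) auto
    then show "((a, s), (c, u)) \<in> frac_rel R S" using h unfolding frac_rel_iff by simp
  qed
qed

lemma frac_mem: "(b, t) \<in> fr a s \<longleftrightarrow> ((a, s), (b, t)) \<in> frac_rel R S" by (simp add: frac_def)

lemma frac_eq_iff: "\<lbrakk>a \<in> carrier R; s \<in> S; b \<in> carrier R; t \<in> S\<rbrakk> \<Longrightarrow>
     fr a s = fr b t \<longleftrightarrow> (\<exists>r\<in>S. a \<otimes> t \<otimes> r = b \<otimes> s \<otimes> r)"
  unfolding frac_def using eq_equiv_class_iff[OF frac_rel_equiv, of "(a, s)" "(b, t)"]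
  by (simp add: frac_rel_iff)

lemma frac_eqI: "\<lbrakk>a \<in> carrier R; s \<in> S; b \<in> carrier R; t \<in> S; a \<otimes> t = b \<otimes> s\<rbrakk> \<Longrightarrow> fr a s = fr b t"
  using one_S by (subst frac_eq_iff) auto

lemma L_carrier: "z \<in> carrier L \<longleftrightarrow> (\<exists>a\<in>carrier R. \<exists>s\<in>S. z = fr a s)"
  by (auto simp: localisation_def quotient_def frac_def)

lemma frac_in [simp]: "\<lbrakk>a \<in> carrier R; s \<in> S\<rbrakk> \<Longrightarrow> fr a s \<in> carrier L" unfolding L_carrier by blast

text \<open>\<open>localisation\<close> forms sums and products as unions over all ways to clear
  denominators; such a union is evaluated by exhibiting one member and showing that all members
  agree.\<close>

lemma Union_const: "A \<noteq> {} \<Longrightarrow> (\<And>Y. Y \<in> A \<Longrightarrow> Y = B) \<Longrightarrow> \<Union>A = B" by auto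

lemma frac_mult:
  assumes h: "a \<in> carrier R" "s \<in> S" "b \<in> carrier R" "t \<in> S"
  shows "fr a s \<otimes>\<^sub>L fr b t = fr (a \<otimes> b) (s \<otimes> t)"
proof -
  let ?A = "{fr (a' \<otimes> u) (t' \<otimes> w) | a' s' b' t' u w.
        (a', s') \<in> fr a s \<and> (b', t') \<in> fr b t \<and> u \<in> carrier R \<and> w \<in> S \<and> s' \<otimes> u = b' \<otimes> w}"
  have "\<Union>?A = fr (a \<otimes> b) (s \<otimes> t)"
  proof (rule Union_const)
    have "(a, s) \<in> fr a s" "(b, t) \<in> fr b t" using h one_S by (auto simp: frac_mem frac_rel_iff)
    then have "fr (a \<otimes> b) (t \<otimes> s) \<in> ?A" using h m_comm[of s b] by blast
    then show "?A \<noteq> {}" by blast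
    fix Y assume "Y \<in> ?A"
    then obtain a' s' b' t' u w where Y: "Y = fr (a' \<otimes> u) (t' \<otimes> w)"
      and m: "(a', s') \<in> fr a s" "(b', t') \<in> fr b t"
      and u: "u \<in> carrier R" "w \<in> S" "s' \<otimes> u = b' \<otimes> w" by blast
    then obtain r r' where p: "a' \<in> carrier R" "s' \<in> S" "b' \<in> carrier R" "t' \<in> S" "r \<in> S" "r' \<in> S"
      and e: "a \<otimes> s' \<otimes> r = a' \<otimes> s \<otimes> r" "b \<otimes> t' \<otimes> r' = b' \<otimes> t \<otimes> r'"
      unfolding frac_mem frac_rel_iff by blast
    have "(a' \<otimes> u) \<otimes> (s \<otimes> t) \<otimes> (r \<otimes> r' \<otimes> s') = (a' \<otimes> s \<otimes> r) \<otimes> (s' \<otimes> u) \<otimes> (t \<otimes> r')"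
      using h u(1,2) p by (simp add: m_ac)
    also have "\<dots> = (a \<otimes> s' \<otimes> r) \<otimes> (b' \<otimes> t \<otimes> r') \<otimes> w"
      unfolding e(1)[symmetric] u(3) using h u(1,2) p by (simp add: m_ac)
    also have "\<dots> = (a \<otimes> b) \<otimes> (t' \<otimes> w) \<otimes> (r \<otimes> r' \<otimes> s')"
      unfolding e(2)[symmetric] using h u(1,2) p by (simp add: m_ac)
    finally have "\<exists>\<rho>\<in>S. (a' \<otimes> u) \<otimes> (s \<otimes> t) \<otimes> \<rho> = (a \<otimes> b) \<otimes> (t' \<otimes> w) \<otimes> \<rho>"
      using p by (intro bexI[of _ "r \<otimes> r' \<otimes> s'"]) auto
    then show "Y = fr (a \<otimes> b) (s \<otimes> t)" unfolding Y using h u p by (subst frac_eq_iff) auto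
  qed
  then show ?thesis by (simp add: localisation_def)
qed

lemma frac_add:
  assumes h: "a \<in> carrier R" "s \<in> S" "b \<in> carrier R" "t \<in> S"
  shows "fr a s \<oplus>\<^sub>L fr b t = fr (a \<otimes> t \<oplus> b \<otimes> s) (s \<otimes> t)"
proof -
  let ?A = "{fr (a' \<otimes> u \<oplus> b' \<otimes> w) (s' \<otimes> u) | a' s' b' t' u w.
        (a', s') \<in> fr a s \<and> (b', t') \<in> fr b t \<and> u \<in> carrier R \<and> w \<in> carrier R \<and>
        s' \<otimes> u = t' \<otimes> w \<and> s' \<otimes> u \<in> S}"
  have "\<Union>?A = fr (a \<otimes> t \<oplus> b \<otimes> s) (s \<otimes> t)"
  proof (rule Union_const)
    have "(a, s) \<in> fr a s" "(b, t) \<in> fr b t" using h one_S by (auto simp: frac_mem frac_rel_iff)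
    moreover have "s \<otimes> t = t \<otimes> s" "s \<otimes> t \<in> S" "t \<in> carrier R" "s \<in> carrier R"
      using h m_comm[of s t] by auto
    ultimately have "fr (a \<otimes> t \<oplus> b \<otimes> s) (s \<otimes> t) \<in> ?A" by blast
    then show "?A \<noteq> {}" by blast
    fix Y assume "Y \<in> ?A"
    then obtain a' s' b' t' u w where Y: "Y = fr (a' \<otimes> u \<oplus> b' \<otimes> w) (s' \<otimes> u)"
      and m: "(a', s') \<in> fr a s" "(b', t') \<in> fr b t"
      and u: "u \<in> carrier R" "w \<in> carrier R" "s' \<otimes> u = t' \<otimes> w" "s' \<otimes> u \<in> S" by blast
    then obtain r r' where p: "a' \<in> carrier R" "s' \<in> S" "b' \<in> carrier R" "t' \<in> S" "r \<in> S" "r' \<in> S"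
      and e: "a \<otimes> s' \<otimes> r = a' \<otimes> s \<otimes> r" "b \<otimes> t' \<otimes> r' = b' \<otimes> t \<otimes> r'"
      unfolding frac_mem frac_rel_iff by blast
    have 1: "(a' \<otimes> u) \<otimes> (s \<otimes> t) \<otimes> (r \<otimes> r') = (a \<otimes> t) \<otimes> (s' \<otimes> u) \<otimes> (r \<otimes> r')"
    proof -
      have "(a' \<otimes> u) \<otimes> (s \<otimes> t) \<otimes> (r \<otimes> r') = (a' \<otimes> s \<otimes> r) \<otimes> (u \<otimes> t \<otimes> r')"
        using h u(1,2) p by (simp add: m_ac)
      also have "\<dots> = (a \<otimes> t) \<otimes> (s' \<otimes> u) \<otimes> (r \<otimes> r')"
        unfolding e(1)[symmetric] using h u(1,2) p by (simp add: m_ac)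
      finally show ?thesis .
    qed
    have 2: "(b' \<otimes> w) \<otimes> (s \<otimes> t) \<otimes> (r \<otimes> r') = (b \<otimes> s) \<otimes> (s' \<otimes> u) \<otimes> (r \<otimes> r')"
    proof -
      have "(b' \<otimes> w) \<otimes> (s \<otimes> t) \<otimes> (r \<otimes> r') = (b' \<otimes> t \<otimes> r') \<otimes> (w \<otimes> s \<otimes> r)"
        using h u(1,2) p by (simp add: m_ac)
      also have "\<dots> = (b \<otimes> s) \<otimes> (t' \<otimes> w) \<otimes> (r \<otimes> r')"
        unfolding e(2)[symmetric] using h u(1,2) p by (simp add: m_ac)
      finally show ?thesis unfolding u(3) .
    qed
    have c: "a' \<otimes> u \<in> carrier R" "b' \<otimes> w \<in> carrier R" "s \<otimes> t \<in> carrier R" "r \<otimes> r' \<in> carrier R"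
      "a \<otimes> t \<in> carrier R" "b \<otimes> s \<in> carrier R" "s' \<otimes> u \<in> carrier R" using h u p by auto
    have "(a' \<otimes> u \<oplus> b' \<otimes> w) \<otimes> (s \<otimes> t) \<otimes> (r \<otimes> r') = (a \<otimes> t \<oplus> b \<otimes> s) \<otimes> (s' \<otimes> u) \<otimes> (r \<otimes> r')"
      using c 1 2 by (simp add: l_distr)
    then have "\<exists>\<rho>\<in>S. (a' \<otimes> u \<oplus> b' \<otimes> w) \<otimes> (s \<otimes> t) \<otimes> \<rho> = (a \<otimes> t \<oplus> b \<otimes> s) \<otimes> (s' \<otimes> u) \<otimes> \<rho>"
      using p by (intro bexI[of _ "r \<otimes> r'"]) auto
    then show "Y = fr (a \<otimes> t \<oplus> b \<otimes> s) (s \<otimes> t)"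
      unfolding Y using h u(4) c by (subst frac_eq_iff) auto
  qed
  then show ?thesis by (simp add: localisation_def)
qed

lemma L_zero: "\<zero>\<^sub>L = fr \<zero> \<one>" and L_one: "\<one>\<^sub>L = fr \<one> \<one>" by (simp_all add: localisation_def)

lemma frac_add_same:
  assumes h: "a \<in> carrier R" "s \<in> S" "b \<in> carrier R"
  shows "fr a s \<oplus>\<^sub>L fr b s = fr (a \<oplus> b) s" unfolding frac_add[OF h(1,2,3) h(2)]
  by (rule frac_eqI) (use h in \<open>auto simp: l_distr m_assoc\<close>)

lemma frac_zero: "s \<in> S \<Longrightarrow> fr \<zero> s = \<zero>\<^sub>L" unfolding L_zero by (rule frac_eqI) auto

lemma abelian_monoid_L: "abelian_monoid L"
proof (rule abelian_monoidI)
  fix u v w assume "u \<in> carrier L" "v \<in> carrier L" "w \<in> carrier L"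
  then obtain a s b t c r where e: "u = fr a s" "v = fr b t" "w = fr c r"
    and h: "a \<in> carrier R" "s \<in> S" "b \<in> carrier R" "t \<in> S" "c \<in> carrier R" "r \<in> S"
    unfolding L_carrier by blast
  show "u \<oplus>\<^sub>L v \<in> carrier L" unfolding e frac_add[OF h(1-4)] using h by simp
  show "u \<oplus>\<^sub>L v = v \<oplus>\<^sub>L u" unfolding e frac_add[OF h(1-4)] frac_add[OF h(3,4,1,2)]
    using h by (intro frac_eqI) (auto simp: l_distr m_ac a_ac)
  have "u \<oplus>\<^sub>L v \<oplus>\<^sub>L w = fr ((a \<otimes> t \<oplus> b \<otimes> s) \<otimes> r \<oplus> c \<otimes> (s \<otimes> t)) (s \<otimes> t \<otimes> r)"
    unfolding e frac_add[OF h(1-4)] using h by (intro frac_add) auto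
  moreover have "u \<oplus>\<^sub>L (v \<oplus>\<^sub>L w) = fr (a \<otimes> (t \<otimes> r) \<oplus> (b \<otimes> r \<oplus> c \<otimes> t) \<otimes> s) (s \<otimes> (t \<otimes> r))"
    unfolding e frac_add[OF h(3-6)] using h by (intro frac_add) auto
  ultimately show "u \<oplus>\<^sub>L v \<oplus>\<^sub>L w = u \<oplus>\<^sub>L (v \<oplus>\<^sub>L w)"
    using h by (simp add: l_distr r_distr m_ac a_ac)
  show "\<zero>\<^sub>L \<oplus>\<^sub>L u = u" unfolding e L_zero frac_add[OF zero_closed one_S h(1,2)]
    using h by (intro frac_eqI) auto
next
  show "\<zero>\<^sub>L \<in> carrier L" unfolding L_zero L_carrier using one_S by blast
qed

sublocale L: abelian_monoid L by (rule abelian_monoid_L)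

lemma frac_finsum:
  assumes "finite A" "s \<in> S" "f \<in> A \<rightarrow> carrier R"
  shows "(\<Oplus>\<^bsub>L\<^esub>i\<in>A. fr (f i) s) = fr (\<Oplus>i\<in>A. f i) s" using assms(1,3)
proof (induction A)
  case empty
  then show ?case using assms(2) by (simp add: frac_zero)
next
  case (insert j A)
  have "(\<lambda>i. fr (f i) s) \<in> insert j A \<rightarrow> carrier L" using insert(4) assms(2) by (auto simp: Pi_iff)
  then show ?case using insert assms(2) by (simp add: frac_add_same Pi_iff)
qed

end

section \<open>The algebra \<open>k[x]/(x\<^sup>2)\<close>\<close>

locale ialg_field = field k for k :: "('a, 'c) ring_scheme" (structure) +
  assumes finite_k: "finite (carrier k)"
begin

abbreviation "KX \<equiv> poly_ring k"
abbreviation "A \<equiv> ialg k"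
abbreviation "const \<equiv> ialg_const k"
abbreviation "proj p \<equiv> PIdl\<^bsub>KX\<^esub> (ialg_rel k) +>\<^bsub>KX\<^esub> p"

definition gen where "gen = proj X"

sublocale UP: domain KX by (rule univ_poly_is_domain[OF carrier_is_subring])

lemma rel_in [simp]: "ialg_rel k \<in> carrier KX"
  unfolding ialg_rel_def by (rule var_pow_closed[OF carrier_is_subring])

lemma rel_eq: "ialg_rel k = [\<one>, \<zero>, \<zero>]"
  unfolding ialg_rel_def unitary_monom_eq_var_pow[OF carrier_is_subring, symmetric]
  by (simp add: monom_def numeral_2_eq_2)

sublocale rel: ideal "PIdl\<^bsub>KX\<^esub> (ialg_rel k)" KX by (rule UP.cgenideal_ideal) simp

lemma quotient_eq: "A = KX Quot (PIdl\<^bsub>KX\<^esub> (ialg_rel k))" by (simp add: ialg_def rupture_def)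

sublocale A: cring A unfolding quotient_eq by (rule rel.quotient_is_cring) (rule UP.is_cring)

lemma proj_hom: "proj \<in> ring_hom KX A"
  unfolding ialg_def by (rule rupture_surj_hom(1)[OF carrier_is_subring rel_in])

sublocale pr: ring_hom_cring KX A proj by unfold_locales (rule proj_hom)

lemma const_hom: "const \<in> ring_hom k A" using rupture_surj_norm_is_hom[OF carrier_is_subring rel_in]
  by (simp add: ialg_const_def[abs_def] ialg_def comp_def)

sublocale co: ring_hom_cring k A const by unfold_locales (rule const_hom)

lemma X_in [simp]: "X \<in> carrier KX" by (rule var_closed(1)[OF carrier_is_subring])

lemma gen_in [simp]: "gen \<in> carrier A" unfolding gen_def by simp

lemma proj_rel: "proj (ialg_rel k) = \<zero>\<^sub>A"
  unfolding quotient_eq by (simp add: UP.a_rcos_zero[OF rel.ideal_axioms UP.cgenideal_self[OF rel_in]] FactRing_def)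

lemma gen_square: "gen \<otimes>\<^sub>A gen = \<zero>\<^sub>A"
proof -
  have "gen \<otimes>\<^sub>A gen = proj (X \<otimes>\<^bsub>KX\<^esub> X)" unfolding gen_def by simp
  also have "X \<otimes>\<^bsub>KX\<^esub> X = ialg_rel k" unfolding ialg_rel_def by (simp add: numeral_2_eq_2)
  finally show ?thesis by (simp add: proj_rel)
qed

lemma poly_const_in [simp]: "a \<in> carrier k \<Longrightarrow> poly_of_const a \<in> carrier KX"
  using canonical_embedding_is_hom[OF carrier_is_subring] by (auto simp: ring_hom_def)

lemma poly_const_X: "b \<in> carrier k \<Longrightarrow> b \<noteq> \<zero> \<Longrightarrow> X \<otimes>\<^bsub>KX\<^esub> poly_of_const b = [b, \<zero>]"
  using poly_mult_var[OF carrier_is_subring poly_const_in[of b]]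
    UP.m_comm[OF X_in poly_const_in[of b]] by (simp add: poly_of_const_def)

lemma linear_poly:
  assumes p: "p \<in> carrier KX" and d: "p = [] \<or> degree p < 2"
  shows "\<exists>a\<in>carrier k. \<exists>b\<in>carrier k. p = poly_of_const a \<oplus>\<^bsub>KX\<^esub> X \<otimes>\<^bsub>KX\<^esub> poly_of_const b"
proof -
  have z: "poly_of_const \<zero> = \<zero>\<^bsub>KX\<^esub>" by (simp add: poly_of_const_def univ_poly_zero)
  have pol: "polynomial (carrier k) p" using p by (simp add: univ_poly_carrier)
  \<comment> \<open>Polynomials are coefficient lists with the leading coefficient first and [] as
    zero, so degree below 2 leaves three shapes.\<close>
  consider "p = []" | a where "p = [a]" | b a where "p = [b, a]"
    using d by (cases p rule: remdups_adj.cases) auto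
  then show ?thesis
  proof cases
    case 1
    have "p = poly_of_const \<zero> \<oplus>\<^bsub>KX\<^esub> X \<otimes>\<^bsub>KX\<^esub> poly_of_const \<zero>"
      unfolding z using 1 by (simp del: univ_poly_zero) (simp add: univ_poly_zero)
    then show ?thesis by blast
  next
    case (2 a)
    have a: "a \<in> carrier k" "a \<noteq> \<zero>" using pol 2 by (auto simp: polynomial_def)
    have e: "poly_of_const a = p" using 2 a by (simp add: poly_of_const_def)
    have "p = poly_of_const a \<oplus>\<^bsub>KX\<^esub> X \<otimes>\<^bsub>KX\<^esub> poly_of_const \<zero>" unfolding z e using p by simp
    then show ?thesis using a by blast
  next
    case (3 b a)
    have a: "a \<in> carrier k" "b \<in> carrier k" "b \<noteq> \<zero>" using pol 3 by (auto simp: polynomial_def)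
    have "poly_of_const a \<oplus>\<^bsub>KX\<^esub> [b, \<zero>] = [b, a]"
      using a by (simp add: univ_poly_add poly_of_const_def)
    then show ?thesis using a 3 poly_const_X[of b] by metis
  qed
qed

text \<open>The normal form a + x b is the remainder of a representing polynomial modulo
  x^2.\<close>

lemma ialg_elem:
  assumes "r \<in> carrier A" obtains a b where "a \<in> carrier k" "b \<in> carrier k"
    "r = const a \<oplus>\<^sub>A gen \<otimes>\<^sub>A const b"
proof -
  have "r \<in> proj ` ((\<lambda>q. ring.pmod k q (ialg_rel k)) ` carrier KX)"
    using assms rupture_carrier_as_pmod_image[OF carrier_is_subfield rel_in] by (simp add: ialg_def)
  then obtain p where p: "p \<in> carrier KX" "r = proj (ring.pmod k p (ialg_rel k))" by blast
  let ?p = "ring.pmod k p (ialg_rel k)"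
  have "?p \<in> carrier KX" by (rule long_division_closed(2)[OF carrier_is_subfield p(1) rel_in])
  moreover have "?p = [] \<or> degree ?p < 2"
    using pmod_degree[OF carrier_is_subfield p(1) rel_in] by (simp add: rel_eq numeral_2_eq_2)
  ultimately obtain a b where ab: "a \<in> carrier k" "b \<in> carrier k"
      "?p = poly_of_const a \<oplus>\<^bsub>KX\<^esub> X \<otimes>\<^bsub>KX\<^esub> poly_of_const b" using linear_poly by blast
  have "r = const a \<oplus>\<^sub>A gen \<otimes>\<^sub>A const b"
    unfolding p(2) ab(3) ialg_const_def gen_def using ab(1,2) by simp
  with ab(1,2) show ?thesis by (rule that)
qed

text \<open>For nonzero b the polynomial b X is its own remainder modulo X^2, and distinct
  remainders represent distinct classes.\<close>

lemma gen_const_zero: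
  assumes b: "b \<in> carrier k" and z: "gen \<otimes>\<^sub>A const b = \<zero>\<^sub>A"
  shows "b = \<zero>"
proof (rule ccontr)
  assume nz: "b \<noteq> \<zero>"
  define p where "p = X \<otimes>\<^bsub>KX\<^esub> poly_of_const b"
  have p: "p \<in> carrier KX" "p = [b, \<zero>]" using b nz poly_const_X[of b] UP.m_closed[OF X_in poly_const_in[of b]]
    by (simp_all add: p_def)
  have "proj p = proj \<zero>\<^bsub>KX\<^esub>" using z b unfolding p_def ialg_const_def gen_def by simp
  moreover have "ring.pmod k p (ialg_rel k) = p"
    by (rule pmod_const(2)[OF carrier_is_subfield p(1) rel_in]) (simp add: rel_eq p(2))
  moreover have "ring.pmod k \<zero>\<^bsub>KX\<^esub> (ialg_rel k) = \<zero>\<^bsub>KX\<^esub>"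
    by (rule pmod_const(2)[OF carrier_is_subfield UP.zero_closed rel_in]) (simp add: rel_eq univ_poly_zero)
  ultimately have "p = \<zero>\<^bsub>KX\<^esub>"
    using inj_onD[OF rupture_surj_inj_on[OF carrier_is_subfield rel_in]] p(1) UP.zero_closed
    by (metis imageI)
  then show False using p(2) by (simp add: univ_poly_zero)
qed

lemma finite_ialg: "finite (carrier A)"
proof -
  have "carrier A \<subseteq> (\<lambda>(a, b). const a \<oplus>\<^sub>A gen \<otimes>\<^sub>A const b) ` (carrier k \<times> carrier k)"
    by (rule subsetI, erule ialg_elem) auto
  then show ?thesis using finite_k by (meson finite_SigmaI finite_imageI finite_subset)
qed

lemma ialg_local:
  assumes "r \<in> carrier A"
  shows "r \<in> Units A \<or> (\<exists>s\<in>carrier A. r = gen \<otimes>\<^sub>A s)"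
proof -
  obtain a b where ab: "a \<in> carrier k" "b \<in> carrier k" "r = const a \<oplus>\<^sub>A gen \<otimes>\<^sub>A const b"
    using assms by (rule ialg_elem)
  show ?thesis
  proof (cases "a = \<zero>")
    case True
    then have "r = gen \<otimes>\<^sub>A const b" using ab by simp
    then show ?thesis using ab by auto
  next
    case False
    then have ia: "inv a \<in> carrier k" "a \<otimes> inv a = \<one>" using ab(1) field_Units by auto
    \<comment> \<open>After division by its constant term a, the element is 1 + n with n^2 = 0, and
      1 - n is the inverse.\<close>
    define n where "n = gen \<otimes>\<^sub>A const (b \<otimes> inv a)"
    have n: "n \<in> carrier A" using ab ia by (simp add: n_def)
    have "n \<otimes>\<^sub>A n = (gen \<otimes>\<^sub>A gen) \<otimes>\<^sub>A (const (b \<otimes> inv a) \<otimes>\<^sub>A const (b \<otimes> inv a))"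
      unfolding n_def using ab ia by (simp add: A.m_ac del: co.hom_mult)
    then have nn: "n \<otimes>\<^sub>A n = \<zero>\<^sub>A" using ab ia by (simp add: gen_square)
    have "r \<otimes>\<^sub>A const (inv a) = const a \<otimes>\<^sub>A const (inv a) \<oplus>\<^sub>A n"
      unfolding ab(3) n_def using ab ia by (simp add: A.l_distr A.m_assoc)
    also have "const a \<otimes>\<^sub>A const (inv a) = \<one>\<^sub>A" using ab ia co.hom_mult[of a "inv a"] by simp
    finally have e: "r \<otimes>\<^sub>A const (inv a) = \<one>\<^sub>A \<oplus>\<^sub>A n" .
    have "(\<one>\<^sub>A \<oplus>\<^sub>A n) \<otimes>\<^sub>A (\<one>\<^sub>A \<ominus>\<^sub>A n) = \<one>\<^sub>A \<ominus>\<^sub>A n \<otimes>\<^sub>A n" using n by algebra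
    also have "\<dots> = \<one>\<^sub>A" unfolding nn by (simp add: A.minus_eq)
    finally have "r \<otimes>\<^sub>A (const (inv a) \<otimes>\<^sub>A (\<one>\<^sub>A \<ominus>\<^sub>A n)) = \<one>\<^sub>A"
      using e assms ia n by (simp add: A.m_assoc[symmetric])
    moreover have "const (inv a) \<otimes>\<^sub>A (\<one>\<^sub>A \<ominus>\<^sub>A n) \<in> carrier A" using ia n by simp
    ultimately have "r \<in> Units A" using assms A.m_comm unfolding Units_def by fastforce
    then show ?thesis ..
  qed
qed

sublocale D: dual_ring A gen
proof
  show "gen \<noteq> \<zero>\<^sub>A" using gen_const_zero[OF one_closed] by (auto simp: one_not_zero)
qed (use finite_ialg gen_square ialg_local in auto)

text \<open>The elements of the ideal (x) are the x b with b in k, uniquely. This identifies the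
  ring-theoretic q with the order of the field.\<close>

lemma card_gen_image: "D.q = card (carrier k)"
proof -
  have "{gen \<otimes>\<^sub>A s | s. s \<in> carrier A} = (\<lambda>b. gen \<otimes>\<^sub>A const b) ` carrier k"
  proof (intro equalityI subsetI)
    fix z assume "z \<in> {gen \<otimes>\<^sub>A s | s. s \<in> carrier A}"
    then obtain s where s: "s \<in> carrier A" "z = gen \<otimes>\<^sub>A s" by blast
    from s(1) obtain a b where ab: "a \<in> carrier k" "b \<in> carrier k" "s = const a \<oplus>\<^sub>A gen \<otimes>\<^sub>A const b"
      by (rule ialg_elem)
    have "z = gen \<otimes>\<^sub>A const a \<oplus>\<^sub>A (gen \<otimes>\<^sub>A gen) \<otimes>\<^sub>A const b"
      unfolding s(2) ab(3) using ab(1,2) by (simp add: A.r_distr A.m_assoc)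
    then have "z = gen \<otimes>\<^sub>A const a" using ab(1,2) by (simp add: gen_square)
    then show "z \<in> (\<lambda>b. gen \<otimes>\<^sub>A const b) ` carrier k" using ab(1) by blast
  qed auto
  moreover have "inj_on (\<lambda>b. gen \<otimes>\<^sub>A const b) (carrier k)"
  proof (rule inj_onI)
    fix a b assume ab: "a \<in> carrier k" "b \<in> carrier k" "gen \<otimes>\<^sub>A const a = gen \<otimes>\<^sub>A const b"
    have "gen \<otimes>\<^sub>A const (a \<ominus> b) = gen \<otimes>\<^sub>A const a \<ominus>\<^sub>A gen \<otimes>\<^sub>A const b"
      using ab(1,2) by (simp add: minus_eq A.minus_eq A.r_distr A.r_minus)
    also have "\<dots> = \<zero>\<^sub>A" unfolding ab(3) using ab(2) by simp
    finally have "a \<ominus> b = \<zero>" using gen_const_zero ab(1,2) by simp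
    then show "a = b" using ab(1,2) by simp
  qed
  ultimately show ?thesis unfolding D.q_def D.xim_regular by (simp add: card_image)
qed

lemma restrict_vectorspace:
  assumes "module A M"
  shows "vectorspace k (restrict_scalars const M)"
proof -
  interpret M: module A M by fact
  have e: "carrier (restrict_scalars const M) = carrier M"
    "\<zero>\<^bsub>restrict_scalars const M\<^esub> = \<zero>\<^sub>M" "add (restrict_scalars const M) = add M"
    "\<And>a v. a \<odot>\<^bsub>restrict_scalars const M\<^esub> v = const a \<odot>\<^sub>M v" by (simp_all add: restrict_scalars_def)
  have "abelian_group (restrict_scalars const M)" by (rule abelian_groupI)
      (auto simp: e M.a_ac intro: M.l_neg)
  then have "module k (restrict_scalars const M)" by (intro moduleI)
      (simp_all add: e is_cring M.smult_l_distr M.smult_r_distr M.smult_assoc1)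
  then show ?thesis by (simp add: vectorspace_def field_axioms)
qed

text \<open>Linear combinations of a finite basis put M in bijection with the coordinate functions
  on the basis.\<close>

lemma fin_dim_card:
  assumes M: "module A M" and fd: "vectorspace.fin_dim k (restrict_scalars const M)"
  shows "finite (carrier M) \<and> card (carrier M) = card (carrier k) ^ kdim k M"
proof -
  interpret V: vectorspace k "restrict_scalars const M" by (rule restrict_vectorspace[OF M])
  have c: "carrier (restrict_scalars const M) = carrier M" by (simp add: restrict_scalars_def)
  obtain B where B: "finite B" "V.basis B" using V.finite_basis_exists[OF fd] by blast
  have Bc: "B \<subseteq> carrier M" using B(2) c by (simp add: V.basis_def)
  have ex: "\<exists>!a. a \<in> B \<rightarrow>\<^sub>E carrier k \<and> V.lincomb a B = v" if "v \<in> carrier M" for v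
    using V.basis_criterion[OF B(1)] B(2) Bc c that by simp
  have "bij_betw (\<lambda>a. V.lincomb a B) (B \<rightarrow>\<^sub>E carrier k) (carrier M)"
  proof (rule bij_betwI')
    have cl: "V.lincomb a B \<in> carrier M" if "a \<in> B \<rightarrow>\<^sub>E carrier k" for a
      using V.lincomb_closed[of B a] Bc that by (auto simp: c)
    show "V.lincomb a B = V.lincomb b B \<longleftrightarrow> a = b" if "a \<in> B \<rightarrow>\<^sub>E carrier k" "b \<in> B \<rightarrow>\<^sub>E carrier k" for a b
      using ex[OF cl[OF that(1)]] that by metis
    show "V.lincomb a B \<in> carrier M" if "a \<in> B \<rightarrow>\<^sub>E carrier k" for a by (rule cl[OF that])
    show "\<exists>a\<in>B \<rightarrow>\<^sub>E carrier k. v = V.lincomb a B" if "v \<in> carrier M" for v using ex[OF that] by metis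
  qed
  moreover have "finite (B \<rightarrow>\<^sub>E carrier k)" using B(1) finite_k by (simp add: finite_PiE)
  moreover have "card (B \<rightarrow>\<^sub>E carrier k) = card (carrier k) ^ V.dim"
    using B V.dim_basis[OF B] by (simp add: card_PiE)
  ultimately show ?thesis unfolding kdim_def using bij_betw_finite bij_betw_same_card by metis
qed

lemma fd_module_iff: "fd_module k M \<longleftrightarrow> module A M \<and> finite (carrier M)"
proof
  assume "fd_module k M"
  then show "module A M \<and> finite (carrier M)" using fin_dim_card by (auto simp: fd_module_def)
next
  assume M: "module A M \<and> finite (carrier M)"
  then interpret V: vectorspace k "restrict_scalars const M" by (intro restrict_vectorspace) simp
  have c: "carrier (restrict_scalars const M) = carrier M" by (simp add: restrict_scalars_def)
  \<comment> \<open>A finite carrier is its own finite spanning set.\<close>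
  have "V.span (carrier M) = carrier M"
    using V.in_own_span[of "carrier M"] V.span_is_subset2[of "carrier M"] by (auto simp: c)
  then have "V.fin_dim" unfolding V.fin_dim_def using M by (intro exI[of _ "carrier M"]) (auto simp: c)
  then show "fd_module k M" using M by (simp add: fd_module_def)
qed

lemma card_carrier_kdim: "module A M \<Longrightarrow> finite (carrier M) \<Longrightarrow> card (carrier M) = D.q ^ kdim k M"
  using fin_dim_card[of M] fd_module_iff[of M] by (simp add: fd_module_def card_gen_image)

sublocale ialg_dual k gen by unfold_locales (simp add: fd_modules_def fd_module_iff)

end

section \<open>The localised Hall algebra and its grading\<close>

text \<open>The two assumptions tie cardinalities to the field and to dimensions: the first makes v
  a square root of q, the second turns the grading by dimension into a condition on |M|.\<close>

locale ihall_alg = ialg_dual k x for k :: "('a, 'c) ring_scheme" and x +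
  assumes q_eq: "q = card (carrier k)"
    and kdim_card: "\<And>M :: 'a imod. M \<in> fd_modules k \<Longrightarrow> card (carrier M) = q ^ kdim k M"
begin

abbreviation "\<Q> \<equiv> hall_quot k"
abbreviation "\<pi> \<equiv> quot_class k"

text \<open>|M| is |xM| times the size of the kernel of x, which contains xM; so kernel and image
  agree exactly if |M| = |xM|^2. Acyclicity is thereby visible in the index of a class.\<close>

lemma acyclic_card:
  assumes M: "M \<in> fd_modules k"
  shows "acyclic_module M \<longleftrightarrow> card (carrier M) = card (xim M) * card (xim M)"
proof -
  note Mm = fdD[OF M]
  interpret M: module \<Lambda> M by (rule Mm(1))
  let ?K = "{m \<in> carrier M. x \<odot>\<^sub>M m = \<zero>\<^sub>M}"
  have c: "card (carrier M) = card (xim M) * card ?K"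
    using card_hom_image[OF Mm(1,1) x_hom[OF Mm(1)] Mm(2)] by (simp add: xim_def)
  have sub: "xim M \<subseteq> ?K" unfolding xim_def using x_x_smult[OF Mm(1)] by auto
  have "acyclic_module M \<longleftrightarrow> ?K = xim M" unfolding acyclic_module_def using sub by blast
  also have "\<dots> \<longleftrightarrow> card ?K = card (xim M)" using card_subset_eq[OF _ sub] Mm(2) by auto
  finally show ?thesis using c xim_card_pos[OF Mm] by auto
qed

lemma denoms_eq: "denoms k = {\<pi> (\<lambda>C. a * bas (d * d) d C) | a d. a \<in> \<rat> \<and> a \<noteq> 0 \<and> cls (d * d) d \<in> \<I>}"
proof (intro equalityI subsetI)
  fix s assume "s \<in> denoms k"
  then obtain a P where P: "s = denom k a P" "a \<in> \<rat>" "a \<noteq> 0" "P \<in> fd_modules k" "acyclic_module P"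
    unfolding denoms_def pdim_iff by blast
  then show "s \<in> {\<pi> (\<lambda>C. a * bas (d * d) d C) | a d. a \<in> \<rat> \<and> a \<noteq> 0 \<and> cls (d * d) d \<in> \<I>}"
    using acyclic_card[OF P(4)] hall_basis_bas[OF fdD[OF P(4)]] cls_in[OF fdD[OF P(4)]]
    unfolding denom_def by auto
next
  fix s assume "s \<in> {\<pi> (\<lambda>C. a * bas (d * d) d C) | a d. a \<in> \<rat> \<and> a \<noteq> 0 \<and> cls (d * d) d \<in> \<I>}"
  then obtain a d where s: "s = \<pi> (\<lambda>C. a * bas (d * d) d C)" "a \<in> \<rat>" "a \<noteq> 0" "cls (d * d) d \<in> \<I>" by blast
  let ?P = "rep (cls (d * d) d)"
  note P = rep_fd[OF s(4)] rep_cls[OF s(4)]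
  have "?P \<in> pdim_le1 k" unfolding pdim_iff using acyclic_card P by simp
  moreover have "s = denom k a ?P" unfolding denom_def s(1) hall_basis_bas[OF fdD[OF P(1)]] using P(2) by simp
  ultimately show "s \<in> denoms k" unfolding denoms_def using s(2,3) by blast
qed

text \<open>Peeling off one copy of K at a time reduces this to \<open>regular_mult\<close>. The
  scalar stays rational and nonzero, as required for the denominators to be closed under
  multiplication.\<close>

lemma acyclic_mult:
  assumes "cls (d * d) d \<in> \<I>" "cls a b \<in> \<I>"
  shows "\<exists>r\<in>\<rat>. r \<noteq> 0 \<and> bas (d * d) d \<otimes>\<^sub>\<H> bas a b = (\<lambda>C. r * bas (d * d * a) (d * b) C)"
  using assms(1)
proof (induction d rule: less_induct)
  case (less d)
  show ?case
  proof (cases "d = 1")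
    case True
    show ?thesis unfolding True using one_bas H.l_one[OF bas_carrier[OF assms(2)]]
      by (intro bexI[of _ 1]) auto
  next
    case False
    obtain c d' where c: "d * d = q * q * c" "d = q * d'" "cls c d' \<in> \<I>" "0 < c" "c < d * d"
      using regular_summand[OF less.prems False] .
    have cd: "c = d' * d'" using c(1) q_gt_1 unfolding c(2) by (simp add: mult_ac)
    have "d' > 0" using c(4) cd by simp
    then have "d' < d" using c(2) q_gt_1 by simp
    then obtain r where r: "r \<in> \<rat>" "r \<noteq> 0" "bas c d' \<otimes>\<^sub>\<H> bas a b = (\<lambda>C. r * bas (c * a) (d' * b) C)"
      using less.IH c(3) unfolding cd by blast
    have a0: "a > 0" using module_card_pos[OF fdD[OF rep_fd[OF assms(2)]]] rep_cls[OF assms(2)] by simp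
    note car = bas_carrier[OF regular_in] bas_carrier[OF c(3)] bas_carrier[OF assms(2)]
    have 1: "bas (q * q) q \<otimes>\<^sub>\<H> bas c d' = (\<lambda>C. (1 / real c) * bas (d * d) d C)"
      unfolding regular_mult[OF c(3)] c(1)[symmetric] c(2)[symmetric] ..
    have "(\<lambda>C. (1 / real c) * (bas (d * d) d \<otimes>\<^sub>\<H> bas a b) C) = (bas (q * q) q \<otimes>\<^sub>\<H> bas c d') \<otimes>\<^sub>\<H> bas a b"
      unfolding 1 SC.mult_smult_left ..
    also have "\<dots> = (\<lambda>C. r * ((1 / real (c * a)) * bas (q * q * (c * a)) (q * (d' * b)) C))"
      unfolding H.m_assoc[OF car] r(3) SC.mult_smult_right regular_mult[OF cls_mult_in[OF c(3) assms(2)]] ..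
    also have "q * q * (c * a) = d * d * a" unfolding c(1) by simp
    also have "q * (d' * b) = d * b" unfolding c(2) by simp
    finally have "(\<lambda>C. (1 / real c) * (bas (d * d) d \<otimes>\<^sub>\<H> bas a b) C) =
        (\<lambda>C. r * ((1 / real (c * a)) * bas (d * d * a) (d * b) C))" .
    then have "(bas (d * d) d \<otimes>\<^sub>\<H> bas a b) C = (r / real a) * bas (d * d * a) (d * b) C" for C
      using c(4) a0 by (auto dest!: fun_cong[of _ _ C] simp: field_simps)
    then show ?thesis using r(1,2) a0 by (intro bexI[of _ "r / real a"]) auto
  qed
qed

lemma one_in: "cls 1 1 \<in> \<I>"
  using SC.carrierD(4)[of "bas 1 1" "cls 1 1"] H.one_closed one_bas by (auto simp: bas_def)

lemma QH_eq: "\<Q> = \<H> Quot {\<zero>\<^sub>\<H>}" by (simp add: hall_quot_def hall_ideal_zero)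

sublocale QH: cring \<Q>
  unfolding QH_eq by (rule ideal.quotient_is_cring[OF H.zeroideal]) (rule H.is_cring)

sublocale pi: ring_hom_cring \<H> \<Q> \<pi>
proof
  show "\<pi> \<in> ring_hom \<H> \<Q>"
    using ideal.rcos_ring_hom[OF H.zeroideal] unfolding QH_eq quot_class_def[abs_def] hall_ideal_zero .
qed

text \<open>The ideal is zero, so cosets are singletons, and equations in the quotient are equations
  between coefficient functions.\<close>

lemma pi_eq: "\<phi> \<in> carrier \<H> \<Longrightarrow> \<pi> \<phi> = {\<phi>}"
  by (simp add: quot_class_def hall_ideal_zero a_r_coset_def' hall_zero hall_add)

lemma pi_inj: "\<phi> \<in> carrier \<H> \<Longrightarrow> \<psi> \<in> carrier \<H> \<Longrightarrow> \<pi> \<phi> = \<pi> \<psi> \<longleftrightarrow> \<phi> = \<psi>" by (simp add: pi_eq)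

lemma smult_bas_carrier: "a \<in> \<rat> \<Longrightarrow> cls c d \<in> \<I> \<Longrightarrow> (\<lambda>C. a * bas c d C) \<in> carrier \<H>"
  by (rule SC.smult_carrier[OF Qv_Rats bas_carrier])

sublocale loc: localised_cring \<Q> "denoms k"
proof
  show "denoms k \<subseteq> carrier \<Q>" unfolding denoms_eq using smult_bas_carrier pi.hom_closed by blast
  have "\<one>\<^sub>\<Q> = \<pi> (\<lambda>C. 1 * bas (1 * 1) 1 C)" using pi.hom_one one_bas by simp
  moreover have "cls (1 * 1) 1 \<in> \<I>" using one_in by simp
  ultimately show "\<one>\<^sub>\<Q> \<in> denoms k" unfolding denoms_eq mem_Collect_eq
    by (intro exI[of _ "1::real"] exI[of _ "1::nat"]) simp
next
  fix s t assume "s \<in> denoms k" "t \<in> denoms k"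
  then obtain a d b e where h: "s = \<pi> (\<lambda>C. a * bas (d * d) d C)" "a \<in> \<rat>" "a \<noteq> 0" "cls (d * d) d \<in> \<I>"
     "t = \<pi> (\<lambda>C. b * bas (e * e) e C)" "b \<in> \<rat>" "b \<noteq> 0" "cls (e * e) e \<in> \<I>"
    unfolding denoms_eq by blast
  obtain r where r: "r \<in> \<rat>" "r \<noteq> 0"
    "bas (d * d) d \<otimes>\<^sub>\<H> bas (e * e) e = (\<lambda>C. r * bas (d * d * (e * e)) (d * e) C)"
    using acyclic_mult[OF h(4,8)] by blast
  have "s \<otimes>\<^sub>\<Q> t = \<pi> ((\<lambda>C. a * bas (d * d) d C) \<otimes>\<^sub>\<H> (\<lambda>C. b * bas (e * e) e C))"
    unfolding h(1,5) using pi.hom_mult smult_bas_carrier h by simp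
  also have "\<dots> = \<pi> (\<lambda>C. (a * b * r) * bas ((d * e) * (d * e)) (d * e) C)"
    unfolding SC.mult_smult_left SC.mult_smult_right r(3) by (simp add: mult_ac)
  finally have "s \<otimes>\<^sub>\<Q> t = \<pi> (\<lambda>C. (a * b * r) * bas ((d * e) * (d * e)) (d * e) C)" .
  moreover have "d * d * (e * e) = (d * e) * (d * e)" by simp
  then have "cls ((d * e) * (d * e)) (d * e) \<in> \<I>" using cls_mult_in[OF h(4,8)] by (simp only:)
  ultimately show "s \<otimes>\<^sub>\<Q> t \<in> denoms k" using h(2,3,6,7) r(1,2) unfolding denoms_eq mem_Collect_eq
    by (intro exI[of _ "a * b * r"] exI[of _ "d * e"]) simp
qed

abbreviation "\<D> \<equiv> sdh k"
text \<open>Fractions with denominator 1. All elements in the identity to be proved are of this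
  kind, so equations in the Hall algebra can be transported instead of computing with
  fractions.\<close>

definition emb where "emb \<phi> = sdh_frac k \<phi> \<one>\<^sub>\<Q>"

lemma sdh_eq: "\<D> = loc.L" by (simp add: sdh_def)

lemma emb_eq: "emb \<phi> = loc.fr (\<pi> \<phi>) \<one>\<^sub>\<Q>" by (simp add: emb_def sdh_frac_def)

sublocale sdh: abelian_monoid \<D> unfolding sdh_eq by (rule loc.abelian_monoid_L)

lemma emb_closed [simp]: "\<phi> \<in> carrier \<H> \<Longrightarrow> emb \<phi> \<in> carrier \<D>" unfolding sdh_eq emb_eq by simp

lemma emb_zero: "emb \<zero>\<^sub>\<H> = \<zero>\<^sub>\<D>" unfolding sdh_eq emb_eq by (simp add: loc.L_zero)

lemma emb_one: "emb \<one>\<^sub>\<H> = \<one>\<^sub>\<D>" unfolding sdh_eq emb_eq by (simp add: loc.L_one)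

lemma emb_mult: "\<phi> \<in> carrier \<H> \<Longrightarrow> \<psi> \<in> carrier \<H> \<Longrightarrow> emb \<phi> \<otimes>\<^sub>\<D> emb \<psi> = emb (\<phi> \<otimes>\<^sub>\<H> \<psi>)"
  unfolding sdh_eq emb_eq by (simp add: loc.frac_mult)

lemma emb_add: "\<phi> \<in> carrier \<H> \<Longrightarrow> \<psi> \<in> carrier \<H> \<Longrightarrow> emb \<phi> \<oplus>\<^sub>\<D> emb \<psi> = emb (\<lambda>C. \<phi> C + \<psi> C)"
  unfolding sdh_eq emb_eq using loc.frac_add_same[of "\<pi> \<phi>" "\<one>\<^sub>\<Q>" "\<pi> \<psi>"] pi.hom_add[of \<phi> \<psi>]
  by (simp add: hall_add)

lemma emb_sum:
  assumes "finite A" "\<And>i. i \<in> A \<Longrightarrow> f i \<in> carrier \<H>"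
  shows "(\<lambda>C. \<Sum>i\<in>A. f i C) \<in> carrier \<H> \<and> (\<Oplus>\<^bsub>\<D>\<^esub>i\<in>A. emb (f i)) = emb (\<lambda>C. \<Sum>i\<in>A. f i C)" using assms
proof (induction A)
  case empty
  then show ?case using emb_zero H.zero_closed by (simp add: hall_zero)
next
  case (insert j A)
  then have "(\<Oplus>\<^bsub>\<D>\<^esub>i\<in>insert j A. emb (f i)) = emb (f j) \<oplus>\<^sub>\<D> (\<Oplus>\<^bsub>\<D>\<^esub>i\<in>A. emb (f i))"
    by (intro sdh.finsum_insert) auto
  then show ?case using insert SC.add_carrier emb_add by simp
qed

lemma smult_emb:
  assumes "c \<in> Qv k" "\<phi> \<in> carrier \<H>"
  shows "ihall_smult k c (emb \<phi>) = emb (\<lambda>C. c * \<phi> C)"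
proof -
  have "ihall_smult k c (emb \<phi>) = emb ((\<lambda>C. c * \<one>\<^sub>\<H> C) \<otimes>\<^sub>\<H> \<phi>)"
    unfolding ihall_smult_def emb_def[symmetric]
    by (rule emb_mult[OF SC.smult_carrier[OF assms(1) H.one_closed] assms(2)])
  then show ?thesis unfolding SC.mult_smult_left H.l_one[OF assms(2)] .
qed

text \<open>Degree expressed by |M| = q^e. The exponent is an integer because the numerators over a
  common denominator arise in degree d + p, whose sign is not known; in negative degree only 0 is
  homogeneous.\<close>

definition homog :: "int \<Rightarrow> 'a hall \<Rightarrow> bool" where
  "homog e \<phi> \<longleftrightarrow> \<phi> \<in> carrier \<H> \<and> (\<forall>C. \<phi> C \<noteq> 0 \<longrightarrow> real (card (carrier (rep C))) = real q powi e)"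

lemma homog_carrier: "homog e \<phi> \<Longrightarrow> \<phi> \<in> carrier \<H>" by (simp add: homog_def)

lemma homog_mult: "homog m \<phi> \<Longrightarrow> homog n \<psi> \<Longrightarrow> homog (m + n) (\<phi> \<otimes>\<^sub>\<H> \<psi>)" unfolding homog_def
proof (intro conjI allI impI)
  assume h: "\<phi> \<in> carrier \<H> \<and> (\<forall>C. \<phi> C \<noteq> 0 \<longrightarrow> real (card (carrier (rep C))) = real q powi m)"
    "\<psi> \<in> carrier \<H> \<and> (\<forall>C. \<psi> C \<noteq> 0 \<longrightarrow> real (card (carrier (rep C))) = real q powi n)"
  then show "\<phi> \<otimes>\<^sub>\<H> \<psi> \<in> carrier \<H>" by simp
  fix C assume "(\<phi> \<otimes>\<^sub>\<H> \<psi>) C \<noteq> 0"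
  then obtain A B where C: "C \<in> \<I>" "\<phi> A \<noteq> 0" "\<psi> B \<noteq> 0" "hall_const k A B C \<noteq> 0"
    using SC.mult_support[of \<phi> \<psi> C] h by blast
  then have AB: "A \<in> \<I>" "B \<in> \<I>" using SC.carrierD(3)[of \<phi>] SC.carrierD(3)[of \<psi>] h by auto
  have "real (card (carrier (rep C))) = real (card (carrier (rep A))) * real (card (carrier (rep B)))"
    using hall_const_nonzeroD(1)[OF AB C(1,4)] by simp
  also have "\<dots> = real q powi (m + n)" using h C q_gt_1 by (simp add: power_int_add)
  finally show "real (card (carrier (rep C))) = real q powi (m + n)" .
qed

lemma homog_zero: "homog m \<zero>\<^sub>\<H>" using H.zero_closed by (simp add: homog_def hall_zero)

lemma q_powi_inj: "real q powi m = real q powi n \<longleftrightarrow> m = n"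
  using q_gt_1 power_int_strict_increasing[of m n "real q"] power_int_strict_increasing[of n m "real q"]
  by (cases m n rule: linorder_cases) auto

lemma homog_smult_bas: "a \<in> Qv k \<Longrightarrow> cls c d \<in> \<I> \<Longrightarrow> c = q ^ m \<Longrightarrow> homog (int m) (\<lambda>C. a * bas c d C)"
  unfolding homog_def using SC.smult_carrier[OF _ bas_carrier] rep_cls[of c d]
  by (auto simp: bas_def power_int_of_nat split: if_splits)

text \<open>The condition in \<open>sdh_degree\<close> concerns all members of an isoclass; they
  share the size of the representative, which determines the dimension.\<close>

lemma kdim_homog:
  assumes \<phi>: "\<phi> \<in> carrier \<H>"
  shows "(\<forall>C. \<phi> C \<noteq> 0 \<longrightarrow> (\<forall>M \<in> C. kdim k M = m)) \<longleftrightarrow> homog (int m) \<phi>"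
proof -
  have "(\<forall>M \<in> C. kdim k M = m) \<longleftrightarrow> real (card (carrier (rep C))) = real q powi int m" if C: "C \<in> \<I>" for C
  proof -
    have *: "kdim k M = m \<longleftrightarrow> card (carrier (rep C)) = q ^ m" if M: "M \<in> C" for M
    proof -
      have M': "M \<in> cls (card (carrier (rep C))) (card (xim (rep C)))" using M class_cls[OF C] by simp
      then have "card (carrier (rep C)) = q ^ kdim k M" using kdim_card[of M] by (simp add: cls_def)
      then show ?thesis using q_gt_1 by (simp add: power_inject_exp)
    qed
    have "real (card (carrier (rep C))) = real q powi int m \<longleftrightarrow> card (carrier (rep C)) = q ^ m"
      by (simp add: power_int_of_nat flip: of_nat_power)
    then show ?thesis using * rep_mem[OF C] by blast
  qed
  then show ?thesis using SC.carrierD(3)[OF \<phi>] \<phi> unfolding homog_def by blast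
qed

lemma sdh_degreeD:
  assumes "z \<in> sdh_degree k d"
  obtains \<phi> \<sigma> m p where "z = loc.fr (\<pi> \<phi>) (\<pi> \<sigma>)" "homog m \<phi>" "homog p \<sigma>" "\<pi> \<sigma> \<in> denoms k" "d = m - p"
proof -
  from assms obtain \<phi> m a P where h: "z = sdh_frac k \<phi> (denom k a P)" "\<phi> \<in> carrier \<H>"
     "\<forall>C. \<phi> C \<noteq> 0 \<longrightarrow> (\<forall>M \<in> C. kdim k M = m)" "a \<in> \<rat>" "a \<noteq> 0" "P \<in> pdim_le1 k" "d = int m - int (kdim k P)"
    unfolding sdh_degree_def by blast
  have P: "P \<in> fd_modules k" using h(6) by (simp add: pdim_iff)
  let ?s = "\<lambda>C. a * hall_basis k P C"
  have "homog (int (kdim k P)) ?s" unfolding hall_basis_bas[OF fdD[OF P]]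
    by (rule homog_smult_bas[OF Qv_Rats[OF h(4)] cls_in[OF fdD[OF P]] kdim_card[OF P]])
  moreover have "homog (int m) \<phi>" by (rule iffD1[OF kdim_homog[OF h(2)] h(3)])
  moreover have "\<pi> ?s \<in> denoms k" unfolding denoms_def denom_def using h by blast
  moreover have "z = loc.fr (\<pi> \<phi>) (\<pi> ?s)" unfolding h(1) sdh_frac_def denom_def ..
  ultimately show ?thesis using that h(7) by blast
qed

lemma emb_degree: "homog (int m) \<phi> \<Longrightarrow> emb \<phi> \<in> sdh_degree k (int m)"
proof -
  assume \<phi>: "homog (int m) \<phi>"
  \<comment> \<open>The unit is known to be a denominator, but only for some P and some scalar.
    Comparing supports with that of the unit forces |P| = 1, so P has dimension 0 and the degree of
    \<open>\<phi>\<close> is unchanged.\<close>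
  obtain P b where P: "\<one>\<^sub>\<Q> = denom k b P" "b \<in> \<rat>" "b \<noteq> 0" "P \<in> pdim_le1 k"
    using loc.one_S unfolding denoms_def by blast
  have Pf: "P \<in> fd_modules k" using P(4) by (simp add: pdim_iff)
  have "\<pi> \<one>\<^sub>\<H> = \<pi> (\<lambda>C. b * bas (card (carrier P)) (card (xim P)) C)"
    using P(1) unfolding denom_def hall_basis_bas[OF fdD[OF Pf]] by simp
  then have "bas 1 1 = (\<lambda>C. b * bas (card (carrier P)) (card (xim P)) C)"
    using pi_inj[OF H.one_closed smult_bas_carrier[OF P(2) cls_in[OF fdD[OF Pf]]]] one_bas by simp
  then have e: "bas 1 1 (cls (card (carrier P)) (card (xim P))) \<noteq> 0" using P(3) by (simp add: bas_def)
  then have "cls (card (carrier P)) (card (xim P)) = cls 1 1" by (simp add: bas_def split: if_splits)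
  then have "card (carrier P) = 1" using rep_cls cls_in[OF fdD[OF Pf]] by metis
  then have "kdim k P = 0" using kdim_card[OF Pf] q_gt_1 by simp
  moreover have "\<phi> \<in> carrier \<H> \<and> (\<forall>C. \<phi> C \<noteq> 0 \<longrightarrow> (\<forall>M \<in> C. kdim k M = m))"
    using kdim_homog \<phi> homog_carrier by blast
  ultimately show ?thesis unfolding sdh_degree_def emb_def P(1) using P(2-4) by force
qed

lemma acyclic_power: "cls (q ^ n * q ^ n) (q ^ n) \<in> \<I>"
proof (induction n)
  case 0
  then show ?case using one_in by simp
next
  case (Suc n)
  then show ?case using cls_mult_in[OF regular_in Suc] by (simp add: mult_ac)
qed

text \<open>The components off the support have to be members of their degree, so 0 must be written
  as a fraction of every integer degree. The denominator K^n of dimension 2n with n = |d| makes the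
  numerator degree d + 2n nonnegative.\<close>

lemma zero_degree: "\<zero>\<^sub>\<D> \<in> sdh_degree k d"
proof -
  define n where "n = nat \<bar>d\<bar>"
  let ?P = "rep (cls (q ^ n * q ^ n) (q ^ n))"
  note P = rep_fd[OF acyclic_power[of n]] rep_cls[OF acyclic_power[of n]]
  have "q ^ kdim k ?P = q ^ (2 * n)" using kdim_card[OF P(1)] P(2) by (simp add: mult_2 power_add)
  then have k: "kdim k ?P = 2 * n" using q_gt_1 by (simp add: power_inject_exp)
  have "?P \<in> pdim_le1 k" unfolding pdim_iff using acyclic_card P by simp
  moreover have "denom k 1 ?P \<in> denoms k" unfolding denoms_def using calculation by force
  then have "\<zero>\<^sub>\<D> = sdh_frac k \<zero>\<^sub>\<H> (denom k 1 ?P)"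
    unfolding sdh_frac_def sdh_eq using loc.frac_zero by simp
  moreover have "int (kdim k ?P) = 2 * int n" using k by linarith
  then have "d = int (nat (d + 2 * int n)) - int (kdim k ?P)" using n_def by linarith
  moreover have "\<zero>\<^sub>\<H> \<in> carrier \<H> \<and> (\<forall>C. \<zero>\<^sub>\<H> C \<noteq> 0 \<longrightarrow> (\<forall>M \<in> C. kdim k M = nat (d + 2 * int n)))"
    by (simp add: hall_zero[symmetric]) (simp add: hall_zero)
  moreover have "(1::real) \<in> \<rat> \<and> (1::real) \<noteq> 0" by simp
  ultimately show ?thesis unfolding sdh_degree_def by blast
qed

end

section \<open>The twisted product on homogeneous elements\<close>

context ihall_alg
begin

text \<open>An equality of fractions is only an equality after multiplication by some denominator.
  Here that denominator is delivered as a homogeneous element, so the comparison of degrees survives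
  the multiplication.\<close>

lemma emb_inj:
  assumes "\<phi> \<in> carrier \<H>" "\<pi> \<sigma> \<in> denoms k" "\<psi> \<in> carrier \<H>" "\<sigma> \<in> carrier \<H>"
    and "loc.fr (\<pi> \<psi>) (\<pi> \<sigma>) = emb \<phi>"
  obtains \<rho> r where "homog r \<rho>" "\<pi> \<rho> \<in> denoms k" "\<psi> \<otimes>\<^sub>\<H> \<rho> = \<phi> \<otimes>\<^sub>\<H> \<sigma> \<otimes>\<^sub>\<H> \<rho>"
proof -
  have "\<exists>r\<in>denoms k. \<pi> \<psi> \<otimes>\<^sub>\<Q> \<one>\<^sub>\<Q> \<otimes>\<^sub>\<Q> r = \<pi> \<phi> \<otimes>\<^sub>\<Q> \<pi> \<sigma> \<otimes>\<^sub>\<Q> r" using assms(5) unfolding emb_eq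
    by (rule iffD1[OF loc.frac_eq_iff, rotated -1]) (use assms in auto)
  then obtain a P where h: "denom k a P \<in> denoms k" "P \<in> fd_modules k" "a \<in> \<rat>"
    "\<pi> \<psi> \<otimes>\<^sub>\<Q> \<one>\<^sub>\<Q> \<otimes>\<^sub>\<Q> denom k a P = \<pi> \<phi> \<otimes>\<^sub>\<Q> \<pi> \<sigma> \<otimes>\<^sub>\<Q> denom k a P"
    unfolding denoms_def pdim_iff by blast
  define \<rho> where "\<rho> = (\<lambda>C. a * hall_basis k P C)"
  have d: "denom k a P = \<pi> \<rho>" by (simp add: denom_def \<rho>_def)
  have \<rho>: "homog (int (kdim k P)) \<rho>" unfolding \<rho>_def hall_basis_bas[OF fdD[OF h(2)]]
    by (rule homog_smult_bas[OF Qv_Rats[OF h(3)] cls_in[OF fdD[OF h(2)]] kdim_card[OF h(2)]])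
  note \<rho>c = homog_carrier[OF \<rho>]
  have "\<pi> (\<psi> \<otimes>\<^sub>\<H> \<rho>) = \<pi> (\<phi> \<otimes>\<^sub>\<H> \<sigma> \<otimes>\<^sub>\<H> \<rho>)" using h(4) \<rho>c assms(1,3,4) unfolding d by simp
  then have "\<psi> \<otimes>\<^sub>\<H> \<rho> = \<phi> \<otimes>\<^sub>\<H> \<sigma> \<otimes>\<^sub>\<H> \<rho>"
    by (rule iffD1[OF pi_inj, rotated -1]) (use \<rho>c assms in auto)
  then show ?thesis using that \<rho> h(1) d by simp
qed

text \<open>The denominators are multiplied up one by one. All numerator degrees shift by the same
  p, so fractions of different degrees keep numerators of different degrees.\<close>

lemma common_denominator:
  assumes "finite A" "\<forall>d\<in>A. f d \<in> sdh_degree k d"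
  shows "\<exists>\<sigma> p \<psi>. homog p \<sigma> \<and> \<pi> \<sigma> \<in> denoms k \<and>
    (\<forall>d\<in>A. homog (d + p) (\<psi> d) \<and> f d = loc.fr (\<pi> (\<psi> d)) (\<pi> \<sigma>))" using assms
proof (induction A)
  case empty
  have "homog (int 0) (\<lambda>C. 1 * bas 1 1 C)" by (rule homog_smult_bas[OF Qv_Rats one_in]) auto
  then have "homog (int 0) \<one>\<^sub>\<H>" by (simp add: one_bas)
  then show ?case using loc.one_S pi.hom_one by (metis empty_iff)
next
  case (insert e A)
  then obtain \<sigma> p \<psi> where h: "homog p \<sigma>" "\<pi> \<sigma> \<in> denoms k"
    "\<And>d. d \<in> A \<Longrightarrow> homog (d + p) (\<psi> d)" "\<And>d. d \<in> A \<Longrightarrow> f d = loc.fr (\<pi> (\<psi> d)) (\<pi> \<sigma>)" by (metis insertCI)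
  have "f e \<in> sdh_degree k e" using insert.prems by simp
  then obtain \<phi> \<tau> m t where e: "f e = loc.fr (\<pi> \<phi>) (\<pi> \<tau>)" "homog m \<phi>" "homog t \<tau>" "\<pi> \<tau> \<in> denoms k" "e = m - t"
    by (rule sdh_degreeD)
  let ?\<psi> = "\<lambda>d. if d = e then \<phi> \<otimes>\<^sub>\<H> \<sigma> else \<psi> d \<otimes>\<^sub>\<H> \<tau>"
  note c = homog_carrier[OF h(1)] homog_carrier[OF e(2)] homog_carrier[OF e(3)]
  have st: "\<pi> (\<sigma> \<otimes>\<^sub>\<H> \<tau>) \<in> denoms k" using loc.mult_S[OF h(2) e(4)] c by simp
  have all: "homog (d + (p + t)) (?\<psi> d) \<and> f d = loc.fr (\<pi> (?\<psi> d)) (\<pi> (\<sigma> \<otimes>\<^sub>\<H> \<tau>))" if d: "d \<in> insert e A" for d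
  proof (cases "d = e")
    case True
    have "d + (p + t) = m + p" using e(5) True by simp
    then have "homog (d + (p + t)) (?\<psi> d)" using homog_mult[OF e(2) h(1)] True by (simp only: if_True refl)
    moreover have "f d = loc.fr (\<pi> (?\<psi> d)) (\<pi> (\<sigma> \<otimes>\<^sub>\<H> \<tau>))"
      unfolding True e(1) using e(4) st c by (intro loc.frac_eqI) (auto simp: QH.m_assoc)
    ultimately show ?thesis by simp
  next
    case False
    then have dA: "d \<in> A" using d by simp
    note dc = homog_carrier[OF h(3)[OF dA]]
    have "homog (d + (p + t)) (?\<psi> d)" using homog_mult[OF h(3)[OF dA] e(3)] False by (simp add: algebra_simps)
    moreover have "f d = loc.fr (\<pi> (?\<psi> d)) (\<pi> (\<sigma> \<otimes>\<^sub>\<H> \<tau>))"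
      unfolding h(4)[OF dA] using False h(2) st c dc by (intro loc.frac_eqI) (auto simp: QH.m_ac)
    ultimately show ?thesis by simp
  qed
  show ?case
    by (intro exI[of _ "\<sigma> \<otimes>\<^sub>\<H> \<tau>"] exI[of _ "p + t"] exI[of _ ?\<psi>] conjI homog_mult[OF h(1) e(3)] st)
      (rule ballI, rule all, assumption)
qed

text \<open>Cleared of denominators, the decomposition is an identity of coefficient functions whose
  summands are homogeneous of distinct degrees. At a given isoclass at most one summand is nonzero,
  so the identity splits into its degrees.\<close>

lemma component_unique:
  assumes \<phi>: "homog m \<phi>" and A: "finite A" "m \<in> A" and f: "\<forall>d\<in>A. f d \<in> sdh_degree k d"
    and s: "emb \<phi> = (\<Oplus>\<^bsub>\<D>\<^esub>d\<in>A. f d)"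
  shows "\<forall>d\<in>A. f d = (if d = m then emb \<phi> else \<zero>\<^sub>\<D>)"
proof -
  obtain \<sigma> p \<psi> where h: "homog p \<sigma>" "\<pi> \<sigma> \<in> denoms k"
    "\<And>d. d \<in> A \<Longrightarrow> homog (d + p) (\<psi> d)" "\<And>d. d \<in> A \<Longrightarrow> f d = loc.fr (\<pi> (\<psi> d)) (\<pi> \<sigma>)"
    using common_denominator[OF A(1) f] by metis
  note pc = homog_carrier[OF \<phi>] and sc = homog_carrier[OF h(1)]
  have psc: "\<psi> d \<in> carrier \<H>" if "d \<in> A" for d using homog_carrier h(3) that by blast
  have "emb \<phi> = (\<Oplus>\<^bsub>\<D>\<^esub>d\<in>A. loc.fr (\<pi> (\<psi> d)) (\<pi> \<sigma>))"
    unfolding s sdh_eq using h psc by (intro loc.L.finsum_cong') auto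
  also have "\<dots> = loc.fr (\<Oplus>\<^bsub>\<Q>\<^esub>d\<in>A. \<pi> (\<psi> d)) (\<pi> \<sigma>)"
    unfolding sdh_eq using psc by (intro loc.frac_finsum[OF A(1) h(2)]) auto
  also have "(\<Oplus>\<^bsub>\<Q>\<^esub>d\<in>A. \<pi> (\<psi> d)) = \<pi> (\<Oplus>\<^bsub>\<H>\<^esub>d\<in>A. \<psi> d)"
    using psc pi.hom_finsum[of \<psi> A] by (simp add: comp_def Pi_iff)
  finally have "loc.fr (\<pi> (\<Oplus>\<^bsub>\<H>\<^esub>d\<in>A. \<psi> d)) (\<pi> \<sigma>) = emb \<phi>" by simp
  then obtain \<rho> r where \<rho>: "homog r \<rho>" "\<pi> \<rho> \<in> denoms k" "(\<Oplus>\<^bsub>\<H>\<^esub>d\<in>A. \<psi> d) \<otimes>\<^sub>\<H> \<rho> = \<phi> \<otimes>\<^sub>\<H> \<sigma> \<otimes>\<^sub>\<H> \<rho>"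
    by (rule emb_inj[OF pc h(2) _ sc, rotated]) (use psc in auto)
  note rc = homog_carrier[OF \<rho>(1)]
  define \<chi> where "\<chi> d = \<psi> d \<otimes>\<^sub>\<H> \<rho>" for d
  define \<theta> where "\<theta> = \<phi> \<otimes>\<^sub>\<H> \<sigma> \<otimes>\<^sub>\<H> \<rho>"
  have \<chi>: "homog (d + p + r) (\<chi> d)" if "d \<in> A" for d
    unfolding \<chi>_def by (rule homog_mult[OF h(3)[OF that] \<rho>(1)])
  have \<theta>: "homog (m + p + r) \<theta>" unfolding \<theta>_def by (intro homog_mult \<phi> h(1) \<rho>(1))
  have fs: "(\<Oplus>\<^bsub>\<H>\<^esub>d\<in>B. \<chi> d) = (\<lambda>C. \<Sum>d\<in>B. \<chi> d C)" if "B \<subseteq> A" for B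
    using finite_subset[OF that A(1)] that
  proof (induction B)
    case (insert b B)
    then have "(\<Oplus>\<^bsub>\<H>\<^esub>d\<in>insert b B. \<chi> d) = \<chi> b \<oplus>\<^sub>\<H> (\<Oplus>\<^bsub>\<H>\<^esub>d\<in>B. \<chi> d)"
      using homog_carrier[OF \<chi>] by (intro H.finsum_insert) auto
    then show ?case using insert by (simp add: hall_add)
  qed (simp add: hall_zero)
  have "(\<Oplus>\<^bsub>\<H>\<^esub>d\<in>A. \<chi> d) = \<theta>" unfolding \<theta>_def \<rho>(3)[symmetric] \<chi>_def
    using H.finsum_ldistr[OF A(1) rc, of \<psi>] psc by auto
  then have sum: "(\<lambda>C. \<Sum>d\<in>A. \<chi> d C) = \<theta>" unfolding fs[OF subset_refl] .
  have eq: "\<chi> d = (if d = m then \<theta> else \<zero>\<^sub>\<H>)" if d: "d \<in> A" for d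
  proof
    fix C
    show "\<chi> d C = (if d = m then \<theta> else \<zero>\<^sub>\<H>) C"
    proof (cases "real (card (carrier (rep C))) = real q powi (d + p + r)")
      case True
      have "\<chi> e C = 0" if "e \<in> A" "e \<noteq> d" for e
        using \<chi>[OF that(1)] True q_powi_inj[of "d + p + r" "e + p + r"] that(2) unfolding homog_def by auto
      then have "(\<Sum>e\<in>A. \<chi> e C) = \<chi> d C" using A(1) d
        by (subst sum.remove[OF A(1) d]) (auto intro: sum.neutral)
      then have "\<chi> d C = \<theta> C" using sum by (metis)
      moreover have "\<theta> C = 0" if "d \<noteq> m"
        using \<theta> True q_powi_inj[of "d + p + r" "m + p + r"] that unfolding homog_def by auto
      ultimately show ?thesis by (simp add: hall_zero)
    next
      case False
      then have "\<chi> d C = 0" using \<chi>[OF d] unfolding homog_def by auto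
      moreover have "\<theta> C = 0" if "d = m" using \<theta> False that unfolding homog_def by auto
      ultimately show ?thesis by (simp add: hall_zero)
    qed
  qed
  show ?thesis
  proof
    fix d assume d: "d \<in> A"
    note dc = psc[OF d]
    have "\<exists>\<rho>\<in>denoms k. \<pi> (\<psi> d) \<otimes>\<^sub>\<Q> \<one>\<^sub>\<Q> \<otimes>\<^sub>\<Q> \<rho> = \<pi> (if d = m then \<phi> else \<zero>\<^sub>\<H>) \<otimes>\<^sub>\<Q> \<pi> \<sigma> \<otimes>\<^sub>\<Q> \<rho>"
    proof (rule bexI[OF _ \<rho>(2)])
      have "\<pi> (\<psi> d) \<otimes>\<^sub>\<Q> \<one>\<^sub>\<Q> \<otimes>\<^sub>\<Q> \<pi> \<rho> = \<pi> (\<chi> d)" unfolding \<chi>_def using dc rc by simp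
      also have "\<dots> = \<pi> (if d = m then \<phi> else \<zero>\<^sub>\<H>) \<otimes>\<^sub>\<Q> \<pi> \<sigma> \<otimes>\<^sub>\<Q> \<pi> \<rho>"
        unfolding eq[OF d] \<theta>_def using pc sc rc by simp
      finally show "\<pi> (\<psi> d) \<otimes>\<^sub>\<Q> \<one>\<^sub>\<Q> \<otimes>\<^sub>\<Q> \<pi> \<rho> = \<pi> (if d = m then \<phi> else \<zero>\<^sub>\<H>) \<otimes>\<^sub>\<Q> \<pi> \<sigma> \<otimes>\<^sub>\<Q> \<pi> \<rho>" .
    qed
    then have "f d = emb (if d = m then \<phi> else \<zero>\<^sub>\<H>)" unfolding h(4)[OF d] emb_eq
      by (rule iffD2[OF loc.frac_eq_iff, rotated -1]) (use h(2) dc pc in auto)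
    then show "f d = (if d = m then emb \<phi> else \<zero>\<^sub>\<D>)" by (simp add: emb_zero)
  qed
qed

text \<open>Evaluates a sum over the support of a function with at most one nonzero value. If that
  value is itself zero the sum is empty, which is the reason for \<open>z\<close>.\<close>

lemma finsum_single:
  assumes g: "\<And>d. g d = (if d = m then y else \<zero>\<^sub>\<D>)" and z: "h \<zero>\<^sub>\<D> = \<zero>\<^sub>\<D>" and c: "h y \<in> carrier \<D>"
    and h: "\<And>d. H d (g d) = (if d = m then h y else \<zero>\<^sub>\<D>)"
  shows "(\<Oplus>\<^bsub>\<D>\<^esub>d\<in>{d. g d \<noteq> \<zero>\<^sub>\<D>}. H d (g d)) = h y"
proof (cases "y = \<zero>\<^sub>\<D>")
  case True
  then have "{d. g d \<noteq> \<zero>\<^sub>\<D>} = {}" by (auto simp: g)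
  then show ?thesis using True z by simp
next
  case False
  then have "{d. g d \<noteq> \<zero>\<^sub>\<D>} = {m}" by (auto simp: g)
  then show ?thesis using c h[of m] by (simp add: sdh.finsum_insert)
qed

lemma component_emb:
  assumes \<phi>: "homog (int m) \<phi>"
  shows "sdh_component k (emb \<phi>) = (\<lambda>d. if d = int m then emb \<phi> else \<zero>\<^sub>\<D>)"
  unfolding sdh_component_def
proof (rule the_equality, intro conjI allI)
  let ?f = "\<lambda>d. if d = int m then emb \<phi> else \<zero>\<^sub>\<D>"
  note pc = homog_carrier[OF \<phi>]
  show "?f d \<in> sdh_degree k d" for d using emb_degree[OF \<phi>] zero_degree by simp
  show "finite {d. ?f d \<noteq> \<zero>\<^sub>\<D>}" by (rule finite_subset[of _ "{int m}"]) auto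
  show "emb \<phi> = (\<Oplus>\<^bsub>\<D>\<^esub>d\<in>{d. ?f d \<noteq> \<zero>\<^sub>\<D>}. ?f d)"
    by (rule finsum_single[of ?f "int m" "emb \<phi>" "\<lambda>z. z" "\<lambda>d z. z", symmetric]) (use pc in auto)
  fix f assume f: "(\<forall>d. f d \<in> sdh_degree k d) \<and> finite {d. f d \<noteq> \<zero>\<^sub>\<D>} \<and>
    emb \<phi> = (\<Oplus>\<^bsub>\<D>\<^esub>d\<in>{d. f d \<noteq> \<zero>\<^sub>\<D>}. f d)"
  \<comment> \<open>The degree m need not lie in the support of f, as the element may be zero;
    inserting it changes no sum and allows the comparison.\<close>
  let ?A = "insert (int m) {d. f d \<noteq> \<zero>\<^sub>\<D>}"
  have fc: "f d \<in> carrier \<D>" for d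
  proof -
    have "f d \<in> sdh_degree k d" using f by blast
    then obtain \<psi> \<sigma> n p where h: "f d = loc.fr (\<pi> \<psi>) (\<pi> \<sigma>)" "homog n \<psi>" "homog p \<sigma>" "\<pi> \<sigma> \<in> denoms k" "d = n - p"
      by (rule sdh_degreeD)
    show ?thesis unfolding h(1) sdh_eq using homog_carrier[OF h(2)] h(4) by simp
  qed
  have "(\<Oplus>\<^bsub>\<D>\<^esub>d\<in>{d. f d \<noteq> \<zero>\<^sub>\<D>}. f d) = (\<Oplus>\<^bsub>\<D>\<^esub>d\<in>?A. f d)"
    by (rule sdh.add.finprod_mono_neutral_cong_left) (use f fc in auto)
  then have "\<forall>d\<in>?A. f d = ?f d" using f by (intro component_unique[OF \<phi>]) auto
  then show "f = ?f" by (intro ext) (auto split: if_splits)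
qed

lemma Qv_powi: "c \<in> Qv k \<Longrightarrow> c powi n \<in> Qv k"
proof -
  have "b ^ i \<in> Qv k" if "b \<in> Qv k" for b i
    by (induction i) (use that Qv_mult Qv_Rats[OF Rats_1] in auto)
  moreover assume "c \<in> Qv k"
  ultimately show ?thesis by (simp add: power_int_def Qv_inverse)
qed

text \<open>Each factor has a single component, so both sums in the definition of the twisted
  product collapse to one term.\<close>

lemma twisted_emb:
  assumes \<phi>: "homog (int m) \<phi>" and \<psi>: "homog (int n) \<psi>"
  shows "twisted_mult k (emb \<phi>) (emb \<psi>) = emb (\<lambda>C. vpar k powi (int m * int n) * (\<phi> \<otimes>\<^sub>\<H> \<psi>) C)"
proof -
  note c = homog_carrier[OF \<phi>] homog_carrier[OF \<psi>]
  define w where "w d e = vpar k powi (d * e)" for d e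
  have w: "w d e \<in> Qv k" for d e unfolding w_def by (rule Qv_powi[OF Qv_vpar])
  have z: "emb \<eta> \<otimes>\<^sub>\<D> \<zero>\<^sub>\<D> = \<zero>\<^sub>\<D>" "\<zero>\<^sub>\<D> \<otimes>\<^sub>\<D> emb \<eta> = \<zero>\<^sub>\<D>" if "\<eta> \<in> carrier \<H>" for \<eta>
    using emb_mult[OF that H.zero_closed] emb_mult[OF H.zero_closed that] that by (simp_all add: emb_zero)
  have sz: "ihall_smult k (w d e) \<zero>\<^sub>\<D> = \<zero>\<^sub>\<D>" for d e
    unfolding emb_zero[symmetric] smult_emb[OF w H.zero_closed] by (simp add: hall_zero)
  have sc: "ihall_smult k (w d e) (emb \<phi> \<otimes>\<^sub>\<D> emb \<psi>) \<in> carrier \<D>" for d e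
    unfolding emb_mult[OF c] using c by (subst smult_emb[OF w]) (auto intro!: emb_closed SC.smult_carrier[OF w])
  let ?g = "sdh_component k (emb \<psi>)" and ?f = "sdh_component k (emb \<phi>)"
  have 1: "(\<Oplus>\<^bsub>\<D>\<^esub>e\<in>{e. ?g e \<noteq> \<zero>\<^sub>\<D>}. ihall_smult k (w d e) (?f d \<otimes>\<^sub>\<D> ?g e)) =
      (if d = int m then ihall_smult k (w (int m) (int n)) (emb \<phi> \<otimes>\<^sub>\<D> emb \<psi>) else \<zero>\<^sub>\<D>)" for d
  proof (cases "d = int m")
    case True
    have "(\<Oplus>\<^bsub>\<D>\<^esub>e\<in>{e. ?g e \<noteq> \<zero>\<^sub>\<D>}. ihall_smult k (w (int m) e) (emb \<phi> \<otimes>\<^sub>\<D> ?g e)) =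
        ihall_smult k (w (int m) (int n)) (emb \<phi> \<otimes>\<^sub>\<D> emb \<psi>)"
      by (rule finsum_single[of ?g "int n" "emb \<psi>" "\<lambda>y. ihall_smult k (w (int m) (int n)) (emb \<phi> \<otimes>\<^sub>\<D> y)"
        "\<lambda>e y. ihall_smult k (w (int m) e) (emb \<phi> \<otimes>\<^sub>\<D> y)"])
        (use z c sz sc in \<open>auto simp: component_emb[OF \<psi>]\<close>)
    then show ?thesis using True by (simp add: component_emb[OF \<phi>])
  next
    case False
    have "ihall_smult k (w d e) (\<zero>\<^sub>\<D> \<otimes>\<^sub>\<D> ?g e) = \<zero>\<^sub>\<D>" for e
      using z c sz z(1)[OF H.zero_closed] by (simp add: component_emb[OF \<psi>] emb_zero)
    then show ?thesis using False by (simp add: component_emb[OF \<phi>])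
  qed
  have "twisted_mult k (emb \<phi>) (emb \<psi>) = ihall_smult k (w (int m) (int n)) (emb \<phi> \<otimes>\<^sub>\<D> emb \<psi>)"
    unfolding twisted_mult_def w_def[symmetric] 1
    by (rule finsum_single[of ?f "int m" "emb \<phi>" "\<lambda>y. ihall_smult k (w (int m) (int n)) (y \<otimes>\<^sub>\<D> emb \<psi>)"
        "\<lambda>d y. if d = int m then ihall_smult k (w (int m) (int n)) (emb \<phi> \<otimes>\<^sub>\<D> emb \<psi>) else \<zero>\<^sub>\<D>"])
      (use z c sz sc in \<open>auto simp: component_emb[OF \<phi>]\<close>)
  then show ?thesis using smult_emb[OF w H.m_closed[OF c]] unfolding emb_mult[OF c] w_def by simp
qed

end

section \<open>Recursions for the coefficients\<close>

text \<open>The coefficient of the theorem with a = n - 2l, b = l and \<open>\<sigma>\<close> =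
  (-1)^n. The recursions change these quantities separately, so they become independent
  arguments.\<close>

definition icoeff :: "real \<Rightarrow> int \<Rightarrow> nat \<Rightarrow> nat \<Rightarrow> real" where
  "icoeff v \<sigma> a b = v powi (int b * (int b + \<sigma>) - int (a choose 2)) * (v - inverse v) ^ b
     / (qfact v a * qdfact_even v b)"

context
  fixes v :: real
  assumes v: "v > 1"
begin

lemma inverse_v: "v - inverse v > 0" using v less_1_mult[OF v v] by (simp add: field_simps)

lemma powi_add_nat: "x = y + int n \<Longrightarrow> v powi x = v powi y * v ^ n"
  using v by (simp add: power_int_add)

lemma qint_eq: "qint v m = (v ^ m - 1 / v ^ m) / (v - inverse v)"
  by (simp add: qint_def power_int_minus field_simps)

lemma qint_pos: "m > 0 \<Longrightarrow> qint v m > 0"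
proof -
  assume "m > 0"
  then have "v ^ m > 1" using v by (simp add: one_less_power)
  then have "v ^ m - 1 / v ^ m > 0" by (simp add: field_simps) (smt (verit) mult_less_cancel_left2)
  then show ?thesis unfolding qint_eq using inverse_v by simp
qed

lemma qfact_Suc: "qfact v (Suc a) = qfact v a * qint v (Suc a)" by (simp add: qfact_def)

lemma qfact_pos: "qfact v a > 0" unfolding qfact_def by (intro prod_pos) (auto intro: qint_pos)

text \<open>Passing from a to a + 1 adds a to the binomial coefficient in the exponent and one
  factor to the quantum factorial.\<close>

lemma icoeff_Suc_left: "icoeff v \<sigma> a b = icoeff v \<sigma> (Suc a) b * qint v (Suc a) * v ^ a"
proof -
  have "int b * (int b + \<sigma>) - int (a choose 2) = (int b * (int b + \<sigma>) - int (Suc a choose 2)) + int a"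
    by (simp add: numeral_2_eq_2)
  note powi_add_nat[OF this]
  then show ?thesis unfolding icoeff_def qfact_Suc using qint_pos[of "Suc a"] by simp
qed

text \<open>Changing the sign shifts the exponent b (b + \<open>\<sigma>\<close>) by 2 b.\<close>

lemma icoeff_sign: "icoeff v 1 a b = v ^ (2 * b) * icoeff v (-1) a b"
proof -
  have "int b * (int b + 1) - int (a choose 2) = (int b * (int b + -1) - int (a choose 2)) + int (2 * b)"
    by (simp add: algebra_simps)
  note powi_add_nat[OF this]
  then show ?thesis unfolding icoeff_def by simp
qed

lemma icoeff_Suc_right:
  "icoeff v 1 a (Suc b) * qint v (2 * b + 2) = v ^ (2 * b + 2) * (v - inverse v) * icoeff v 1 a b"
  "icoeff v (-1) a (Suc b) * qint v (2 * b + 2) = v ^ (2 * b) * (v - inverse v) * icoeff v (-1) a b"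
proof -
  have q: "qdfact_even v (Suc b) = qdfact_even v b * qint v (2 * b + 2)" by (simp add: qdfact_even_def)
  have p: "qint v (2 * b + 2) > 0" by (rule qint_pos) simp
  have "int (Suc b) * (int (Suc b) + 1) - int (a choose 2) = (int b * (int b + 1) - int (a choose 2)) + int (2 * b + 2)"
    "int (Suc b) * (int (Suc b) + -1) - int (a choose 2) = (int b * (int b + -1) - int (a choose 2)) + int (2 * b)"
    by (simp_all add: algebra_simps)
  note powi_add_nat[OF this(1)] powi_add_nat[OF this(2)]
  then show "icoeff v 1 a (Suc b) * qint v (2 * b + 2) = v ^ (2 * b + 2) * (v - inverse v) * icoeff v 1 a b"
    "icoeff v (-1) a (Suc b) * qint v (2 * b + 2) = v ^ (2 * b) * (v - inverse v) * icoeff v (-1) a b"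
    unfolding icoeff_def q using p by simp_all
qed

text \<open>The addition rule v^B [A] + v^(-A) [B] = [A + B], taken at A = a + 1 and B = 2 b +
  2.\<close>

lemma qint_add_even: "v ^ (2 * b + 2) * qint v (Suc a) + qint v (2 * b + 2) / v ^ Suc a = qint v (a + 2 * b + 3)"
proof -
  have *: "v ^ (a + 2 * b + 3) = v ^ (2 * b + 2) * v ^ Suc a" by (simp add: power_add eval_nat_numeral mult_ac)
  have "B * (A - 1 / A) + (B - 1 / B) / A = B * A - 1 / (B * A)" if "A \<noteq> 0" "B \<noteq> 0" for A B :: real
    using that by (simp add: field_simps)
  from this[of "v ^ Suc a" "v ^ (2 * b + 2)"]
  have "v ^ (2 * b + 2) * (v ^ Suc a - 1 / v ^ Suc a) + (v ^ (2 * b + 2) - 1 / v ^ (2 * b + 2)) / v ^ Suc a =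
    v ^ (a + 2 * b + 3) - 1 / v ^ (a + 2 * b + 3)" using v unfolding * by simp
  note h = this
  have gen: "B * (P / w) + R / w / A = (B * P + R / A) / w" for A B P R w :: real
    by (simp add: add_divide_distrib mult_ac)
  show ?thesis unfolding qint_eq h[symmetric] by (rule gen)
qed

text \<open>The coefficient of e(a + 1, b + 1) in [S] * D_n for even n = a + 2b + 2. The two terms
  on the left come from e(a, b + 1) and from e(a + 2, b).\<close>

lemma coeff_step_even:
  "icoeff v 1 a (Suc b) / v ^ a + (v ^ (a + 2) - 1 / v ^ (a + 2)) * icoeff v 1 (a + 2) b =
     qint v (a + 2 * b + 3) * icoeff v (-1) (Suc a) (Suc b)"
proof -
  let ?u = "v - inverse v" and ?G = "icoeff v (-1) (Suc a) (Suc b)"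
  have v0: "v \<noteq> 0" "?u \<noteq> 0" using v inverse_v by auto
  have 1: "icoeff v 1 a (Suc b) / v ^ a = v ^ (2 * b + 2) * qint v (Suc a) * ?G"
    using icoeff_Suc_left[of 1 a "Suc b"] icoeff_sign[of "Suc a" "Suc b"] v0 by simp
  have "(v ^ (a + 2) - 1 / v ^ (a + 2)) * icoeff v 1 (a + 2) b = ?u * (qint v (a + 2) * icoeff v 1 (a + 2) b)"
    unfolding qint_eq using v0 by simp
  also have "qint v (a + 2) * icoeff v 1 (a + 2) b = icoeff v 1 (Suc a) b / v ^ Suc a"
    using icoeff_Suc_left[of 1 "Suc a" b] v0 by (simp add: mult_ac)
  also have "?u * (icoeff v 1 (Suc a) b / v ^ Suc a) = ?G * qint v (2 * b + 2) / v ^ Suc a"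
    unfolding icoeff_Suc_right(2) icoeff_sign by (simp add: mult_ac)
  finally show ?thesis unfolding 1 qint_add_even[symmetric] by (simp add: algebra_simps)
qed

text \<open>What remains of \<open>coeff_step_odd\<close> once each of its terms has been written as
  a multiple of \<open>icoeff v 1 a (Suc b)\<close>.\<close>

lemma qint_add_odd: "qint v a / v ^ (2 * b + 2) + qint v (2 * b + 2) / v ^ (a + 4 * b + 2)
    + (v - inverse v) / v ^ (2 * b + 1) * qint v (a + 2 * b + 1) * qint v (2 * b + 2) = qint v (a + 2 * b + 2)"
proof -
  let ?u = "v - inverse v"
  have u0: "?u \<noteq> 0" "v \<noteq> 0" using inverse_v v by auto
  define A B where AB: "A = v ^ a" "B = v ^ (2 * b + 2)"
  have nz: "A \<noteq> 0" "B \<noteq> 0" using v by (auto simp: AB)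
  have e: "v ^ (a + 4 * b + 2) = A * (B * B) / v ^ 2" "v ^ (2 * b + 1) = B / v" "v ^ (a + 2 * b + 1) = A * B / v"
     "v ^ (a + 2 * b + 2) = A * B"
    using u0 unfolding AB by (simp_all add: power_add eval_nat_numeral field_simps)
  \<comment> \<open>The third summand contributes A B - A / B and minus the second summand, so
    everything but A B - 1 / (A B) cancels.\<close>
  have "(A - 1 / A) / B + (B - 1 / B) / (A * (B * B) / v ^ 2) + 1 / (B / v) * (A * B / v - 1 / (A * B / v)) * (B - 1 / B)
      = A * B - 1 / (A * B)" using nz u0 by (simp add: field_simps power2_eq_square)
  note h = this
  have gen: "P / w / B + R / w / T + w / W * (Y / w) * (R / w) = (P / B + R / T + 1 / W * Y * R) / w"
    if "w \<noteq> 0" for P R T W Y w :: real using that by (simp add: add_divide_distrib mult_ac)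
  show ?thesis unfolding qint_eq e AB[symmetric] h[symmetric] by (rule gen[OF u0(1)])
qed

text \<open>The coefficient of e(a, b + 1) for odd n = a + 2b + 1. The three terms come from e(a -
  1, b + 1), from e(a + 1, b), and from [K] * D_(n-1). The first is rewritten with a factor [a], so
  that it is 0 for a = 0, where e(a - 1, b + 1) does not exist.\<close>

lemma coeff_step_odd:
  "qint v a / v ^ (2 * b + 2) * icoeff v 1 a (Suc b) + (v ^ (a + 1) - 1 / v ^ (a + 1)) * icoeff v (-1) (a + 1) b
     + v * (v - inverse v)\<^sup>2 * qint v (a + 2 * b + 1) * icoeff v 1 a b =
     qint v (a + 2 * b + 2) * icoeff v 1 a (Suc b)"
proof -
  let ?u = "v - inverse v" and ?G = "icoeff v 1 a (Suc b)"
  have v0: "v \<noteq> 0" "?u \<noteq> 0" using v inverse_v by auto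
  have g: "?u * icoeff v 1 a b = ?G * qint v (2 * b + 2) / v ^ (2 * b + 2)"
    unfolding icoeff_Suc_right(1) using v0 by simp
  have "(v ^ (a + 1) - 1 / v ^ (a + 1)) * icoeff v (-1) (a + 1) b = ?u * (qint v (a + 1) * icoeff v (-1) (a + 1) b)"
    unfolding qint_eq using v0 by simp
  also have "qint v (a + 1) * icoeff v (-1) (a + 1) b = icoeff v (-1) a b / v ^ a"
    using icoeff_Suc_left[of "-1" a b] v0 by (simp add: mult_ac)
  also have "icoeff v (-1) a b = icoeff v 1 a b / v ^ (2 * b)" unfolding icoeff_sign using v0 by simp
  also have "?u * (icoeff v 1 a b / v ^ (2 * b) / v ^ a) = ?G * qint v (2 * b + 2) / v ^ (2 * b + 2) / v ^ (2 * b) / v ^ a"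
    unfolding g[symmetric] by simp
  also have "\<dots> = ?G * (qint v (2 * b + 2) / v ^ (a + 4 * b + 2))"
    by (simp add: power_add[symmetric] add_ac flip: mult.assoc)
  finally have 2: "(v ^ (a + 1) - 1 / v ^ (a + 1)) * icoeff v (-1) (a + 1) b = ?G * (qint v (2 * b + 2) / v ^ (a + 4 * b + 2))" .
  have "v * ?u\<^sup>2 * qint v (a + 2 * b + 1) * icoeff v 1 a b = v * ?u * qint v (a + 2 * b + 1) * (?u * icoeff v 1 a b)"
    by (simp add: power2_eq_square)
  also have "\<dots> = ?G * (?u / v ^ (2 * b + 1) * qint v (a + 2 * b + 1) * qint v (2 * b + 2))"
    unfolding g using v0 by (simp add: field_simps)
  finally have 3: "v * ?u\<^sup>2 * qint v (a + 2 * b + 1) * icoeff v 1 a b =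
    ?G * (?u / v ^ (2 * b + 1) * qint v (a + 2 * b + 1) * qint v (2 * b + 2))" .
  show ?thesis unfolding 2 3 qint_add_odd[symmetric] by (simp add: algebra_simps)
qed

text \<open>\<open>E j\<close> stands for e(n + 1 - 2j, j), evaluated at one isoclass, with n = 2l;
  shifting the index in the second half of the summand collects the coefficient of each
  \<open>E j\<close>.\<close>

lemma sum_step_even:
  "(\<Sum>j\<le>l. icoeff v 1 (2 * l - 2 * j) j * (E j / v ^ (2 * l - 2 * j) + (v ^ (2 * l - 2 * j) - 1 / v ^ (2 * l - 2 * j)) * E (Suc j))) =
   qint v (2 * l + 1) * (\<Sum>j\<le>l. icoeff v (-1) (2 * l + 1 - 2 * j) j * E j)"
proof -
  let ?c = "\<lambda>j. icoeff v 1 (2 * l - 2 * j) j" and ?d = "\<lambda>j. icoeff v (-1) (2 * l + 1 - 2 * j) j"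
  let ?p = "\<lambda>j. v ^ (2 * l - 2 * j)"
  have "(\<Sum>j\<le>l. ?c j * (E j / ?p j + (?p j - 1 / ?p j) * E (Suc j))) =
      (\<Sum>j\<le>l. ?c j / ?p j * E j) + (\<Sum>j\<le>l. (?p j - 1 / ?p j) * ?c j * E (Suc j))"
    by (simp add: algebra_simps sum.distrib[symmetric])
  \<comment> \<open>At j = l the factor v^0 - 1 / v^0 vanishes, so no \<open>E (Suc l)\<close>
    appears.\<close>
  also have "(\<Sum>j\<le>l. (?p j - 1 / ?p j) * ?c j * E (Suc j)) = (\<Sum>j<l. (?p j - 1 / ?p j) * ?c j * E (Suc j))"
    by (simp flip: lessThan_Suc_atMost)
  also have "(\<Sum>j\<le>l. ?c j / ?p j * E j) = ?c 0 / ?p 0 * E 0 + (\<Sum>b<l. ?c (Suc b) / ?p (Suc b) * E (Suc b))"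
    by (rule sum.atMost_shift)
  also have "?c 0 / ?p 0 = qint v (2 * l + 1) * ?d 0"
    using icoeff_Suc_left[of 1 "2 * l" 0] icoeff_sign[of "Suc (2 * l)" 0] v by simp
  finally have "(\<Sum>j\<le>l. ?c j * (E j / ?p j + (?p j - 1 / ?p j) * E (Suc j))) =
      qint v (2 * l + 1) * ?d 0 * E 0 + (\<Sum>b<l. (?c (Suc b) / ?p (Suc b) + (?p b - 1 / ?p b) * ?c b) * E (Suc b))"
    by (simp add: algebra_simps sum.distrib[symmetric])
  also have "(\<Sum>b<l. (?c (Suc b) / ?p (Suc b) + (?p b - 1 / ?p b) * ?c b) * E (Suc b)) =
      (\<Sum>b<l. qint v (2 * l + 1) * ?d (Suc b) * E (Suc b))"
  proof (rule sum.cong[OF refl])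
    fix b assume "b \<in> {..<l}"
    then have e: "2 * l - 2 * b = (2 * l - 2 * Suc b) + 2" "2 * l + 1 - 2 * Suc b = Suc (2 * l - 2 * Suc b)"
      "2 * l + 1 = (2 * l - 2 * Suc b) + 2 * b + 3" by auto
    show "(?c (Suc b) / ?p (Suc b) + (?p b - 1 / ?p b) * ?c b) * E (Suc b) = qint v (2 * l + 1) * ?d (Suc b) * E (Suc b)"
      using coeff_step_even[of "2 * l - 2 * Suc b" b] unfolding e(1,2) e(3)[symmetric] by simp
  qed
  also have "qint v (2 * l + 1) * ?d 0 * E 0 + (\<Sum>b<l. qint v (2 * l + 1) * ?d (Suc b) * E (Suc b)) =
      qint v (2 * l + 1) * (\<Sum>j\<le>l. ?d j * E j)"
    by (simp add: sum.atMost_shift sum_distrib_left algebra_simps)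
  finally show ?thesis .
qed

text \<open>The step from n = 2l + 1 to n + 1. Unlike in the even case, the sum on the right has one
  more term, with \<open>E (Suc l)\<close>, the class of a power of K.\<close>

lemma sum_step_odd: "(\<Sum>j\<le>l. icoeff v (-1) (2 * l + 1 - 2 * j) j * (E j / v ^ (2 * l + 1 - 2 * j) +
       (v ^ (2 * l + 1 - 2 * j) - 1 / v ^ (2 * l + 1 - 2 * j)) * E (Suc j))) +
   v * (v - inverse v)\<^sup>2 * qint v (2 * l + 1) * (\<Sum>j\<le>l. icoeff v 1 (2 * l - 2 * j) j * E (Suc j)) =
   qint v (2 * l + 2) * (\<Sum>j\<le>Suc l. icoeff v 1 (2 * l + 2 - 2 * j) j * E j)"
proof -
  let ?c = "\<lambda>j. icoeff v (-1) (2 * l + 1 - 2 * j) j" and ?d = "\<lambda>j. icoeff v 1 (2 * l + 2 - 2 * j) j"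
  let ?b = "\<lambda>j. icoeff v 1 (2 * l - 2 * j) j"
  let ?p = "\<lambda>j. v ^ (2 * l + 1 - 2 * j)" and ?w = "v * (v - inverse v)\<^sup>2 * qint v (2 * l + 1)"
  let ?f = "\<lambda>b. qint v (2 * l - 2 * b) / v ^ (2 * b + 2) * ?d (Suc b)"
  have "(\<Sum>j\<le>l. ?c j * (E j / ?p j + (?p j - 1 / ?p j) * E (Suc j))) =
      (\<Sum>j\<le>l. ?c j / ?p j * E j) + (\<Sum>j\<le>l. (?p j - 1 / ?p j) * ?c j * E (Suc j))"
    by (simp add: algebra_simps sum.distrib[symmetric])
  also have "(\<Sum>j\<le>l. ?c j / ?p j * E j) = ?c 0 / ?p 0 * E 0 + (\<Sum>b<l. ?c (Suc b) / ?p (Suc b) * E (Suc b))"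
    by (rule sum.atMost_shift)
  also have "?c 0 / ?p 0 = qint v (2 * l + 2) * ?d 0"
    using icoeff_Suc_left[of "-1" "2 * l + 1" 0] icoeff_sign[of "2 * l + 2" 0] v by simp
  also have "(\<Sum>b<l. ?c (Suc b) / ?p (Suc b) * E (Suc b)) = (\<Sum>b<l. ?f b * E (Suc b))"
  proof (rule sum.cong[OF refl])
    fix b assume b: "b \<in> {..<l}"
    define a where "a = 2 * l + 1 - 2 * Suc b"
    have e: "2 * l - 2 * b = Suc a" "2 * l + 2 - 2 * Suc b = Suc a" using b by (auto simp: a_def)
    have "icoeff v (-1) a (Suc b) / v ^ a = qint v (Suc a) / v ^ (2 * b + 2) * icoeff v 1 (Suc a) (Suc b)"
      using icoeff_Suc_left[of "-1" a "Suc b"] icoeff_sign[of "Suc a" "Suc b"] v by simp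
    then show "?c (Suc b) / ?p (Suc b) * E (Suc b) = ?f b * E (Suc b)"
      unfolding e a_def[symmetric] by simp
  qed
  \<comment> \<open>The summand b = l may be added because [0] = 0; all three sums then have the
    same range.\<close>
  also have "\<dots> = (\<Sum>b\<le>l. ?f b * E (Suc b))" by (simp add: qint_def flip: lessThan_Suc_atMost)
  finally have "(\<Sum>j\<le>l. ?c j * (E j / ?p j + (?p j - 1 / ?p j) * E (Suc j))) + ?w * (\<Sum>j\<le>l. ?b j * E (Suc j)) =
      qint v (2 * l + 2) * ?d 0 * E 0 + (\<Sum>b\<le>l. (?f b + (?p b - 1 / ?p b) * ?c b + ?w * ?b b) * E (Suc b))"
    by (simp add: sum_distrib_left sum.distrib distrib_right mult.assoc)
  also have "(\<Sum>b\<le>l. (?f b + (?p b - 1 / ?p b) * ?c b + ?w * ?b b) * E (Suc b)) =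
      (\<Sum>b\<le>l. qint v (2 * l + 2) * ?d (Suc b) * E (Suc b))"
  proof (rule sum.cong[OF refl])
    fix b assume "b \<in> {..l}"
    then have e: "2 * l + 1 - 2 * b = (2 * l - 2 * b) + 1" "2 * l + 2 - 2 * Suc b = 2 * l - 2 * b"
      "2 * l + 1 = (2 * l - 2 * b) + 2 * b + 1" "2 * l + 2 = (2 * l - 2 * b) + 2 * b + 2" by auto
    show "(?f b + (?p b - 1 / ?p b) * ?c b + ?w * ?b b) * E (Suc b) = qint v (2 * l + 2) * ?d (Suc b) * E (Suc b)"
      using coeff_step_odd[of "2 * l - 2 * b" b] unfolding e(1,2) e(3,4)[symmetric] by simp
  qed
  also have "qint v (2 * l + 2) * ?d 0 * E 0 + (\<Sum>b\<le>l. qint v (2 * l + 2) * ?d (Suc b) * E (Suc b)) =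
      qint v (2 * l + 2) * (\<Sum>j\<le>Suc l. ?d j * E j)"
    unfolding sum.atMost_Suc_shift by (simp add: sum_distrib_left algebra_simps)
  finally show ?thesis .
qed

end

section \<open>The divided powers\<close>

lemma (in cring) power_module:
  assumes "module R M"
  shows "module R (power_module n M)"
proof -
  interpret M: module R M by fact
  let ?P = "power_module n M"
  have e: "carrier ?P = (\<Pi>\<^sub>E i\<in>{..<n}. carrier M)" "\<zero>\<^bsub>?P\<^esub> = (\<lambda>i\<in>{..<n}. \<zero>\<^sub>M)"
    "\<And>a b. a \<oplus>\<^bsub>?P\<^esub> b = (\<lambda>i\<in>{..<n}. a i \<oplus>\<^sub>M b i)" "\<And>r a. r \<odot>\<^bsub>?P\<^esub> a = (\<lambda>i\<in>{..<n}. r \<odot>\<^sub>M a i)"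
    by (simp_all add: power_module_def)
  have mem: "a i \<in> carrier M" if "a \<in> carrier ?P" "i < n" for a i using that by (auto simp: e)
  have ext: "a = b" if "a \<in> carrier ?P" "b \<in> carrier ?P" "\<And>i. i < n \<Longrightarrow> a i = b i" for a b
    using PiE_ext[of a "{..<n}" _ b] that by (auto simp: e)
  have cl: "(\<lambda>i\<in>{..<n}. h i) \<in> carrier ?P" if "\<And>i. i < n \<Longrightarrow> h i \<in> carrier M" for h
    using that by (auto simp: e)
  have "abelian_group ?P"
  proof (rule abelian_groupI)
    show "\<zero>\<^bsub>?P\<^esub> \<in> carrier ?P" unfolding e(2) by (rule cl) auto
    show "a \<oplus>\<^bsub>?P\<^esub> b \<in> carrier ?P" if "a \<in> carrier ?P" "b \<in> carrier ?P" for a b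
      unfolding e(3) by (rule cl) (use that[THEN mem] in auto)
    show "a \<oplus>\<^bsub>?P\<^esub> b \<oplus>\<^bsub>?P\<^esub> c = a \<oplus>\<^bsub>?P\<^esub> (b \<oplus>\<^bsub>?P\<^esub> c)"
      if "a \<in> carrier ?P" "b \<in> carrier ?P" "c \<in> carrier ?P" for a b c
      unfolding e(3) by (rule ext; (rule cl)?) (use that[THEN mem] in \<open>auto simp: M.a_assoc\<close>)
    show "a \<oplus>\<^bsub>?P\<^esub> b = b \<oplus>\<^bsub>?P\<^esub> a" if "a \<in> carrier ?P" "b \<in> carrier ?P" for a b
      unfolding e(3) by (rule ext; (rule cl)?) (use that[THEN mem] in \<open>auto simp: M.a_comm\<close>)
    show "\<zero>\<^bsub>?P\<^esub> \<oplus>\<^bsub>?P\<^esub> a = a" if "a \<in> carrier ?P" for a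
      unfolding e(2,3) by (rule ext; (rule cl that)?) (use that[THEN mem] in auto)
    show "\<exists>b\<in>carrier ?P. b \<oplus>\<^bsub>?P\<^esub> a = \<zero>\<^bsub>?P\<^esub>" if "a \<in> carrier ?P" for a
    proof (rule bexI)
      show "(\<lambda>i\<in>{..<n}. \<ominus>\<^sub>M a i) \<oplus>\<^bsub>?P\<^esub> a = \<zero>\<^bsub>?P\<^esub>"
        unfolding e(2,3) by (rule ext; (rule cl)?) (use that[THEN mem] in \<open>auto simp: M.l_neg\<close>)
      show "(\<lambda>i\<in>{..<n}. \<ominus>\<^sub>M a i) \<in> carrier ?P" by (rule cl) (use that[THEN mem] in auto)
    qed
  qed
  then show ?thesis
  proof (rule moduleI[OF is_cring])
    show "r \<odot>\<^bsub>?P\<^esub> a \<in> carrier ?P" if "r \<in> carrier R" "a \<in> carrier ?P" for r a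
      unfolding e(4) by (rule cl) (use that(1) mem[OF that(2)] in auto)
    show "(r \<oplus> s) \<odot>\<^bsub>?P\<^esub> a = r \<odot>\<^bsub>?P\<^esub> a \<oplus>\<^bsub>?P\<^esub> s \<odot>\<^bsub>?P\<^esub> a"
      if "r \<in> carrier R" "s \<in> carrier R" "a \<in> carrier ?P" for r s a
      unfolding e(3,4) by (rule ext; (rule cl)?) (use that(1,2) mem[OF that(3)] in \<open>auto simp: M.smult_l_distr\<close>)
    show "r \<odot>\<^bsub>?P\<^esub> (a \<oplus>\<^bsub>?P\<^esub> b) = r \<odot>\<^bsub>?P\<^esub> a \<oplus>\<^bsub>?P\<^esub> r \<odot>\<^bsub>?P\<^esub> b"
      if "r \<in> carrier R" "a \<in> carrier ?P" "b \<in> carrier ?P" for r a b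
      unfolding e(3,4) by (rule ext; (rule cl)?)
        (use that(1) mem[OF that(2)] mem[OF that(3)] in \<open>auto simp: M.smult_r_distr\<close>)
    show "(r \<otimes> s) \<odot>\<^bsub>?P\<^esub> a = r \<odot>\<^bsub>?P\<^esub> (s \<odot>\<^bsub>?P\<^esub> a)"
      if "r \<in> carrier R" "s \<in> carrier R" "a \<in> carrier ?P" for r s a
      unfolding e(4) by (rule ext; (rule cl)?) (use that(1,2) mem[OF that(3)] in \<open>auto simp: M.smult_assoc1\<close>)
    show "\<one> \<odot>\<^bsub>?P\<^esub> a = a" if "a \<in> carrier ?P" for a
      unfolding e(4) by (rule ext; (rule cl that)?) (use mem[OF that] in auto)
  qed
qed

section \<open>Homogeneous computations in the basis of classes of S^m + K^l\<close>

context ihall_alg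
begin

abbreviation "v \<equiv> vpar k"
abbreviation "\<T> \<equiv> ihall k"

text \<open>The class of S^(n - 2l) + K^l for 2l at most n. Indexing by the total dimension n
  displays the degree, on which the twist depends.\<close>

definition Eb :: "nat \<Rightarrow> nat \<Rightarrow> 'a hall" where "Eb n l = bas (q ^ n) (q ^ l)"

lemma v_square: "v\<^sup>2 = real q" "v > 1" using q_gt_1 by (simp_all add: vpar_def q_eq)

lemma v_pow: "real q ^ n = v ^ (2 * n)" by (simp add: v_square(1) power_mult)

lemma Eb_in: "2 * l \<le> n \<Longrightarrow> cls (q ^ n) (q ^ l) \<in> \<I>"
proof (induction l arbitrary: n)
  case 0
  show ?case
  proof (induction n)
    case (Suc n)
    then show ?case using cls_mult_in[OF simple_in Suc] by simp
  qed (use one_in in simp)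
next
  case (Suc l)
  then obtain m where n: "n = Suc (Suc m)" by (cases n rule: nat.exhaust) (auto dest!: Suc_le_D)
  then show ?case using cls_mult_in[OF regular_in Suc.IH[of m]] Suc.prems by (simp add: mult_ac)
qed

lemma Eb_carrier: "2 * l \<le> n \<Longrightarrow> Eb n l \<in> carrier \<H>" unfolding Eb_def by (rule bas_carrier[OF Eb_in])

lemma Eb_carrier_1: "Eb 1 0 \<in> carrier \<H>" and Eb_carrier_2: "Eb 2 1 \<in> carrier \<H>"
  by (auto intro: Eb_carrier)

lemma homog_smult: "c \<in> Qv k \<Longrightarrow> homog e \<phi> \<Longrightarrow> homog e (\<lambda>C. c * \<phi> C)"
  unfolding homog_def by (auto intro: SC.smult_carrier)

lemma homog_add: "homog e \<phi> \<Longrightarrow> homog e \<psi> \<Longrightarrow> homog e (\<lambda>C. \<phi> C + \<psi> C)" unfolding homog_def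
proof (intro conjI allI impI)
  assume h: "\<phi> \<in> carrier \<H> \<and> (\<forall>C. \<phi> C \<noteq> 0 \<longrightarrow> real (card (carrier (rep C))) = real q powi e)"
    "\<psi> \<in> carrier \<H> \<and> (\<forall>C. \<psi> C \<noteq> 0 \<longrightarrow> real (card (carrier (rep C))) = real q powi e)"
  then show "(\<lambda>C. \<phi> C + \<psi> C) \<in> carrier \<H>" using SC.add_carrier by simp
  fix C assume "\<phi> C + \<psi> C \<noteq> 0"
  then have "\<phi> C \<noteq> 0 \<or> \<psi> C \<noteq> 0" by auto
  then show "real (card (carrier (rep C))) = real q powi e" using h by auto
qed

lemma homog_Eb: "2 * l \<le> n \<Longrightarrow> homog (int n) (Eb n l)"
  using homog_smult_bas[OF Qv_Rats[OF Rats_1] Eb_in[of l n] refl] by (simp add: Eb_def)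

lemma one_Eb: "\<one>\<^sub>\<H> = Eb 0 0" by (simp add: Eb_def one_bas)

lemma regular_Eb: "2 * l \<le> n \<Longrightarrow> Eb 2 1 \<otimes>\<^sub>\<H> Eb n l = (\<lambda>C. (1 / real q ^ n) * Eb (n + 2) (Suc l) C)"
  unfolding Eb_def using regular_mult[OF Eb_in] by (simp add: power2_eq_square mult_ac)

text \<open>K is moved past S by commutativity, which reduces the claim to semisimple modules, where
  it is \<open>simple_mult\<close>. The factor is 1 / |Hom(S, S^m + K^l)|.\<close>

lemma simple_Eb: "Eb 1 0 \<otimes>\<^sub>\<H> Eb (m + 2 * l) l = (\<lambda>C. (1 / real q ^ (m + l)) *
     (Eb (m + 2 * l + 1) l C + (real q ^ m - 1) * Eb (m + 2 * l + 1) (Suc l) C))"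
proof (induction l)
  case 0
  show ?case unfolding Eb_def
    using simple_mult(1)[OF simple_in, of "q ^ m"] Eb_in[of 0 m] by (simp add: mult_ac)
next
  case (Suc l)
  let ?n = "m + 2 * l"
  have nz: "real q ^ i \<noteq> 0" for i using q_gt_1 by simp
  note c1 = Eb_carrier[of 1 2, simplified] and c2 = Eb_carrier[of 0 1, simplified] and c3 = Eb_carrier[of l ?n, simplified]
  have "Eb (?n + 2) (Suc l) = (\<lambda>C. real q ^ ?n * (Eb 2 1 \<otimes>\<^sub>\<H> Eb ?n l) C)"
    using regular_Eb[of l ?n] q_gt_1 by simp
  then have "Eb 1 0 \<otimes>\<^sub>\<H> Eb (?n + 2) (Suc l) = (\<lambda>C. real q ^ ?n * (Eb 1 0 \<otimes>\<^sub>\<H> (Eb 2 1 \<otimes>\<^sub>\<H> Eb ?n l)) C)"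
    by (simp only: SC.mult_smult_right)
  also have "Eb 1 0 \<otimes>\<^sub>\<H> (Eb 2 1 \<otimes>\<^sub>\<H> Eb ?n l) = Eb 2 1 \<otimes>\<^sub>\<H> (Eb 1 0 \<otimes>\<^sub>\<H> Eb ?n l)"
    using H.m_lcomm c1 c2 c3 by simp
  also have "\<dots> = (\<lambda>C. (1 / real q ^ (m + l)) * (1 / real q ^ (?n + 1)) *
      (Eb (?n + 3) (Suc l) C + (real q ^ m - 1) * Eb (?n + 3) (Suc (Suc l)) C))"
  \<comment> \<open>For m = 0 the second basis element would need a negative number of copies of S,
    so \<open>regular_Eb\<close> does not apply to it; its coefficient is 0.\<close>
  proof (cases "m = 0")
    case True
    then show ?thesis unfolding Suc.IH SC.mult_smult_right using regular_Eb[of l "?n + 1"]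
      by (simp add: eval_nat_numeral mult_ac)
  next
    case False
    note d = Eb_carrier[of l "?n + 1"] Eb_carrier[of "Suc l" "?n + 1"]
    have f: "(\<lambda>C. (real q ^ m - 1) * Eb (?n + 1) (Suc l) C) \<in> carrier \<H>"
      by (rule SC.smult_carrier[OF Qv_Rats d(2)]) (use False in auto)
    have "Eb 2 1 \<otimes>\<^sub>\<H> (\<lambda>C. Eb (?n + 1) l C + (real q ^ m - 1) * Eb (?n + 1) (Suc l) C) =
       (\<lambda>C. (Eb 2 1 \<otimes>\<^sub>\<H> Eb (?n + 1) l) C + (real q ^ m - 1) * (Eb 2 1 \<otimes>\<^sub>\<H> Eb (?n + 1) (Suc l)) C)"
      using SC.mult_add_right[OF d(1) f c1] unfolding SC.mult_smult_right by simp
    then show ?thesis unfolding Suc.IH SC.mult_smult_right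
      using regular_Eb[of l "?n + 1"] regular_Eb[of "Suc l" "?n + 1"] False
      by (simp add: eval_nat_numeral distrib_left mult_ac)
  qed
  finally have r: "Eb 1 0 \<otimes>\<^sub>\<H> Eb (?n + 2) (Suc l) = (\<lambda>C. real q ^ ?n * ((1 / real q ^ (m + l)) * (1 / real q ^ (?n + 1)) *
      (Eb (?n + 3) (Suc l) C + (real q ^ m - 1) * Eb (?n + 3) (Suc (Suc l)) C)))" .
  have "real q ^ ?n * ((1 / real q ^ (m + l)) * (1 / real q ^ (?n + 1)) * y) = (1 / real q ^ (m + Suc l)) * y" for y
    using nz by (simp add: field_simps power_add)
  moreover have "m + 2 * Suc l = ?n + 2" "m + 2 * Suc l + 1 = ?n + 3" by simp_all
  ultimately show ?case using r by (simp only:)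
qed

text \<open>The twisted product of elements of degrees m and n, with the degrees as parameters
  instead of being recovered from the elements.\<close>

definition tw :: "nat \<Rightarrow> nat \<Rightarrow> 'a hall \<Rightarrow> 'a hall \<Rightarrow> 'a hall" where
  "tw m n \<phi> \<psi> = (\<lambda>C. v ^ (m * n) * (\<phi> \<otimes>\<^sub>\<H> \<psi>) C)"

lemma emb_tw: "homog (int m) \<phi> \<Longrightarrow> homog (int n) \<psi> \<Longrightarrow> emb \<phi> \<otimes>\<^sub>\<T> emb \<psi> = emb (tw m n \<phi> \<psi>)"
  using twisted_emb[of m \<phi> n \<psi>] by (simp add: ihall_def tw_def power_int_of_nat flip: of_nat_mult)

lemma v_pow_Qv: "v ^ i \<in> Qv k" using Qv_powi[OF Qv_vpar[of k], of "int i"] by simp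

lemma homog_tw: "homog (int m) \<phi> \<Longrightarrow> homog (int n) \<psi> \<Longrightarrow> homog (int (m + n)) (tw m n \<phi> \<psi>)"
  unfolding tw_def using homog_smult[OF v_pow_Qv homog_mult] by simp

text \<open>The Euler form is bilinear, so both sides carry the twist v^(mn + mp + np).\<close>

lemma tw_assoc:
  assumes "\<phi> \<in> carrier \<H>" "\<psi> \<in> carrier \<H>" "\<chi> \<in> carrier \<H>"
  shows "tw (m + n) p (tw m n \<phi> \<psi>) \<chi> = tw m (n + p) \<phi> (tw n p \<psi> \<chi>)"
  unfolding tw_def SC.mult_smult_left SC.mult_smult_right H.m_assoc[OF assms]
  by (simp add: algebra_simps power_add)

lemma tw_commute: "\<phi> \<in> carrier \<H> \<Longrightarrow> \<psi> \<in> carrier \<H> \<Longrightarrow> tw m n \<phi> \<psi> = tw n m \<psi> \<phi>"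
  unfolding tw_def by (simp add: H.m_comm mult.commute)

lemma tw_smult_right: "tw m n \<phi> (\<lambda>C. c * \<psi> C) = (\<lambda>C. c * tw m n \<phi> \<psi> C)"
  unfolding tw_def SC.mult_smult_right by (simp add: mult_ac)

lemma mult_sum_right:
  assumes "finite A" "\<chi> \<in> carrier \<H>" "\<And>i. i \<in> A \<Longrightarrow> f i \<in> carrier \<H>"
  shows "(\<lambda>C. \<Sum>i\<in>A. f i C) \<in> carrier \<H> \<and> \<chi> \<otimes>\<^sub>\<H> (\<lambda>C. \<Sum>i\<in>A. f i C) = (\<lambda>C. \<Sum>i\<in>A. (\<chi> \<otimes>\<^sub>\<H> f i) C)"
  using assms(1,3)
proof (induction A)
  case empty
  show ?case using H.zero_closed H.r_null[OF assms(2)] by (simp add: hall_zero)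
next
  case (insert j A)
  then show ?case using SC.add_carrier[of "f j" "\<lambda>C. \<Sum>i\<in>A. f i C"]
      SC.mult_add_right[of "f j" "\<lambda>C. \<Sum>i\<in>A. f i C" \<chi>] assms(2) by simp
qed

text \<open>The twist v^(2n) = q^n cancels the factor 1 / q^n, so multiplication by [K] just moves
  along the basis.\<close>

lemma tw_regular: "2 * l \<le> n \<Longrightarrow> tw 2 n (Eb 2 1) (Eb n l) = Eb (n + 2) (Suc l)"
  unfolding tw_def regular_Eb v_pow using v_square(2) by simp

text \<open>With n = m + 2l the twist v^(m + 2l) meets 1 / q^(m + l) and leaves v^(-m); multiplied
  by q^m - 1 this becomes v^m - v^(-m).\<close>

lemma tw_simple:
  assumes "2 * l \<le> n"
  shows "tw 1 n (Eb 1 0) (Eb n l) = (\<lambda>C. Eb (n + 1) l C / v ^ (n - 2 * l) +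
    (v ^ (n - 2 * l) - 1 / v ^ (n - 2 * l)) * Eb (n + 1) (Suc l) C)"
proof -
  obtain m where n: "n = m + 2 * l" using assms by (metis add.commute le_Suc_ex)
  have v0: "v \<noteq> 0" using v_square(2) by simp
  have "2 * (m + l) = (m + 2 * l) + m" by simp
  then have "v ^ (2 * (m + l)) = v ^ (m + 2 * l) * v ^ m" by (simp only: power_add)
  then have 1: "v ^ (m + 2 * l) * (1 / v ^ (2 * (m + l))) = 1 / v ^ m" using v0 by simp
  have "(1 / A) * (A * A - 1) = A - 1 / A" if "A \<noteq> 0" for A :: real
    using that by (simp add: field_simps)
  from this[of "v ^ m"] have 2: "(1 / v ^ m) * (v ^ (2 * m) - 1) = v ^ m - 1 / v ^ m"
    unfolding mult_2 power_add using v0 by (simp only: power_not_zero simp_thms)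
  have "v ^ (m + 2 * l) * ((1 / v ^ (2 * (m + l))) * (y + (v ^ (2 * m) - 1) * z)) = y / v ^ m + (v ^ m - 1 / v ^ m) * z" for y z
    unfolding mult.assoc[symmetric, of "v ^ (m + 2 * l)"] 1 2[symmetric] by (simp add: distrib_left mult.assoc)
  then show ?thesis unfolding tw_def n simple_Eb v_pow by simp
qed

definition lin :: "nat \<Rightarrow> (nat \<Rightarrow> real) \<Rightarrow> 'a hall" where "lin n c = (\<lambda>C. \<Sum>j\<le>n div 2. c j * Eb n j C)"

lemma homog_sum: "finite A \<Longrightarrow> (\<And>i. i \<in> A \<Longrightarrow> homog e (f i)) \<Longrightarrow> homog e (\<lambda>C. \<Sum>i\<in>A. f i C)"
proof (induction A rule: finite_induct)
  case empty
  then show ?case using homog_zero by (simp add: hall_zero)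
qed (simp add: homog_add)

lemma homog_lin: "(\<And>j. c j \<in> Qv k) \<Longrightarrow> homog (int n) (lin n c)"
  unfolding lin_def by (intro homog_sum homog_smult homog_Eb) auto

lemma tw_lin:
  assumes c: "\<And>j. c j \<in> Qv k" and \<chi>: "\<chi> \<in> carrier \<H>"
  shows "tw m n \<chi> (lin n c) = (\<lambda>C. \<Sum>j\<le>n div 2. c j * tw m n \<chi> (Eb n j) C)"
proof -
  have "(\<lambda>C. c j * Eb n j C) \<in> carrier \<H>" if "j \<in> {..n div 2}" for j
    by (rule SC.smult_carrier[OF c Eb_carrier]) (use that in auto)
  then have "\<chi> \<otimes>\<^sub>\<H> lin n c = (\<lambda>C. \<Sum>j\<le>n div 2. (\<chi> \<otimes>\<^sub>\<H> (\<lambda>C. c j * Eb n j C)) C)"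
    unfolding lin_def using mult_sum_right[OF _ \<chi>, of "{..n div 2}" "\<lambda>j C. c j * Eb n j C"] by simp
  then show ?thesis unfolding tw_def by (simp add: SC.mult_smult_right sum_distrib_left mult_ac)
qed

lemma tw_simple_lin:
  assumes c: "\<And>j. c j \<in> Qv k"
  shows "tw 1 n (Eb 1 0) (lin n c) = (\<lambda>C. \<Sum>j\<le>n div 2. c j * (Eb (n + 1) j C / v ^ (n - 2 * j) +
    (v ^ (n - 2 * j) - 1 / v ^ (n - 2 * j)) * Eb (n + 1) (Suc j) C))"
  unfolding tw_lin[OF c Eb_carrier_1]
  by (intro ext sum.cong refl arg_cong2[where f = times]) (subst tw_simple; auto)

lemma tw_regular_lin:
  assumes c: "\<And>j. c j \<in> Qv k"
  shows "tw 2 n (Eb 2 1) (lin n c) = (\<lambda>C. \<Sum>j\<le>n div 2. c j * Eb (n + 2) (Suc j) C)"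
  unfolding tw_lin[OF c Eb_carrier_2]
  by (intro ext sum.cong refl arg_cong2[where f = times]) (subst tw_regular; auto)

lemma qint_Qv: "qint v m \<in> Qv k" unfolding qint_def
  by (intro Qv_divide) (simp_all only: diff_conv_add_uminus Qv_add Qv_uminus Qv_powi Qv_vpar Qv_inverse)

lemma qfact_Qv: "qfact v m \<in> Qv k" "qdfact_even v m \<in> Qv k" unfolding qfact_def qdfact_even_def
  by (induction m) (simp_all add: Qv_Rats Qv_mult qint_Qv)

lemma icoeff_Qv: "icoeff v \<sigma> a b \<in> Qv k"
proof -
  have "(v - inverse v) ^ b \<in> Qv k"
    using Qv_powi[OF Qv_add[OF Qv_vpar[of k] Qv_uminus[OF Qv_inverse[OF Qv_vpar[of k]]]], of "int b"] by simp
  then show ?thesis unfolding icoeff_def by (intro Qv_divide Qv_mult Qv_powi Qv_vpar qfact_Qv)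
qed

text \<open>The given S is known only through its submodules. The submodule xS cannot be all of a
  nonzero module, since x^2 = 0, so x acts as zero; and Rm is all of S for any nonzero m.\<close>

lemma simple_module_card:
  assumes "simple_module \<Lambda> S"
  shows "finite (carrier S)" "card (carrier S) = q" "\<And>a. a \<in> carrier S \<Longrightarrow> x \<odot>\<^sub>S a = \<zero>\<^sub>S"
proof -
  have S: "module \<Lambda> S" and ne: "carrier S \<noteq> {\<zero>\<^sub>S}"
    and sub: "\<And>N. Module.submodule N \<Lambda> S \<Longrightarrow> N = {\<zero>\<^sub>S} \<or> N = carrier S"
    using assms by (auto simp: simple_module_def)
  interpret S: module \<Lambda> S by (rule S)
  have z: "xim S = {\<zero>\<^sub>S} \<or> xim S = carrier S"
    unfolding xim_def by (rule sub[OF image_submodule[OF S S x_hom[OF S]]])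
  show xz: "x \<odot>\<^sub>S a = \<zero>\<^sub>S" if a: "a \<in> carrier S" for a using z
  proof
    assume "xim S = {\<zero>\<^sub>S}"
    then show ?thesis using a by (auto simp: xim_def)
  next
    assume "xim S = carrier S"
    then obtain b where "b \<in> carrier S" "a = x \<odot>\<^sub>S b" using a by (auto simp: xim_def)
    then show ?thesis using x_x_smult[OF S] by simp
  qed
  obtain m where m: "m \<in> carrier S" "m \<noteq> \<zero>\<^sub>S" using ne S.M.zero_closed by blast
  have "Module.submodule ((\<lambda>r. r \<odot>\<^sub>S m) ` carrier (regular_module \<Lambda>)) \<Lambda> S"
    by (rule image_submodule[OF module_regular_module S regular_hom[OF S m(1)]])
  then have "(\<lambda>r. r \<odot>\<^sub>S m) ` carrier \<Lambda> = {\<zero>\<^sub>S} \<or> (\<lambda>r. r \<odot>\<^sub>S m) ` carrier \<Lambda> = carrier S"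
    using sub by simp
  moreover have c: "card ((\<lambda>r. r \<odot>\<^sub>S m) ` carrier \<Lambda>) = q"
    by (rule card_cyclic(2)[OF S m(1) xz[OF m(1)] m(2)])
  ultimately have e: "(\<lambda>r. r \<odot>\<^sub>S m) ` carrier \<Lambda> = carrier S" using q_gt_1 by auto
  then show "card (carrier S) = q" using c by simp
  show "finite (carrier S)" unfolding e[symmetric] using finite_R by simp
qed

lemma class_power:
  assumes "simple_module \<Lambda> S"
  shows "ihall_class k (power_module n S) = emb (Eb n 0)"
proof -
  note S = simple_module_card[OF assms]
  have m: "module \<Lambda> (power_module n S)"
    using assms power_module[of S n] by (simp add: simple_module_def)
  have c: "carrier (power_module n S) = (\<Pi>\<^sub>E i\<in>{..<n}. carrier S)" by (simp add: power_module_def)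
  have f: "finite (carrier (power_module n S))" unfolding c using S(1) by (simp add: finite_PiE)
  have k: "card (carrier (power_module n S)) = q ^ n" unfolding c using S by (simp add: card_PiE)
  have "card (xim (power_module n S)) = 1"
    unfolding xim_card_1_iff[OF m f] unfolding c using S(3) by (auto simp: power_module_def fun_eq_iff)
  then show ?thesis
    unfolding ihall_class_def emb_def[symmetric] hall_basis_bas[OF m f] k by (simp add: Eb_def)
qed

lemma class_simple:
  assumes "simple_module \<Lambda> S"
  shows "ihall_class k S = emb (Eb 1 0)"
proof -
  note S = simple_module_card[OF assms]
  have m: "module \<Lambda> S" using assms by (simp add: simple_module_def)
  have "card (xim S) = 1" unfolding xim_card_1_iff[OF m S(1)] using S(3) by simp
  then show ?thesis
    unfolding ihall_class_def emb_def[symmetric] hall_basis_bas[OF m S(1)] S(2) by (simp add: Eb_def)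
qed

lemma class_regular: "ihall_class k (regular_module \<Lambda>) = emb (Eb 2 1)"
  using hall_basis_bas[OF module_regular_module] finite_R
  unfolding ihall_class_def emb_def[symmetric] by (simp add: Eb_def card_R power2_eq_square flip: q_def)

lemma ihall_simps: "\<one>\<^sub>\<T> = emb (Eb 0 0)" "add (ihall k) = add \<D>" "finsum (ihall k) = finsum \<D>"
  unfolding finsum_def by (simp_all add: ihall_def emb_one flip: one_Eb)

lemma regular_power: "emb (Eb 2 1) [^]\<^bsub>\<T>\<^esub> l = emb (Eb (2 * l) l)"
proof (induction l)
  case (Suc l)
  have "emb (Eb 2 1) [^]\<^bsub>\<T>\<^esub> Suc l = emb (Eb (2 * l) l) \<otimes>\<^sub>\<T> emb (Eb 2 1)"
    using Suc by (simp add: nat_pow_def)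
  also have "\<dots> = emb (tw (2 * l) 2 (Eb (2 * l) l) (Eb 2 1))" by (rule emb_tw) (rule homog_Eb, simp)+
  also have "tw (2 * l) 2 (Eb (2 * l) l) (Eb 2 1) = Eb (2 * Suc l) (Suc l)"
    using tw_commute[OF Eb_carrier[of l "2 * l"] Eb_carrier[of 1 2]] tw_regular[of l "2 * l"] by simp
  finally show ?case .
qed (simp add: nat_pow_def ihall_simps)

text \<open>No coefficient arises here, so the elements [(n - 2l) S] * [K]^l of the expansion are
  exactly the basis elements \<open>Eb n l\<close>.\<close>

lemma power_times_regular: "emb (Eb m 0) \<otimes>\<^sub>\<T> emb (Eb (2 * l) l) = emb (Eb (m + 2 * l) l)"
proof -
  have "tw (2 * l) m (Eb (2 * l) l) (Eb m 0) = Eb (m + 2 * l) l"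
  proof (induction l)
    case 0
    show ?case unfolding tw_def one_Eb[symmetric] using Eb_carrier[of 0 m] by (simp flip: one_Eb)
  next
    case (Suc l)
    have "tw (2 * Suc l) m (Eb (2 * Suc l) (Suc l)) (Eb m 0) =
        tw (2 + 2 * l) m (tw 2 (2 * l) (Eb 2 1) (Eb (2 * l) l)) (Eb m 0)"
      using tw_regular[of l "2 * l"] by simp
    also have "\<dots> = tw 2 (2 * l + m) (Eb 2 1) (tw (2 * l) m (Eb (2 * l) l) (Eb m 0))"
      by (rule tw_assoc) (auto intro: Eb_carrier)
    also have "\<dots> = Eb (m + 2 * Suc l) (Suc l)" unfolding Suc using tw_regular[of l "m + 2 * l"] by (simp add: add_ac)
    finally show ?case .
  qed
  moreover have "emb (Eb m 0) \<otimes>\<^sub>\<T> emb (Eb (2 * l) l) = emb (tw m (2 * l) (Eb m 0) (Eb (2 * l) l))"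
    by (rule emb_tw) (rule homog_Eb, simp)+
  ultimately show ?thesis using tw_commute[OF Eb_carrier[of 0 m] Eb_carrier[of l "2 * l"]] by simp
qed

end

section \<open>Expansion of the divided powers\<close>

context ihall_alg
begin

definition beta :: "nat \<Rightarrow> real" where "beta j = inverse v * (v\<^sup>2 - 1)\<^sup>2 * (qint v (2 * j - 1))\<^sup>2"

definition factor :: "nat \<Rightarrow> 'a hall" where
  "factor j = (\<lambda>C. tw 1 1 (Eb 1 0) (Eb 1 0) C + beta j * Eb 2 1 C)"

lemma beta_Qv: "beta j \<in> Qv k"
proof -
  have "v\<^sup>2 - 1 \<in> Qv k" using Qv_add[OF v_pow_Qv[of 2] Qv_Rats[of "- 1"]] by simp
  then show ?thesis unfolding beta_def power2_eq_square
    by (intro Qv_mult Qv_inverse Qv_vpar qint_Qv)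
qed

lemma homog_factor: "homog (int 2) (factor j)"
proof -
  have "homog (int (1 + 1)) (tw 1 1 (Eb 1 0) (Eb 1 0))" by (rule homog_tw; rule homog_Eb; simp)
  then show ?thesis
    unfolding factor_def using homog_add homog_smult[OF beta_Qv homog_Eb[of 1 2]] by simp
qed

lemma idiv_factor_eq:
  assumes "simple_module \<Lambda> S"
  shows "idiv_factor k S j = emb (factor j)"
proof -
  have 1: "emb (Eb 1 0) [^]\<^bsub>\<T>\<^esub> (2::nat) = emb (tw 1 1 (Eb 1 0) (Eb 1 0))"
  proof -
    have "emb (Eb 0 0) \<otimes>\<^sub>\<T> emb (Eb 1 0) = emb (tw 0 1 (Eb 0 0) (Eb 1 0))"
      by (rule emb_tw; rule homog_Eb; simp)
    also have "tw 0 1 (Eb 0 0) (Eb 1 0) = Eb 1 0"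
      unfolding tw_def one_Eb[symmetric] H.l_one[OF Eb_carrier_1] by simp
    finally have "emb (Eb 1 0) [^]\<^bsub>\<T>\<^esub> (2::nat) = emb (Eb 1 0) \<otimes>\<^sub>\<T> emb (Eb 1 0)"
      by (simp add: nat_pow_def ihall_simps numeral_2_eq_2)
    also have "\<dots> = emb (tw 1 1 (Eb 1 0) (Eb 1 0))" by (rule emb_tw; rule homog_Eb; simp)
    finally show ?thesis .
  qed
  have c: "tw 1 1 (Eb 1 0) (Eb 1 0) \<in> carrier \<H>"
    unfolding tw_def by (intro SC.smult_carrier v_pow_Qv H.m_closed Eb_carrier_1)
  show ?thesis unfolding idiv_factor_def class_simple[OF assms] class_regular 1 beta_def[symmetric]
      smult_emb[OF beta_Qv Eb_carrier_2] ihall_simps(2) emb_add[OF c SC.smult_carrier[OF beta_Qv Eb_carrier_2]]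
      factor_def ..
qed

lemma emb_left_commute:
  assumes "homog (int m) \<phi>" "homog (int n) \<psi>" "homog (int p) \<chi>"
  shows "emb \<phi> \<otimes>\<^sub>\<T> (emb \<psi> \<otimes>\<^sub>\<T> emb \<chi>) = emb \<psi> \<otimes>\<^sub>\<T> (emb \<phi> \<otimes>\<^sub>\<T> emb \<chi>)"
proof -
  note c = assms[THEN homog_carrier]
  have "tw m (n + p) \<phi> (tw n p \<psi> \<chi>) = tw n (m + p) \<psi> (tw m p \<phi> \<chi>)"
    unfolding tw_assoc[OF c, symmetric] tw_assoc[OF c(2,1,3), symmetric] tw_commute[OF c(1,2)]
    by (simp only: add.commute)
  then show ?thesis unfolding emb_tw[OF assms(2,3)] emb_tw[OF assms(1,3)]
      emb_tw[OF assms(1) homog_tw[OF assms(2,3)]] emb_tw[OF assms(2) homog_tw[OF assms(1,3)]] by simp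
qed

text \<open>In \<open>idiv_prod\<close> the factor with the largest index stands innermost. The last
  conjunct moves an innermost factor to the front, which makes induction on the number of factors
  possible; homogeneity is carried along because only homogeneous products can be evaluated.\<close>

lemma foldr_factor: "\<exists>\<chi>. homog (int (2 * length xs)) \<chi> \<and>
     foldr (\<lambda>j z. emb (factor j) \<otimes>\<^sub>\<T> z) xs \<one>\<^sub>\<T> = emb \<chi> \<and>
     (\<forall>a. foldr (\<lambda>j z. emb (factor j) \<otimes>\<^sub>\<T> z) xs (emb (factor a) \<otimes>\<^sub>\<T> \<one>\<^sub>\<T>) =
       emb (factor a) \<otimes>\<^sub>\<T> emb \<chi>)"
proof (induction xs)
  case Nil
  show ?case using homog_Eb[of 0 0] by (intro exI[of _ "Eb 0 0"]) (simp add: ihall_simps)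
next
  case (Cons b xs)
  then obtain \<chi> where \<chi>: "homog (int (2 * length xs)) \<chi>"
    "foldr (\<lambda>j z. emb (factor j) \<otimes>\<^sub>\<T> z) xs \<one>\<^sub>\<T> = emb \<chi>"
    "\<And>a. foldr (\<lambda>j z. emb (factor j) \<otimes>\<^sub>\<T> z) xs (emb (factor a) \<otimes>\<^sub>\<T> \<one>\<^sub>\<T>) =
       emb (factor a) \<otimes>\<^sub>\<T> emb \<chi>" by blast
  note e = emb_tw[OF homog_factor \<chi>(1)] and h = homog_tw[OF homog_factor \<chi>(1)]
  have "homog (int (2 * length (b # xs))) (tw 2 (2 * length xs) (factor b) \<chi>)" using h[of b] by simp
  then show ?case using \<chi>(2,3) emb_left_commute[OF homog_factor homog_factor \<chi>(1)] e
    by (intro exI[of _ "tw 2 (2 * length xs) (factor b) \<chi>"]) (simp add: e)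
qed

lemma idiv_prod_Suc:
  assumes "simple_module \<Lambda> S"
  shows "idiv_prod k S 0 = emb (Eb 0 0)"
    "idiv_prod k S (Suc l) = emb (factor (Suc l)) \<otimes>\<^sub>\<T> idiv_prod k S l"
proof -
  show "idiv_prod k S 0 = emb (Eb 0 0)" by (simp add: idiv_prod_def ihall_simps)
  obtain \<chi> where \<chi>: "foldr (\<lambda>j z. emb (factor j) \<otimes>\<^sub>\<T> z) [1..<Suc l] \<one>\<^sub>\<T> = emb \<chi>"
    "foldr (\<lambda>j z. emb (factor j) \<otimes>\<^sub>\<T> z) [1..<Suc l] (emb (factor (Suc l)) \<otimes>\<^sub>\<T> \<one>\<^sub>\<T>) =
       emb (factor (Suc l)) \<otimes>\<^sub>\<T> emb \<chi>" using foldr_factor[of "[1..<Suc l]"] by blast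
  have "[1..<Suc (Suc l)] = [1..<Suc l] @ [Suc l]" by simp
  then show "idiv_prod k S (Suc l) = emb (factor (Suc l)) \<otimes>\<^sub>\<T> idiv_prod k S l"
    unfolding idiv_prod_def idiv_factor_eq[OF assms] using \<chi> by (simp only: foldr_append foldr.simps comp_apply id_apply)
qed

abbreviation "cf n j \<equiv> icoeff v ((-1) ^ n) (n - 2 * j) j"

lemma tw_linear_left:
  assumes "\<phi> \<in> carrier \<H>" "\<psi> \<in> carrier \<H>" "\<chi> \<in> carrier \<H>" "c \<in> Qv k"
  shows "tw m n (\<lambda>C. \<phi> C + c * \<psi> C) \<chi> = (\<lambda>C. tw m n \<phi> \<chi> C + c * tw m n \<psi> \<chi> C)"
  unfolding tw_def SC.mult_add_left[OF assms(1) SC.smult_carrier[OF assms(4,2)] assms(3)] SC.mult_smult_left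
  by (simp add: algebra_simps)

text \<open>The induction alternates between parities: [S] times the even product is the odd one,
  and the next even product is [S] times the odd one plus a multiple of [K] times the previous even
  one. Keeping the quantum factorials outside avoids divisions.\<close>

lemma idiv_prod_even_odd:
  assumes S: "simple_module \<Lambda> S"
  shows "idiv_prod k S l = emb (\<lambda>C. qfact v (2 * l) * lin (2 * l) (cf (2 * l)) C) \<and>
    ihall_class k S \<otimes>\<^sub>\<T> idiv_prod k S l =
      emb (\<lambda>C. qfact v (2 * l + 1) * lin (2 * l + 1) (cf (2 * l + 1)) C)"
proof -
  have odd: "tw 1 (2 * l) (Eb 1 0) (\<lambda>C. qfact v (2 * l) * lin (2 * l) (cf (2 * l)) C) =
      (\<lambda>C. qfact v (2 * l + 1) * lin (2 * l + 1) (cf (2 * l + 1)) C)" for l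
  proof
    fix C
    show "tw 1 (2 * l) (Eb 1 0) (\<lambda>C. qfact v (2 * l) * lin (2 * l) (cf (2 * l)) C) C =
      qfact v (2 * l + 1) * lin (2 * l + 1) (cf (2 * l + 1)) C"
      unfolding tw_smult_right tw_simple_lin[OF icoeff_Qv]
      using sum_step_even[OF v_square(2), where E = "\<lambda>j. Eb (2 * l + 1) j C" and l = l]
      by (simp add: lin_def qfact_Suc[OF v_square(2)] mult.assoc)
  qed
  have homog: "homog (int n) (\<lambda>C. qfact v n * lin n (cf n) C)" for n
    by (intro homog_smult qfact_Qv homog_lin icoeff_Qv)
  have mult: "ihall_class k S \<otimes>\<^sub>\<T> emb (\<lambda>C. qfact v (2 * l) * lin (2 * l) (cf (2 * l)) C) =
      emb (\<lambda>C. qfact v (2 * l + 1) * lin (2 * l + 1) (cf (2 * l + 1)) C)" for l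
    unfolding class_simple[OF S] odd[symmetric] by (rule emb_tw[OF homog_Eb homog]) simp
  have "idiv_prod k S l = emb (\<lambda>C. qfact v (2 * l) * lin (2 * l) (cf (2 * l)) C)"
  proof (induction l)
    case 0
    have "(\<lambda>C. qfact v (2 * 0) * lin (2 * 0) (cf (2 * 0)) C) = Eb 0 0"
      by (simp add: lin_def icoeff_def qfact_def qdfact_even_def numeral_2_eq_2)
    then show ?case unfolding idiv_prod_Suc(1)[OF S] by simp
  next
    case (Suc l)
    let ?P = "\<lambda>C. qfact v (2 * l) * lin (2 * l) (cf (2 * l)) C"
    note pc = homog_carrier[OF homog]
    have sc: "tw 1 1 (Eb 1 0) (Eb 1 0) \<in> carrier \<H>"
      unfolding tw_def by (intro SC.smult_carrier v_pow_Qv H.m_closed Eb_carrier_1)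
    have "idiv_prod k S (Suc l) = emb (tw 2 (2 * l) (factor (Suc l)) ?P)"
      unfolding idiv_prod_Suc(2)[OF S] Suc by (rule emb_tw[OF homog_factor homog])
    also have "tw 2 (2 * l) (factor (Suc l)) ?P =
        (\<lambda>C. tw (1 + 1) (2 * l) (tw 1 1 (Eb 1 0) (Eb 1 0)) ?P C + beta (Suc l) * tw 2 (2 * l) (Eb 2 1) ?P C)"
      unfolding factor_def one_add_one by (rule tw_linear_left[OF sc Eb_carrier_2 pc beta_Qv])
    \<comment> \<open>[S]^2 is applied as two successive multiplications by [S], the first of which
      is the odd step just established.\<close>
    also have "tw (1 + 1) (2 * l) (tw 1 1 (Eb 1 0) (Eb 1 0)) ?P =
        tw 1 (2 * l + 1) (Eb 1 0) (\<lambda>C. qfact v (2 * l + 1) * lin (2 * l + 1) (cf (2 * l + 1)) C)"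
      unfolding tw_assoc[OF Eb_carrier_1 Eb_carrier_1 pc] odd by (simp only: add.commute)
    also have "(\<lambda>C. tw 1 (2 * l + 1) (Eb 1 0) (\<lambda>C. qfact v (2 * l + 1) * lin (2 * l + 1) (cf (2 * l + 1)) C) C
          + beta (Suc l) * tw 2 (2 * l) (Eb 2 1) ?P C) =
        (\<lambda>C. qfact v (2 * Suc l) * lin (2 * Suc l) (cf (2 * Suc l)) C)"
    proof
      fix C
      define Xs Ys Zs where Xs: "Xs = (\<Sum>j\<le>l. icoeff v (-1) (2 * l + 1 - 2 * j) j * (Eb (2 * l + 2) j C / v ^ (2 * l + 1 - 2 * j) +
        (v ^ (2 * l + 1 - 2 * j) - 1 / v ^ (2 * l + 1 - 2 * j)) * Eb (2 * l + 2) (Suc j) C))"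
        and Ys: "Ys = (\<Sum>j\<le>l. icoeff v 1 (2 * l - 2 * j) j * Eb (2 * l + 2) (Suc j) C)"
        and Zs: "Zs = (\<Sum>j\<le>Suc l. icoeff v 1 (2 * l + 2 - 2 * j) j * Eb (2 * l + 2) j C)"
      have v0: "v \<noteq> 0" using v_square(2) by simp
      have s: "Xs + v * (v - inverse v)\<^sup>2 * qint v (2 * l + 1) * Ys = qint v (2 * l + 2) * Zs"
        unfolding Xs Ys Zs by (rule sum_step_odd[OF v_square(2)])
      \<comment> \<open>One factor [2l + 1] of the constant completes [2l]! to [2l + 1]!; what is
        left is the coefficient required by \<open>sum_step_odd\<close>.\<close>
      have b: "beta (Suc l) = v * (v - inverse v)\<^sup>2 * qint v (2 * l + 1) * qint v (2 * l + 1)"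
        unfolding beta_def using v0 by (simp add: power2_eq_square field_simps)
      have f: "qfact v (2 * l + 1) = qfact v (2 * l) * qint v (2 * l + 1)"
        "qfact v (2 * Suc l) = qfact v (2 * l + 1) * qint v (2 * l + 2)"
        by (simp_all add: qfact_Suc[OF v_square(2)])
      have d: "(2 * l + 1) div 2 = l" "2 * l + 1 + 1 = 2 * l + 2" "(- 1 :: int) ^ (2 * l + 1) = - 1"
        "2 * Suc l = 2 * l + 2" "(2 * l + 2) div 2 = Suc l" "(- 1 :: int) ^ (2 * l + 2) = 1" by auto
      have 1: "tw 1 (2 * l + 1) (Eb 1 0) (\<lambda>C. qfact v (2 * l + 1) * lin (2 * l + 1) (cf (2 * l + 1)) C) C = qfact v (2 * l + 1) * Xs"
        unfolding tw_smult_right tw_simple_lin[OF icoeff_Qv] Xs d ..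
      have 2: "tw 2 (2 * l) (Eb 2 1) ?P C = qfact v (2 * l) * Ys"
        unfolding tw_smult_right tw_regular_lin[OF icoeff_Qv] Ys by simp
      have 3: "lin (2 * Suc l) (cf (2 * Suc l)) C = Zs" unfolding lin_def Zs d ..
      have "qfact v (2 * l + 1) * Xs + beta (Suc l) * (qfact v (2 * l) * Ys) =
          qfact v (2 * l + 1) * (Xs + v * (v - inverse v)\<^sup>2 * qint v (2 * l + 1) * Ys)"
        unfolding b f(1) by (simp add: algebra_simps)
      also have "\<dots> = qfact v (2 * Suc l) * Zs" unfolding s f(2) by simp
      finally show "tw 1 (2 * l + 1) (Eb 1 0) (\<lambda>C. qfact v (2 * l + 1) * lin (2 * l + 1) (cf (2 * l + 1)) C) C
          + beta (Suc l) * tw 2 (2 * l) (Eb 2 1) ?P C = qfact v (2 * Suc l) * lin (2 * Suc l) (cf (2 * Suc l)) C"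
        unfolding 1 2 3 .
    qed
    finally show ?case .
  qed
  then show ?thesis using mult by simp
qed

lemma idiv_power_eq:
  assumes S: "simple_module \<Lambda> S"
  shows "idiv_power k S n = emb (lin n (cf n))"
proof -
  have "(if even n then idiv_prod k S (n div 2) else ihall_class k S \<otimes>\<^sub>\<T> idiv_prod k S (n div 2)) =
      emb (\<lambda>C. qfact v n * lin n (cf n) C)"
  proof (cases "even n")
    case True
    then show ?thesis using idiv_prod_even_odd[OF S, of "n div 2"] by simp
  next
    case False
    then have "2 * (n div 2) + 1 = n" by presburger
    then show ?thesis using conjunct2[OF idiv_prod_even_odd[OF S, of "n div 2"]] False by (simp only: if_False)
  qed
  moreover have c: "(\<lambda>C. qfact v n * lin n (cf n) C) \<in> carrier \<H>"
    by (intro homog_carrier[of "int n"] homog_smult qfact_Qv homog_lin icoeff_Qv)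
  ultimately show ?thesis
    using smult_emb[OF Qv_divide[OF Qv_Rats[OF Rats_1] qfact_Qv(1)] c] qfact_pos[OF v_square(2), of n]
    unfolding idiv_power_def by simp
qed

lemma idiv_power_sum:
  assumes S: "simple_module \<Lambda> S"
  shows "idiv_power k S n = (\<Oplus>\<^bsub>\<T>\<^esub>l\<in>{0..n div 2}. ihall_smult k (cf n l)
     (ihall_class k (power_module (n - 2 * l) S) \<otimes>\<^sub>\<T> ihall_class k (regular_module \<Lambda>) [^]\<^bsub>\<T>\<^esub> l))"
proof -
  let ?f = "\<lambda>l C. cf n l * Eb n l C"
  have c: "?f l \<in> carrier \<H>" if "l \<in> {0..n div 2}" for l
    by (rule SC.smult_carrier[OF icoeff_Qv Eb_carrier]) (use that in auto)
  have "ihall_smult k (cf n l) (ihall_class k (power_module (n - 2 * l) S) \<otimes>\<^sub>\<T>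
      ihall_class k (regular_module \<Lambda>) [^]\<^bsub>\<T>\<^esub> l) = emb (?f l)" if l: "l \<in> {0..n div 2}" for l
  proof -
    have l': "2 * l \<le> n" using l by auto
    have "n - 2 * l + 2 * l = n" using l' by simp
    then show ?thesis unfolding class_power[OF S] class_regular regular_power power_times_regular
      using smult_emb[OF icoeff_Qv Eb_carrier[OF l']] by simp
  qed
  then have "(\<Oplus>\<^bsub>\<D>\<^esub>l\<in>{0..n div 2}. ihall_smult k (cf n l) (ihall_class k (power_module (n - 2 * l) S) \<otimes>\<^sub>\<T>
      ihall_class k (regular_module \<Lambda>) [^]\<^bsub>\<T>\<^esub> l)) = (\<Oplus>\<^bsub>\<D>\<^esub>l\<in>{0..n div 2}. emb (?f l))"
    using c by (intro sdh.finsum_cong') auto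
  also have "\<dots> = emb (lin n (cf n))"
    using emb_sum[of "{0..n div 2}" ?f] c by (simp add: lin_def atMost_atLeast0)
  finally show ?thesis unfolding idiv_power_eq[OF S] ihall_simps(3) by simp
qed

end

theorem proposition6p5:
  fixes k :: "('a, 'c) ring_scheme" and S :: "('a list set, 's) module" and n :: nat
  assumes "field k" and "finite (carrier k)" and "simple_module (ialg k) S"
  shows "idiv_power k S n = (\<Oplus>\<^bsub>ihall k\<^esub>l\<in>{0..n div 2}. ihall_smult k
        (vpar k powi (int l * (int l + (-1) ^ n) - int ((n - 2 * l) choose 2))
           * (vpar k - inverse (vpar k)) ^ l
         / (qfact (vpar k) (n - 2 * l) * qdfact_even (vpar k) l))
        (ihall_class k (power_module (n - 2 * l) S) \<otimes>\<^bsub>ihall k\<^esub>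
         ihall_class k (regular_module (ialg k)) [^]\<^bsub>ihall k\<^esub> l))"
proof -
  interpret F: ialg_field k using assms(1,2) by (simp add: ialg_field_def ialg_field_axioms_def)
  interpret ihall_alg k "ialg_field.gen k"
    by unfold_locales (simp_all add: F.card_gen_image F.card_carrier_kdim F.fdD)
  show ?thesis using idiv_power_sum[OF assms(3), of n] unfolding icoeff_def .
qed

end
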